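(* Let $m>0$ and $0\le a\le m$, and define $$r_h(a)=\begin{cases} m+\sqrt{m^2-a^2}, & a\le \sqrt3\,m/2,\\ \sqrt3\,a, & a>\sqrt3\,m/2.\end{cases}$$ Let $r>r_h(a)$, and let $S$ be the surface of constant $t$ and constant $r$ in the Kerr spacetime with parameters $(m,a)$ in Boyer–Lindquist coordinates, whose induced metric is $H\,d\phi^2+\Sigma^2\,d\theta^2$. (1) If $\tau$ is a function on $S$ depending only on $\theta$ such that the metric $H\,d\phi^2+(\Sigma^2+\tau_\theta^2)\,d\theta^2$ has positive Gaussian curvature, then $E_{\mathrm{WY}}(S,\tau)\ge E_{\mathrm{WY}}(S,0)$, where $E_{\mathrm{WY}}$ is the Wang–Yau quasi-local energy. (2) If $y$ is a function of $\theta$ such that the metric $H\,d\phi^2+(\Sigma^2+y^2)\,d\theta^2$ has positive Gaussian curvature, then $E(y)\ge E(0)$, where $E(y)$ is the quasi-local energy functional given in the context.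
   Context: **Kerr metric.** In Boyer–Lindquist coordinates $(t,r,\theta,\phi)$, $$g=F\,dt^2+2G\,dt\,d\phi+H\,d\phi^2+R^2\,dr^2+\Sigma^2\,d\theta^2,$$ $$\Delta=r^2-2mr+a^2,\quad \Sigma^2=r^2+a^2\cos^2\theta,\quad R^2\Delta=\Sigma^2,$$ $$F=-\frac{\Delta-a^2\sin^2\theta}{\Sigma^2},\quad G=-\frac{2mar\sin^2\theta}{\Sigma^2},\quad H\Sigma^2=\sin^2\theta\big((r^2+a^2)^2-\Delta a^2\sin^2\theta\big),$$ with $R,\Sigma>0$. Subscripts $r,\theta$ denote partial derivatives. The future direction outside the outer horizon is that of the timelike vector $\partial_t-(G/H)\partial_\phi$. All functions are assumed smooth; in (2), $y$ is of the form $y=d\tau/d\theta$ for a function $\tau$ on $S$ depending only on $\theta$. **Wang–Yau energy.** Let $\tau$ be a function on $S$ such that (induced metric of $S$) $+\,d\tau\otimes d\tau$ has positive Gaussian curvature. Let $\varphi_0:S\to\mathbb{R}^{1,3}$ be the isometric embedding (unique up to rigid motions of $\mathbb{R}^3$) whose time component is $\tau$, where $\mathbb{R}^{1,3}$ has coordinates $(T,X,Y,Z)$ and signature $(-,+,+,+)$, and let $\bar S=\varphi_0(S)$. Let $\vec H$ (assumed spacelike) and $\vec{\bar H}$ be the mean curvature vectors of $S$ in the Kerr spacetime and of $\bar S$ in $\mathbb{R}^{1,3}$ (trace of the vector-valued second fundamental form, so that it points inward for a round sphere in Euclidean space). Let $\nabla\tau$, $\Delta_S\tau$ be the gradient and Laplacian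 of $\tau$ for the induced metric on $S$ (identified with $\bar S$ via $\varphi_0$). Let $e_0$ be the future-directed unit timelike normal to $S$ with $$\langle \vec H,e_0\rangle=-\frac{\Delta_S\tau}{\sqrt{1+\|\nabla\tau\|^2}},$$ and $e_1$ the unit spacelike normal to $S$ orthogonal to $e_0$ and pointing outward (increasing $r$). Let $\bar e_1$ be the outward-pointing unit vector orthogonal to $\bar S$ and to $\partial/\partial T$, and $\bar e_0$ the future-directed unit timelike vector orthogonal to $\bar S$ and $\bar e_1$. Then $$E_{\mathrm{WY}}(S,\tau)=\frac1{8\pi}\int_{\bar S}\Big(-\sqrt{1+\|\nabla\tau\|^2}\,\langle\vec{\bar H},\bar e_1\rangle+\langle\bar\nabla_{-\nabla\tau}\bar e_1,\bar e_0\rangle\Big)dV_{\bar S}-\frac1{8\pi}\int_S\Big(-\sqrt{1+\|\nabla\tau\|^2}\,\langle\vec H,e_1\rangle+\langle\nabla_{-\nabla\tau}e_1,e_0\rangle\Big)dV_S,$$ where inside the brackets $\bar\nabla$ and $\nabla$ (acting on $\bar e_1$, $e_1$) denote the Levi-Civita connections of $\mathbb{R}^{1,3}$ and of the Kerr spacetime. **The functional $E(y)$.** For functions $x,y$ of $\theta$ put $$l=y^2+\Sigma^2,\qquad \alpha=\sqrt{x^2\Sigma^2+R^2l},\qquad \beta=\sqrt{-H_\theta^2+4Hl},$$ $$\mathfrak B(x,y)=-\frac{\alpha(H\Sigma^2)_r}{2\sqrt H R^2\Sigma^2}-\sqrt H\left(\frac{H_{\theta\theta}-2l}{\beta}+\frac{R_\theta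 xy}{R\alpha}-\frac{xy^3\beta+H_\theta\alpha\Sigma^2}{l\alpha\beta\Sigma}\Sigma_\theta\right)+\frac{\sqrt H\,y\,x_\theta}{\alpha}+\frac{\sqrt H\,y\,(H_\theta\alpha-xy\beta)}{l\alpha\beta}\,y_\theta,$$ $$E(x,y)=\frac14\int_0^\pi\mathfrak B(x,y)\,d\theta,$$ all evaluated at the fixed value of $r$ (the $r$-derivatives being taken of the metric coefficients). This is the Chen–Nester–Tung quasi-local energy of $S$ with a 4D isometric matching, axially symmetric Minkowski reference. Then $E(y):=E(x,y)$, where $x$ is determined by $y$ through $$y_\theta=-\frac{(\Sigma^2H)_r}{2HR^2}\,x-\frac{\Sigma H_\theta-2H\Sigma_\theta}{2H\Sigma}\,y.$$ *)

theory Defs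
  imports "HOL-Analysis.Analysis"
begin

subsection \<open>Smooth maps\<close>

primrec Ck_on :: "nat \<Rightarrow> ('a::real_normed_vector \<Rightarrow> 'b::real_normed_vector) \<Rightarrow> 'a set \<Rightarrow> bool" where
  "Ck_on 0 f U \<longleftrightarrow> continuous_on U f"
| "Ck_on (Suc k) f U \<longleftrightarrow> (\<forall>x\<in>U. f differentiable (at x)) \<and>
     (\<forall>v. Ck_on k (\<lambda>x. frechet_derivative f (at x) v) U)"

definition smooth_on_sphere :: "(real^3 \<Rightarrow> 'b::real_normed_vector) \<Rightarrow> bool" where
  "smooth_on_sphere f \<longleftrightarrow> (\<exists>U h. open U \<and> sphere 0 1 \<subseteq> U \<and> (\<forall>k. Ck_on k h U) \<and>
     (\<forall>x\<in>sphere 0 1. h x = f x))"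

text \<open>The polar chart (coordinate 1 is \<open>\<theta>\<close>, coordinate 2 is \<open>\<phi>\<close>). A closed surface of constant
  \<open>t\<close> and \<open>r\<close> is identified with the unit sphere of \<open>\<real>\<^sup>3\<close> by means of its angular coordinates.
  The chart misses only the two poles.\<close>

definition sph :: "real^2 \<Rightarrow> real^3" where
  "sph p = vector [sin (p$1) * cos (p$2), sin (p$1) * sin (p$2), cos (p$1)]"

definition polar_dom :: "(real^2) set" where
  "polar_dom = {p. 0 < p$1 \<and> p$1 < pi}"

subsection \<open>Semi-Riemannian geometry in coordinates\<close>

definition pd :: "'n::finite \<Rightarrow> (real^'n \<Rightarrow> 'b::real_normed_vector) \<Rightarrow> real^'n \<Rightarrow> 'b" where
  "pd i f x = vector_derivative (\<lambda>s. f (x + s *\<^sub>R axis i 1)) (at 0)"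

definition metric_inner :: "real^'n^'n::finite \<Rightarrow> real^'n \<Rightarrow> real^'n \<Rightarrow> real" where
  "metric_inner g u v = (\<Sum>i\<in>UNIV. \<Sum>j\<in>UNIV. g$i$j * u$i * v$j)"

text \<open>\<open>christoffel g x k i j\<close> has \<open>k\<close> as the upper index.\<close>

definition christoffel ::
  "(real^'n \<Rightarrow> real^'n^'n::finite) \<Rightarrow> real^'n \<Rightarrow> 'n \<Rightarrow> 'n \<Rightarrow> 'n \<Rightarrow> real" where
  "christoffel g x k i j = (1/2) * (\<Sum>l\<in>UNIV. matrix_inv (g x) $ k $ l *
     (pd i (\<lambda>z. g z $ j $ l) x + pd j (\<lambda>z. g z $ i $ l) x - pd l (\<lambda>z. g z $ i $ j) x))"

text \<open>\<open>riemann g x l k i j\<close> is the component \<open>l\<close> of \<open>R(\<partial>\<^sub>i, \<partial>\<^sub>j) \<partial>\<^sub>k\<close>, where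
  \<open>R(X,Y) = \<nabla>\<^sub>X \<nabla>\<^sub>Y - \<nabla>\<^sub>Y \<nabla>\<^sub>X - \<nabla>\<^bsub>[X,Y]\<^esub>\<close>.\<close>

definition riemann ::
  "(real^'n \<Rightarrow> real^'n^'n::finite) \<Rightarrow> real^'n \<Rightarrow> 'n \<Rightarrow> 'n \<Rightarrow> 'n \<Rightarrow> 'n \<Rightarrow> real" where
  "riemann g x l k i j =
     pd i (\<lambda>z. christoffel g z l j k) x - pd j (\<lambda>z. christoffel g z l i k) x
     + (\<Sum>q\<in>UNIV. christoffel g x l i q * christoffel g x q j k)
     - (\<Sum>q\<in>UNIV. christoffel g x l j q * christoffel g x q i k)"

definition gauss_curvature :: "(real^2 \<Rightarrow> real^2^2) \<Rightarrow> real^2 \<Rightarrow> real" where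
  "gauss_curvature \<sigma> p = (\<Sum>l\<in>UNIV. \<sigma> p $ 1 $ l * riemann \<sigma> p l 2 1 2) / det (\<sigma> p)"

text \<open>For a metric on the sphere given in the polar chart. At a pole the curvature, which is
  continuous, is the limit of its values along the meridians.\<close>

definition positive_gauss_curvature :: "(real^2 \<Rightarrow> real^2^2) \<Rightarrow> bool" where
  "positive_gauss_curvature \<sigma> \<longleftrightarrow>
     (\<forall>p\<in>polar_dom. 0 < gauss_curvature \<sigma> p) \<and>
     (\<forall>\<phi>. (\<exists>K>0. ((\<lambda>\<theta>. gauss_curvature \<sigma> (vector [\<theta>, \<phi>])) \<longlongrightarrow> K) (at_right 0)) \<and>
          (\<exists>K>0. ((\<lambda>\<theta>. gauss_curvature \<sigma> (vector [\<theta>, \<phi>])) \<longlongrightarrow> K) (at_left pi)))"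

definition gradient :: "(real^'n \<Rightarrow> real^'n^'n::finite) \<Rightarrow> (real^'n \<Rightarrow> real) \<Rightarrow> real^'n \<Rightarrow> real^'n" where
  "gradient \<sigma> f p = (\<chi> i. \<Sum>j\<in>UNIV. matrix_inv (\<sigma> p) $ i $ j * pd j f p)"

definition laplacian :: "(real^'n \<Rightarrow> real^'n^'n::finite) \<Rightarrow> (real^'n \<Rightarrow> real) \<Rightarrow> real^'n \<Rightarrow> real" where
  "laplacian \<sigma> f p = (\<Sum>i\<in>UNIV. \<Sum>j\<in>UNIV. matrix_inv (\<sigma> p) $ i $ j *
     (pd i (pd j f) p - (\<Sum>k\<in>UNIV. christoffel \<sigma> p k i j * pd k f p)))"

text \<open>Below \<open>F\<close> is a parametrized submanifold of a coordinate domain with metric \<open>g\<close>, and a vector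
  field along \<open>F\<close> is a function of the parameters with values in coordinate components.\<close>

definition induced_metric ::
  "(real^'n \<Rightarrow> real^'n^'n::finite) \<Rightarrow> (real^'k \<Rightarrow> real^'n) \<Rightarrow> real^'k \<Rightarrow> real^'k^'k::finite" where
  "induced_metric g F p = (\<chi> i j. metric_inner (g (F p)) (pd i F p) (pd j F p))"

definition cov_along ::
  "(real^'n \<Rightarrow> real^'n^'n::finite) \<Rightarrow> (real^'k \<Rightarrow> real^'n) \<Rightarrow> 'k::finite \<Rightarrow>
   (real^'k \<Rightarrow> real^'n) \<Rightarrow> real^'k \<Rightarrow> real^'n" where
  "cov_along g F i V p = (\<chi> \<mu>. pd i V p $ \<mu> +
     (\<Sum>\<alpha>\<in>UNIV. \<Sum>\<beta>\<in>UNIV. christoffel g (F p) \<mu> \<alpha> \<beta> * pd i F p $ \<alpha> * V p $ \<beta>))"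

definition cov_along_dir ::
  "(real^'n \<Rightarrow> real^'n^'n::finite) \<Rightarrow> (real^'k \<Rightarrow> real^'n) \<Rightarrow> real^'k::finite \<Rightarrow>
   (real^'k \<Rightarrow> real^'n) \<Rightarrow> real^'k \<Rightarrow> real^'n" where
  "cov_along_dir g F X V p = (\<Sum>i\<in>UNIV. X$i *\<^sub>R cov_along g F i V p)"

definition normal_part ::
  "(real^'n \<Rightarrow> real^'n^'n::finite) \<Rightarrow> (real^'k \<Rightarrow> real^'n) \<Rightarrow> real^'k::finite \<Rightarrow> real^'n \<Rightarrow> real^'n" where
  "normal_part g F p v = v - (\<Sum>i\<in>UNIV. \<Sum>j\<in>UNIV.
     (matrix_inv (induced_metric g F p) $ i $ j * metric_inner (g (F p)) v (pd i F p)) *\<^sub>R pd j F p)"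

definition mean_curvature_vector ::
  "(real^'n \<Rightarrow> real^'n^'n::finite) \<Rightarrow> (real^'k::finite \<Rightarrow> real^'n) \<Rightarrow> real^'k \<Rightarrow> real^'n" where
  "mean_curvature_vector g F p = (\<Sum>i\<in>UNIV. \<Sum>j\<in>UNIV.
     matrix_inv (induced_metric g F p) $ i $ j *\<^sub>R normal_part g F p (cov_along g F i (pd j F) p))"

definition normal_to ::
  "(real^'n \<Rightarrow> real^'n^'n::finite) \<Rightarrow> (real^'k::finite \<Rightarrow> real^'n) \<Rightarrow> real^'k \<Rightarrow> real^'n \<Rightarrow> bool" where
  "normal_to g F p v \<longleftrightarrow> (\<forall>i. metric_inner (g (F p)) v (pd i F p) = 0)"

subsection \<open>The Kerr and Minkowski metrics\<close>

definition kerr_Delta :: "real \<Rightarrow> real \<Rightarrow> real \<Rightarrow> real" where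
  "kerr_Delta m a r = r\<^sup>2 - 2 * m * r + a\<^sup>2"

definition kerr_Sigma :: "real \<Rightarrow> real \<Rightarrow> real \<Rightarrow> real" where
  "kerr_Sigma a r \<theta> = sqrt (r\<^sup>2 + a\<^sup>2 * (cos \<theta>)\<^sup>2)"

definition kerr_R :: "real \<Rightarrow> real \<Rightarrow> real \<Rightarrow> real \<Rightarrow> real" where
  "kerr_R m a r \<theta> = sqrt ((kerr_Sigma a r \<theta>)\<^sup>2 / kerr_Delta m a r)"

definition kerr_F :: "real \<Rightarrow> real \<Rightarrow> real \<Rightarrow> real \<Rightarrow> real" where
  "kerr_F m a r \<theta> = - (kerr_Delta m a r - a\<^sup>2 * (sin \<theta>)\<^sup>2) / (kerr_Sigma a r \<theta>)\<^sup>2"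

definition kerr_G :: "real \<Rightarrow> real \<Rightarrow> real \<Rightarrow> real \<Rightarrow> real" where
  "kerr_G m a r \<theta> = - (2 * m * a * r * (sin \<theta>)\<^sup>2) / (kerr_Sigma a r \<theta>)\<^sup>2"

definition kerr_H :: "real \<Rightarrow> real \<Rightarrow> real \<Rightarrow> real \<Rightarrow> real" where
  "kerr_H m a r \<theta> = (sin \<theta>)\<^sup>2 * ((r\<^sup>2 + a\<^sup>2)\<^sup>2 - kerr_Delta m a r * a\<^sup>2 * (sin \<theta>)\<^sup>2)
     / (kerr_Sigma a r \<theta>)\<^sup>2"

text \<open>Boyer--Lindquist coordinates, in the order \<open>(t, r, \<theta>, \<phi>)\<close>.\<close>

definition kerr_metric :: "real \<Rightarrow> real \<Rightarrow> real^4 \<Rightarrow> real^4^4" where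
  "kerr_metric m a z = (let r = z$2; \<theta> = z$3 in vector
     [vector [kerr_F m a r \<theta>, 0, 0, kerr_G m a r \<theta>],
      vector [0, (kerr_R m a r \<theta>)\<^sup>2, 0, 0],
      vector [0, 0, (kerr_Sigma a r \<theta>)\<^sup>2, 0],
      vector [kerr_G m a r \<theta>, 0, 0, kerr_H m a r \<theta>]])"

definition kerr_future :: "real \<Rightarrow> real \<Rightarrow> real^4 \<Rightarrow> real^4" where
  "kerr_future m a z = vector [1, 0, 0, - kerr_G m a (z$2) (z$3) / kerr_H m a (z$2) (z$3)]"

definition kerr_surface :: "real \<Rightarrow> real \<Rightarrow> real^2 \<Rightarrow> real^4" where
  "kerr_surface t r p = vector [t, r, p$1, p$2]"

text \<open>Coordinates \<open>(T, X, Y, Z)\<close>.\<close>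

definition minkowski_metric :: "real^4 \<Rightarrow> real^4^4" where
  "minkowski_metric z = vector
     [vector [-1, 0, 0, 0], vector [0, 1, 0, 0], vector [0, 0, 1, 0], vector [0, 0, 0, 1]]"

definition spatial_part :: "real^4 \<Rightarrow> real^3" where
  "spatial_part z = vector [z$2, z$3, z$4]"

text \<open>The metric \<open>H d\<phi>\<^sup>2 + (\<Sigma>\<^sup>2 + y\<^sup>2) d\<theta>\<^sup>2\<close> in the polar chart.\<close>

definition augmented_metric :: "real \<Rightarrow> real \<Rightarrow> real \<Rightarrow> (real \<Rightarrow> real) \<Rightarrow> real^2 \<Rightarrow> real^2^2" where
  "augmented_metric m a r y p = vector
     [vector [(kerr_Sigma a r (p$1))\<^sup>2 + (y (p$1))\<^sup>2, 0], vector [0, kerr_H m a r (p$1)]]"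

definition kerr_rh :: "real \<Rightarrow> real \<Rightarrow> real" where
  "kerr_rh m a = (if a \<le> sqrt 3 * m / 2 then m + sqrt (m\<^sup>2 - a\<^sup>2) else sqrt 3 * a)"

subsection \<open>Functions of the polar angle\<close>

definition depends_only_on_theta :: "(real^3 \<Rightarrow> real) \<Rightarrow> bool" where
  "depends_only_on_theta f \<longleftrightarrow> (\<forall>\<theta> \<phi> \<phi>'. f (sph (vector [\<theta>, \<phi>])) = f (sph (vector [\<theta>, \<phi>'])))"

definition theta_deriv :: "(real^3 \<Rightarrow> real) \<Rightarrow> real \<Rightarrow> real" where
  "theta_deriv f = deriv (\<lambda>\<theta>. f (sph (vector [\<theta>, 0])))"

subsection \<open>The Wang--Yau energy\<close>

definition is_isometric_embedding ::
  "(real^2 \<Rightarrow> real^2^2) \<Rightarrow> (real^3 \<Rightarrow> real) \<Rightarrow> (real^3 \<Rightarrow> real^4) \<Rightarrow> bool" where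
  "is_isometric_embedding \<sigma> \<tau> X \<longleftrightarrow>
     smooth_on_sphere X \<and> inj_on X (sphere 0 1) \<and>
     (\<forall>x\<in>sphere 0 1. X x $ 1 = \<tau> x) \<and>
     (\<forall>p\<in>polar_dom. induced_metric minkowski_metric (\<lambda>q. X (sph q)) p = \<sigma> p)"

text \<open>The frame \<open>(e\<^sub>0, e\<^sub>1)\<close> along the surface of constant \<open>t\<close> and \<open>r\<close> in the Kerr spacetime. A timelike
  vector is future-directed iff its product with a future-directed timelike vector is negative.\<close>

definition is_kerr_frame ::
  "real \<Rightarrow> real \<Rightarrow> real \<Rightarrow> real \<Rightarrow> (real^3 \<Rightarrow> real) \<Rightarrow> (real^2 \<Rightarrow> real^4) \<Rightarrow> (real^2 \<Rightarrow> real^4) \<Rightarrow> bool" where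
  "is_kerr_frame m a t r \<tau> e0 e1 \<longleftrightarrow>
     (let g = kerr_metric m a; F = kerr_surface t r; \<sigma> = induced_metric g F;
          f = (\<lambda>p. \<tau> (sph p)); Hv = mean_curvature_vector g F
      in \<forall>p\<in>polar_dom. let ip = metric_inner (g (F p)); grad = gradient \<sigma> f p in
          0 < ip (Hv p) (Hv p) \<and>
          normal_to g F p (e0 p) \<and> ip (e0 p) (e0 p) = -1 \<and> ip (e0 p) (kerr_future m a (F p)) < 0 \<and>
          ip (Hv p) (e0 p) = - laplacian \<sigma> f p / sqrt (1 + metric_inner (\<sigma> p) grad grad) \<and>
          normal_to g F p (e1 p) \<and> ip (e1 p) (e1 p) = 1 \<and> ip (e1 p) (e0 p) = 0 \<and> 0 < e1 p $ 2)"

text \<open>The frame along the image of \<open>X\<close> in Minkowski space. As \<open>e\<^sub>1\<close> has no time component, it is normal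
  to the projection of the image to \<open>\<real>\<^sup>3\<close>, and it points out of that closed surface.\<close>

definition is_minkowski_frame ::
  "(real^3 \<Rightarrow> real^4) \<Rightarrow> (real^2 \<Rightarrow> real^4) \<Rightarrow> (real^2 \<Rightarrow> real^4) \<Rightarrow> bool" where
  "is_minkowski_frame X e0 e1 \<longleftrightarrow>
     (let g = minkowski_metric; F = (\<lambda>q. X (sph q)); dT = axis 1 1;
          S = spatial_part ` X ` sphere 0 1
      in \<forall>p\<in>polar_dom. let ip = metric_inner (g (F p)) in
          normal_to g F p (e1 p) \<and> ip (e1 p) (e1 p) = 1 \<and> ip (e1 p) dT = 0 \<and>
          (\<exists>\<epsilon>>0. \<forall>s\<in>{0<..<\<epsilon>}. spatial_part (F p + s *\<^sub>R e1 p) \<in> outside S) \<and>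
          normal_to g F p (e0 p) \<and> ip (e0 p) (e0 p) = -1 \<and> ip (e0 p) (e1 p) = 0 \<and> ip (e0 p) dT < 0)"

text \<open>The common form of the reference and the physical integral, over the polar chart.\<close>

definition wang_yau_integral ::
  "(real^4 \<Rightarrow> real^4^4) \<Rightarrow> (real^2 \<Rightarrow> real^4) \<Rightarrow> (real^2 \<Rightarrow> real) \<Rightarrow>
   (real^2 \<Rightarrow> real^4) \<Rightarrow> (real^2 \<Rightarrow> real^4) \<Rightarrow> real" where
  "wang_yau_integral g F f e0 e1 = (let \<sigma> = induced_metric g F in
     integral (box (vector [0, 0]) (vector [pi, 2 * pi])) (\<lambda>p.
       let ip = metric_inner (g (F p)); grad = gradient \<sigma> f p in
       (- sqrt (1 + metric_inner (\<sigma> p) grad grad) * ip (mean_curvature_vector g F p) (e1 p)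
        + ip (cov_along_dir g F (- grad) e1 p) (e0 p)) * sqrt (det (\<sigma> p))))"

text \<open>The energy is a relation since the isometric embedding is only unique up to rigid motions:
  \<open>is_wang_yau_energy m a t r \<tau> E\<close> says that \<open>E\<close> is the energy of the surface with respect to some
  isometric embedding whose time component is \<open>\<tau>\<close>.\<close>

definition is_wang_yau_energy ::
  "real \<Rightarrow> real \<Rightarrow> real \<Rightarrow> real \<Rightarrow> (real^3 \<Rightarrow> real) \<Rightarrow> real \<Rightarrow> bool" where
  "is_wang_yau_energy m a t r \<tau> E \<longleftrightarrow>
     (\<exists>X e0 e1 e0' e1'.
        is_isometric_embedding (induced_metric (kerr_metric m a) (kerr_surface t r)) \<tau> X \<and>
        is_minkowski_frame X e0' e1' \<and> is_kerr_frame m a t r \<tau> e0 e1 \<and>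
        E = 1 / (8 * pi) * wang_yau_integral minkowski_metric (\<lambda>q. X (sph q)) (\<lambda>p. \<tau> (sph p)) e0' e1'
          - 1 / (8 * pi) * wang_yau_integral (kerr_metric m a) (kerr_surface t r) (\<lambda>p. \<tau> (sph p)) e0 e1)"

subsection \<open>The Chen--Nester--Tung energy\<close>

definition cnt_density ::
  "real \<Rightarrow> real \<Rightarrow> real \<Rightarrow> (real \<Rightarrow> real) \<Rightarrow> (real \<Rightarrow> real) \<Rightarrow> real \<Rightarrow> real" where
  "cnt_density m a r x y \<theta> =
    (let H = kerr_H m a r; R = kerr_R m a r; \<Sigma> = kerr_Sigma a r;
         h = H \<theta>; R' = R \<theta>; s = \<Sigma> \<theta>; X = x \<theta>; Y = y \<theta>;
         H\<theta> = deriv H \<theta>; H\<theta>\<theta> = deriv (deriv H) \<theta>; R\<theta> = deriv R \<theta>; s\<theta> = deriv \<Sigma> \<theta>;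
         HS_r = deriv (\<lambda>u. kerr_H m a u \<theta> * (kerr_Sigma a u \<theta>)\<^sup>2) r;
         l = Y\<^sup>2 + s\<^sup>2;
         \<alpha> = sqrt (X\<^sup>2 * s\<^sup>2 + R'\<^sup>2 * l);
         \<beta> = sqrt (- (H\<theta>\<^sup>2) + 4 * h * l)
     in - (\<alpha> * HS_r) / (2 * sqrt h * R'\<^sup>2 * s\<^sup>2)
        - sqrt h * ((H\<theta>\<theta> - 2 * l) / \<beta> + R\<theta> * X * Y / (R' * \<alpha>)
            - (X * Y^3 * \<beta> + H\<theta> * \<alpha> * s\<^sup>2) / (l * \<alpha> * \<beta> * s) * s\<theta>)
        + sqrt h * Y * deriv x \<theta> / \<alpha>
        + sqrt h * Y * (H\<theta> * \<alpha> - X * Y * \<beta>) / (l * \<alpha> * \<beta>) * deriv y \<theta>)"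

definition cnt_energy_xy ::
  "real \<Rightarrow> real \<Rightarrow> real \<Rightarrow> (real \<Rightarrow> real) \<Rightarrow> (real \<Rightarrow> real) \<Rightarrow> real" where
  "cnt_energy_xy m a r x y = (1/4) * integral {0..pi} (cnt_density m a r x y)"

text \<open>The relation is linear in \<open>x\<close> at each \<open>\<theta>\<close>, with nonzero coefficient for \<open>0 < \<theta> < \<pi>\<close>.\<close>

definition cnt_x :: "real \<Rightarrow> real \<Rightarrow> real \<Rightarrow> (real \<Rightarrow> real) \<Rightarrow> real \<Rightarrow> real" where
  "cnt_x m a r y \<theta> =
    (let H = kerr_H m a r; \<Sigma> = kerr_Sigma a r; R = kerr_R m a r;
         SH_r = deriv (\<lambda>u. (kerr_Sigma a u \<theta>)\<^sup>2 * kerr_H m a u \<theta>) r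
     in THE x. deriv y \<theta> = - SH_r / (2 * H \<theta> * (R \<theta>)\<^sup>2) * x
          - (\<Sigma> \<theta> * deriv H \<theta> - 2 * H \<theta> * deriv \<Sigma> \<theta>) / (2 * H \<theta> * \<Sigma> \<theta>) * y \<theta>)"

definition cnt_energy :: "real \<Rightarrow> real \<Rightarrow> real \<Rightarrow> (real \<Rightarrow> real) \<Rightarrow> real" where
  "cnt_energy m a r y = cnt_energy_xy m a r (cnt_x m a r y) y"

end

theory Submission
  imports Defs
begin

text \<open>
  Let \<open>\<rho> = \<surd>H\<close>, let \<open>y = \<tau>'\<close>, let \<open>w\<^sup>2 = \<Sigma>\<^sup>2 + y\<^sup>2\<close>, so that \<open>w\<^sup>2 d\<theta>\<^sup>2 + \<rho>\<^sup>2 d\<phi>\<^sup>2\<close> is the induced metric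
  augmented by \<open>d\<tau>\<^sup>2\<close>, and let \<open>h\<close> be the norm of the mean curvature vector. In the
  Kerr spacetime the frame \<open>(e\<^sub>0, e\<^sub>1)\<close> is the one of the zero angular momentum observers, boosted by
  the \<open>\<chi>\<close> with \<open>sinh \<chi> = (\<rho> y / \<Sigma>)' / (h \<rho> w)\<close>, and the physical density is
  \<open>\<rho> w h cosh \<chi> + (\<rho> y / \<Sigma>) \<chi>'\<close>. The reference integral is the total mean curvature of a surface in
  \<open>\<real>\<^sup>3\<close> with the augmented metric. By Herglotz's integral formula, applied to this surface and the
  surface of revolution with the same metric in either order, it does not depend on the embedding,
  provided that positively curved surfaces lie on one side of their tangent planes. The latter holds
  since the Gauss map covers the unit sphere already by its values at points of support, while the
  area of its image, counted with multiplicity, is at most that of the sphere. Hence the Wang--Yau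
  and the Chen--Nester--Tung energies are the same integral over \<open>\<theta>\<close>.

  The reference density for \<open>y\<close> is the one for \<open>y = 0\<close> times \<open>(w / \<Sigma>) cosh \<upsilon>\<close>, plus
  \<open>(\<rho> y / \<Sigma>) \<upsilon>'\<close>, for a suitable \<open>\<upsilon>\<close>. Since \<open>cosh \<upsilon> \<ge> cosh \<chi> + (\<upsilon> - \<chi>) sinh \<chi>\<close>, the difference of
  the densities for \<open>y\<close> and for \<open>0\<close> is at least the total derivative of \<open>(\<rho> y / \<Sigma>) (\<upsilon> - \<chi>)\<close>, as soon as
  the mean curvature of the surface of revolution for \<open>y = 0\<close> is at least \<open>h\<close>. This follows from
  \<open>h\<^sup>2 \<le> 4 K\<close>, a polynomial inequality in the Kerr parameters, which is where \<open>r\<^sub>h\<close> enters.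
\<close>

subsection \<open>Partial derivatives\<close>

text \<open>The isometric embedding is an arbitrary smooth one: neither axial symmetry nor convexity
  is given, and only one number of it, the total mean curvature, has to be pinned down. The chart
  degenerates at both poles, so hypotheses and estimates carry explicit powers of
  \<open>sin \<theta>\<close>; boundary terms die and singular quotients stay bounded because
  \<open>rho\<close> and \<open>y\<close> both vanish there at least to first order. Why
  \<open>h\<^sup>2 \<le> 4 * K\<close> suffices: the principal curvatures of the surface of
  revolution have product K, so by the arithmetic-geometric mean their sum is at least
  \<open>2 * sqrt K\<close>. Origin of the radius: the polynomial inequality is expanded in
  \<open>r\<^sup>2 - 3 * a\<^sup>2\<close>, so it needs \<open>sqrt 3 * a \<le> r\<close>. The outer
  horizon guarantees this for \<open>a \<le> sqrt 3 * m / 2\<close>; at equality its radius is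
  \<open>3 * m / 2 = sqrt 3 * a\<close>, and for larger \<open>a\<close> the bound
  \<open>sqrt 3 * a\<close> takes over and lies outside the horizon.\<close>

definition has_pd :: "'n::finite \<Rightarrow> (real^'n \<Rightarrow> 'b::real_normed_vector) \<Rightarrow> 'b \<Rightarrow> real^'n \<Rightarrow> bool" where
  "has_pd i f d p \<longleftrightarrow> ((\<lambda>s. f (p + s *\<^sub>R axis i 1)) has_vector_derivative d) (at 0)"

lemma pd_eqI: "has_pd i f d p \<Longrightarrow> pd i f p = d"
  unfolding has_pd_def pd_def by (rule vector_derivative_at)

lemma has_pd_eq_rhs: "has_pd i f d p \<Longrightarrow> d = e \<Longrightarrow> has_pd i f e p"
  by simp

lemma has_pd_const [simp]: "has_pd i (\<lambda>p. c) 0 p"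
  unfolding has_pd_def by simp

lemma has_pd_diff: "has_pd i f d p \<Longrightarrow> has_pd i g e p \<Longrightarrow> has_pd i (\<lambda>p. f p - g p) (d - e) p"
  unfolding has_pd_def by (rule has_vector_derivative_diff)

lemma has_pd_minus: "has_pd i f d p \<Longrightarrow> has_pd i (\<lambda>p. - f p) (- d) p"
  unfolding has_pd_def by (rule has_vector_derivative_minus)

lemma has_pd_sum: "(\<And>j. j \<in> A \<Longrightarrow> has_pd i (f j) (d j) p) \<Longrightarrow> has_pd i (\<lambda>p. \<Sum>j\<in>A. f j p) (\<Sum>j\<in>A. d j) p"
  unfolding has_pd_def by (rule has_vector_derivative_sum)

lemma has_pd_bilinear:
  assumes "bounded_bilinear b" "has_pd i f d p" "has_pd i g e p"
  shows "has_pd i (\<lambda>p. b (f p) (g p)) (b (f p) e + b d (g p)) p"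
  using bounded_bilinear.has_vector_derivative[OF assms(1) assms(2,3)[unfolded has_pd_def]]
  unfolding has_pd_def by simp

lemmas has_pd_mult = has_pd_bilinear[OF bounded_bilinear_mult]
lemmas has_pd_scaleR = has_pd_bilinear[OF bounded_bilinear_scaleR]
lemmas has_pd_inner = has_pd_bilinear[OF bounded_bilinear_inner]

lemma has_pd_linear:
  assumes "bounded_linear l" "has_pd i f d p"
  shows "has_pd i (\<lambda>p. l (f p)) (l d) p"
  using bounded_linear.has_vector_derivative[OF assms(1) assms(2)[unfolded has_pd_def]]
  unfolding has_pd_def .

lemma has_pd_chain:
  fixes f :: "real^'n::finite \<Rightarrow> real" and F :: "real \<Rightarrow> 'b::real_normed_vector"
  assumes "(F has_vector_derivative e) (at (f p))" "has_pd i f d p"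
  shows "has_pd i (\<lambda>p. F (f p)) (d *\<^sub>R e) p"
  using vector_diff_chain_at[of "\<lambda>s. f (p + s *\<^sub>R axis i 1)" d 0 F e] assms
  unfolding has_pd_def o_def by simp

lemma has_pd_coord: "has_pd i (\<lambda>p. p $ j) (if i = j then 1 else 0) p"
  unfolding has_pd_def
  by (auto simp: axis_def intro!: derivative_eq_intros simp flip: has_real_derivative_iff_has_vector_derivative)

lemma has_pd_fun_coord:
  assumes "(F has_real_derivative d) (at (p $ i))"
  shows "has_pd i (\<lambda>p. F (p $ i)) d p" "j \<noteq> i \<Longrightarrow> has_pd j (\<lambda>p. F (p $ i)) 0 p"
  using has_pd_chain[OF assms[unfolded has_real_derivative_iff_has_vector_derivative] has_pd_coord, of i]
    has_pd_chain[OF assms[unfolded has_real_derivative_iff_has_vector_derivative] has_pd_coord, of j]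
  by simp_all

lemma has_pd_other_coord: "j \<noteq> i \<Longrightarrow> has_pd j (\<lambda>p. F (p $ i)) 0 p"
  unfolding has_pd_def by (simp add: axis_def)

lemma has_derivative_imp_has_pd:
  assumes "(f has_derivative D) (at p)"
  shows "has_pd i f (D (axis i 1)) p"
proof -
  have "((\<lambda>s. p + s *\<^sub>R axis i 1) has_derivative (\<lambda>s. s *\<^sub>R axis i 1)) (at 0)"
    by (auto intro!: derivative_eq_intros)
  then have "((\<lambda>s. f (p + s *\<^sub>R axis i 1)) has_derivative (\<lambda>s. D (s *\<^sub>R axis i 1))) (at 0)"
    using has_derivative_compose[of "\<lambda>s. p + s *\<^sub>R axis i 1" _ 0 UNIV f D] assms by simp
  moreover have "D (s *\<^sub>R axis i 1) = s *\<^sub>R D (axis i 1)" for s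
    using has_derivative_bounded_linear[OF assms] by (simp add: linear_simps)
  ultimately show ?thesis
    unfolding has_pd_def has_vector_derivative_def by simp
qed

lemma has_pd_cong:
  assumes "open U" "p \<in> U" "\<And>q. q \<in> U \<Longrightarrow> f q = g q" "has_pd i f d p"
  shows "has_pd i g d p"
proof -
  let ?l = "\<lambda>s. p + s *\<^sub>R axis i 1"
  have "open (?l -` U)"
    by (intro open_vimage assms continuous_intros)
  with assms show ?thesis
    unfolding has_pd_def by (auto intro: has_vector_derivative_transform_within_open[of _ _ _ "?l -` U"])
qed

text \<open>\<open>pd\<close> is a choice among the vectors satisfying \<open>has_pd\<close>, and
  locally equal functions have the same candidates, so this also covers points without a
  derivative.\<close>

lemma pd_cong:
  assumes "open U" "p \<in> U" "\<And>q. q \<in> U \<Longrightarrow> f q = g q"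
  shows "pd i f p = pd i g p"
proof -
  have "has_pd i f d p \<longleftrightarrow> has_pd i g d p" for d
    using assms has_pd_cong[of U p f g i d] has_pd_cong[of U p g f i d] by auto
  then show ?thesis
    unfolding pd_def has_pd_def vector_derivative_def by simp
qed

subsection \<open>Smooth functions\<close>

lemma Ck_on_imp_continuous_on: "Ck_on k f U \<Longrightarrow> continuous_on U f"
  by (cases k) (auto intro: differentiable_imp_continuous_within differentiable_at_withinI
      simp: continuous_on_eq_continuous_within)

lemma Ck_on_SucD: "Ck_on (Suc k) f U \<Longrightarrow> Ck_on k f U"
proof (induction k arbitrary: f)
  case 0
  then show ?case using Ck_on_imp_continuous_on[of "Suc 0" f U] by auto
next
  case (Suc k)
  then show ?case by (metis Ck_on.simps(2))
qed

lemma Ck_on_cong: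
  assumes "open U" "\<And>x. x \<in> U \<Longrightarrow> f x = g x" "Ck_on k f U"
  shows "Ck_on k g U"
  using assms(2,3)
proof (induction k arbitrary: f g)
  case 0
  then show ?case using continuous_on_cong by auto
next
  case (Suc k)
  have d: "(g has_derivative frechet_derivative f (at x)) (at x)" if "x \<in> U" for x
    using Suc.prems that assms(1)
    by (auto intro: has_derivative_transform_within_open[of f _ x UNIV U] simp: frechet_derivative_works)
  have e: "frechet_derivative f (at x) = frechet_derivative g (at x)" if "x \<in> U" for x
    using d[OF that] by (rule frechet_derivative_at)
  show ?case
    using Suc.prems d Suc.IH[of "\<lambda>x. frechet_derivative f (at x) v" "\<lambda>x. frechet_derivative g (at x) v" for v] e
    by (auto simp: differentiable_def)
qed

lemma Ck_on_const: "Ck_on k (\<lambda>x. c) U"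
  by (induction k arbitrary: c) (auto simp: frechet_derivative_const)

lemma Ck_on_SucI:
  assumes "\<And>x. x \<in> U \<Longrightarrow> (f has_derivative D x) (at x)" "open U" "\<And>v. Ck_on k (\<lambda>x. D x v) U"
  shows "Ck_on (Suc k) f U"
proof -
  have e: "D x = frechet_derivative f (at x)" if "x \<in> U" for x
    using assms(1)[OF that] by (rule frechet_derivative_at)
  have "Ck_on k (\<lambda>x. frechet_derivative f (at x) v) U" for v
    by (rule Ck_on_cong[OF assms(2) _ assms(3)[of v]]) (simp add: e)
  then show ?thesis using assms(1) by (auto simp: differentiable_def)
qed

lemma Ck_on_has_derivative:
  "Ck_on (Suc k) f U \<Longrightarrow> x \<in> U \<Longrightarrow> (f has_derivative frechet_derivative f (at x)) (at x)"
  by (simp add: frechet_derivative_works)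

lemma Ck_on_add: "open U \<Longrightarrow> Ck_on k f U \<Longrightarrow> Ck_on k g U \<Longrightarrow> Ck_on k (\<lambda>x. f x + g x) U"
proof (induction k arbitrary: f g)
  case 0
  then show ?case by (auto intro: continuous_intros)
next
  case (Suc k)
  show ?case
    by (rule Ck_on_SucI[where D = "\<lambda>x v. frechet_derivative f (at x) v + frechet_derivative g (at x) v"])
      (use Suc in \<open>auto intro!: has_derivative_add simp flip: frechet_derivative_works\<close>)
qed

lemma Ck_on_sum: "open U \<Longrightarrow> (\<And>i. i \<in> A \<Longrightarrow> Ck_on k (f i) U) \<Longrightarrow> Ck_on k (\<lambda>x. \<Sum>i\<in>A. f i x) U"
  by (induction A rule: infinite_finite_induct) (auto intro: Ck_on_add simp: Ck_on_const)

lemma Ck_on_bilinear: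
  assumes b: "bounded_bilinear b" and "open U" "Ck_on k f U" "Ck_on k g U"
  shows "Ck_on k (\<lambda>x. b (f x) (g x)) U"
  using assms(3,4)
proof (induction k arbitrary: f g)
  case 0
  then show ?case by (auto intro: bounded_bilinear.continuous_on[OF b])
next
  case (Suc k)
  show ?case
  proof (rule Ck_on_SucI[OF _ \<open>open U\<close>])
    show "((\<lambda>x. b (f x) (g x)) has_derivative (\<lambda>v. b (f x) (frechet_derivative g (at x) v) +
        b (frechet_derivative f (at x) v) (g x))) (at x)" if "x \<in> U" for x
      using Suc.prems that by (intro bounded_bilinear.FDERIV[OF b] Ck_on_has_derivative)
    show "Ck_on k (\<lambda>x. b (f x) (frechet_derivative g (at x) v) + b (frechet_derivative f (at x) v) (g x)) U" for v
      using Suc.prems by (intro Ck_on_add Suc.IH \<open>open U\<close>) (auto dest: Ck_on_SucD intro: Ck_on_SucD[of _ f] Ck_on_SucD[of _ g])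
  qed
qed

lemma Ck_on_linear:
  assumes "bounded_linear l" "open U" "Ck_on k f U"
  shows "Ck_on k (\<lambda>x. l (f x)) U"
  using assms(3)
proof (induction k arbitrary: f)
  case 0
  then show ?case using bounded_linear.continuous_on[OF assms(1)] by auto
next
  case (Suc k)
  show ?case
    by (rule Ck_on_SucI[OF bounded_linear.has_derivative[OF assms(1) Ck_on_has_derivative[OF Suc.prems]] assms(2)])
      (use Suc in auto)
qed

lemma linear_componentwise_expansion:
  fixes l :: "'b::euclidean_space \<Rightarrow> 'c::real_vector"
  assumes "linear l"
  shows "l w = (\<Sum>b\<in>Basis. (w \<bullet> b) *\<^sub>R l b)"
proof -
  have "l w = l (\<Sum>b\<in>Basis. (w \<bullet> b) *\<^sub>R b)" by (simp only: euclidean_representation)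
  also have "\<dots> = (\<Sum>b\<in>Basis. l ((w \<bullet> b) *\<^sub>R b))" by (rule linear_sum[OF assms])
  also have "\<dots> = (\<Sum>b\<in>Basis. (w \<bullet> b) *\<^sub>R l b)" by (simp only: linear_cmul[OF assms])
  finally show ?thesis .
qed

text \<open>\<open>Ck_on\<close> only speaks of derivatives in fixed directions, whereas the chain
  rule differentiates \<open>f\<close> in the moving direction that \<open>g\<close> produces.
  Expanding that direction in the basis of the middle space leaves fixed directions
  \<open>b\<close>, to which the induction hypothesis applies.\<close>

lemma Ck_on_compose:
  fixes f :: "'b::euclidean_space \<Rightarrow> 'c::real_normed_vector" and g :: "'a::real_normed_vector \<Rightarrow> 'b"
  assumes "open U" "g ` U \<subseteq> V" "Ck_on k f V" "Ck_on k g U"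
  shows "Ck_on k (\<lambda>x. f (g x)) U"
  using assms(3,4)
proof (induction k arbitrary: f)
  case 0
  then show ?case using assms(2) by (auto intro: continuous_on_compose2)
next
  case (Suc k)
  let ?f = "\<lambda>y. frechet_derivative f (at y)" and ?g = "\<lambda>x. frechet_derivative g (at x)"
  show ?case
  proof (rule Ck_on_SucI[OF _ \<open>open U\<close>])
    show "((\<lambda>x. f (g x)) has_derivative (\<lambda>v. \<Sum>b\<in>Basis. (?g x v \<bullet> b) *\<^sub>R ?f (g x) b)) (at x)" if "x \<in> U" for x
    proof -
      have f: "(f has_derivative ?f (g x)) (at (g x))" and g: "(g has_derivative ?g x) (at x)"
        using that assms(2) by (auto intro: Ck_on_has_derivative[OF Suc.prems(1)] Ck_on_has_derivative[OF Suc.prems(2)])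
      have "(\<lambda>v. ?f (g x) (?g x v)) = (\<lambda>v. \<Sum>b\<in>Basis. (?g x v \<bullet> b) *\<^sub>R ?f (g x) b)"
        using linear_componentwise_expansion[OF has_derivative_linear[OF f]] by blast
      with has_derivative_compose[OF g f] show ?thesis by (simp only:)
    qed
    show "Ck_on k (\<lambda>x. \<Sum>b\<in>Basis. (?g x v \<bullet> b) *\<^sub>R ?f (g x) b) U" for v
      using Suc.prems Ck_on_SucD[OF Suc.prems(2)]
      by (intro Ck_on_sum Ck_on_bilinear[OF bounded_bilinear_scaleR] Suc.IH
          Ck_on_linear[OF bounded_linear_inner_left] \<open>open U\<close>) auto
  qed
qed

definition smooth :: "('a::real_normed_vector \<Rightarrow> 'b::real_normed_vector) \<Rightarrow> 'a set \<Rightarrow> bool" where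
  "smooth f U \<longleftrightarrow> (\<forall>k. Ck_on k f U)"

lemma smooth_has_derivative: "smooth f U \<Longrightarrow> x \<in> U \<Longrightarrow> (f has_derivative frechet_derivative f (at x)) (at x)"
  unfolding smooth_def using Ck_on_has_derivative by blast

lemma smooth_frechet: "smooth f U \<Longrightarrow> smooth (\<lambda>x. frechet_derivative f (at x) v) U"
  unfolding smooth_def using Ck_on.simps(2) by blast

lemma smooth_continuous_on: "smooth f U \<Longrightarrow> continuous_on U f"
  unfolding smooth_def by (auto intro: Ck_on_imp_continuous_on)

lemma smooth_cong: "open U \<Longrightarrow> (\<And>x. x \<in> U \<Longrightarrow> f x = g x) \<Longrightarrow> smooth f U \<Longrightarrow> smooth g U"
  unfolding smooth_def using Ck_on_cong by blast

lemma smooth_subset: "smooth f U \<Longrightarrow> V \<subseteq> U \<Longrightarrow> smooth f V"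
proof -
  have "Ck_on k f U \<Longrightarrow> V \<subseteq> U \<Longrightarrow> Ck_on k f V" for k
    by (induction k arbitrary: f) (auto intro: continuous_on_subset)
  then show "smooth f U \<Longrightarrow> V \<subseteq> U \<Longrightarrow> smooth f V" by (auto simp: smooth_def)
qed

lemma smooth_compose:
  fixes f :: "'b::euclidean_space \<Rightarrow> 'c::real_normed_vector"
  shows "smooth f V \<Longrightarrow> smooth g U \<Longrightarrow> open U \<Longrightarrow> g ` U \<subseteq> V \<Longrightarrow> smooth (\<lambda>x. f (g x)) U"
  unfolding smooth_def using Ck_on_compose by blast

lemma smooth_linear: "bounded_linear l \<Longrightarrow> open U \<Longrightarrow> smooth f U \<Longrightarrow> smooth (\<lambda>x. l (f x)) U"
  unfolding smooth_def using Ck_on_linear by blast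

lemma smooth_bilinear:
  "bounded_bilinear b \<Longrightarrow> open U \<Longrightarrow> smooth f U \<Longrightarrow> smooth g U \<Longrightarrow> smooth (\<lambda>x. b (f x) (g x)) U"
  unfolding smooth_def using Ck_on_bilinear by blast

lemma smooth_has_pd: "smooth f U \<Longrightarrow> x \<in> U \<Longrightarrow> has_pd i f (frechet_derivative f (at x) (axis i 1)) x"
  by (intro has_derivative_imp_has_pd smooth_has_derivative)

lemma smooth_pd_eq: "smooth f U \<Longrightarrow> x \<in> U \<Longrightarrow> pd i f x = frechet_derivative f (at x) (axis i 1)"
  by (intro pd_eqI smooth_has_pd)

lemma smooth_has_pd': "smooth f U \<Longrightarrow> x \<in> U \<Longrightarrow> has_pd i f (pd i f x) x"
  using smooth_pd_eq smooth_has_pd by metis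

lemma smooth_pd: "smooth f U \<Longrightarrow> open U \<Longrightarrow> smooth (pd i f) U"
  by (rule smooth_cong[OF _ _ smooth_frechet]) (auto simp: smooth_pd_eq)

text \<open>Symmetry of second derivatives: the second difference of \<open>f\<close> over a parallelogram is, by the mean
  value theorem applied in either order, a value of either mixed derivative.\<close>

lemma second_difference:
  fixes f :: "'a::real_normed_vector \<Rightarrow> real"
  assumes f: "Ck_on 2 f U" and "0 < t" and sub: "\<And>\<xi> \<eta>. \<xi> \<in> {0..t} \<Longrightarrow> \<eta> \<in> {0..t} \<Longrightarrow> p + \<xi> *\<^sub>R u + \<eta> *\<^sub>R v \<in> U"
  shows "\<exists>\<xi>\<in>{0..t}. \<exists>\<eta>\<in>{0..t}. f (p + t *\<^sub>R u + t *\<^sub>R v) - f (p + t *\<^sub>R u) - (f (p + t *\<^sub>R v) - f p)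
    = t\<^sup>2 * frechet_derivative (\<lambda>q. frechet_derivative f (at q) u) (at (p + \<xi> *\<^sub>R u + \<eta> *\<^sub>R v)) v"
proof -
  let ?f = "\<lambda>q. frechet_derivative f (at q)" and ?fu = "\<lambda>q. frechet_derivative f (at q) u"
  have f1: "(f has_derivative ?f q) (at q)" and f2: "(?fu has_derivative frechet_derivative ?fu (at q)) (at q)"
    if "q \<in> U" for q
    using f that by (auto simp: numeral_2_eq_2 simp flip: frechet_derivative_works)
  have dir: "((\<lambda>s. G (q + s *\<^sub>R w)) has_real_derivative D w) (at s)"
    if "(G has_derivative D) (at (q + s *\<^sub>R w))" for G :: "'a \<Rightarrow> real" and D q w s
  proof -
    have "((\<lambda>s. q + s *\<^sub>R w) has_derivative (\<lambda>s. s *\<^sub>R w)) (at s)"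
      by (auto intro!: derivative_eq_intros)
    from has_derivative_compose[OF this that]
    have "((\<lambda>s. G (q + s *\<^sub>R w)) has_derivative (\<lambda>s. D (s *\<^sub>R w))) (at s)" .
    moreover have "D (s *\<^sub>R w) = D w * s" for s
      using has_derivative_bounded_linear[OF that] by (simp add: linear_simps)
    ultimately show ?thesis by (simp add: has_field_derivative_def)
  qed
  let ?g = "\<lambda>s. f ((p + t *\<^sub>R v) + s *\<^sub>R u) - f (p + s *\<^sub>R u)"
  have "(?g has_real_derivative ?fu ((p + t *\<^sub>R v) + s *\<^sub>R u) - ?fu (p + s *\<^sub>R u)) (at s)" if "0 \<le> s" "s \<le> t" for s
    using sub[of s t] sub[of s 0] that \<open>0 < t\<close> by (intro DERIV_diff dir f1) (auto simp: algebra_simps)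
  from MVT2[OF \<open>0 < t\<close> this] obtain \<xi> where \<xi>: "0 < \<xi>" "\<xi> < t"
    and 1: "?g t - ?g 0 = (t - 0) * (?fu ((p + t *\<^sub>R v) + \<xi> *\<^sub>R u) - ?fu (p + \<xi> *\<^sub>R u))" by blast
  have "((\<lambda>s. ?fu ((p + \<xi> *\<^sub>R u) + s *\<^sub>R v)) has_real_derivative
      frechet_derivative ?fu (at ((p + \<xi> *\<^sub>R u) + s *\<^sub>R v)) v) (at s)" if "0 \<le> s" "s \<le> t" for s
    using sub[of \<xi> s] that \<xi> by (intro dir f2) auto
  from MVT2[OF \<open>0 < t\<close> this] obtain \<eta> where \<eta>: "0 < \<eta>" "\<eta> < t"
    and 2: "?fu ((p + \<xi> *\<^sub>R u) + t *\<^sub>R v) - ?fu ((p + \<xi> *\<^sub>R u) + 0 *\<^sub>R v) =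
      (t - 0) * frechet_derivative ?fu (at ((p + \<xi> *\<^sub>R u) + \<eta> *\<^sub>R v)) v" by blast
  show ?thesis
    using 1 2 \<xi> \<eta> by (intro bexI[of _ \<xi>] bexI[of _ \<eta>]) (auto simp: power2_eq_square add.commute add.left_commute)
qed

lemma frechet_derivative_symmetric_real:
  fixes f :: "'a::real_normed_vector \<Rightarrow> real"
  assumes f: "Ck_on 2 f U" and U: "open U" "p \<in> U"
  shows "frechet_derivative (\<lambda>q. frechet_derivative f (at q) u) (at p) v =
    frechet_derivative (\<lambda>q. frechet_derivative f (at q) v) (at p) u"
proof (rule ccontr)
  let ?A = "\<lambda>q. frechet_derivative (\<lambda>q. frechet_derivative f (at q) u) (at q) v"
  let ?B = "\<lambda>q. frechet_derivative (\<lambda>q. frechet_derivative f (at q) v) (at q) u"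
  assume "?A p \<noteq> ?B p"
  define e where "e = \<bar>?A p - ?B p\<bar> / 2"
  have "e > 0" using \<open>?A p \<noteq> ?B p\<close> by (simp add: e_def)
  have "continuous_on U ?A" "continuous_on U ?B"
    using f by (simp_all add: numeral_2_eq_2)
  then have "isCont ?A p" "isCont ?B p" using U continuous_on_eq_continuous_at by blast+
  have modulus: "\<exists>d>0. \<forall>q. dist q p < d \<longrightarrow> dist (F q) (F p) < e" if "isCont F p" for F :: "'a \<Rightarrow> real"
    using that \<open>e > 0\<close> unfolding continuous_at_eps_delta by blast
  obtain d1 where d1: "d1 > 0" "\<forall>q. dist q p < d1 \<longrightarrow> dist (?A q) (?A p) < e"
    using modulus[OF \<open>isCont ?A p\<close>] by (elim exE conjE)
  obtain d2 where d2: "d2 > 0" "\<forall>q. dist q p < d2 \<longrightarrow> dist (?B q) (?B p) < e"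
    using modulus[OF \<open>isCont ?B p\<close>] by (elim exE conjE)
  obtain d3 where d3: "d3 > 0" "ball p d3 \<subseteq> U" using U openE by blast
  define d where "d = min d1 (min d2 d3)"
  \<comment> \<open>Small enough for the parallelogram with sides \<open>t *\<^sub>R u\<close> and
    \<open>t *\<^sub>R v\<close> to stay in the ball of radius \<open>d\<close>; the summand 1
    covers \<open>u = v = 0\<close>.\<close>
  define t where "t = d / (2 * (norm u + norm v + 1))"
  have "d > 0" using d1(1) d2(1) d3(1) by (simp add: d_def)
  have uv: "0 < norm u + norm v + 1" using norm_ge_zero[of u] norm_ge_zero[of v] by linarith
  with \<open>d > 0\<close> have "t > 0" by (simp add: t_def)
  have near: "dist (p + \<xi> *\<^sub>R u + \<eta> *\<^sub>R v) p < d" if "\<xi> \<in> {0..t}" "\<eta> \<in> {0..t}" for \<xi> \<eta>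
  proof -
    have "dist (p + \<xi> *\<^sub>R u + \<eta> *\<^sub>R v) p \<le> \<xi> * norm u + \<eta> * norm v"
      using norm_triangle_ineq[of "\<xi> *\<^sub>R u" "\<eta> *\<^sub>R v"] that by (simp add: dist_norm add.assoc)
    also have "\<dots> \<le> t * norm u + t * norm v"
      using that by (intro add_mono mult_right_mono) auto
    also have "\<dots> = t * (norm u + norm v)" by (simp add: algebra_simps)
    also have "\<dots> < t * (2 * (norm u + norm v + 1))"
      by (rule mult_strict_left_mono[OF _ \<open>t > 0\<close>]) (use norm_ge_zero[of u] norm_ge_zero[of v] in argo)
    also have "\<dots> = d" using uv by (simp add: t_def)
    finally show ?thesis .
  qed
  have inU: "p + \<xi> *\<^sub>R u + \<eta> *\<^sub>R v \<in> U" if "\<xi> \<in> {0..t}" "\<eta> \<in> {0..t}" for \<xi> \<eta>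
    using near[OF that] d3(2) by (simp add: d_def dist_commute subset_iff)
  have inU': "p + \<xi> *\<^sub>R v + \<eta> *\<^sub>R u \<in> U" if "\<xi> \<in> {0..t}" "\<eta> \<in> {0..t}" for \<xi> \<eta>
    using inU[OF that(2,1)] by (metis add.assoc add.commute)
  obtain \<xi> \<eta> where 1: "\<xi> \<in> {0..t}" "\<eta> \<in> {0..t}" "f (p + t *\<^sub>R u + t *\<^sub>R v) - f (p + t *\<^sub>R u) - (f (p + t *\<^sub>R v) - f p)
      = t\<^sup>2 * ?A (p + \<xi> *\<^sub>R u + \<eta> *\<^sub>R v)"
    using second_difference[OF f \<open>t > 0\<close> inU] by blast
  obtain \<xi>' \<eta>' where 2: "\<xi>' \<in> {0..t}" "\<eta>' \<in> {0..t}" "f (p + t *\<^sub>R v + t *\<^sub>R u) - f (p + t *\<^sub>R v) - (f (p + t *\<^sub>R u) - f p)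
      = t\<^sup>2 * ?B (p + \<xi>' *\<^sub>R v + \<eta>' *\<^sub>R u)"
    using second_difference[OF f \<open>t > 0\<close> inU'] by blast
  have "p + t *\<^sub>R v + t *\<^sub>R u = p + t *\<^sub>R u + t *\<^sub>R v" by (simp add: algebra_simps)
  from 1(3) 2(3)[unfolded this]
  have "t\<^sup>2 * ?A (p + \<xi> *\<^sub>R u + \<eta> *\<^sub>R v) = t\<^sup>2 * ?B (p + \<xi>' *\<^sub>R v + \<eta>' *\<^sub>R u)"
    by linarith
  moreover have "p + \<xi>' *\<^sub>R v + \<eta>' *\<^sub>R u = p + \<eta>' *\<^sub>R u + \<xi>' *\<^sub>R v"
    by (simp add: add.assoc add.commute[of "\<eta>' *\<^sub>R u"])
  ultimately have eq: "?A (p + \<xi> *\<^sub>R u + \<eta> *\<^sub>R v) = ?B (p + \<eta>' *\<^sub>R u + \<xi>' *\<^sub>R v)" using \<open>t > 0\<close>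
    by simp
  have "dist (?A (p + \<xi> *\<^sub>R u + \<eta> *\<^sub>R v)) (?A p) < e" "dist (?B (p + \<eta>' *\<^sub>R u + \<xi>' *\<^sub>R v)) (?B p) < e"
    using near[OF 1(1,2)] near[OF 2(2,1)] d1(2) d2(2) by (simp_all add: d_def)
  with eq show False unfolding e_def dist_real_def by argo
qed

lemma frechet_derivative_symmetric:
  fixes f :: "'a::real_normed_vector \<Rightarrow> 'b::euclidean_space"
  assumes f: "smooth f U" and U: "open U" "p \<in> U"
  shows "frechet_derivative (\<lambda>q. frechet_derivative f (at q) u) (at p) v =
    frechet_derivative (\<lambda>q. frechet_derivative f (at q) v) (at p) u"
proof (rule euclidean_eqI)
  fix b :: 'b
  let ?g = "\<lambda>q. f q \<bullet> b"
  have g: "smooth ?g U" using smooth_linear[OF bounded_linear_inner_left U(1) f] .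
  have 1: "frechet_derivative ?g (at q) w = frechet_derivative f (at q) w \<bullet> b" if "q \<in> U" for q w
    using frechet_derivative_at[OF bounded_linear.has_derivative[OF bounded_linear_inner_left[of b] smooth_has_derivative[OF f that]]]
    by (metis)
  have 2: "frechet_derivative (\<lambda>q. frechet_derivative ?g (at q) w) (at p) w' =
      frechet_derivative (\<lambda>q. frechet_derivative f (at q) w) (at p) w' \<bullet> b" for w w'
  proof -
    have "((\<lambda>q. frechet_derivative f (at q) w \<bullet> b) has_derivative
       (\<lambda>w'. frechet_derivative (\<lambda>q. frechet_derivative f (at q) w) (at p) w' \<bullet> b)) (at p)"
      by (intro bounded_linear.has_derivative[OF bounded_linear_inner_left] smooth_has_derivative[OF smooth_frechet[OF f] U(2)])
    then have "((\<lambda>q. frechet_derivative ?g (at q) w) has_derivative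
       (\<lambda>w'. frechet_derivative (\<lambda>q. frechet_derivative f (at q) w) (at p) w' \<bullet> b)) (at p)"
      by (rule has_derivative_transform_within_open[OF _ U]) (simp add: 1)
    from frechet_derivative_at[OF this] show ?thesis by metis
  qed
  show "frechet_derivative (\<lambda>q. frechet_derivative f (at q) u) (at p) v \<bullet> b =
    frechet_derivative (\<lambda>q. frechet_derivative f (at q) v) (at p) u \<bullet> b"
    using frechet_derivative_symmetric_real[of ?g U p u v] g U unfolding smooth_def 2 by blast
qed

lemma pd_commute:
  fixes f :: "real^'n::finite \<Rightarrow> 'b::euclidean_space"
  assumes f: "smooth f U" and U: "open U" "p \<in> U"
  shows "pd i (pd j f) p = pd j (pd i f) p"
proof -
  have "pd i (pd j f) p = frechet_derivative (\<lambda>q. frechet_derivative f (at q) (axis j 1)) (at p) (axis i 1)" for i j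
    using pd_cong[OF U, of "pd j f" "\<lambda>q. frechet_derivative f (at q) (axis j 1)"] smooth_pd_eq[OF f]
      smooth_pd_eq[OF smooth_frechet[OF f] U(2)] by simp
  then show ?thesis using frechet_derivative_symmetric[OF f U] by simp
qed

subsection \<open>Integration over the polar chart\<close>

lemma vec2_eq_iff: "(p::'a^2) = q \<longleftrightarrow> p$1 = q$1 \<and> p$2 = q$2"
  by (simp add: vec_eq_iff forall_2)

lemma vector2_nth [simp]: "(vector [p$1, p$2] :: 'a::zero^2) = p"
  by (simp add: vec2_eq_iff vector_2)

lemma vector2_add_axis [simp]:
  "(vector [a, b] :: real^2) + s *\<^sub>R axis 1 1 = vector [a + s, b]"
  "(vector [a, b] :: real^2) + s *\<^sub>R axis 2 1 = vector [a, b + s]"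
  by (simp_all add: vec2_eq_iff vector_2 axis_def)

lemma ex_2: "(\<exists>i::2. P i) \<longleftrightarrow> P 1 \<or> P 2"
  by (metis exhaust_2)

lemma mem_polar_dom: "p \<in> polar_dom \<longleftrightarrow> 0 < p$1 \<and> p$1 < pi"
  by (simp add: polar_dom_def)

lemma vector_mem_polar_dom [simp]: "vector [\<theta>, \<phi>] \<in> polar_dom \<longleftrightarrow> 0 < \<theta> \<and> \<theta> < pi"
  by (simp add: polar_dom_def vector_2)

lemma open_polar_dom: "open polar_dom"
proof -
  have "polar_dom = (\<lambda>p. p$1) -` {0<..<pi}" by (auto simp: polar_dom_def)
  moreover have "open \<dots>" by (rule open_vimage) (auto intro!: continuous_intros)
  ultimately show ?thesis by simp
qed

lemma continuous_on_vector2 [continuous_intros]: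
  fixes f g :: "'a::topological_space \<Rightarrow> real"
  assumes "continuous_on S f" "continuous_on S g"
  shows "continuous_on S (\<lambda>x. vector [f x, g x] :: real^2)"
proof -
  have "(\<lambda>x. vector [f x, g x] :: real^2) = (\<lambda>x. f x *\<^sub>R axis 1 1 + g x *\<^sub>R axis 2 1)"
    by (auto simp: vec2_eq_iff vector_2 axis_def)
  then show ?thesis by (simp only:) (intro continuous_intros assms)
qed

abbreviation polar_box :: "(real^2) set" where
  "polar_box \<equiv> box (vector [0, 0]) (vector [pi, 2 * pi])"

lemma mem_polar_box: "p \<in> polar_box \<longleftrightarrow> 0 < p$1 \<and> p$1 < pi \<and> 0 < p$2 \<and> p$2 < 2 * pi"
  by (auto simp: mem_box_cart forall_2 vector_2)

text \<open>Moves an integral from pairs, where Fubini applies, to \<open>real^2\<close>: the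
  coordinate map sends boxes to boxes of the same content.\<close>

lemma has_integral_real2_of_prod:
  fixes f :: "real^2 \<Rightarrow> real"
  assumes "((\<lambda>z. f (vector [fst z, snd z])) has_integral i) (cbox (a, b) (c, d))"
  shows "(f has_integral i) (cbox (vector [a, b]) (vector [c, d]))"
proof -
  let ?g = "\<lambda>p::real^2. (p$1, p$2)" and ?h = "\<lambda>z. vector [fst z, snd z] :: real^2"
  have hcb: "?h ` cbox u v = cbox (?h u) (?h v)" for u v
  proof (intro equalityI subsetI)
    fix p assume "p \<in> cbox (?h u) (?h v)"
    then have "?g p \<in> cbox u v"
      by (cases u; cases v) (auto simp: mem_box_cart forall_2 vector_2)
    then show "p \<in> ?h ` cbox u v" by (intro image_eqI[of _ _ "?g p"]) auto
  qed (cases u; cases v; auto simp: mem_box_cart forall_2 vector_2)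
  have gcb: "?g ` cbox u v = cbox (?g u) (?g v)" for u v
  proof (intro equalityI subsetI)
    fix z assume "z \<in> cbox (?g u) (?g v)"
    then have "?h z \<in> cbox u v"
      by (cases z) (auto simp: mem_box_cart forall_2 vector_2)
    then show "z \<in> ?g ` cbox u v" by (intro image_eqI[of _ _ "?h z"]) (auto simp: vector_2)
  qed (auto simp: mem_box_cart forall_2)
  have *: "((\<lambda>p. (\<lambda>z. f (?h z)) (?g p)) has_integral (1 / 1) *\<^sub>R i) (?h ` cbox (a, b) (c, d))"
  proof (rule has_integral_twiddle[OF _ _ _ _ _ _ _ assms])
    show "continuous (at x) ?g" for x
      by (intro continuous_intros)
    show "\<exists>w z. ?g ` cbox u v = cbox w z" "\<exists>w z. ?h ` cbox u' v' = cbox w z" for u v u' v'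
      using gcb hcb by blast+
    show "measure lborel (?g ` cbox u v) = 1 * measure lborel (cbox u v)" for u v :: "real^2"
      unfolding gcb content_Pair content_cbox_if_cart
      by (auto simp: UNIV_2 interval_eq_empty_cart ex_2 content_real_if)
  qed (auto simp: vector_2)
  then show ?thesis unfolding hcb by simp
qed

text \<open>The integrands need not extend continuously to the poles. Cut off to zero outside the
  open box they are bounded, measurable and of bounded support, so Fubini applies on the whole
  plane.\<close>

lemma polar_box_integral:
  fixes f :: "real^2 \<Rightarrow> real"
  assumes cont: "continuous_on polar_dom f" and bd: "\<And>p. p \<in> polar_dom \<Longrightarrow> \<bar>f p\<bar> \<le> C"
  shows "(f has_integral (integral {0..pi} (\<lambda>\<theta>. integral {0..2*pi} (\<lambda>\<phi>. f (vector [\<theta>, \<phi>]))))) polar_box"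
    and "(\<lambda>\<theta>. integral {0..2*pi} (\<lambda>\<phi>. f (vector [\<theta>, \<phi>]))) integrable_on {0..pi}"
proof -
  let ?B = "{0<..<pi} \<times> {0<..<2*pi}"
  define G where "G z = indicat_real ?B z *\<^sub>R f (vector [fst z, snd z])" for z
  define J where "J \<theta> = integral {0..2*pi} (\<lambda>\<phi>. f (vector [\<theta>, \<phi>]))" for \<theta>
  have oB: "open ?B" by (intro open_Times) auto
  have C0: "0 \<le> C" using bd[of "vector [pi/2, 0]"] pi_gt_zero by force
  have "continuous_on ?B (\<lambda>z. f (vector [fst z, snd z]))"
    by (rule continuous_on_compose2[OF cont]) (auto intro!: continuous_intros)
  then have Gm: "G \<in> borel_measurable borel"
    unfolding G_def using oB by (intro borel_measurable_continuous_on_indicator) auto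
  have bB: "emeasure lborel ?B < \<infinity>"
    by (intro emeasure_bounded_finite bounded_Times) auto
  have Gbd: "norm (G z) \<le> C" for z
    using C0 bd[of "vector [fst z, snd z]"] by (cases z) (simp add: G_def indicator_def)
  have G0: "G z = 0" if "z \<notin> ?B" for z using that by (simp add: G_def)
  have Gint: "integrable lborel G"
    by (rule integrableI_bounded_set[OF _ _ bB, of _ C]) (use Gm oB Gbd G0 in auto)
  have inner: "(\<integral>\<phi>. G (\<theta>, \<phi>) \<partial>lborel) = (if \<theta> \<in> {0<..<pi} then J \<theta> else 0)" for \<theta>
  proof (cases "\<theta> \<in> {0<..<pi}")
    case True
    have "(\<lambda>\<phi>. G (\<theta>, \<phi>)) \<in> borel_measurable borel"
      using Gm by (rule measurable_compose[rotated]) (auto intro!: borel_measurable_continuous_onI continuous_intros)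
    then have "integrable lborel (\<lambda>\<phi>. G (\<theta>, \<phi>))"
      by (intro integrableI_bounded_set[of "{0<..<2*pi}" _ _ C]) (use Gbd G0 in auto)
    from has_integral_integral_lborel[OF this]
    have "((\<lambda>\<phi>. G (\<theta>, \<phi>)) has_integral (\<integral>\<phi>. G (\<theta>, \<phi>) \<partial>lborel)) UNIV" .
    moreover have "(\<lambda>\<phi>. G (\<theta>, \<phi>)) = (\<lambda>\<phi>. if \<phi> \<in> {0<..<2*pi} then f (vector [\<theta>, \<phi>]) else 0)"
      using True by (auto simp: G_def indicator_def)
    ultimately have "((\<lambda>\<phi>. f (vector [\<theta>, \<phi>])) has_integral (\<integral>\<phi>. G (\<theta>, \<phi>) \<partial>lborel)) {0<..<2*pi}"
      by (simp only: has_integral_restrict_UNIV)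
    then have "((\<lambda>\<phi>. f (vector [\<theta>, \<phi>])) has_integral (\<integral>\<phi>. G (\<theta>, \<phi>) \<partial>lborel)) {0..2*pi}"
      by (simp add: has_integral_Icc_iff_Ioo)
    then show ?thesis using True unfolding J_def by (auto simp: integral_unique)
  qed (auto simp: G_def indicator_def)
  have outer: "((\<lambda>\<theta>. if \<theta> \<in> {0<..<pi} then J \<theta> else 0) has_integral (integral\<^sup>L lborel G)) UNIV"
  proof -
    have i: "integrable (lborel \<Otimes>\<^sub>M lborel) G" using Gint by (simp add: lborel_prod)
    from lborel_pair.integrable_fst'[OF i] lborel_pair.integral_fst'[OF i] show ?thesis
      using has_integral_integral_lborel[of "\<lambda>\<theta>. \<integral>\<phi>. G (\<theta>, \<phi>) \<partial>lborel"] by (simp add: inner lborel_prod)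
  qed
  then have J: "(J has_integral (integral\<^sup>L lborel G)) {0..pi}"
    by (simp only: has_integral_restrict_UNIV has_integral_Icc_iff_Ioo)
  then show "(\<lambda>\<theta>. integral {0..2*pi} (\<lambda>\<phi>. f (vector [\<theta>, \<phi>]))) integrable_on {0..pi}"
    unfolding J_def by blast
  have "(G has_integral (integral\<^sup>L lborel G)) UNIV"
    by (rule has_integral_integral_lborel[OF Gint])
  moreover have "G = (\<lambda>z. if z \<in> cbox (0, 0) (pi, 2*pi) then G z else 0)"
    by (rule ext) (auto simp: G_def indicator_def)
  ultimately have "(G has_integral (integral\<^sup>L lborel G)) (cbox (0, 0) (pi, 2*pi))"
    by (metis has_integral_restrict_UNIV)
  moreover have "G = (\<lambda>z. (\<lambda>p. if p \<in> polar_box then f p else 0) (vector [fst z, snd z]))"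
    by (rule ext) (auto simp: G_def indicator_def mem_polar_box vector_2)
  ultimately have "((\<lambda>z. (\<lambda>p. if p \<in> polar_box then f p else 0) (vector [fst z, snd z])) has_integral
      (integral\<^sup>L lborel G)) (cbox (0, 0) (pi, 2*pi))"
    by (simp only:)
  from has_integral_real2_of_prod[OF this]
  have "(f has_integral (integral\<^sup>L lborel G)) (polar_box \<inter> cbox (vector [0, 0]) (vector [pi, 2*pi]))"
    by (simp only: has_integral_restrict_Int Int_commute)
  then have "(f has_integral (integral\<^sup>L lborel G)) polar_box"
    using box_subset_cbox by (metis Int_absorb2)
  moreover have "integral\<^sup>L lborel G = integral {0..pi} J" using J by (simp add: integral_unique)
  ultimately show "(f has_integral (integral {0..pi} (\<lambda>\<theta>. integral {0..2*pi} (\<lambda>\<phi>. f (vector [\<theta>, \<phi>]))))) polar_box"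
    unfolding J_def by simp
qed

lemma polar_box_integral_theta:
  fixes F :: "real \<Rightarrow> real"
  assumes cont: "continuous_on {0<..<pi} F" and bd: "\<And>\<theta>. \<theta> \<in> {0<..<pi} \<Longrightarrow> \<bar>F \<theta>\<bar> \<le> C"
  shows "((\<lambda>p. F (p$1)) has_integral (2 * pi * integral {0..pi} F)) polar_box"
proof -
  have "continuous_on polar_dom (\<lambda>p. F (p$1))"
    by (rule continuous_on_compose2[OF cont]) (auto simp: polar_dom_def intro!: continuous_intros)
  from polar_box_integral(1)[OF this, of C] bd show ?thesis
    by (simp add: mem_polar_dom vector_2)
qed

text \<open>The bound by \<open>sin\<close> makes \<open>F\<close>, cut off to zero outside the open
  interval, a continuous primitive on the closed one, with value 0 at both ends.\<close>

lemma has_integral_deriv_vanishing: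
  fixes F f :: "real \<Rightarrow> real"
  assumes d: "\<And>\<theta>. 0 < \<theta> \<Longrightarrow> \<theta> < pi \<Longrightarrow> (F has_real_derivative f \<theta>) (at \<theta>)"
    and bd: "\<And>\<theta>. 0 < \<theta> \<Longrightarrow> \<theta> < pi \<Longrightarrow> \<bar>F \<theta>\<bar> \<le> K * sin \<theta>"
  shows "(f has_integral 0) {0..pi}"
proof -
  define I where "I \<theta> = (if 0 < \<theta> \<and> \<theta> < pi then F \<theta> else 0)" for \<theta>
  have dI: "(I has_real_derivative f \<theta>) (at \<theta>)" if "0 < \<theta>" "\<theta> < pi" for \<theta>
    by (rule has_field_derivative_transform_within_open[OF d[OF that], of "{0<..<pi}"])
      (use that in \<open>auto simp: I_def\<close>)
  have Ibd: "norm (I \<theta>) \<le> \<bar>K\<bar> * sin \<theta>" if "\<theta> \<in> {0..pi}" for \<theta>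
  proof (cases "0 < \<theta> \<and> \<theta> < pi")
    case True
    then have "K * sin \<theta> \<le> \<bar>K\<bar> * sin \<theta>" using sin_gt_zero[of \<theta>] by (intro mult_right_mono) auto
    then show ?thesis using bd[of \<theta>] True by (simp add: I_def)
  next
    case False then show ?thesis using that by (auto simp: I_def intro!: mult_nonneg_nonneg sin_ge_zero)
  qed
  have "continuous (at \<theta> within {0..pi}) I" if \<theta>: "\<theta> \<in> {0..pi}" for \<theta>
  proof (cases "0 < \<theta> \<and> \<theta> < pi")
    case True
    then show ?thesis using dI DERIV_isCont continuous_at_imp_continuous_at_within by blast
  next
    case False
    then have s: "sin \<theta> = 0" and I0: "I \<theta> = 0" using \<theta> by (auto simp: I_def)
    have "((\<lambda>\<theta>. \<bar>K\<bar> * sin \<theta>) \<longlongrightarrow> \<bar>K\<bar> * sin \<theta>) (at \<theta> within {0..pi})"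
      by (intro tendsto_intros)
    then have "((\<lambda>\<theta>. \<bar>K\<bar> * sin \<theta>) \<longlongrightarrow> 0) (at \<theta> within {0..pi})" using s by simp
    moreover have "\<forall>\<^sub>F x in at \<theta> within {0..pi}. norm (I x) \<le> \<bar>K\<bar> * sin x"
      using Ibd unfolding eventually_at by (intro exI[of _ 1]) auto
    ultimately have "(I \<longlongrightarrow> 0) (at \<theta> within {0..pi})" by (rule Lim_null_comparison[rotated])
    then show ?thesis using I0 by (simp add: continuous_within)
  qed
  then have "continuous_on {0..pi} I" by (simp add: continuous_on_eq_continuous_within)
  then have "(f has_integral (I pi - I 0)) {0..pi}"
    using dI by (intro fundamental_theorem_of_calculus_interior)
      (auto simp flip: has_real_derivative_iff_has_vector_derivative)
  then show ?thesis by (simp add: I_def)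
qed

text \<open>The divergence theorem on the sphere minus its poles: the derivative of \<open>B\<close>
  integrates to zero along each parallel by periodicity, and the flux of \<open>A\<close> through
  the parallels tends to zero at the poles.\<close>

lemma polar_divergence:
  fixes A B D :: "real^2 \<Rightarrow> real"
  assumes A: "\<And>p. p \<in> polar_dom \<Longrightarrow> has_pd 1 A (A1 p) p" and B: "\<And>p. p \<in> polar_dom \<Longrightarrow> has_pd 2 B (B2 p) p"
    and cA': "continuous_on polar_dom A" and cA: "continuous_on polar_dom A1" and cB: "continuous_on polar_dom B2"
    and D: "\<And>p. p \<in> polar_dom \<Longrightarrow> D p = A1 p + B2 p" and bd: "\<And>p. p \<in> polar_dom \<Longrightarrow> \<bar>D p\<bar> \<le> C"
    and Abd: "\<And>p. p \<in> polar_dom \<Longrightarrow> \<bar>A p\<bar> \<le> C' * sin (p$1)"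
    and per: "\<And>\<theta>. 0 < \<theta> \<Longrightarrow> \<theta> < pi \<Longrightarrow> B (vector [\<theta>, 2 * pi]) = B (vector [\<theta>, 0])"
  shows "(D has_integral 0) polar_box"
proof -
  let ?V = "\<lambda>\<theta> \<phi>. vector [\<theta>, \<phi>] :: real^2"
  have dA: "((\<lambda>x. A (?V x \<phi>)) has_real_derivative A1 (?V \<theta> \<phi>)) (at \<theta>)" if "0 < \<theta>" "\<theta> < pi" for \<theta> \<phi>
    using A[of "?V \<theta> \<phi>"] that DERIV_shift[of "\<lambda>x. A (?V x \<phi>)" _ 0 \<theta>]
    unfolding has_pd_def vector2_add_axis has_real_derivative_iff_has_vector_derivative[symmetric] add.commute[of \<theta>]
    by simp
  have dB: "((\<lambda>x. B (?V \<theta> x)) has_real_derivative B2 (?V \<theta> \<phi>)) (at \<phi>)" if "0 < \<theta>" "\<theta> < pi" for \<theta> \<phi>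
    using B[of "?V \<theta> \<phi>"] that DERIV_shift[of "\<lambda>x. B (?V \<theta> x)" _ 0 \<phi>]
    unfolding has_pd_def vector2_add_axis has_real_derivative_iff_has_vector_derivative[symmetric] add.commute[of \<phi>]
    by simp
  have cV: "continuous_on (U \<times> {0..2*pi}) (\<lambda>(x, t). f (?V x t))"
    if "continuous_on polar_dom f" "U \<subseteq> {0<..<pi}" for f :: "real^2 \<Rightarrow> real" and U
    unfolding case_prod_unfold
    by (rule continuous_on_compose2[OF that(1)]) (use that(2) in \<open>auto intro!: continuous_intros\<close>)
  have cV1: "continuous_on {0..2*pi} (\<lambda>t. f (?V \<theta> t))"
    if "continuous_on polar_dom f" "0 < \<theta>" "\<theta> < pi" for f :: "real^2 \<Rightarrow> real" and \<theta>
    by (rule continuous_on_compose2[OF that(1)]) (use that(2,3) in \<open>auto intro!: continuous_intros\<close>)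
  define I where "I \<theta> = integral {0..2*pi} (\<lambda>\<phi>. A (?V \<theta> \<phi>))" for \<theta>
  have cA0: "(\<lambda>\<phi>. A (?V \<theta> \<phi>)) integrable_on {0..2*pi}" if "0 < \<theta>" "\<theta> < pi" for \<theta>
    by (intro integrable_continuous_interval cV1 cA' that)
  have J: "integral {0..2*pi} (\<lambda>\<phi>. D (?V \<theta> \<phi>)) = integral {0..2*pi} (\<lambda>\<phi>. A1 (?V \<theta> \<phi>))" if "0 < \<theta>" "\<theta> < pi" for \<theta>
  proof -
    have "((\<lambda>\<phi>. B2 (?V \<theta> \<phi>)) has_integral B (?V \<theta> (2*pi)) - B (?V \<theta> 0)) {0..2*pi}"
      using dB[OF that] by (intro fundamental_theorem_of_calculus)
        (auto intro: has_field_derivative_at_within simp flip: has_real_derivative_iff_has_vector_derivative)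
    with per[OF that] have B0: "((\<lambda>\<phi>. B2 (?V \<theta> \<phi>)) has_integral 0) {0..2*pi}" by simp
    have "((\<lambda>\<phi>. A1 (?V \<theta> \<phi>)) has_integral integral {0..2*pi} (\<lambda>\<phi>. A1 (?V \<theta> \<phi>))) {0..2*pi}"
      by (intro integrable_integral integrable_continuous_interval cV1 cA that)
    from has_integral_add[OF this B0] show ?thesis
      using D that by (auto simp: integral_unique)
  qed
  \<comment> \<open>The flux through a parallel is differentiated under the integral sign; the
    derivative is the integral of \<open>D\<close> over that parallel.\<close>
  have dI: "(I has_real_derivative integral {0..2*pi} (\<lambda>\<phi>. D (?V \<theta> \<phi>))) (at \<theta>)" if \<theta>: "0 < \<theta>" "\<theta> < pi" for \<theta>
  proof -
    have "((\<lambda>x. integral (cbox 0 (2*pi)) (\<lambda>\<phi>. A (?V x \<phi>))) has_field_derivative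
        integral (cbox 0 (2*pi)) (\<lambda>\<phi>. A1 (?V \<theta> \<phi>))) (at \<theta> within {0<..<pi})"
    proof (rule leibniz_rule_field_derivative)
      show "((\<lambda>x. A (?V x t)) has_field_derivative A1 (?V x t)) (at x within {0<..<pi})"
        if "x \<in> {0<..<pi}" for x t using dA that by (auto intro: has_field_derivative_at_within)
      show "continuous_on ({0<..<pi} \<times> cbox 0 (2 * pi)) (\<lambda>(x, t). A1 (?V x t))"
        using cV[OF cA] by simp
    qed (use cA0 \<theta> in auto)
    then have "((\<lambda>x. integral {0..2*pi} (\<lambda>\<phi>. A (?V x \<phi>))) has_real_derivative integral {0..2*pi} (\<lambda>\<phi>. A1 (?V \<theta> \<phi>))) (at \<theta>)"
      using \<theta> by (simp add: at_within_open[of \<theta> "{0<..<pi}"])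
    then show ?thesis using J[OF \<theta>] by (simp add: I_def[abs_def])
  qed
  have Ibd: "\<bar>I \<theta>\<bar> \<le> (\<bar>C'\<bar> * (2*pi)) * sin \<theta>" if \<theta>: "0 < \<theta>" "\<theta> < pi" for \<theta>
  proof -
    have "sin \<theta> > 0" using sin_gt_zero \<theta> by simp
    have "\<bar>A (?V \<theta> t)\<bar> \<le> \<bar>C'\<bar> * sin \<theta>" for t
    proof -
      have "\<bar>A (?V \<theta> t)\<bar> \<le> C' * sin \<theta>" using Abd[of "?V \<theta> t"] \<theta> by (simp add: vector_2)
      also have "\<dots> \<le> \<bar>C'\<bar> * sin \<theta>" using \<open>sin \<theta> > 0\<close> by (intro mult_right_mono) auto
      finally show ?thesis .
    qed
    then have "\<bar>I \<theta>\<bar> \<le> \<bar>C'\<bar> * sin \<theta> * (2*pi - 0)"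
      unfolding I_def using \<theta> integral_bound[OF _ cV1[OF cA'], of \<theta> "\<bar>C'\<bar> * sin \<theta>"] by simp
    then show ?thesis by (simp add: mult.commute mult.left_commute)
  qed
  from has_integral_deriv_vanishing[OF dI Ibd]
  have "integral {0..pi} (\<lambda>\<theta>. integral {0..2*pi} (\<lambda>\<phi>. D (?V \<theta> \<phi>))) = 0"
    by (rule integral_unique)
  moreover have "continuous_on polar_dom D"
    using D continuous_on_add[OF cA cB] by (metis (no_types, lifting) continuous_on_cong)
  ultimately show ?thesis using polar_box_integral(1)[of D C] bd by simp
qed

subsection \<open>Metrics of revolution\<close>

text \<open>The metric is \<open>w\<^sup>2 d\<theta>\<^sup>2 + rho\<^sup>2 d\<phi>\<^sup>2\<close> and \<open>k = rho' / w\<close>, so the Gaussian curvature is \<open>- k1 / (w rho)\<close>.\<close>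

locale revolution =
  fixes w rho k w1 k1 :: "real \<Rightarrow> real" and c C :: real
  assumes w_deriv: "0 < \<theta> \<Longrightarrow> \<theta> < pi \<Longrightarrow> (w has_real_derivative w1 \<theta>) (at \<theta>)"
    and rho_deriv: "0 < \<theta> \<Longrightarrow> \<theta> < pi \<Longrightarrow> (rho has_real_derivative w \<theta> * k \<theta>) (at \<theta>)"
    and k_deriv: "0 < \<theta> \<Longrightarrow> \<theta> < pi \<Longrightarrow> (k has_real_derivative k1 \<theta>) (at \<theta>)"
    and cont_w1: "continuous_on {0<..<pi} w1" and cont_k1: "continuous_on {0<..<pi} k1"
    and cont_w: "continuous_on {0..pi} w" and cont_k: "continuous_on {0..pi} k"
    and k_0: "k 0 = 1" and k_pi: "k pi = -1"
    and c_pos: "0 < c"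
    and w_bounds: "0 < \<theta> \<Longrightarrow> \<theta> < pi \<Longrightarrow> c \<le> w \<theta>" "0 < \<theta> \<Longrightarrow> \<theta> < pi \<Longrightarrow> w \<theta> \<le> C"
    and rho_bounds: "0 < \<theta> \<Longrightarrow> \<theta> < pi \<Longrightarrow> c * sin \<theta> \<le> rho \<theta>" "0 < \<theta> \<Longrightarrow> \<theta> < pi \<Longrightarrow> rho \<theta> \<le> C * sin \<theta>"
    and k1_bounds: "0 < \<theta> \<Longrightarrow> \<theta> < pi \<Longrightarrow> c * sin \<theta> \<le> - k1 \<theta>" "0 < \<theta> \<Longrightarrow> \<theta> < pi \<Longrightarrow> - k1 \<theta> \<le> C * sin \<theta>"
begin

lemma C_pos: "0 < C"
  using w_bounds[of 1] c_pos pi_gt3 by linarith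

lemma w_pos: "0 < \<theta> \<Longrightarrow> \<theta> < pi \<Longrightarrow> 0 < w \<theta>"
  using w_bounds(1) c_pos by fastforce

lemma rho_pos: "0 < \<theta> \<Longrightarrow> \<theta> < pi \<Longrightarrow> 0 < rho \<theta>"
  using rho_bounds(1) c_pos sin_gt_zero mult_pos_pos by (metis less_le_trans)

lemma k1_neg: "0 < \<theta> \<Longrightarrow> \<theta> < pi \<Longrightarrow> k1 \<theta> < 0"
  using k1_bounds(1)[of \<theta>] c_pos sin_gt_zero[of \<theta>] mult_pos_pos[of c "sin \<theta>"] by linarith

lemma cont_rho: "continuous_on {0<..<pi} rho"
  using DERIV_isCont[OF rho_deriv] by (auto intro!: continuous_at_imp_continuous_on)

lemma k_decreasing: "0 \<le> x \<Longrightarrow> x < y \<Longrightarrow> y \<le> pi \<Longrightarrow> k y < k x"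
  using DERIV_neg_imp_decreasing_open[of x y k] k_deriv k1_neg continuous_on_subset[OF cont_k, of "{x..y}"]
  by (metis atLeastatMost_subset_iff less_le_trans le_less_trans)

text \<open>\<open>k \<theta> - c * cos \<theta>\<close> is nonincreasing by the bound on
  \<open>k1\<close>; comparing it with its values at the two poles gives the two
  inequalities.\<close>

lemma k_bounds:
  assumes "0 < \<theta>" "\<theta> < pi"
  shows "c * (1 - cos \<theta>) \<le> 1 - k \<theta>" "c * (1 + cos \<theta>) \<le> 1 + k \<theta>"
proof -
  let ?g = "\<lambda>\<theta>. k \<theta> - c * cos \<theta>"
  have d: "\<exists>y. (?g has_real_derivative y) (at x) \<and> y \<le> 0" if "0 < x" "x < pi" for x
    using k1_bounds(1)[OF that] by (intro exI[of _ "k1 x + c * sin x"]) (auto intro!: derivative_eq_intros k_deriv that)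
  have "?g \<theta> \<le> ?g 0" "?g pi \<le> ?g \<theta>"
    using assms by (intro DERIV_nonpos_imp_decreasing_open[of _ _ ?g] d continuous_intros
        continuous_on_subset[OF cont_k]; simp)+
  then show "c * (1 - cos \<theta>) \<le> 1 - k \<theta>" "c * (1 + cos \<theta>) \<le> 1 + k \<theta>"
    by (simp_all add: k_0 k_pi algebra_simps)
qed

text \<open>The unit tangent of the profile curve has radial component \<open>k\<close>;
  \<open>sig\<close> is the size of its axial component.\<close>

definition sig :: "real \<Rightarrow> real" where "sig \<theta> = sqrt (1 - (k \<theta>)\<^sup>2)"

lemma sig_sq_ge: assumes "0 < \<theta>" "\<theta> < pi" shows "(c * sin \<theta>)\<^sup>2 \<le> 1 - (k \<theta>)\<^sup>2"
proof -
  have "(c * (1 - cos \<theta>)) * (c * (1 + cos \<theta>)) \<le> (1 - k \<theta>) * (1 + k \<theta>)"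
    by (intro mult_mono k_bounds[OF assms] order_trans[OF _ k_bounds(1)[OF assms]] mult_nonneg_nonneg)
      (use c_pos cos_ge_minus_one[of \<theta>] cos_le_one[of \<theta>] in linarith)+
  moreover have "(c * (1 - cos \<theta>)) * (c * (1 + cos \<theta>)) = (c * sin \<theta>)\<^sup>2"
    by (simp add: power2_eq_square algebra_simps sin_squared_eq[unfolded power2_eq_square])
  ultimately show ?thesis by (simp add: power2_eq_square algebra_simps)
qed

lemma sig_bounds: assumes "0 < \<theta>" "\<theta> < pi"
  shows "c * sin \<theta> \<le> sig \<theta>" "0 < sig \<theta>" "sig \<theta> \<le> 1" "(sig \<theta>)\<^sup>2 = 1 - (k \<theta>)\<^sup>2"
proof -
  have s: "0 < c * sin \<theta>" using assms c_pos sin_gt_zero by simp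
  show 1: "c * sin \<theta> \<le> sig \<theta>" unfolding sig_def using sig_sq_ge[OF assms] by (rule real_le_rsqrt)
  then show "0 < sig \<theta>" using s by linarith
  show "sig \<theta> \<le> 1" by (simp add: sig_def)
  have "0 \<le> 1 - (k \<theta>)\<^sup>2" using sig_sq_ge[OF assms] zero_le_power2[of "c * sin \<theta>"] by linarith
  then show "(sig \<theta>)\<^sup>2 = 1 - (k \<theta>)\<^sup>2" by (simp add: sig_def)
qed

lemma k_abs_less_1: assumes "0 < \<theta>" "\<theta> < pi" shows "\<bar>k \<theta>\<bar> < 1"
  using sig_bounds(2,4)[OF assms] zero_less_power[of "sig \<theta>" 2] abs_square_less_1[of "k \<theta>"] by simp

lemma sig_upper: assumes "0 < \<theta>" "\<theta> < pi" shows "sig \<theta> \<le> (C + 1) * sin \<theta>"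
proof -
  let ?g = "\<lambda>\<theta>. k \<theta> - C * cos \<theta>"
  have d: "\<exists>y. (?g has_real_derivative y) (at x) \<and> y \<ge> 0" if "0 < x" "x < pi" for x
    using k1_bounds(2)[OF that] by (intro exI[of _ "k1 x + C * sin x"]) (auto intro!: derivative_eq_intros k_deriv that)
  have "?g 0 \<le> ?g \<theta>" "?g \<theta> \<le> ?g pi"
    using assms by (intro DERIV_nonneg_imp_increasing_open[of _ _ ?g] d continuous_intros
        continuous_on_subset[OF cont_k]; simp)+
  then have 1: "1 - k \<theta> \<le> C * (1 - cos \<theta>)" "1 + k \<theta> \<le> C * (1 + cos \<theta>)"
    by (simp_all add: k_0 k_pi algebra_simps)
  have k: "\<bar>k \<theta>\<bar> < 1" using k_abs_less_1[OF assms] .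
  have "1 - (k \<theta>)\<^sup>2 = (1 - k \<theta>) * (1 + k \<theta>)" by (simp add: power2_eq_square algebra_simps)
  also have "\<dots> \<le> (C * (1 - cos \<theta>)) * (C * (1 + cos \<theta>))"
    using 1 k C_pos by (intro mult_mono) auto
  also have "\<dots> = (C * sin \<theta>)\<^sup>2"
    by (simp add: power2_eq_square algebra_simps sin_squared_eq[unfolded power2_eq_square])
  also have "\<dots> \<le> ((C + 1) * sin \<theta>)\<^sup>2"
    using C_pos sin_gt_zero[OF assms] by (intro power_mono mult_right_mono) auto
  finally show ?thesis unfolding sig_def
    using C_pos sin_gt_zero[OF assms] by (intro real_le_lsqrt) auto
qed

lemma sig_deriv: assumes "0 < \<theta>" "\<theta> < pi"
  shows "(sig has_real_derivative - (k \<theta> * k1 \<theta> / sig \<theta>)) (at \<theta>)"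
proof -
  have "0 < 1 - (k \<theta>)\<^sup>2" using sig_bounds(2,4)[OF assms] by (metis zero_less_power)
  then show ?thesis unfolding sig_def[abs_def]
    by (auto intro!: derivative_eq_intros k_deriv assms simp: field_simps)
qed

lemma cont_sig: "continuous_on {0..pi} sig"
  unfolding sig_def[abs_def] by (intro continuous_intros cont_k)

end

text \<open>Near a pole the quotients of interest have a numerator of order
  \<open>sin\<^sup>2\<close> over a denominator of order \<open>sin\<close>; the first form gives
  vanishing fluxes, the second bounded integrands.\<close>

lemma abs_divide_le_of_sin:
  fixes x y s :: real
  assumes "\<bar>x\<bar> \<le> K * s\<^sup>2" "d * s \<le> y" "0 < d" "0 < s" "s \<le> 1"
  shows "\<bar>x / y\<bar> \<le> K / d * s" "\<bar>x / y\<bar> \<le> K / d"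
proof -
  have y: "0 < d * s" "0 < y" using assms by (auto intro: less_le_trans[OF mult_pos_pos])
  have "0 \<le> K * s\<^sup>2" using assms(1) abs_ge_zero order_trans by blast
  then have K: "0 \<le> K" using assms(4) by (simp add: zero_le_mult_iff)
  have "\<bar>x / y\<bar> \<le> (K * s\<^sup>2) / (d * s)"
    unfolding abs_divide using assms y by (intro frac_le) auto
  also have "\<dots> = K / d * s" using assms by (simp add: power2_eq_square)
  finally show 1: "\<bar>x / y\<bar> \<le> K / d * s" .
  also have "\<dots> \<le> K / d * 1" using assms K by (intro mult_left_mono) auto
  finally show "\<bar>x / y\<bar> \<le> K / d" by simp
qed

subsection \<open>Herglotz's integral formula\<close>

text \<open>\<open>L\<close> is the second fundamental form of a surface \<open>x\<close> with unit normal \<open>\<nu>\<close> inducing the metric,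
  \<open>P\<^sub>i = x \<bullet> \<partial>\<^sub>i x\<close> and \<open>h = x \<bullet> \<nu>\<close>.\<close>

locale second_form = revolution +
  fixes L11 L12 L22 P1 P2 h :: "real^2 \<Rightarrow> real" and B :: real
  assumes cont_L: "continuous_on polar_dom L11" "continuous_on polar_dom L12" "continuous_on polar_dom L22"
    and cont_P: "continuous_on polar_dom P1" "continuous_on polar_dom P2" "continuous_on polar_dom h"
    and cont_dL: "continuous_on polar_dom (pd 1 L22)" "continuous_on polar_dom (pd 1 L12)"
      "continuous_on polar_dom (pd 2 L12)" "continuous_on polar_dom (pd 2 L11)"
    and pd_L: "p \<in> polar_dom \<Longrightarrow> has_pd 1 L22 (pd 1 L22 p) p" "p \<in> polar_dom \<Longrightarrow> has_pd 1 L12 (pd 1 L12 p) p"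
      "p \<in> polar_dom \<Longrightarrow> has_pd 2 L12 (pd 2 L12 p) p" "p \<in> polar_dom \<Longrightarrow> has_pd 2 L11 (pd 2 L11 p) p"
    and codazzi1: "p \<in> polar_dom \<Longrightarrow> pd 2 L11 p - pd 1 L12 p =
        (w (p$1) * k (p$1) / rho (p$1) - w1 (p$1) / w (p$1)) * L12 p"
    and codazzi2: "p \<in> polar_dom \<Longrightarrow> pd 2 L12 p - pd 1 L22 p =
        - (w (p$1) * k (p$1) / rho (p$1)) * L22 p - rho (p$1) * k (p$1) / w (p$1) * L11 p"
    and pd_P: "p \<in> polar_dom \<Longrightarrow> has_pd 1 P1 ((w (p$1))\<^sup>2 + w1 (p$1) / w (p$1) * P1 p - L11 p * h p) p"
      "p \<in> polar_dom \<Longrightarrow> has_pd 2 P1 (w (p$1) * k (p$1) / rho (p$1) * P2 p - L12 p * h p) p"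
      "p \<in> polar_dom \<Longrightarrow> has_pd 1 P2 (w (p$1) * k (p$1) / rho (p$1) * P2 p - L12 p * h p) p"
      "p \<in> polar_dom \<Longrightarrow> has_pd 2 P2 ((rho (p$1))\<^sup>2 - rho (p$1) * k (p$1) / w (p$1) * P1 p - L22 p * h p) p"
    and gauss: "p \<in> polar_dom \<Longrightarrow> L11 p * L22 p - (L12 p)\<^sup>2 = - k1 (p$1) * w (p$1) * rho (p$1)"
    and L11_pos: "p \<in> polar_dom \<Longrightarrow> 0 < L11 p"
    and L_bound: "p \<in> polar_dom \<Longrightarrow> \<bar>L11 p\<bar> \<le> B" "p \<in> polar_dom \<Longrightarrow> \<bar>L12 p\<bar> \<le> B * sin (p$1)"
      "p \<in> polar_dom \<Longrightarrow> \<bar>L22 p\<bar> \<le> B * (sin (p$1))\<^sup>2"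
    and P_bound: "p \<in> polar_dom \<Longrightarrow> \<bar>P1 p\<bar> \<le> B" "p \<in> polar_dom \<Longrightarrow> \<bar>P2 p\<bar> \<le> B * sin (p$1)"
      "p \<in> polar_dom \<Longrightarrow> \<bar>h p\<bar> \<le> B"
    and periodic: "0 < \<theta> \<Longrightarrow> \<theta> < pi \<Longrightarrow> L11 (vector [\<theta>, 2 * pi]) = L11 (vector [\<theta>, 0])"
      "0 < \<theta> \<Longrightarrow> \<theta> < pi \<Longrightarrow> L12 (vector [\<theta>, 2 * pi]) = L12 (vector [\<theta>, 0])"
      "0 < \<theta> \<Longrightarrow> \<theta> < pi \<Longrightarrow> P1 (vector [\<theta>, 2 * pi]) = P1 (vector [\<theta>, 0])"
      "0 < \<theta> \<Longrightarrow> \<theta> < pi \<Longrightarrow> P2 (vector [\<theta>, 2 * pi]) = P2 (vector [\<theta>, 0])"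
begin

text \<open>The trace \<open>L11 / w\<^sup>2 + L22 / rho\<^sup>2\<close> times the area element
  \<open>w * rho\<close>.\<close>

definition mean_integrand :: "real^2 \<Rightarrow> real" where
  "mean_integrand p = w (p$1) * L22 p / rho (p$1) + rho (p$1) * L11 p / w (p$1)"

lemma B_nonneg: "0 \<le> B"
  using L_bound(1)[of "vector [1, 0]"] abs_ge_zero[of "L11 (vector [1, 0])"] pi_gt3 by force

lemma cont_theta:
  assumes "continuous_on {0<..<pi} f" shows "continuous_on polar_dom (\<lambda>p. f (p$1))"
  by (rule continuous_on_compose2[OF assms]) (auto simp: polar_dom_def intro!: continuous_intros)

lemma cont_wrk: "continuous_on polar_dom (\<lambda>p. w (p$1))" "continuous_on polar_dom (\<lambda>p. rho (p$1))"
  "continuous_on polar_dom (\<lambda>p. k (p$1))" "continuous_on polar_dom (\<lambda>p. w1 (p$1))"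
  by (intro cont_theta cont_rho cont_w1 continuous_on_subset[OF cont_w] continuous_on_subset[OF cont_k]; force)+

lemma wr_pos: "p \<in> polar_dom \<Longrightarrow> 0 < w (p$1)" "p \<in> polar_dom \<Longrightarrow> 0 < rho (p$1)"
  using w_pos rho_pos by (auto simp: mem_polar_dom)

lemma mean_integrand_bound: assumes "p \<in> polar_dom" shows "\<bar>mean_integrand p\<bar> \<le> C * B / c + C * B / c"
proof -
  have \<theta>: "0 < p$1" "p$1 < pi" using assms by (auto simp: mem_polar_dom)
  note s = sin_gt_zero[OF \<theta>]
  have 1: "\<bar>w (p$1) * L22 p\<bar> \<le> C * B * (sin (p$1))\<^sup>2"
    unfolding abs_mult using L_bound(3)[OF assms] w_bounds(2)[OF \<theta>] w_pos[OF \<theta>] C_pos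
    by (simp add: mult.assoc) (intro mult_mono, auto)
  have "\<bar>rho (p$1)\<bar> \<le> C" using rho_bounds(2)[OF \<theta>] rho_pos[OF \<theta>] mult_left_mono[OF sin_le_one[of "p$1"], of C] C_pos by linarith
  then have 2: "\<bar>rho (p$1) * L11 p\<bar> \<le> C * B"
    unfolding abs_mult using L_bound(1)[OF assms] C_pos by (intro mult_mono) auto
  have "\<bar>rho (p$1) * L11 p / w (p$1)\<bar> \<le> C * B / c"
    unfolding abs_divide using 2 w_bounds(1)[OF \<theta>] c_pos by (intro frac_le) auto
  with abs_divide_le_of_sin(2)[OF 1 rho_bounds(1)[OF \<theta>] c_pos s sin_le_one] show ?thesis
    unfolding mean_integrand_def using abs_triangle_ineq order_trans add_mono by meson
qed

end

locale second_form_pair = L: second_form w rho k w1 k1 c C L11 L12 L22 P1 P2 h B +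
    M: second_form w rho k w1 k1 c C M11 M12 M22 Q1 Q2 g B'
  for w rho k w1 k1 c C L11 L12 L22 P1 P2 h B M11 M12 M22 Q1 Q2 g B'
begin

text \<open>The support function times the polarised determinant of the two second fundamental
  forms; for equal forms it is \<open>2 * h\<close> times the curvature times the area
  element.\<close>

definition mixed :: "real^2 \<Rightarrow> real" where
  "mixed p = h p * (L11 p * M22 p + L22 p * M11 p - 2 * (L12 p * M12 p)) / (w (p$1) * rho (p$1))"

lemma cont_mixed: "continuous_on polar_dom mixed"
  unfolding mixed_def[abs_def] using L.wr_pos
  by (intro continuous_intros L.cont_wrk L.cont_L M.cont_L L.cont_P) force+

lemma mixed_bound: assumes "p \<in> polar_dom" shows "\<bar>mixed p\<bar> \<le> B * (4 * (B * B')) / (c * c)"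
proof -
  let ?s = "sin (p$1)"
  have \<theta>: "0 < p$1" "p$1 < pi" using assms by (auto simp: mem_polar_dom)
  note s = sin_gt_zero[OF \<theta>] and Lb = L.L_bound[OF assms] and Mb = M.L_bound[OF assms]
  have "\<bar>L11 p * M22 p\<bar> \<le> B * (B' * ?s\<^sup>2)" "\<bar>L22 p * M11 p\<bar> \<le> (B * ?s\<^sup>2) * B'" "\<bar>L12 p * M12 p\<bar> \<le> (B * ?s) * (B' * ?s)"
    unfolding abs_mult using Lb Mb L.B_nonneg M.B_nonneg s by (intro mult_mono; force)+
  then have "\<bar>L11 p * M22 p + L22 p * M11 p - 2 * (L12 p * M12 p)\<bar> \<le> (4 * (B * B')) * ?s\<^sup>2"
    by (simp add: power2_eq_square algebra_simps)
  then have "\<bar>h p * (L11 p * M22 p + L22 p * M11 p - 2 * (L12 p * M12 p))\<bar> \<le> B * ((4 * (B * B')) * ?s\<^sup>2)"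
    unfolding abs_mult using L.P_bound(3)[OF assms] L.B_nonneg by (intro mult_mono) auto
  then have 1: "\<bar>h p * (L11 p * M22 p + L22 p * M11 p - 2 * (L12 p * M12 p))\<bar> \<le> B * (4 * (B * B')) * ?s\<^sup>2"
    by (simp add: mult.assoc)
  have 2: "c * c * ?s \<le> w (p$1) * rho (p$1)"
    using mult_mono[OF L.w_bounds(1)[OF \<theta>] L.rho_bounds(1)[OF \<theta>]] L.c_pos s L.w_pos[OF \<theta>] by (simp add: mult.assoc)
  show ?thesis unfolding mixed_def
    by (rule abs_divide_le_of_sin(2)[OF 1 2 _ s sin_le_one]) (use L.c_pos in simp)
qed

text \<open>The field \<open>(?A, ?Bf)\<close> is the cofactor of \<open>M\<close> applied to the
  gradient of half the squared distance from the origin. By Codazzi the cofactor has divergence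
  zero, and the Hessian of that function is the metric minus \<open>h * L\<close>. So the divergence
  is the trace of \<open>M\<close> minus the mixed term.\<close>

lemma herglotz: "integral polar_box M.mean_integrand = integral polar_box mixed"
proof -
  let ?A = "\<lambda>p. (P1 p * M22 p - P2 p * M12 p) / (w (p$1) * rho (p$1))"
  let ?Bf = "\<lambda>p. (P2 p * M11 p - P1 p * M12 p) / (w (p$1) * rho (p$1))"
  let ?D = "\<lambda>p. M.mean_integrand p - mixed p"
  let ?W = "\<lambda>p. w (p$1) * rho (p$1)"
  define P11 P12 P22 where "P11 p = (w (p$1))\<^sup>2 + w1 (p$1) / w (p$1) * P1 p - L11 p * h p"
    and "P12 p = w (p$1) * k (p$1) / rho (p$1) * P2 p - L12 p * h p"
    and "P22 p = (rho (p$1))\<^sup>2 - rho (p$1) * k (p$1) / w (p$1) * P1 p - L22 p * h p" for p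
  define A1 where "A1 p = ((P1 p * pd 1 M22 p + P11 p * M22 p) - (P2 p * pd 1 M12 p + P12 p * M12 p)) / ?W p
     - (P1 p * M22 p - P2 p * M12 p) * ((w (p$1) * (w (p$1) * k (p$1)) + w1 (p$1) * rho (p$1)) / (?W p)\<^sup>2)" for p
  define B2 where "B2 p = ((P2 p * pd 2 M11 p + P22 p * M11 p) - (P1 p * pd 2 M12 p + P12 p * M12 p)) / ?W p" for p
  have W: "?W p \<noteq> 0" "w (p$1) > 0" "rho (p$1) > 0" if "p \<in> polar_dom" for p
    using L.wr_pos[OF that] by auto
  have pdP: "has_pd 1 P1 (P11 p) p" "has_pd 2 P1 (P12 p) p" "has_pd 1 P2 (P12 p) p" "has_pd 2 P2 (P22 p) p"
    if "p \<in> polar_dom" for p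
    using L.pd_P[OF that] by (simp_all add: P11_def P12_def P22_def)
  have pdW: "has_pd 1 (\<lambda>p. inverse (?W p)) (- ((w (p$1) * (w (p$1) * k (p$1)) + w1 (p$1) * rho (p$1)) / (?W p)\<^sup>2)) p"
    if "p \<in> polar_dom" for p
  proof -
    have "((\<lambda>\<theta>. inverse (w \<theta> * rho \<theta>)) has_real_derivative
       - ((w (p$1) * (w (p$1) * k (p$1)) + w1 (p$1) * rho (p$1)) / (?W p)\<^sup>2)) (at (p$1))"
      using that W[OF that] by (auto simp: mem_polar_dom power2_eq_square divide_simps
        intro!: derivative_eq_intros L.w_deriv L.rho_deriv)
    from has_pd_fun_coord(1)[OF this] show ?thesis .
  qed
  have pdA: "has_pd 1 ?A (A1 p) p" if "p \<in> polar_dom" for p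
  proof -
    have "has_pd 1 (\<lambda>p. (P1 p * M22 p - P2 p * M12 p) * inverse (?W p)) (A1 p) p"
      by (rule has_pd_eq_rhs[OF has_pd_mult[OF has_pd_diff[OF has_pd_mult[OF pdP(1)[OF that] M.pd_L(1)[OF that]]
              has_pd_mult[OF pdP(3)[OF that] M.pd_L(2)[OF that]]] pdW[OF that]]])
        (simp add: A1_def divide_inverse)
    then show ?thesis by (simp add: divide_inverse)
  qed
  have pdB: "has_pd 2 ?Bf (B2 p) p" if "p \<in> polar_dom" for p
  proof -
    have "has_pd 2 (\<lambda>p. (P2 p * M11 p - P1 p * M12 p) * inverse (?W p)) (B2 p) p"
      by (rule has_pd_eq_rhs[OF has_pd_mult[OF has_pd_diff[OF has_pd_mult[OF pdP(4)[OF that] M.pd_L(4)[OF that]]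
              has_pd_mult[OF pdP(2)[OF that] M.pd_L(3)[OF that]]] has_pd_other_coord[of 2 1 "\<lambda>\<theta>. inverse (w \<theta> * rho \<theta>)"]]])
        (simp_all add: B2_def divide_inverse)
    then show ?thesis by (simp add: divide_inverse)
  qed
  have cP: "continuous_on polar_dom P11" "continuous_on polar_dom P12" "continuous_on polar_dom P22"
    unfolding P11_def[abs_def] P12_def[abs_def] P22_def[abs_def] using W
    by (intro continuous_intros L.cont_wrk L.cont_L L.cont_P; force)+
  have "(?D has_integral 0) polar_box"
  proof (rule polar_divergence[where A = ?A and B = ?Bf and ?A1.0 = A1 and ?B2.0 = B2])
    show "continuous_on polar_dom A1" "continuous_on polar_dom B2"
      unfolding A1_def[abs_def] B2_def[abs_def] using W
      by (intro continuous_intros cP L.cont_wrk M.cont_L L.cont_P M.cont_dL; force)+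
    show "continuous_on polar_dom ?A"
      using W by (intro continuous_intros L.cont_wrk M.cont_L L.cont_P; force)
    show "?D p = A1 p + B2 p" if "p \<in> polar_dom" for p
    proof -
      \<comment> \<open>Once the Codazzi equations are substituted, all derivatives of
        \<open>M\<close> cancel and the claim is algebraic.\<close>
      have e1: "pd 2 M11 p = pd 1 M12 p + (w (p$1) * k (p$1) / rho (p$1) - w1 (p$1) / w (p$1)) * M12 p"
        and e2: "pd 2 M12 p = pd 1 M22 p - (w (p$1) * k (p$1) / rho (p$1)) * M22 p - rho (p$1) * k (p$1) / w (p$1) * M11 p"
        using M.codazzi1[OF that] M.codazzi2[OF that] by linarith+
      show ?thesis
        unfolding A1_def B2_def e1 e2 P11_def P12_def P22_def M.mean_integrand_def mixed_def
        using W[OF that] by (simp add: field_simps power2_eq_square)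
    qed
    show "\<bar>?D p\<bar> \<le> (C * B' / c + C * B' / c) + B * (4 * (B * B')) / (c * c)" if "p \<in> polar_dom" for p
      using mixed_bound[OF that] M.mean_integrand_bound[OF that] by linarith
    show "\<bar>?A p\<bar> \<le> 2 * (B * B') / (c * c) * sin (p$1)" if p: "p \<in> polar_dom" for p
    proof -
      let ?s = "sin (p$1)"
      have \<theta>: "0 < p$1" "p$1 < pi" using p by (auto simp: mem_polar_dom)
      note s = sin_gt_zero[OF \<theta>]
      have "\<bar>P1 p * M22 p\<bar> \<le> B * (B' * ?s\<^sup>2)" "\<bar>P2 p * M12 p\<bar> \<le> (B * ?s) * (B' * ?s)"
        unfolding abs_mult using L.P_bound[OF p] M.L_bound[OF p] L.B_nonneg M.B_nonneg s by (intro mult_mono; force)+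
      then have 1: "\<bar>P1 p * M22 p - P2 p * M12 p\<bar> \<le> 2 * (B * B') * ?s\<^sup>2"
        by (simp add: power2_eq_square algebra_simps)
      have 2: "c * c * ?s \<le> ?W p"
        using mult_mono[OF L.w_bounds(1)[OF \<theta>] L.rho_bounds(1)[OF \<theta>]] L.c_pos s L.w_pos[OF \<theta>] by (simp add: mult.assoc)
      show ?thesis
        by (rule abs_divide_le_of_sin(1)[OF 1 2 _ s sin_le_one]) (use L.c_pos in simp)
    qed
  qed (use pdA pdB L.periodic M.periodic in \<open>auto simp: vector_2\<close>)
  moreover have "(mixed has_integral integral polar_box mixed) polar_box"
    using polar_box_integral(1)[OF cont_mixed mixed_bound] by (simp add: has_integral_integral integral_unique)
  ultimately have "((\<lambda>p. ?D p + mixed p) has_integral (0 + integral polar_box mixed)) polar_box"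
    by (rule has_integral_add)
  then show ?thesis by (simp add: integral_unique)
qed

end

text \<open>Multiplied by \<open>a * a'\<close>, the difference of the two sides becomes
  \<open>d * (a - a')\<^sup>2 + (a * b' - a' * b)\<^sup>2\<close>.\<close>

lemma mixed_discriminant_ge:
  fixes a b c a' b' c' :: real
  assumes "0 < a" "0 < a'" "a * c - b\<^sup>2 = d" "a' * c' - b'\<^sup>2 = d" "0 \<le> d"
  shows "2 * d \<le> a * c' + c * a' - 2 * (b * b')"
proof -
  have "a * a' * (a * c' + c * a' - 2 * (b * b') - 2 * d) = d * (a - a')\<^sup>2 + (a * b' - a' * b)\<^sup>2"
  proof -
    have c: "a * c = d + b\<^sup>2" "a' * c' = d + b'\<^sup>2" using assms(3,4) by simp_all
    have "a * a' * (a * c' + c * a' - 2 * (b * b') - 2 * d) =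
        a\<^sup>2 * (a' * c') + a'\<^sup>2 * (a * c) - 2 * a * a' * (b * b') - 2 * a * a' * d"
      by (simp add: algebra_simps power2_eq_square)
    then show ?thesis unfolding c by (simp add: algebra_simps power2_eq_square)
  qed
  also have "\<dots> \<ge> 0" using assms(5) by simp
  finally have "0 \<le> a * a' * (a * c' + c * a' - 2 * (b * b') - 2 * d)" .
  moreover have "0 < a * a'" using assms(1,2) by simp
  ultimately have "0 \<le> a * c' + c * a' - 2 * (b * b') - 2 * d" by (simp only: zero_le_mult_iff) linarith
  then show ?thesis by simp
qed

context second_form_pair
begin

text \<open>Herglotz's formula for the pair \<open>(L, M)\<close> and for \<open>(L, L)\<close>,
  with the same support function. By the Gauss equation both forms have the same determinant, so the
  mixed discriminant is smallest when they coincide.\<close>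

lemma total_mean_le:
  assumes h: "\<And>p. p \<in> polar_dom \<Longrightarrow> 0 \<le> h p"
  shows "integral polar_box L.mean_integrand \<le> integral polar_box M.mean_integrand"
proof -
  interpret LL: second_form_pair w rho k w1 k1 c C L11 L12 L22 P1 P2 h B L11 L12 L22 P1 P2 h B
    by unfold_locales
  have "integral polar_box LL.mixed \<le> integral polar_box mixed"
  proof (rule integral_le)
    show "LL.mixed integrable_on polar_box" "mixed integrable_on polar_box"
      using polar_box_integral(1)[OF cont_mixed mixed_bound] polar_box_integral(1)[OF LL.cont_mixed LL.mixed_bound] by blast+
    fix p assume "p \<in> polar_box"
    then have p: "p \<in> polar_dom" by (auto simp: mem_polar_box mem_polar_dom)
    define d where "d = - k1 (p$1) * w (p$1) * rho (p$1)"
    have d: "0 < d" using L.k1_neg[of "p$1"] L.wr_pos[OF p] p by (auto simp: d_def mem_polar_dom mult_neg_pos)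
    have "L11 p * L22 p + L22 p * L11 p - 2 * (L12 p * L12 p) = 2 * d"
      using L.gauss[OF p] by (simp add: d_def power2_eq_square)
    also have "\<dots> \<le> L11 p * M22 p + L22 p * M11 p - 2 * (L12 p * M12 p)"
      using mixed_discriminant_ge[OF L.L11_pos[OF p] M.L11_pos[OF p], of "L22 p" "L12 p" d "M22 p" "M12 p"]
        L.gauss[OF p] M.gauss[OF p] d by (simp add: d_def)
    finally show "LL.mixed p \<le> mixed p"
      unfolding mixed_def LL.mixed_def using h[OF p] L.wr_pos[OF p]
      by (intro divide_right_mono mult_left_mono) auto
  qed
  then show ?thesis using herglotz LL.herglotz by simp
qed

end

subsection \<open>The surface of revolution\<close>

context revolution
begin

text \<open>The mean curvature of the surface of revolution times its area element: the first term
  comes from the parallels, the second from the meridians.\<close>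

definition mean_density :: "real \<Rightarrow> real" where
  "mean_density \<theta> = w \<theta> * sig \<theta> - rho \<theta> * k1 \<theta> / sig \<theta>"

lemma cont_on_open:
  "continuous_on {0<..<pi} w" "continuous_on {0<..<pi} k" "continuous_on {0<..<pi} sig"
  by (intro continuous_on_subset[OF cont_w] continuous_on_subset[OF cont_k] continuous_on_subset[OF cont_sig]; force)+

lemma cont_mean_density: "continuous_on {0<..<pi} mean_density"
  unfolding mean_density_def[abs_def] using sig_bounds(2)
  by (intro continuous_intros cont_on_open cont_rho cont_k1) force

lemma k1_over_sig_bound: assumes "0 < \<theta>" "\<theta> < pi" shows "\<bar>k1 \<theta> / sig \<theta>\<bar> \<le> C / c"
proof -
  have s: "0 < sin \<theta>" using sin_gt_zero assms by simp
  have "\<bar>k1 \<theta> / sig \<theta>\<bar> \<le> (C * sin \<theta>) / (c * sin \<theta>)"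
    unfolding abs_divide using k1_bounds(2)[OF assms] k1_neg[OF assms] sig_bounds(1,2)[OF assms] s c_pos C_pos
    by (intro frac_le) auto
  then show ?thesis using s by simp
qed

lemma rho_le: assumes "0 < \<theta>" "\<theta> < pi" shows "\<bar>rho \<theta>\<bar> \<le> C"
  using rho_bounds(2)[OF assms] rho_pos[OF assms] mult_left_mono[OF sin_le_one[of \<theta>], of C] C_pos by linarith

lemma mean_density_bound: assumes "0 < \<theta>" "\<theta> < pi" shows "\<bar>mean_density \<theta>\<bar> \<le> C + C * (C / c)"
proof -
  have 1: "\<bar>w \<theta> * sig \<theta>\<bar> \<le> C * 1" unfolding abs_mult
    using w_bounds(2)[OF assms] w_pos[OF assms] sig_bounds(2,3)[OF assms] by (intro mult_mono) auto
  have 2: "\<bar>rho \<theta> * (k1 \<theta> / sig \<theta>)\<bar> \<le> C * (C / c)" unfolding abs_mult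
    using rho_le[OF assms] k1_over_sig_bound[OF assms] C_pos by (intro mult_mono) auto
  have "\<bar>w \<theta> * sig \<theta> - rho \<theta> * (k1 \<theta> / sig \<theta>)\<bar> \<le> C + C * (C / c)"
    using 1 2 by linarith
  then show ?thesis by (simp add: mean_density_def)
qed

text \<open>In cylindrical coordinates the surface is \<open>(rho, z)\<close> with \<open>z' = - w sig\<close> and outward normal
  \<open>(sig, k)\<close>. With \<open>z = 0\<close> where \<open>k = 0\<close> the support function is nonnegative.\<close>

lemma second_form_of_revolution:
  "\<exists>P h B. second_form w rho k w1 k1 c C (\<lambda>p. - w (p$1) * k1 (p$1) / sig (p$1)) (\<lambda>p. 0)
     (\<lambda>p. rho (p$1) * sig (p$1)) P (\<lambda>p. 0) h B \<and> (\<forall>p\<in>polar_dom. 0 \<le> h p)"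
proof -
  \<comment> \<open>The equator, where the normal is horizontal.\<close>
  obtain \<theta>0 where \<theta>0: "0 \<le> \<theta>0" "\<theta>0 \<le> pi" "k \<theta>0 = 0"
    using IVT2'[of k pi 0 0] k_0 k_pi cont_k by auto
  define Z where "Z x = integral {0..x} (\<lambda>x. w x * sig x)" for x
  define z where "z x = Z \<theta>0 - Z x" for x
  have cws: "continuous_on {0..pi} (\<lambda>x. w x * sig x)" by (intro continuous_intros cont_w cont_sig)
  have Z: "(Z has_real_derivative w x * sig x) (at x within {0..pi})" if "x \<in> {0..pi}" for x
    unfolding Z_def[abs_def] by (rule integral_has_real_derivative[OF cws that])
  have z: "(z has_real_derivative - (w x * sig x)) (at x)" if "0 < x" "x < pi" for x
    using Z[of x] that unfolding z_def[abs_def] by (auto intro!: derivative_eq_intros simp: at_within_Icc_at)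
  have cz: "continuous_on {0..pi} z"
    unfolding z_def[abs_def] continuous_on_eq_continuous_within using DERIV_continuous[OF Z]
    by (intro ballI continuous_intros)
  obtain Bz where Bz: "\<And>x. x \<in> {0..pi} \<Longrightarrow> \<bar>z x\<bar> \<le> Bz" "Bz \<ge> 0"
  proof -
    have "bounded (z ` {0..pi})" by (intro compact_imp_bounded compact_continuous_image cz) simp
    then obtain B where "\<forall>x\<in>{0..pi}. \<bar>z x\<bar> \<le> B" unfolding bounded_iff by auto
    then show ?thesis by (intro that[of "max B 0"]) (auto simp: le_max_iff_disj)
  qed
  have zdec: "z y \<le> z x" if "0 \<le> x" "x \<le> y" "y \<le> pi" for x y
  proof (rule DERIV_nonpos_imp_decreasing_open[OF \<open>x \<le> y\<close>])
    show "\<exists>d. (z has_real_derivative d) (at u) \<and> d \<le> 0" if "x < u" "u < y" for u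
      using that \<open>0 \<le> x\<close> \<open>y \<le> pi\<close> z[of u] w_pos[of u] sig_bounds(2)[of u] mult_pos_pos[of "w u" "sig u"] by (intro exI conjI) auto
  qed (use that in \<open>auto intro: continuous_on_subset[OF cz]\<close>)
  have z0: "z \<theta>0 = 0" by (simp add: z_def)
  \<comment> \<open>Height and \<open>k\<close> both decrease along the meridian and both vanish at
    the equator, so they have the same sign.\<close>
  have zk: "0 \<le> z x * k x" if "0 < x" "x < pi" for x
  proof (cases "x < \<theta>0")
    case True
    then have "0 \<le> z x" "0 < k x" using zdec[of x \<theta>0] z0 \<theta>0 that k_decreasing[of x \<theta>0] by auto
    then show ?thesis by simp
  next
    case False
    then have "z x \<le> 0" using zdec[of \<theta>0 x] z0 \<theta>0 that by auto
    moreover have "k x \<le> 0" using k_decreasing[of \<theta>0 x] \<theta>0 that False by (cases "x = \<theta>0") auto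
    ultimately show ?thesis by (rule mult_nonpos_nonpos)
  qed
  define L11 where "L11 p = - w (p$1) * k1 (p$1) / sig (p$1)" for p :: "real^2"
  define L22 where "L22 p = rho (p$1) * sig (p$1)" for p :: "real^2"
  define P where "P p = w (p$1) * (rho (p$1) * k (p$1) - z (p$1) * sig (p$1))" for p :: "real^2"
  define h where "h p = rho (p$1) * sig (p$1) + z (p$1) * k (p$1)" for p :: "real^2"
  define dL22 where "dL22 x = w x * k x * sig x - rho x * k x * k1 x / sig x" for x
  have ct: "continuous_on polar_dom (\<lambda>p. f (p$1))" if "continuous_on {0<..<pi} f" for f :: "real \<Rightarrow> real"
    by (rule continuous_on_compose2[OF that]) (auto simp: polar_dom_def intro!: continuous_intros)
  have ct': "continuous_on polar_dom f \<Longrightarrow> continuous_on polar_dom g \<Longrightarrow> (\<And>p. p \<in> polar_dom \<Longrightarrow> g p \<noteq> 0)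
     \<Longrightarrow> continuous_on polar_dom (\<lambda>p. f p / g p)" for f g :: "real^2 \<Rightarrow> real"
    by (intro continuous_intros) auto
  have cz': "continuous_on {0<..<pi} z" by (rule continuous_on_subset[OF cz]) auto
  note cc = ct[OF cont_on_open(1)] ct[OF cont_on_open(2)] ct[OF cont_on_open(3)] ct[OF cont_rho] ct[OF cont_k1] ct[OF cz']
  have sg: "sig (p$1) \<noteq> 0" if "p \<in> polar_dom" for p using sig_bounds(2) that by (force simp: mem_polar_dom)
  have d22: "has_pd 1 L22 (dL22 (p$1)) p" if p: "p \<in> polar_dom" for p
  proof -
    have "((\<lambda>x. rho x * sig x) has_real_derivative dL22 (p$1)) (at (p$1))"
      using p by (auto simp: mem_polar_dom dL22_def intro!: derivative_eq_intros rho_deriv sig_deriv)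
    from has_pd_fun_coord(1)[OF this] show ?thesis by (simp add: L22_def[abs_def])
  qed
  have d11: "has_pd 2 L11 0 p" for p unfolding L11_def[abs_def]
    by (rule has_pd_other_coord[of 2 1 "\<lambda>x. - w x * k1 x / sig x"]) simp
  have pd22: "pd 1 L22 p = dL22 (p$1)" if "p \<in> polar_dom" for p using pd_eqI[OF d22[OF that]] .
  have pd11: "pd 2 L11 p = 0" for p using pd_eqI[OF d11] .
  have pd12: "pd i (\<lambda>p. 0::real) p = 0" for i and p :: "real^2" by (rule pd_eqI) simp
  define B where "B = C * C / c + C * (C + 1) + C * (C + Bz) + C + Bz"
  have sfB: "second_form w rho k w1 k1 c C L11 (\<lambda>p. 0) L22 P (\<lambda>p. 0) h B"
  proof (unfold_locales)
    show "continuous_on polar_dom L11" "continuous_on polar_dom L22" "continuous_on polar_dom P" "continuous_on polar_dom h"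
      unfolding L11_def[abs_def] L22_def[abs_def] P_def[abs_def] h_def[abs_def] using sg
      by (intro continuous_intros ct' cc; force)+
    have "continuous_on polar_dom (\<lambda>p. dL22 (p$1))"
      unfolding dL22_def using sg by (intro continuous_intros ct' cc; force)
    then show "continuous_on polar_dom (pd 1 L22)" using pd22 by (simp cong: continuous_on_cong)
    show "continuous_on polar_dom (pd 2 L11)" "continuous_on polar_dom (pd 1 (\<lambda>p::real^2. 0::real))"
      "continuous_on polar_dom (pd 2 (\<lambda>p::real^2. 0::real))"
      using pd11 pd12 by (simp_all cong: continuous_on_cong)
    fix p :: "real^2" assume p: "p \<in> polar_dom"
    then have \<theta>: "0 < p$1" "p$1 < pi" by (auto simp: mem_polar_dom)
    note pos = w_pos[OF \<theta>] rho_pos[OF \<theta>] sig_bounds[OF \<theta>] sin_gt_zero[OF \<theta>]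
    show "has_pd 1 L22 (pd 1 L22 p) p" "has_pd 2 L11 (pd 2 L11 p) p" using d22[OF p] pd22[OF p] d11 pd11 by simp_all
    show "has_pd 1 (\<lambda>p. 0::real) (pd 1 (\<lambda>p. 0) p) p" "has_pd 2 (\<lambda>p. 0::real) (pd 2 (\<lambda>p. 0) p) p" by (simp_all add: pd12)
    show "pd 2 L11 p - pd 1 (\<lambda>p. 0) p = (w (p $ 1) * k (p $ 1) / rho (p $ 1) - w1 (p $ 1) / w (p $ 1)) * 0"
      by (simp add: pd11 pd12)
    show "pd 2 (\<lambda>p. 0) p - pd 1 L22 p = - (w (p $ 1) * k (p $ 1) / rho (p $ 1)) * L22 p - rho (p $ 1) * k (p $ 1) / w (p $ 1) * L11 p"
      using pos by (simp add: pd22[OF p] pd12 dL22_def L22_def L11_def field_simps)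
    have sk: "sig (p$1) * sig (p$1) = 1 - k (p$1) * k (p$1)" using pos(6) by (simp add: power2_eq_square)
    have "((\<lambda>x. w x * (rho x * k x - z x * sig x)) has_real_derivative
        ((w (p$1))\<^sup>2 + w1 (p$1) / w (p$1) * P p - L11 p * h p)) (at (p$1))"
    proof (rule derivative_eq_intros w_deriv rho_deriv k_deriv sig_deriv z \<theta> refl)+
      define W R K K1 S X where "W = w (p$1)" and "R = rho (p$1)" and "K = k (p$1)" and "K1 = k1 (p$1)" and "S = sig (p$1)" and "X = z (p$1)"
      have S: "S > 0" "S * S = 1 - K * K" "W > 0" using pos sk by (auto simp: S_def K_def W_def)
      have a: "W * (W * K * K + R * K1 - (- (W * S) * S + - (K * K1 / S) * X)) = W\<^sup>2 + W * K1 / S * (R * S + X * K)"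
        using S by (simp add: divide_simps power2_eq_square) (use S(2) in algebra)
      show "w1 (p $ 1) * (rho (p $ 1) * k (p $ 1) - z (p $ 1) * sig (p $ 1)) +
         (w (p $ 1) * k (p $ 1) * k (p $ 1) + k1 (p $ 1) * rho (p $ 1) -
          (- (w (p $ 1) * sig (p $ 1)) * sig (p $ 1) + - (k (p $ 1) * k1 (p $ 1) / sig (p $ 1)) * z (p $ 1))) * w (p $ 1) =
         (w (p $ 1))\<^sup>2 + w1 (p $ 1) / w (p $ 1) * P p - L11 p * h p"
        using a S(3) unfolding W_def R_def K_def K1_def S_def X_def P_def L11_def h_def by (simp add: algebra_simps)
    qed
    from has_pd_fun_coord(1)[OF this]
    show "has_pd 1 P ((w (p$1))\<^sup>2 + w1 (p$1) / w (p$1) * P p - L11 p * h p) p" by (simp add: P_def[abs_def])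
    show "has_pd 2 P (w (p $ 1) * k (p $ 1) / rho (p $ 1) * 0 - 0 * h p) p"
      unfolding P_def[abs_def] using has_pd_other_coord[of 2 1 "\<lambda>x. w x * (rho x * k x - z x * sig x)" p] by simp
    show "has_pd 1 (\<lambda>p. 0) (w (p $ 1) * k (p $ 1) / rho (p $ 1) * 0 - 0 * h p) p" by simp
    have "(rho (p$1))\<^sup>2 - rho (p$1) * k (p$1) / w (p$1) * P p - L22 p * h p = 0"
      using pos(1) unfolding P_def L22_def h_def power2_eq_square by simp (use sk in algebra)
    then show "has_pd 2 (\<lambda>p. 0) ((rho (p$1))\<^sup>2 - rho (p$1) * k (p$1) / w (p$1) * P p - L22 p * h p) p" by simp
    show "L11 p * L22 p - 0\<^sup>2 = - k1 (p$1) * w (p$1) * rho (p$1)"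
      using pos by (simp add: L11_def L22_def)
    show "0 < L11 p" using pos k1_neg[OF \<theta>] by (simp add: L11_def mult_pos_neg divide_neg_pos)
    note Bs = C_pos c_pos Bz(2)
    have cc0: "0 \<le> C * C / c" "0 \<le> C * (C + 1)" "0 \<le> C * (C + Bz)" using Bs by auto
    have Bge: "C * (C / c) \<le> B" "C * (C + 1) \<le> B" "C * (C + Bz) \<le> B" "C + Bz \<le> B" "0 \<le> B"
      unfolding B_def times_divide_eq_right using cc0 Bs by linarith+
    have "\<bar>L11 p\<bar> = \<bar>w (p$1)\<bar> * \<bar>k1 (p$1) / sig (p$1)\<bar>" by (simp add: L11_def abs_mult abs_divide)
    also have "\<dots> \<le> C * (C / c)" using pos w_bounds(2)[OF \<theta>] k1_over_sig_bound[OF \<theta>] Bs by (intro mult_mono) auto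
    finally show "\<bar>L11 p\<bar> \<le> B" using Bge by linarith
    show "\<bar>0\<bar> \<le> B * sin (p$1)" using Bge pos by auto
    have "\<bar>L22 p\<bar> \<le> (C * sin (p$1)) * ((C + 1) * sin (p$1))" unfolding L22_def abs_mult
      using pos rho_bounds(2)[OF \<theta>] sig_upper[OF \<theta>] Bs by (intro mult_mono) auto
    also have "\<dots> = (C * (C + 1)) * (sin (p$1))\<^sup>2" by (simp add: power2_eq_square)
    also have "\<dots> \<le> B * (sin (p$1))\<^sup>2" using Bge by (intro mult_right_mono) auto
    finally show "\<bar>L22 p\<bar> \<le> B * (sin (p$1))\<^sup>2" .
    have kb: "\<bar>k (p$1)\<bar> \<le> 1" "\<bar>sig (p$1)\<bar> \<le> 1" "\<bar>z (p$1)\<bar> \<le> Bz" "\<bar>rho (p$1)\<bar> \<le> C" "\<bar>w (p$1)\<bar> \<le> C"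
      using k_abs_less_1[OF \<theta>] pos Bz \<theta> rho_le[OF \<theta>] w_bounds(2)[OF \<theta>] by auto
    have m: "\<bar>rho (p$1) * k (p$1)\<bar> \<le> C * 1" "\<bar>z (p$1) * sig (p$1)\<bar> \<le> Bz * 1" "\<bar>rho (p$1) * sig (p$1)\<bar> \<le> C * 1" "\<bar>z (p$1) * k (p$1)\<bar> \<le> Bz * 1"
      unfolding abs_mult using mult_mono[OF kb(4,1)] mult_mono[OF kb(3,2)] mult_mono[OF kb(4,2)] mult_mono[OF kb(3,1)] Bs
      by auto
    have "\<bar>P p\<bar> \<le> C * (C + Bz)"
    proof -
      have "\<bar>rho (p$1) * k (p$1) - z (p$1) * sig (p$1)\<bar> \<le> C + Bz" using m(1,2) by linarith
      from mult_mono[OF kb(5) this] Bs show ?thesis unfolding P_def abs_mult[of "w (p$1)"] by simp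
    qed
    then show "\<bar>P p\<bar> \<le> B" using Bge by linarith
    show "\<bar>h p\<bar> \<le> B" using m Bge unfolding h_def by linarith
  qed (auto simp: L11_def P_def vector_2)
  moreover have "\<forall>p\<in>polar_dom. 0 \<le> h p"
    using zk mult_pos_pos[OF rho_pos sig_bounds(2)] by (force simp: h_def mem_polar_dom intro: add_nonneg_nonneg less_imp_le)
  ultimately show ?thesis unfolding L11_def[abs_def] L22_def[abs_def] by blast
qed

end

subsection \<open>The one-dimensional inequality\<close>

definition bdd :: "(real \<Rightarrow> real) \<Rightarrow> bool" where
  "bdd f \<longleftrightarrow> (\<exists>K. \<forall>\<theta>. 0 < \<theta> \<and> \<theta> < pi \<longrightarrow> \<bar>f \<theta>\<bar> \<le> K)"

lemma bddI: "(\<And>\<theta>. 0 < \<theta> \<Longrightarrow> \<theta> < pi \<Longrightarrow> \<bar>f \<theta>\<bar> \<le> K) \<Longrightarrow> bdd f"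
  unfolding bdd_def by blast

lemma bdd_const: "bdd (\<lambda>\<theta>. c)"
  by (rule bddI[of _ "\<bar>c\<bar>"]) simp

lemma bdd_add: "bdd f \<Longrightarrow> bdd g \<Longrightarrow> bdd (\<lambda>\<theta>. f \<theta> + g \<theta>)"
  unfolding bdd_def by (meson abs_triangle_ineq add_mono order_trans)

lemma bdd_mult: "bdd f \<Longrightarrow> bdd g \<Longrightarrow> bdd (\<lambda>\<theta>. f \<theta> * g \<theta>)"
  unfolding bdd_def abs_mult by (meson abs_ge_zero mult_mono order_trans)

lemma bdd_minus: "bdd f \<Longrightarrow> bdd (\<lambda>\<theta>. - f \<theta>)"
  unfolding bdd_def by simp

lemma bdd_diff: "bdd f \<Longrightarrow> bdd g \<Longrightarrow> bdd (\<lambda>\<theta>. f \<theta> - g \<theta>)"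
  using bdd_add[OF _ bdd_minus] by fastforce

lemma bdd_power: "bdd f \<Longrightarrow> bdd (\<lambda>\<theta>. f \<theta> ^ n)"
  by (induction n) (auto intro: bdd_const bdd_mult)

lemma bdd_inverse:
  assumes "0 < d" "\<And>\<theta>. 0 < \<theta> \<Longrightarrow> \<theta> < pi \<Longrightarrow> d \<le> g \<theta>"
  shows "bdd (\<lambda>\<theta>. inverse (g \<theta>))"
proof (rule bddI)
  fix \<theta> :: real assume "0 < \<theta>" "\<theta> < pi"
  then have "d \<le> g \<theta>" using assms by blast
  then show "\<bar>inverse (g \<theta>)\<bar> \<le> inverse d" using assms(1) by (simp add: le_imp_inverse_le)
qed

lemma bdd_cong: "bdd f \<Longrightarrow> (\<And>\<theta>. 0 < \<theta> \<Longrightarrow> \<theta> < pi \<Longrightarrow> f \<theta> = g \<theta>) \<Longrightarrow> bdd g"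
  unfolding bdd_def by simp

lemma bdd_arsinh: "bdd f \<Longrightarrow> bdd (\<lambda>\<theta>. arsinh (f \<theta>))"
proof -
  assume "bdd f"
  then obtain K where K: "\<And>\<theta>. 0 < \<theta> \<Longrightarrow> \<theta> < pi \<Longrightarrow> \<bar>f \<theta>\<bar> \<le> K" unfolding bdd_def by blast
  show ?thesis
  proof (rule bddI)
    fix \<theta> :: real assume "0 < \<theta>" "\<theta> < pi"
    then have "\<bar>f \<theta>\<bar> \<le> K" by (rule K)
    then have "- K \<le> f \<theta>" "f \<theta> \<le> K" by linarith+
    moreover have "arsinh a \<le> arsinh b" if "a \<le> b" for a b :: real
      using that by (simp flip: not_less)
    ultimately have "arsinh (- K) \<le> arsinh (f \<theta>)" "arsinh (f \<theta>) \<le> arsinh K"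
      by blast+
    then show "\<bar>arsinh (f \<theta>)\<bar> \<le> arsinh K" by (simp add: arsinh_minus_real abs_le_iff)
  qed
qed

lemma integrable_bdd:
  assumes "bdd f" "continuous_on {0<..<pi} f"
  shows "f integrable_on {0..pi}"
proof -
  obtain K where K: "\<And>\<theta>. 0 < \<theta> \<Longrightarrow> \<theta> < pi \<Longrightarrow> \<bar>f \<theta>\<bar> \<le> K" using assms(1) unfolding bdd_def by blast
  have "f absolutely_integrable_on {0<..<pi}"
  proof (rule measurable_bounded_by_integrable_imp_absolutely_integrable)
    show "f \<in> borel_measurable (lebesgue_on {0<..<pi})"
      by (rule continuous_imp_measurable_on_sets_lebesgue[OF assms(2)]) auto
    show "\<And>x. x \<in> {0<..<pi} \<Longrightarrow> norm (f x) \<le> K" using K by auto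
    show "(\<lambda>x. K) integrable_on {0<..<pi}" by (simp add: integrable_on_Icc_iff_Ioo[symmetric] integrable_const_ivl)
  qed auto
  then show ?thesis
    using set_lebesgue_integral_eq_integral(1) integrable_on_Icc_iff_Ioo[of f 0 pi] by blast
qed

text \<open>Half the sum of the tangent-line inequalities for \<open>exp\<close> at \<open>b\<close>
  and at \<open>- b\<close>.\<close>

lemma cosh_tangent: "cosh (b::real) + sinh b * (a - b) \<le> cosh a"
proof -
  have e: "exp b * (1 + (a - b)) \<le> exp a" for a b :: real
  proof -
    have "exp b * (1 + (a - b)) \<le> exp b * exp (a - b)" by (intro mult_left_mono exp_ge_add_one_self) simp
    then show ?thesis by (simp add: exp_diff)
  qed
  have "cosh b + sinh b * (a - b) = (exp b * (1 + (a - b)) + exp (- b) * (1 + (- a - - b))) / 2"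
    by (simp add: cosh_def sinh_def algebra_simps divide_simps)
  also have "\<dots> \<le> (exp a + exp (- a)) / 2" using e[of b a] e[of "-b" "-a"] by simp
  finally show ?thesis by (simp add: cosh_def)
qed

lemma arsinh_deriv:
  "(f has_real_derivative d) (at x) \<Longrightarrow> ((\<lambda>x. arsinh (f x)) has_real_derivative d / cosh (arsinh (f x))) (at x)"
  for f :: "real \<Rightarrow> real"
  using DERIV_chain2[OF arsinh_real_has_field_derivative] by (simp add: cosh_arsinh_real add.commute)

text \<open>\<open>s\<close> is the \<open>\<theta>\<close>-coefficient of the metric of the surface, \<open>w\<close> that of the metric augmented by
  \<open>d\<tau>\<close>, \<open>y = \<tau>'\<close>, and \<open>h\<close> the norm of the mean curvature vector.\<close>

locale energy =
  base: revolution s rho k0 s1 k01 c C + aug: revolution w rho k w1 k1 c' C'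
  for s rho k0 s1 k01 c C w k w1 k1 c' C' +
  fixes y y1 y2 s2 h h1 :: "real \<Rightarrow> real" and N d :: real
  assumes w_sq: "0 < \<theta> \<Longrightarrow> \<theta> < pi \<Longrightarrow> (w \<theta>)\<^sup>2 = (s \<theta>)\<^sup>2 + (y \<theta>)\<^sup>2"
    and y_deriv: "0 < \<theta> \<Longrightarrow> \<theta> < pi \<Longrightarrow> (y has_real_derivative y1 \<theta>) (at \<theta>)"
    and y1_deriv: "0 < \<theta> \<Longrightarrow> \<theta> < pi \<Longrightarrow> (y1 has_real_derivative y2 \<theta>) (at \<theta>)"
    and s1_deriv: "0 < \<theta> \<Longrightarrow> \<theta> < pi \<Longrightarrow> (s1 has_real_derivative s2 \<theta>) (at \<theta>)"
    and h_deriv: "0 < \<theta> \<Longrightarrow> \<theta> < pi \<Longrightarrow> (h has_real_derivative h1 \<theta>) (at \<theta>)"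
    and cont_deriv: "continuous_on {0<..<pi} y2" "continuous_on {0<..<pi} s2" "continuous_on {0<..<pi} h1"
    and bdd_deriv: "bdd y1" "bdd y2" "bdd s1" "bdd s2" "bdd h" "bdd h1"
    and y_bound: "0 < \<theta> \<Longrightarrow> \<theta> < pi \<Longrightarrow> \<bar>y \<theta>\<bar> \<le> N * sin \<theta>"
    and d_pos: "0 < d" and h_ge: "0 < \<theta> \<Longrightarrow> \<theta> < pi \<Longrightarrow> d \<le> h \<theta>"
    and h_le: "0 < \<theta> \<Longrightarrow> \<theta> < pi \<Longrightarrow> rho \<theta> * s \<theta> * h \<theta> \<le> base.mean_density \<theta>"
begin

text \<open>\<open>Dv / s\<close> is the Laplacian of the time function for the induced metric, and
  \<open>rho * Dv\<close> is the derivative of \<open>Y\<close>.\<close>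

definition Dv where "Dv \<theta> = k0 \<theta> * (y \<theta> / rho \<theta>) + y1 \<theta> / s \<theta> - y \<theta> * s1 \<theta> / (s \<theta>)\<^sup>2"
definition dDv where "dDv \<theta> = k01 \<theta> * (y \<theta> / rho \<theta>) + k0 \<theta> * ((y1 \<theta> * rho \<theta> - y \<theta> * (s \<theta> * k0 \<theta>)) / (rho \<theta>)\<^sup>2)
  + (y2 \<theta> * s \<theta> - y1 \<theta> * s1 \<theta>) / (s \<theta>)\<^sup>2
  - ((y1 \<theta> * s1 \<theta> + y \<theta> * s2 \<theta>) * (s \<theta>)\<^sup>2 - y \<theta> * s1 \<theta> * (2 * s \<theta> * s1 \<theta>)) / (s \<theta>)^4"
definition Y where "Y \<theta> = rho \<theta> * y \<theta> / s \<theta>"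
text \<open>The frame condition on \<open>e0\<close> reads \<open>h * sinh chi = Dv / w\<close>,
  since \<open>w / s\<close> is the square root of one plus the squared gradient and
  \<open>Dv / s\<close> is the Laplacian.\<close>

definition sh where "sh \<theta> = Dv \<theta> / (h \<theta> * w \<theta>)"
definition dsh where "dsh \<theta> = (dDv \<theta> * (h \<theta> * w \<theta>) - Dv \<theta> * (h1 \<theta> * w \<theta> + h \<theta> * w1 \<theta>)) / (h \<theta> * w \<theta>)\<^sup>2"
definition chi where "chi \<theta> = arsinh (sh \<theta>)"
definition dchi where "dchi \<theta> = dsh \<theta> / cosh (chi \<theta>)"
definition phys where "phys \<theta> = rho \<theta> * w \<theta> * h \<theta> * cosh (chi \<theta>) + Y \<theta> * dchi \<theta>"
text \<open>The hyperbolic sine of the reference boost \<open>ups\<close>, chosen so that the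
  hyperbolic cosine is \<open>aug.sig / base.sig\<close>.\<close>

definition q where "q \<theta> = y \<theta> * k \<theta> / (s \<theta> * base.sig \<theta>)"
definition dq where "dq \<theta> = ((y1 \<theta> * k \<theta> + y \<theta> * k1 \<theta>) * (s \<theta> * base.sig \<theta>) -
  y \<theta> * k \<theta> * (s1 \<theta> * base.sig \<theta> - s \<theta> * (k0 \<theta> * k01 \<theta> / base.sig \<theta>))) / (s \<theta> * base.sig \<theta>)\<^sup>2"
definition ups where "ups \<theta> = arsinh (q \<theta>)"
definition dups where "dups \<theta> = dq \<theta> / cosh (ups \<theta>)"

lemma pos: assumes "0 < \<theta>" "\<theta> < pi"
  shows "0 < s \<theta>" "0 < w \<theta>" "0 < rho \<theta>" "0 < h \<theta>" "0 < base.sig \<theta>" "0 < aug.sig \<theta>"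
  using base.w_pos[OF assms] aug.w_pos[OF assms] base.rho_pos[OF assms] h_ge[OF assms] d_pos base.sig_bounds(2)[OF assms]
    aug.sig_bounds(2)[OF assms] by linarith+

text \<open>Both metrics share the radius \<open>rho\<close>, and each side is its
  derivative.\<close>

lemma k_rel: assumes "0 < \<theta>" "\<theta> < pi" shows "w \<theta> * k \<theta> = s \<theta> * k0 \<theta>"
  using DERIV_unique[OF aug.rho_deriv[OF assms] base.rho_deriv[OF assms]] .

lemma w1_rel: assumes "0 < \<theta>" "\<theta> < pi" shows "w \<theta> * w1 \<theta> = s \<theta> * s1 \<theta> + y \<theta> * y1 \<theta>"
proof -
  have "((\<lambda>\<theta>. (w \<theta>)\<^sup>2) has_real_derivative 2 * w \<theta> * w1 \<theta>) (at \<theta>)"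
    by (auto intro!: derivative_eq_intros aug.w_deriv assms)
  moreover have "((\<lambda>\<theta>. (s \<theta>)\<^sup>2 + (y \<theta>)\<^sup>2) has_real_derivative 2 * s \<theta> * s1 \<theta> + 2 * y \<theta> * y1 \<theta>) (at \<theta>)"
    by (auto intro!: derivative_eq_intros base.w_deriv y_deriv assms)
  then have "((\<lambda>\<theta>. (w \<theta>)\<^sup>2) has_real_derivative 2 * s \<theta> * s1 \<theta> + 2 * y \<theta> * y1 \<theta>) (at \<theta>)"
    by (rule has_field_derivative_transform_within_open[of _ _ _ "{0<..<pi}"]) (use assms in \<open>auto simp: w_sq\<close>)
  ultimately show ?thesis using DERIV_unique by fastforce
qed

lemma k1_rel: assumes "0 < \<theta>" "\<theta> < pi" shows "w1 \<theta> * k \<theta> + w \<theta> * k1 \<theta> = s1 \<theta> * k0 \<theta> + s \<theta> * k01 \<theta>"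
proof -
  have "((\<lambda>\<theta>. w \<theta> * k \<theta>) has_real_derivative w1 \<theta> * k \<theta> + w \<theta> * k1 \<theta>) (at \<theta>)"
    by (auto intro!: derivative_eq_intros aug.w_deriv aug.k_deriv assms)
  moreover have "((\<lambda>\<theta>. s \<theta> * k0 \<theta>) has_real_derivative s1 \<theta> * k0 \<theta> + s \<theta> * k01 \<theta>) (at \<theta>)"
    by (auto intro!: derivative_eq_intros base.w_deriv base.k_deriv assms)
  then have "((\<lambda>\<theta>. w \<theta> * k \<theta>) has_real_derivative s1 \<theta> * k0 \<theta> + s \<theta> * k01 \<theta>) (at \<theta>)"
    by (rule has_field_derivative_transform_within_open[of _ _ _ "{0<..<pi}"]) (use assms in \<open>auto simp: k_rel\<close>)
  ultimately show ?thesis using DERIV_unique by blast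
qed

text \<open>Both sides equal \<open>(s \<theta>)\<^sup>2 * (1 - (k \<theta>)\<^sup>2)\<close>, by
  \<open>w * k = s * k0\<close> and \<open>w\<^sup>2 = s\<^sup>2 + y\<^sup>2\<close>.\<close>

lemma sig_rel: assumes "0 < \<theta>" "\<theta> < pi"
  shows "(s \<theta> * aug.sig \<theta>)\<^sup>2 = (s \<theta> * base.sig \<theta>)\<^sup>2 + (y \<theta> * k \<theta>)\<^sup>2"
proof -
  have "(s \<theta>)\<^sup>2 * (k0 \<theta>)\<^sup>2 = (w \<theta>)\<^sup>2 * (k \<theta>)\<^sup>2" using k_rel[OF assms] by (metis power_mult_distrib)
  then show ?thesis
    using base.sig_bounds(4)[OF assms] aug.sig_bounds(4)[OF assms] w_sq[OF assms]
    by (simp add: power_mult_distrib right_diff_distrib distrib_right)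
qed

lemma cosh_ups: assumes "0 < \<theta>" "\<theta> < pi" shows "cosh (ups \<theta>) = aug.sig \<theta> / base.sig \<theta>"
proof -
  note p = pos[OF assms]
  have "1 + (q \<theta>)\<^sup>2 = ((s \<theta> * base.sig \<theta>)\<^sup>2 + (y \<theta> * k \<theta>)\<^sup>2) / (s \<theta> * base.sig \<theta>)\<^sup>2"
    using p by (simp add: q_def power_divide add_divide_distrib)
  also have "\<dots> = (aug.sig \<theta> / base.sig \<theta>)\<^sup>2"
    unfolding sig_rel[OF assms, symmetric] using p by (simp add: power_divide power_mult_distrib)
  finally have "1 + (q \<theta>)\<^sup>2 = (aug.sig \<theta> / base.sig \<theta>)\<^sup>2" .
  then show ?thesis unfolding ups_def cosh_arsinh_real using p by (simp add: add.commute)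
qed

lemma Y_deriv: assumes "0 < \<theta>" "\<theta> < pi" shows "(Y has_real_derivative rho \<theta> * Dv \<theta>) (at \<theta>)"
  unfolding Y_def[abs_def] using pos[OF assms]
  by (auto intro!: derivative_eq_intros base.rho_deriv base.w_deriv y_deriv assms simp: Dv_def divide_simps power2_eq_square)

lemma Dv_deriv: assumes "0 < \<theta>" "\<theta> < pi" shows "(Dv has_real_derivative dDv \<theta>) (at \<theta>)"
proof -
  have u: "((\<lambda>\<theta>. y \<theta> / rho \<theta>) has_real_derivative (y1 \<theta> * rho \<theta> - y \<theta> * (s \<theta> * k0 \<theta>)) / (rho \<theta>)\<^sup>2) (at \<theta>)"
    and v: "((\<lambda>\<theta>. y1 \<theta> / s \<theta>) has_real_derivative (y2 \<theta> * s \<theta> - y1 \<theta> * s1 \<theta>) / (s \<theta>)\<^sup>2) (at \<theta>)"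
    using pos[OF assms]
    by (auto intro!: derivative_eq_intros base.rho_deriv base.w_deriv y_deriv y1_deriv assms simp: power2_eq_square mult.commute)
  have t: "((\<lambda>\<theta>. y \<theta> * s1 \<theta> / (s \<theta>)\<^sup>2) has_real_derivative
      ((y1 \<theta> * s1 \<theta> + y \<theta> * s2 \<theta>) * (s \<theta>)\<^sup>2 - y \<theta> * s1 \<theta> * (2 * s \<theta> * s1 \<theta>)) / (s \<theta>)^4) (at \<theta>)"
    using pos[OF assms]
    by (auto intro!: derivative_eq_intros base.w_deriv y_deriv s1_deriv assms simp: power2_eq_square power4_eq_xxxx mult.commute mult.left_commute)
  have "((\<lambda>\<theta>. k0 \<theta> * (y \<theta> / rho \<theta>) + y1 \<theta> / s \<theta> - y \<theta> * s1 \<theta> / (s \<theta>)\<^sup>2) has_real_derivative dDv \<theta>) (at \<theta>)"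
    by (rule DERIV_cong[OF DERIV_diff[OF DERIV_add[OF DERIV_mult[OF base.k_deriv[OF assms] u] v] t]]) (simp add: dDv_def)
  then show ?thesis by (simp add: Dv_def[abs_def])
qed

lemma sh_deriv: assumes "0 < \<theta>" "\<theta> < pi" shows "(sh has_real_derivative dsh \<theta>) (at \<theta>)"
  unfolding sh_def[abs_def] dsh_def using pos[OF assms]
  by (auto intro!: derivative_eq_intros Dv_deriv h_deriv aug.w_deriv assms simp: power2_eq_square)

lemma chi_deriv: assumes "0 < \<theta>" "\<theta> < pi" shows "(chi has_real_derivative dchi \<theta>) (at \<theta>)"
  unfolding chi_def[abs_def] dchi_def by (rule arsinh_deriv[OF sh_deriv[OF assms]])

lemma q_deriv: assumes "0 < \<theta>" "\<theta> < pi" shows "(q has_real_derivative dq \<theta>) (at \<theta>)"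
  unfolding q_def[abs_def] dq_def using pos[OF assms]
  by (auto intro!: derivative_eq_intros base.w_deriv base.sig_deriv aug.k_deriv y_deriv assms simp: power2_eq_square)
    (simp add: algebra_simps)

lemma ups_deriv: assumes "0 < \<theta>" "\<theta> < pi" shows "(ups has_real_derivative dups \<theta>) (at \<theta>)"
  unfolding ups_def[abs_def] dups_def by (rule arsinh_deriv[OF q_deriv[OF assms]])

text \<open>Gives the reference density the same shape as \<open>phys\<close>:
  \<open>base.mean_density / s\<close> stands in the place of \<open>rho * h\<close>, and
  \<open>ups\<close> in that of \<open>chi\<close>. This is what makes a pointwise comparison by
  convexity possible.\<close>

lemma mean_density_rel: assumes "0 < \<theta>" "\<theta> < pi"
  shows "aug.mean_density \<theta> = base.mean_density \<theta> * (w \<theta> / s \<theta>) * cosh (ups \<theta>) + Y \<theta> * dups \<theta>"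
proof -
  define S W R K0 K S1 K01 K1 W1 G0 G y' y1' where
    "S = s \<theta>" and "W = w \<theta>" and "R = rho \<theta>" and "K0 = k0 \<theta>" and "K = k \<theta>" and "S1 = s1 \<theta>" and "K01 = k01 \<theta>"
    and "K1 = k1 \<theta>" and "W1 = w1 \<theta>" and "G0 = base.sig \<theta>" and "G = aug.sig \<theta>" and "y' = y \<theta>" and "y1' = y1 \<theta>"
  note d = S_def W_def R_def K0_def K_def S1_def K01_def K1_def W1_def G0_def G_def y'_def y1'_def
  have p: "S > 0" "W > 0" "R > 0" "G0 > 0" "G > 0" using pos[OF assms] by (simp_all add: d)
  have r: "W * K = S * K0" "W * W1 = S * S1 + y' * y1'" "W1 * K + W * K1 = S1 * K0 + S * K01"
    "(S * G)\<^sup>2 = (S * G0)\<^sup>2 + (y' * K)\<^sup>2" "W\<^sup>2 = S\<^sup>2 + y'\<^sup>2"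
    using k_rel[OF assms] w1_rel[OF assms] k1_rel[OF assms] sig_rel[OF assms] w_sq[OF assms] by (simp_all add: d)
  \<comment> \<open>The differentiated relation \<open>w * k = s * k0\<close>, multiplied by
    \<open>s * w\<close> so that \<open>w * w1\<close> and \<open>s * k0\<close> can be replaced; it
    is then solved for the term with \<open>k1\<close>.\<close>
  have "S * W * (W1 * K + W * K1) = S * W * (S1 * K0 + S * K01)" using r(3) by simp
  then have "S * K * (W * W1) + S * W\<^sup>2 * K1 = W * S1 * (S * K0) + S\<^sup>2 * W * K01"
    by (simp add: algebra_simps power2_eq_square)
  then have "S * K * (S * S1 + y' * y1') + S * W\<^sup>2 * K1 = W\<^sup>2 * S1 * K + S\<^sup>2 * W * K01"
    unfolding r(2) r(1)[symmetric] by (simp add: algebra_simps power2_eq_square)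
  then have E: "S * W\<^sup>2 * K1 = S\<^sup>2 * W * K01 + (y'\<^sup>2 * S1 - S * y' * y1') * K"
    unfolding r(5) by (simp add: algebra_simps power2_eq_square)
  have "dups \<theta> = ((y1' * K + y' * K1) * (S * G0) - y' * K * (S1 * G0 - S * (K0 * K01 / G0))) / (S * G0)\<^sup>2 * (G0 / G)"
    unfolding dups_def dq_def cosh_ups[OF assms] d by simp
  also have "\<dots> = ((y1' * K + y' * K1) * S * G0\<^sup>2 - y' * K * (S1 * G0\<^sup>2 - S * K0 * K01)) / (S\<^sup>2 * G0\<^sup>2 * G)"
    using p by (simp add: divide_simps power2_eq_square)
  finally have du: "dups \<theta> = ((y1' * K + y' * K1) * S * G0\<^sup>2 - y' * K * (S1 * G0\<^sup>2 - S * K0 * K01)) / (S\<^sup>2 * G0\<^sup>2 * G)" .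
  have main: "- (S^3 * G0\<^sup>2) * K1 = - (S\<^sup>2 * K01 * W * G\<^sup>2) + y' * ((y1' * K + y' * K1) * S * G0\<^sup>2 - y' * K * (S1 * G0\<^sup>2 - S * K0 * K01))"
  proof -
    have "S\<^sup>2 * G\<^sup>2 = S\<^sup>2 * G0\<^sup>2 + y'\<^sup>2 * K\<^sup>2" using r(4) by (simp add: power_mult_distrib)
    then have "S\<^sup>2 * K01 * W * G\<^sup>2 = K01 * W * (S\<^sup>2 * G0\<^sup>2 + y'\<^sup>2 * K\<^sup>2)" by (simp add: algebra_simps)
    moreover have x: "S * K0 * K01 = W * K * K01" using r(1) by simp
    moreover have "G0\<^sup>2 * (S * (S\<^sup>2 + y'\<^sup>2) * K1) = G0\<^sup>2 * (S\<^sup>2 * W * K01 + (y'\<^sup>2 * S1 - S * y' * y1') * K)"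
      using E unfolding r(5) by simp
    ultimately show ?thesis
      unfolding x by (simp add: algebra_simps power2_eq_square power3_eq_cube)
  qed
  have "aug.mean_density \<theta> = W * G - R * K1 / G" by (simp add: aug.mean_density_def d)
  moreover have "base.mean_density \<theta> * (w \<theta> / s \<theta>) * cosh (ups \<theta>) = (S * G0 - R * K01 / G0) * (W / S) * (G / G0)"
    by (simp add: base.mean_density_def cosh_ups[OF assms] d)
  moreover have "Y \<theta> = R * y' / S" by (simp add: Y_def d)
  moreover have "W * G - R * K1 / G = (S * G0 - R * K01 / G0) * (W / S) * (G / G0) +
     R * y' / S * (((y1' * K + y' * K1) * S * G0\<^sup>2 - y' * K * (S1 * G0\<^sup>2 - S * K0 * K01)) / (S\<^sup>2 * G0\<^sup>2 * G))"
  proof -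
    have "(S * G0 - R * K01 / G0) * (W / S) * (G / G0) +
     R * y' / S * (((y1' * K + y' * K1) * S * G0\<^sup>2 - y' * K * (S1 * G0\<^sup>2 - S * K0 * K01)) / (S\<^sup>2 * G0\<^sup>2 * G))
     = W * G + R / (S^3 * G0\<^sup>2 * G) * (- (S\<^sup>2 * K01 * W * G\<^sup>2) + y' * ((y1' * K + y' * K1) * S * G0\<^sup>2 - y' * K * (S1 * G0\<^sup>2 - S * K0 * K01)))"
      using p by (simp add: divide_simps power2_eq_square power3_eq_cube) (simp add: algebra_simps)
    also have "\<dots> = W * G + R / (S^3 * G0\<^sup>2 * G) * (- (S^3 * G0\<^sup>2) * K1)" by (simp only: main)
    also have "\<dots> = W * G - R * K1 / G" using p by (simp add: divide_simps)
    finally show ?thesis by simp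
  qed
  ultimately show ?thesis by (simp only: du)
qed

text \<open>The bracket is the derivative of \<open>Y * (chi - ups)\<close>. It arises because
  \<open>rho * w * h * sinh chi = rho * Dv\<close> is the derivative of \<open>Y\<close>: the linear
  term of the tangent inequality for \<open>cosh\<close> at \<open>chi\<close> is that derivative
  times \<open>ups - chi\<close>.\<close>

lemma pointwise: assumes "0 < \<theta>" "\<theta> < pi"
  shows "base.mean_density \<theta> - rho \<theta> * s \<theta> * h \<theta> - (rho \<theta> * Dv \<theta> * (chi \<theta> - ups \<theta>) + Y \<theta> * (dchi \<theta> - dups \<theta>))
    \<le> aug.mean_density \<theta> - phys \<theta>"
proof -
  note p = pos[OF assms]
  define W a M where "W = w \<theta> / s \<theta>" and "a = rho \<theta> * w \<theta> * h \<theta>" and "M = base.mean_density \<theta>"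
  have "s \<theta> \<le> w \<theta>" by (rule power2_le_imp_le) (use w_sq[OF assms] p in simp_all)
  then have W: "1 \<le> W" using p by (simp add: W_def)
  have aW: "rho \<theta> * s \<theta> * h \<theta> * W = a" using p by (simp add: W_def a_def)
  \<comment> \<open>The factor \<open>w / s * cosh ups\<close> is at least 1, and it multiplies the
    nonnegative excess of \<open>base.mean_density\<close> over \<open>rho * s * h\<close>.\<close>
  have "1 * 1 \<le> W * cosh (ups \<theta>)" using W cosh_real_ge_1[of "ups \<theta>"] by (intro mult_mono) auto
  then have "(M - rho \<theta> * s \<theta> * h \<theta>) * 1 \<le> (M - rho \<theta> * s \<theta> * h \<theta>) * (W * cosh (ups \<theta>))"
    using h_le[OF assms] by (intro mult_left_mono) (auto simp: M_def)
  also have "\<dots> = M * W * cosh (ups \<theta>) - a * cosh (ups \<theta>)"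
    unfolding aW[symmetric] by (simp only: left_diff_distrib mult.assoc)
  finally have 1: "M - rho \<theta> * s \<theta> * h \<theta> \<le> M * W * cosh (ups \<theta>) - a * cosh (ups \<theta>)" by simp
  have as: "a * sinh (chi \<theta>) = rho \<theta> * Dv \<theta>"
    using p by (simp add: a_def chi_def sh_def)
  have "a * (cosh (chi \<theta>) + sinh (chi \<theta>) * (ups \<theta> - chi \<theta>)) = a * cosh (chi \<theta>) + a * sinh (chi \<theta>) * (ups \<theta> - chi \<theta>)"
    by (simp only: distrib_left mult.assoc)
  also have "\<dots> = a * cosh (chi \<theta>) - rho \<theta> * Dv \<theta> * (chi \<theta> - ups \<theta>)"
    unfolding as by (simp add: algebra_simps)
  finally have "a * cosh (chi \<theta>) - rho \<theta> * Dv \<theta> * (chi \<theta> - ups \<theta>) \<le> a * cosh (ups \<theta>)"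
    using mult_left_mono[OF cosh_tangent[of "chi \<theta>" "ups \<theta>"], of a] p by (simp add: a_def)
  with 1 have "M - rho \<theta> * s \<theta> * h \<theta> - (rho \<theta> * Dv \<theta> * (chi \<theta> - ups \<theta>) + (Y \<theta> * dchi \<theta> - Y \<theta> * dups \<theta>))
    \<le> M * W * cosh (ups \<theta>) + Y \<theta> * dups \<theta> - (a * cosh (chi \<theta>) + Y \<theta> * dchi \<theta>)"
    by simp
  then show ?thesis
    unfolding mean_density_rel[OF assms] phys_def W_def[symmetric] M_def[symmetric] a_def[symmetric] right_diff_distrib[of "Y \<theta>"] .
qed

lemma bdd_basic: "bdd (\<lambda>\<theta>. y \<theta> / rho \<theta>)" "bdd y" "bdd k0" "bdd k01" "bdd s" "bdd w" "bdd rho" "bdd w1" "bdd k1" "bdd k"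
  "bdd (\<lambda>\<theta>. inverse (w \<theta>))" "bdd (\<lambda>\<theta>. inverse (s \<theta>))" "bdd (\<lambda>\<theta>. inverse (h \<theta>))"
proof -
  show "bdd (\<lambda>\<theta>. y \<theta> / rho \<theta>)"
  proof (rule bddI)
    fix \<theta> :: real assume \<theta>: "0 < \<theta>" "\<theta> < pi"
    have s: "0 < sin \<theta>" using sin_gt_zero \<theta> by simp
    have "\<bar>y \<theta>\<bar> / \<bar>rho \<theta>\<bar> \<le> (N * sin \<theta>) / (c * sin \<theta>)"
      using y_bound[OF \<theta>] base.rho_bounds(1)[OF \<theta>] pos[OF \<theta>] s base.c_pos order_trans[OF abs_ge_zero y_bound[OF \<theta>]]
      by (intro frac_le) auto
    then show "\<bar>y \<theta> / rho \<theta>\<bar> \<le> N / c" using s by simp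
  qed
  show 1: "bdd w" "bdd s" by (rule bddI, use pos aug.w_bounds(2) base.w_bounds(2) in force)+
  show "bdd rho" by (rule bddI[OF base.rho_le])
  with \<open>bdd (\<lambda>\<theta>. y \<theta> / rho \<theta>)\<close> have "bdd (\<lambda>\<theta>. y \<theta> / rho \<theta> * rho \<theta>)" by (rule bdd_mult)
  then show 2: "bdd y" by (rule bdd_cong) (use pos(3) in force)
  show "bdd k0" "bdd k" by (rule bddI, use base.k_abs_less_1 aug.k_abs_less_1 less_imp_le in blast)+
  show "bdd k01" by (rule bddI[of _ C])
    (use base.k1_bounds(2) base.k1_neg base.C_pos mult_left_mono[OF sin_le_one, of C] in \<open>smt (verit)\<close>)
  show "bdd k1" by (rule bddI[of _ C'])
    (use aug.k1_bounds(2) aug.k1_neg aug.C_pos mult_left_mono[OF sin_le_one, of C'] in \<open>smt (verit)\<close>)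
  show i: "bdd (\<lambda>\<theta>. inverse (w \<theta>))" "bdd (\<lambda>\<theta>. inverse (s \<theta>))" "bdd (\<lambda>\<theta>. inverse (h \<theta>))"
    by (rule bdd_inverse[OF aug.c_pos aug.w_bounds(1)] bdd_inverse[OF base.c_pos base.w_bounds(1)] bdd_inverse[OF d_pos h_ge]; assumption)+
  have "bdd (\<lambda>\<theta>. (s \<theta> * s1 \<theta> + y \<theta> * y1 \<theta>) * inverse (w \<theta>))"
    by (intro bdd_mult bdd_add 1 2 i bdd_deriv)
  then show "bdd w1"
  proof (rule bdd_cong)
    fix \<theta> :: real assume \<theta>: "0 < \<theta>" "\<theta> < pi"
    show "(s \<theta> * s1 \<theta> + y \<theta> * y1 \<theta>) * inverse (w \<theta>) = w1 \<theta>"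
      using pos(2)[OF \<theta>] by (simp add: w1_rel[OF \<theta>, symmetric])
  qed
qed

lemma cont_basic: "continuous_on {0<..<pi} y" "continuous_on {0<..<pi} y1" "continuous_on {0<..<pi} s1" "continuous_on {0<..<pi} h"
  using DERIV_isCont[OF y_deriv] DERIV_isCont[OF y1_deriv] DERIV_isCont[OF s1_deriv] DERIV_isCont[OF h_deriv]
  by (auto intro!: continuous_at_imp_continuous_on)

lemma bdd_sh: "bdd sh"
proof -
  have "bdd (\<lambda>\<theta>. (k0 \<theta> * (y \<theta> / rho \<theta>) + y1 \<theta> * inverse (s \<theta>) - y \<theta> * s1 \<theta> * (inverse (s \<theta>) * inverse (s \<theta>))) *
     (inverse (h \<theta>) * inverse (w \<theta>)))"
    by (intro bdd_mult bdd_add bdd_diff bdd_basic bdd_deriv)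
  then show ?thesis by (rule bdd_cong) (simp add: sh_def Dv_def divide_inverse power2_eq_square)
qed

lemma bdd_Y_dsh: "bdd (\<lambda>\<theta>. Y \<theta> * dsh \<theta>)"
proof -
  let ?u = "\<lambda>\<theta>. y \<theta> / rho \<theta>" and ?i = "\<lambda>\<theta>. inverse (s \<theta>)"
  let ?D = "\<lambda>\<theta>. k0 \<theta> * ?u \<theta> + y1 \<theta> * ?i \<theta> - y \<theta> * s1 \<theta> * (?i \<theta>)^2"
  \<comment> \<open>the only unbounded part of \<open>dDv\<close> is cancelled by the double zero of \<open>Y\<close>\<close>
  let ?A = "\<lambda>\<theta>. y1 \<theta> * rho \<theta> - y \<theta> * (s \<theta> * k0 \<theta>)" and ?E = "\<lambda>\<theta>. y2 \<theta> * s \<theta> - y1 \<theta> * s1 \<theta>"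
    and ?F = "\<lambda>\<theta>. (y1 \<theta> * s1 \<theta> + y \<theta> * s2 \<theta>) * (s \<theta>)\<^sup>2 - y \<theta> * s1 \<theta> * (2 * s \<theta> * s1 \<theta>)"
  let ?YD = "\<lambda>\<theta>. rho \<theta> * y \<theta> * ?i \<theta> * (k01 \<theta> * ?u \<theta>) + ?u \<theta> * ?i \<theta> * k0 \<theta> * ?A \<theta>
    + rho \<theta> * y \<theta> * ?i \<theta> * (?E \<theta> * (?i \<theta>)\<^sup>2) - rho \<theta> * y \<theta> * ?i \<theta> * (?F \<theta> * (?i \<theta>)^4)"
  let ?hw = "\<lambda>\<theta>. inverse (h \<theta>) * inverse (w \<theta>)"
  have "bdd (\<lambda>\<theta>. (?YD \<theta> * (h \<theta> * w \<theta>) - rho \<theta> * y \<theta> * ?i \<theta> * (?D \<theta> * (h1 \<theta> * w \<theta> + h \<theta> * w1 \<theta>))) * (?hw \<theta>)\<^sup>2)"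
    by (intro bdd_mult bdd_add bdd_diff bdd_power bdd_basic bdd_deriv bdd_const)
  then show ?thesis
  proof (rule bdd_cong)
    fix \<theta> :: real assume "0 < \<theta>" "\<theta> < pi"
    note p = pos[OF this]
    have "Y \<theta> * (k0 \<theta> * (?A \<theta> / (rho \<theta>)\<^sup>2)) = ?u \<theta> * ?i \<theta> * k0 \<theta> * ?A \<theta>"
      using p by (simp add: Y_def power2_eq_square divide_simps)
    moreover have "?E \<theta> / (s \<theta>)\<^sup>2 = ?E \<theta> * (?i \<theta>)\<^sup>2" "?F \<theta> / (s \<theta>)^4 = ?F \<theta> * (?i \<theta>)^4"
      by (simp_all add: divide_inverse power_inverse)
    moreover have "Y \<theta> = rho \<theta> * y \<theta> * ?i \<theta>" by (simp add: Y_def divide_inverse)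
    moreover have "Y \<theta> * dDv \<theta> = Y \<theta> * (k01 \<theta> * ?u \<theta>) + Y \<theta> * (k0 \<theta> * (?A \<theta> / (rho \<theta>)\<^sup>2)) +
       Y \<theta> * (?E \<theta> / (s \<theta>)\<^sup>2) - Y \<theta> * (?F \<theta> / (s \<theta>)^4)"
      unfolding dDv_def by (simp only: distrib_left right_diff_distrib)
    ultimately have "Y \<theta> * dDv \<theta> = ?YD \<theta>" by (simp only:)
    moreover have "Dv \<theta> = ?D \<theta>" by (simp add: Dv_def divide_inverse power_inverse)
    moreover have "Y \<theta> * dsh \<theta> = (Y \<theta> * dDv \<theta> * (h \<theta> * w \<theta>) - Y \<theta> * (Dv \<theta> * (h1 \<theta> * w \<theta> + h \<theta> * w1 \<theta>))) * (?hw \<theta>)\<^sup>2"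
      by (simp add: dsh_def divide_inverse right_diff_distrib left_diff_distrib mult.assoc power_mult_distrib power_inverse)
    moreover have "Y \<theta> = rho \<theta> * y \<theta> * ?i \<theta>" by (simp add: Y_def divide_inverse)
    ultimately show "(?YD \<theta> * (h \<theta> * w \<theta>) - rho \<theta> * y \<theta> * ?i \<theta> * (?D \<theta> * (h1 \<theta> * w \<theta> + h \<theta> * w1 \<theta>))) * (?hw \<theta>)\<^sup>2 = Y \<theta> * dsh \<theta>"
      by (simp only:)
  qed
qed

lemma bdd_phys: "bdd phys"
proof -
  obtain K where K: "\<And>\<theta>. 0 < \<theta> \<Longrightarrow> \<theta> < pi \<Longrightarrow> \<bar>Y \<theta> * dsh \<theta>\<bar> \<le> K" using bdd_Y_dsh unfolding bdd_def by blast
  have "bdd (\<lambda>\<theta>. Y \<theta> * dchi \<theta>)"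
  proof (rule bddI)
    fix \<theta> :: real assume \<theta>: "0 < \<theta>" "\<theta> < pi"
    have "\<bar>Y \<theta> * dchi \<theta>\<bar> = \<bar>Y \<theta> * dsh \<theta>\<bar> / cosh (chi \<theta>)" by (simp add: dchi_def abs_mult abs_divide)
    also have "\<dots> \<le> \<bar>Y \<theta> * dsh \<theta>\<bar> / 1" using cosh_real_ge_1[of "chi \<theta>"] by (intro divide_left_mono) auto
    also have "\<dots> \<le> K" using K[OF \<theta>] by simp
    finally show "\<bar>Y \<theta> * dchi \<theta>\<bar> \<le> K" .
  qed
  moreover have "bdd (\<lambda>\<theta>. cosh (chi \<theta>))"
  proof -
    obtain K where K: "\<And>\<theta>. 0 < \<theta> \<Longrightarrow> \<theta> < pi \<Longrightarrow> \<bar>sh \<theta>\<bar> \<le> K" using bdd_sh unfolding bdd_def by blast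
    show ?thesis
    proof (rule bddI)
      fix \<theta> :: real assume "0 < \<theta>" "\<theta> < pi"
      then have "(sh \<theta>)\<^sup>2 \<le> K\<^sup>2" using K[of \<theta>] by (metis abs_ge_zero power2_abs power_mono)
      then show "\<bar>cosh (chi \<theta>)\<bar> \<le> sqrt (K\<^sup>2 + 1)" by (simp add: chi_def cosh_arsinh_real)
    qed
  qed
  ultimately show ?thesis unfolding phys_def[abs_def]
    by (intro bdd_add[OF bdd_mult[OF bdd_mult[OF bdd_mult[OF bdd_basic(7,6)] bdd_deriv(5)]]])
qed

lemma cont_phys: "continuous_on {0<..<pi} phys"
proof -
  have n: "\<forall>\<theta>\<in>{0<..<pi}. rho \<theta> \<noteq> 0" "\<forall>\<theta>\<in>{0<..<pi}. s \<theta> \<noteq> 0" "\<forall>\<theta>\<in>{0<..<pi}. h \<theta> * w \<theta> \<noteq> 0"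
    "\<forall>\<theta>\<in>{0<..<pi}. (rho \<theta>)\<^sup>2 \<noteq> 0" "\<forall>\<theta>\<in>{0<..<pi}. (s \<theta>)\<^sup>2 \<noteq> 0" "\<forall>\<theta>\<in>{0<..<pi}. (s \<theta>)^4 \<noteq> 0"
    "\<forall>\<theta>\<in>{0<..<pi}. (h \<theta> * w \<theta>)\<^sup>2 \<noteq> 0"
    using pos by force+
  note cs = cont_basic cont_deriv base.cont_on_open aug.cont_on_open base.cont_rho base.cont_w1 base.cont_k1 aug.cont_w1
  have Dv: "continuous_on {0<..<pi} Dv"
    unfolding Dv_def[abs_def] by (intro continuous_intros cs n)
  have "continuous_on {0<..<pi} dDv"
    unfolding dDv_def[abs_def] by (intro continuous_intros cs n)
  with Dv have "continuous_on {0<..<pi} dsh"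
    unfolding dsh_def[abs_def] by (intro continuous_intros cs n)
  moreover have "continuous_on {0<..<pi} chi"
    unfolding chi_def[abs_def] sh_def[abs_def] by (intro continuous_intros cs Dv n)
  moreover from this have "continuous_on {0<..<pi} (\<lambda>\<theta>. cosh (chi \<theta>))"
    by (intro continuous_intros)
  ultimately show ?thesis
    unfolding phys_def[abs_def] dchi_def[abs_def] Y_def[abs_def]
    by (intro continuous_intros cs n(2)) auto
qed

theorem energy_le:
  "integral {0..pi} (\<lambda>\<theta>. base.mean_density \<theta> - rho \<theta> * s \<theta> * h \<theta>) \<le> integral {0..pi} (\<lambda>\<theta>. aug.mean_density \<theta> - phys \<theta>)"
proof -
  have i1: "(\<lambda>\<theta>. base.mean_density \<theta> - rho \<theta> * s \<theta> * h \<theta>) integrable_on {0..pi}"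
    by (rule integrable_bdd, intro bdd_diff bdd_mult bdd_basic bdd_deriv bddI[OF base.mean_density_bound],
        assumption+, intro continuous_intros base.cont_mean_density base.cont_rho base.cont_on_open cont_basic)
  have i2: "(\<lambda>\<theta>. aug.mean_density \<theta> - phys \<theta>) integrable_on {0..pi}"
    by (rule integrable_bdd, intro bdd_diff bdd_phys bddI[OF aug.mean_density_bound], assumption+,
        intro continuous_intros aug.cont_mean_density cont_phys)
  \<comment> \<open>\<open>base.sig\<close> tends to zero at the poles no faster than
    \<open>sin\<close>, and \<open>y\<close> at least as fast, so \<open>q\<close> stays
    bounded.\<close>
  have bups: "bdd ups"
  proof -
    have "bdd q"
    proof (rule bddI)
      fix \<theta> :: real assume \<theta>: "0 < \<theta>" "\<theta> < pi"
      have sn: "0 < sin \<theta>" using sin_gt_zero \<theta> by simp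
      have "\<bar>y \<theta> * k \<theta>\<bar> \<le> (N * sin \<theta>) * 1" unfolding abs_mult
        using y_bound[OF \<theta>] aug.k_abs_less_1[OF \<theta>] order_trans[OF abs_ge_zero y_bound[OF \<theta>]] by (intro mult_mono) auto
      moreover have "c * (c * sin \<theta>) \<le> s \<theta> * base.sig \<theta>"
        using base.w_bounds(1)[OF \<theta>] base.sig_bounds(1)[OF \<theta>] base.c_pos sn pos[OF \<theta>] by (intro mult_mono) auto
      ultimately have "\<bar>q \<theta>\<bar> \<le> (N * sin \<theta>) / (c * (c * sin \<theta>))"
        unfolding q_def abs_divide using base.c_pos sn pos[OF \<theta>] order_trans[OF abs_ge_zero y_bound[OF \<theta>]] by (intro frac_le) auto
      then show "\<bar>q \<theta>\<bar> \<le> N / (c * c)" using sn by simp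
    qed
    then show ?thesis unfolding ups_def[abs_def] by (rule bdd_arsinh)
  qed
  have "bdd (\<lambda>\<theta>. (y \<theta> / rho \<theta>) * inverse (s \<theta>) * (chi \<theta> - ups \<theta>))"
    unfolding chi_def by (intro bdd_mult bdd_diff bdd_basic bdd_arsinh[OF bdd_sh] bups)
  then obtain K where K: "\<And>\<theta>. 0 < \<theta> \<Longrightarrow> \<theta> < pi \<Longrightarrow> \<bar>(y \<theta> / rho \<theta>) * inverse (s \<theta>) * (chi \<theta> - ups \<theta>)\<bar> \<le> K"
    unfolding bdd_def by blast
  have "((\<lambda>\<theta>. rho \<theta> * Dv \<theta> * (chi \<theta> - ups \<theta>) + Y \<theta> * (dchi \<theta> - dups \<theta>)) has_integral 0) {0..pi}"
  proof (rule has_integral_deriv_vanishing[where F = "\<lambda>\<theta>. Y \<theta> * (chi \<theta> - ups \<theta>)"])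
    fix \<theta> :: real assume \<theta>: "0 < \<theta>" "\<theta> < pi"
    show "((\<lambda>\<theta>. Y \<theta> * (chi \<theta> - ups \<theta>)) has_real_derivative
        rho \<theta> * Dv \<theta> * (chi \<theta> - ups \<theta>) + Y \<theta> * (dchi \<theta> - dups \<theta>)) (at \<theta>)"
      by (auto intro!: derivative_eq_intros Y_deriv chi_deriv ups_deriv \<theta>)
    have sn: "0 < sin \<theta>" using sin_gt_zero \<theta> by simp
    note p = pos[OF \<theta>]
    have "Y \<theta> * (chi \<theta> - ups \<theta>) = rho \<theta> * rho \<theta> * ((y \<theta> / rho \<theta>) * inverse (s \<theta>) * (chi \<theta> - ups \<theta>))"
      using p by (simp add: Y_def divide_inverse)
    then have "\<bar>Y \<theta> * (chi \<theta> - ups \<theta>)\<bar> = \<bar>rho \<theta> * rho \<theta>\<bar> * \<bar>(y \<theta> / rho \<theta>) * inverse (s \<theta>) * (chi \<theta> - ups \<theta>)\<bar>"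
      by (simp only: abs_mult)
    also have "\<dots> \<le> ((C * sin \<theta>) * C) * K"
    proof (rule mult_mono)
      have "rho \<theta> * rho \<theta> \<le> (C * sin \<theta>) * C"
        using base.rho_bounds(2)[OF \<theta>] base.rho_le[OF \<theta>] p sn base.C_pos by (intro mult_mono) auto
      then show "\<bar>rho \<theta> * rho \<theta>\<bar> \<le> (C * sin \<theta>) * C" by simp
    qed (use K[OF \<theta>] base.C_pos sn in auto)
    finally show "\<bar>Y \<theta> * (chi \<theta> - ups \<theta>)\<bar> \<le> (C * C * K) * sin \<theta>" by (simp add: algebra_simps)
  qed
  from has_integral_diff[OF integrable_integral[OF i1] this]
  have "((\<lambda>\<theta>. base.mean_density \<theta> - rho \<theta> * s \<theta> * h \<theta> - (rho \<theta> * Dv \<theta> * (chi \<theta> - ups \<theta>) + Y \<theta> * (dchi \<theta> - dups \<theta>)))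
    has_integral integral {0..pi} (\<lambda>\<theta>. base.mean_density \<theta> - rho \<theta> * s \<theta> * h \<theta>)) {0<..<pi}"
    by (simp add: has_integral_Icc_iff_Ioo)
  moreover have "((\<lambda>\<theta>. aug.mean_density \<theta> - phys \<theta>) has_integral integral {0..pi} (\<lambda>\<theta>. aug.mean_density \<theta> - phys \<theta>)) {0<..<pi}"
    using integrable_integral[OF i2] by (simp add: has_integral_Icc_iff_Ioo)
  ultimately show ?thesis by (rule has_integral_le) (use pointwise in auto)
qed

end

subsection \<open>Surfaces in Euclidean space\<close>

lemma pd_translate:
  assumes "\<And>q. f (q + v) = f q" shows "pd i f (p + v) = pd i f p"
proof -
  have "f (p + v + s *\<^sub>R axis i 1) = f (p + s *\<^sub>R axis i 1)" for s
    using assms[of "p + s *\<^sub>R axis i 1"] by (simp add: ac_simps)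
  then show ?thesis by (simp add: pd_def)
qed

lemma bounded_bilinear_cross3: "bounded_bilinear cross3"
  using bilinear_cross by (simp add: bilinear_conv_bounded_bilinear)

lemma has_derivative_fun_coord:
  assumes "(F has_real_derivative d) (at (p $ i))"
  shows "((\<lambda>p. F (p $ i)) has_derivative (\<lambda>v. d * v $ i)) (at p)"
  using has_derivative_compose[OF bounded_linear.has_derivative[OF bounded_linear_vec_nth has_derivative_ident]
      assms[unfolded has_field_derivative_def]] by simp

text \<open>The remainder is orthogonal to \<open>a\<close> and \<open>b\<close>, so by Lagrange's
  identity its cross product with \<open>n\<close> vanishes; being orthogonal to \<open>n\<close> as
  well, it is zero.\<close>

lemma orthogonal_frame_expansion:
  fixes v a b n :: "real^3"
  assumes "a \<bullet> b = 0" "a \<noteq> 0" "b \<noteq> 0" "n = t *\<^sub>R cross3 a b" "n \<bullet> n = 1"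
  shows "v = (v \<bullet> a / (a \<bullet> a)) *\<^sub>R a + (v \<bullet> b / (b \<bullet> b)) *\<^sub>R b + (v \<bullet> n) *\<^sub>R n"
proof -
  define z where "z = v - ((v \<bullet> a / (a \<bullet> a)) *\<^sub>R a + (v \<bullet> b / (b \<bullet> b)) *\<^sub>R b + (v \<bullet> n) *\<^sub>R n)"
  have n: "n \<bullet> a = 0" "n \<bullet> b = 0" "a \<bullet> n = 0" "b \<bullet> n = 0" by (simp_all add: assms(4) dot_cross_self)
  have "z \<bullet> a = 0" "z \<bullet> b = 0" "z \<bullet> n = 0"
    using assms(1-3,5) n by (simp_all add: z_def inner_diff_left inner_add_left inner_commute[of b a])
  then have "cross3 z n = 0" "n \<bullet> z = 0"
    by (simp_all add: assms(4) cross_mult_right Lagrange) (simp add: inner_commute)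
  moreover have "n \<noteq> 0" using assms(5) by auto
  ultimately have "z = 0" using cross_dot_cancel[of n z 0] cross_skew[of n z] by simp
  then show ?thesis by (simp add: z_def)
qed

text \<open>The sign \<open>e\<close> leaves the choice of the unit normal open; it is settled later
  by requiring \<open>L11\<close> to be positive.\<close>

locale surface = revolution +
  fixes x :: "real^2 \<Rightarrow> real^3" and e :: real
  assumes smooth_x: "smooth x polar_dom"
    and x_periodic: "x (p + (2 * pi) *\<^sub>R axis 2 1) = x p"
    and first_form: "p \<in> polar_dom \<Longrightarrow> pd 1 x p \<bullet> pd 1 x p = (w (p$1))\<^sup>2" "p \<in> polar_dom \<Longrightarrow> pd 1 x p \<bullet> pd 2 x p = 0"
      "p \<in> polar_dom \<Longrightarrow> pd 2 x p \<bullet> pd 2 x p = (rho (p$1))\<^sup>2"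
    and e_sign: "e = 1 \<or> e = -1"
begin

lemmas C_deriv = w_deriv rho_deriv k_deriv

definition nu :: "real^2 \<Rightarrow> real^3" where
  "nu p = (e / (w (p$1) * rho (p$1))) *\<^sub>R cross3 (pd 1 x p) (pd 2 x p)"

text \<open>With this sign the form is positive definite for a positively curved convex surface and
  its outward normal.\<close>

definition L11 where "L11 p = - (pd 1 (pd 1 x) p \<bullet> nu p)"
definition L12 where "L12 p = - (pd 1 (pd 2 x) p \<bullet> nu p)"
definition L22 where "L22 p = - (pd 2 (pd 2 x) p \<bullet> nu p)"

lemma smooth_pds: "smooth (pd i x) polar_dom" "smooth (pd i (pd j x)) polar_dom" "smooth (pd i (pd j (pd l x))) polar_dom"
  by (intro smooth_pd smooth_x open_polar_dom)+

lemmas pds = smooth_has_pd'[OF smooth_x] smooth_has_pd'[OF smooth_pds(1)] smooth_has_pd'[OF smooth_pds(2)]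
lemmas cpds = smooth_continuous_on[OF smooth_pds(1)] smooth_continuous_on[OF smooth_pds(2)] smooth_continuous_on[OF smooth_pds(3)]

lemma commute2: "p \<in> polar_dom \<Longrightarrow> pd i (pd j x) p = pd j (pd i x) p"
  by (rule pd_commute[OF smooth_x open_polar_dom])

lemma commute3: assumes "p \<in> polar_dom"
  shows "pd 2 (pd 1 (pd 1 x)) p = pd 1 (pd 1 (pd 2 x)) p" "pd 2 (pd 1 (pd 2 x)) p = pd 1 (pd 2 (pd 2 x)) p"
proof -
  have "pd 2 (pd 1 (pd 1 x)) p = pd 1 (pd 2 (pd 1 x)) p"
    by (rule pd_commute[OF smooth_pds(1) open_polar_dom assms])
  also have "\<dots> = pd 1 (pd 1 (pd 2 x)) p"
    by (rule pd_cong[OF open_polar_dom assms commute2])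
  finally show "pd 2 (pd 1 (pd 1 x)) p = pd 1 (pd 1 (pd 2 x)) p" .
  show "pd 2 (pd 1 (pd 2 x)) p = pd 1 (pd 2 (pd 2 x)) p"
    by (rule pd_commute[OF smooth_pds(1) open_polar_dom assms])
qed

lemma theta_pos: assumes "p \<in> polar_dom"
  shows "0 < p$1" "p$1 < pi" "0 < w (p$1)" "0 < rho (p$1)" "0 < sin (p$1)"
  using assms w_pos rho_pos sin_gt_zero by (auto simp: mem_polar_dom)

lemma nu_unit: assumes "p \<in> polar_dom"
  shows "nu p \<bullet> nu p = 1" "pd i x p \<bullet> nu p = 0" "nu p \<bullet> pd i x p = 0"
proof -
  note pos = theta_pos[OF assms]
  have "cross3 (pd 1 x p) (pd 2 x p) \<bullet> cross3 (pd 1 x p) (pd 2 x p) = (w (p$1) * rho (p$1))\<^sup>2"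
    unfolding dot_cross using first_form[OF assms] by (simp add: power_mult_distrib inner_commute)
  then show "nu p \<bullet> nu p = 1"
    unfolding nu_def using e_sign pos by (auto simp: power2_eq_square)
  show "pd i x p \<bullet> nu p = 0" "nu p \<bullet> pd i x p = 0"
    using exhaust_2[of i] by (auto simp: nu_def dot_cross_self)
qed

lemma expansion: assumes "p \<in> polar_dom"
  shows "v = (v \<bullet> pd 1 x p / (w (p$1))\<^sup>2) *\<^sub>R pd 1 x p + (v \<bullet> pd 2 x p / (rho (p$1))\<^sup>2) *\<^sub>R pd 2 x p + (v \<bullet> nu p) *\<^sub>R nu p"
proof -
  have "pd 1 x p \<bullet> pd 1 x p \<noteq> 0" "pd 2 x p \<bullet> pd 2 x p \<noteq> 0"
    using first_form[OF assms] theta_pos[OF assms] by simp_all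
  then have "pd 1 x p \<noteq> 0" "pd 2 x p \<noteq> 0" by auto
  from orthogonal_frame_expansion[OF first_form(2)[OF assms] this nu_def nu_unit(1)[OF assms]]
  show ?thesis unfolding first_form(1,3)[OF assms] .
qed

lemma pd_inner_eq:
  assumes p: "p \<in> polar_dom" and f: "has_pd i f f' p" and g: "has_pd i g g' p"
    and eq: "\<And>q. q \<in> polar_dom \<Longrightarrow> f q \<bullet> g q = F q" and F: "has_pd i F F' p"
  shows "f p \<bullet> g' + f' \<bullet> g p = F'"
  using pd_eqI[OF has_pd_inner[OF f g]] pd_eqI[OF F] pd_cong[OF open_polar_dom p eq, where i = i] by simp

text \<open>Derivatives of the first fundamental form: they determine the tangential parts of the
  second derivatives, whose coefficients are the Christoffel symbols of the metric.\<close>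

lemma second_inner: assumes p: "p \<in> polar_dom"
  shows "pd 1 (pd 1 x) p \<bullet> pd 1 x p = w (p$1) * w1 (p$1)" "pd 1 (pd 1 x) p \<bullet> pd 2 x p = 0"
    "pd 1 (pd 2 x) p \<bullet> pd 1 x p = 0" "pd 1 (pd 2 x) p \<bullet> pd 2 x p = rho (p$1) * (w (p$1) * k (p$1))"
    "pd 2 (pd 2 x) p \<bullet> pd 1 x p = - (rho (p$1) * (w (p$1) * k (p$1)))" "pd 2 (pd 2 x) p \<bullet> pd 2 x p = 0"
proof -
  note pos = theta_pos[OF p]
  have "((\<lambda>\<theta>. (w \<theta>)\<^sup>2) has_real_derivative 2 * (w (p$1) * w1 (p$1))) (at (p$1))"
    "((\<lambda>\<theta>. (rho \<theta>)\<^sup>2) has_real_derivative 2 * (rho (p$1) * (w (p$1) * k (p$1)))) (at (p$1))"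
    using pos by (auto intro!: derivative_eq_intros C_deriv)
  note W = has_pd_fun_coord(1)[OF this(1)] and R = has_pd_fun_coord(1)[OF this(2)]
    and W2 = has_pd_other_coord[of 2 1 "\<lambda>\<theta>. (w \<theta>)\<^sup>2" p] and R2 = has_pd_other_coord[of 2 1 "\<lambda>\<theta>. (rho \<theta>)\<^sup>2" p]
  note d = pds(2)[OF p]
  show 1: "pd 1 (pd 1 x) p \<bullet> pd 1 x p = w (p$1) * w1 (p$1)"
    using pd_inner_eq[OF p d d first_form(1) W] by (simp add: inner_commute)
  show 2: "pd 1 (pd 2 x) p \<bullet> pd 1 x p = 0"
    using pd_inner_eq[OF p d d first_form(1) W2] commute2[OF p, of 2 1] by (simp add: inner_commute)
  show 3: "pd 1 (pd 2 x) p \<bullet> pd 2 x p = rho (p$1) * (w (p$1) * k (p$1))"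
    using pd_inner_eq[OF p d d first_form(3) R] by (simp add: inner_commute)
  show "pd 2 (pd 2 x) p \<bullet> pd 2 x p = 0"
    using pd_inner_eq[OF p d d first_form(3) R2] by (simp add: inner_commute)
  show "pd 1 (pd 1 x) p \<bullet> pd 2 x p = 0"
    using pd_inner_eq[OF p d d first_form(2) has_pd_const, where i = 1] 2 by (simp add: inner_commute)
  show "pd 2 (pd 2 x) p \<bullet> pd 1 x p = - (rho (p$1) * (w (p$1) * k (p$1)))"
    using pd_inner_eq[OF p d d first_form(2) has_pd_const, where i = 2] 3 commute2[OF p, of 2 1] by (simp add: inner_commute)
qed

lemma second_expansion: assumes p: "p \<in> polar_dom"
  shows "pd 1 (pd 1 x) p = (w1 (p$1) / w (p$1)) *\<^sub>R pd 1 x p - L11 p *\<^sub>R nu p"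
    "pd 1 (pd 2 x) p = (w (p$1) * k (p$1) / rho (p$1)) *\<^sub>R pd 2 x p - L12 p *\<^sub>R nu p"
    "pd 2 (pd 2 x) p = (- (rho (p$1) * k (p$1) / w (p$1))) *\<^sub>R pd 1 x p - L22 p *\<^sub>R nu p"
  using expansion[OF p, of "pd 1 (pd 1 x) p"] expansion[OF p, of "pd 1 (pd 2 x) p"] expansion[OF p, of "pd 2 (pd 2 x) p"]
    theta_pos[OF p]
  unfolding second_inner[OF p] L11_def L12_def L22_def by (simp_all add: power2_eq_square)

lemma nu_has_derivative: assumes p: "p \<in> polar_dom" shows "\<exists>D. (nu has_derivative D) (at p)"
proof -
  note pos = theta_pos[OF p]
  have "((\<lambda>\<theta>. e / (w \<theta> * rho \<theta>)) has_real_derivative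
    - (e * (w (p$1) * (w (p$1) * k (p$1)) + w1 (p$1) * rho (p$1))) / (w (p$1) * rho (p$1))\<^sup>2) (at (p$1))"
    using pos by (auto intro!: derivative_eq_intros C_deriv simp: power2_eq_square)
  from bounded_bilinear.FDERIV[OF bounded_bilinear_scaleR has_derivative_fun_coord[OF this]
      bounded_bilinear.FDERIV[OF bounded_bilinear_cross3 smooth_has_derivative[OF smooth_pds(1) p] smooth_has_derivative[OF smooth_pds(1) p]]]
  show ?thesis unfolding nu_def[abs_def] by blast
qed

lemma nu_has_pd: assumes "p \<in> polar_dom" shows "has_pd i nu (pd i nu p) p"
  using nu_has_derivative[OF assms] has_derivative_imp_has_pd pd_eqI by metis

lemma cont_nu: "continuous_on polar_dom nu"
  unfolding continuous_on_eq_continuous_within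
  by (meson nu_has_derivative has_derivative_continuous continuous_at_imp_continuous_at_within)

lemma pd_nu: assumes p: "p \<in> polar_dom"
  shows "pd 1 nu p = (L11 p / (w (p$1))\<^sup>2) *\<^sub>R pd 1 x p + (L12 p / (rho (p$1))\<^sup>2) *\<^sub>R pd 2 x p"
    "pd 2 nu p = (L12 p / (w (p$1))\<^sup>2) *\<^sub>R pd 1 x p + (L22 p / (rho (p$1))\<^sup>2) *\<^sub>R pd 2 x p"
proof -
  have "pd i nu p \<bullet> nu p = 0" for i
    using pd_inner_eq[OF p nu_has_pd[OF p] nu_has_pd[OF p] nu_unit(1) has_pd_const] by (simp add: inner_commute)
  moreover have "pd i nu p \<bullet> pd j x p = - (pd i (pd j x) p \<bullet> nu p)" for i j
    using pd_inner_eq[OF p nu_has_pd[OF p] pds(2)[OF p] nu_unit(3)[of _ j] has_pd_const, where i = i]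
    by (simp add: inner_commute[of "nu p"])
  moreover have "pd 2 (pd 1 x) p = pd 1 (pd 2 x) p" by (rule commute2[OF p])
  ultimately show "pd 1 nu p = (L11 p / (w (p$1))\<^sup>2) *\<^sub>R pd 1 x p + (L12 p / (rho (p$1))\<^sup>2) *\<^sub>R pd 2 x p"
    "pd 2 nu p = (L12 p / (w (p$1))\<^sup>2) *\<^sub>R pd 1 x p + (L22 p / (rho (p$1))\<^sup>2) *\<^sub>R pd 2 x p"
    using expansion[OF p, of "pd 1 nu p"] expansion[OF p, of "pd 2 nu p"] by (simp_all add: L11_def L12_def L22_def)
qed

text \<open>Theorema egregium: differentiating two of the relations in \<open>second_inner\<close>
  produces the same product with a third derivative of \<open>x\<close>, which is
  eliminated.\<close>

lemma gauss: assumes p: "p \<in> polar_dom"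
  shows "L11 p * L22 p - (L12 p)\<^sup>2 = - k1 (p$1) * w (p$1) * rho (p$1)"
proof -
  note pos = theta_pos[OF p]
  have "((\<lambda>\<theta>. rho \<theta> * (w \<theta> * k \<theta>)) has_real_derivative
     (w (p$1) * k (p$1))\<^sup>2 + rho (p$1) * (w1 (p$1) * k (p$1) + w (p$1) * k1 (p$1))) (at (p$1))"
    using pos by (auto intro!: derivative_eq_intros C_deriv simp: power2_eq_square algebra_simps)
  from pd_inner_eq[OF p pds(3)[OF p] pds(2)[OF p] second_inner(4) has_pd_fun_coord(1)[OF this]]
  have 1: "pd 1 (pd 2 x) p \<bullet> pd 1 (pd 2 x) p + pd 1 (pd 1 (pd 2 x)) p \<bullet> pd 2 x p =
     (w (p$1) * k (p$1))\<^sup>2 + rho (p$1) * (w1 (p$1) * k (p$1) + w (p$1) * k1 (p$1))" .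
  have 2: "pd 1 (pd 1 x) p \<bullet> pd 2 (pd 2 x) p + pd 1 (pd 1 (pd 2 x)) p \<bullet> pd 2 x p = 0"
    using pd_inner_eq[OF p pds(3)[OF p] pds(2)[OF p] second_inner(2) has_pd_const, where i = 2] by (simp add: commute3[OF p])
  have 3: "pd 1 (pd 1 x) p \<bullet> pd 2 (pd 2 x) p = (w1 (p$1) / w (p$1)) * (- (rho (p$1) * (w (p$1) * k (p$1)))) + L11 p * L22 p"
    by (subst second_expansion(1)[OF p])
      (simp add: inner_diff_left second_inner[OF p] L22_def inner_commute[of "nu p"] inner_commute[of "pd 1 x p" "pd 2 (pd 2 x) p"])
  have 4: "pd 1 (pd 2 x) p \<bullet> pd 1 (pd 2 x) p = (w (p$1) * k (p$1) / rho (p$1)) * (rho (p$1) * (w (p$1) * k (p$1))) + (L12 p)\<^sup>2"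
    by (subst second_expansion(2)[OF p])
      (simp add: inner_diff_left inner_add_left second_inner[OF p] L12_def inner_commute[of "nu p"] inner_commute[of "pd 2 x p" "pd 1 (pd 2 x) p"] power2_eq_square)
  show ?thesis using 1 2 3 4 pos by (simp add: power2_eq_square algebra_simps)
qed

lemma cont_frame: "continuous_on polar_dom (\<lambda>p. w (p$1))" "continuous_on polar_dom (\<lambda>p. rho (p$1))"
proof -
  have "continuous_on polar_dom (\<lambda>p. f (p$1))" if "continuous_on {0<..<pi} f" for f :: "real \<Rightarrow> real"
    by (rule continuous_on_compose2[OF that]) (auto simp: polar_dom_def intro!: continuous_intros)
  then show "continuous_on polar_dom (\<lambda>p. w (p$1))" "continuous_on polar_dom (\<lambda>p. rho (p$1))"
    using cont_on_open cont_rho by blast+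
qed

lemma cont_L: "continuous_on polar_dom L11" "continuous_on polar_dom L12" "continuous_on polar_dom L22"
  unfolding L11_def[abs_def] L12_def[abs_def] L22_def[abs_def] by (intro continuous_intros cpds cont_nu)+

lemma cont_pd_nu: "continuous_on polar_dom (pd 1 nu)" "continuous_on polar_dom (pd 2 nu)"
proof -
  have n: "\<forall>p\<in>polar_dom. (w (p$1))\<^sup>2 \<noteq> 0" "\<forall>p\<in>polar_dom. (rho (p$1))\<^sup>2 \<noteq> 0"
    using theta_pos by force+
  show "continuous_on polar_dom (pd 1 nu)" "continuous_on polar_dom (pd 2 nu)"
    by (rule continuous_on_eq[OF _ pd_nu(1)[symmetric]] continuous_on_eq[OF _ pd_nu(2)[symmetric]],
        intro continuous_intros cont_L cpds cont_frame n, assumption)+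
qed

lemma pd_form: assumes p: "p \<in> polar_dom"
  shows "has_pd l (\<lambda>p. - (pd i (pd j x) p \<bullet> nu p)) (- (pd i (pd j x) p \<bullet> pd l nu p + pd l (pd i (pd j x)) p \<bullet> nu p)) p"
  by (intro has_pd_minus has_pd_inner pds nu_has_pd p)

lemma periodic: "pd i x (vector [\<theta>, 2 * pi]) = pd i x (vector [\<theta>, 0])"
  "pd i (pd j x) (vector [\<theta>, 2 * pi]) = pd i (pd j x) (vector [\<theta>, 0])" "nu (vector [\<theta>, 2 * pi]) = nu (vector [\<theta>, 0])"
  "x (vector [\<theta>, 2 * pi]) = x (vector [\<theta>, 0])"
proof -
  have v: "vector [\<theta>, 2 * pi] = vector [\<theta>, 0] + (2 * pi) *\<^sub>R (axis 2 1 :: real^2)" by simp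
  have d: "pd i x (q + (2 * pi) *\<^sub>R axis 2 1) = pd i x q" for i q by (rule pd_translate) (rule x_periodic)
  show 1: "pd i x (vector [\<theta>, 2 * pi]) = pd i x (vector [\<theta>, 0])" for i unfolding v by (rule d)
  show "pd i (pd j x) (vector [\<theta>, 2 * pi]) = pd i (pd j x) (vector [\<theta>, 0])" unfolding v by (rule pd_translate) (rule d)
  show "nu (vector [\<theta>, 2 * pi]) = nu (vector [\<theta>, 0])" by (simp add: nu_def 1 vector_2)
  show "x (vector [\<theta>, 2 * pi]) = x (vector [\<theta>, 0])" unfolding v by (rule x_periodic)
qed

text \<open>The Codazzi equations express that the third derivatives of \<open>x\<close> commute.
  The origin \<open>x0\<close> is left free, so that it can be placed where the support function has
  a sign.\<close>

lemma second_form_of_surface: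
  assumes pos: "\<And>p. p \<in> polar_dom \<Longrightarrow> 0 < L11 p"
    and bd: "\<And>p. p \<in> polar_dom \<Longrightarrow> \<bar>L11 p\<bar> \<le> B" "\<And>p. p \<in> polar_dom \<Longrightarrow> \<bar>L12 p\<bar> \<le> B * sin (p$1)"
      "\<And>p. p \<in> polar_dom \<Longrightarrow> \<bar>L22 p\<bar> \<le> B * (sin (p$1))\<^sup>2"
    and xb: "\<And>p. p \<in> polar_dom \<Longrightarrow> norm (x p - x0) \<le> B"
  shows "second_form w rho k w1 k1 c C L11 L12 L22 (\<lambda>p. (x p - x0) \<bullet> pd 1 x p) (\<lambda>p. (x p - x0) \<bullet> pd 2 x p)
     (\<lambda>p. (x p - x0) \<bullet> nu p) (B + B * C)"
proof -
  note d = pd_form[of _ 1 2 2] pd_form[of _ 1 1 2] pd_form[of _ 2 1 2] pd_form[of _ 2 1 1]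
  have dL: "pd 1 L22 p = - (pd 2 (pd 2 x) p \<bullet> pd 1 nu p + pd 1 (pd 2 (pd 2 x)) p \<bullet> nu p)"
     "pd 1 L12 p = - (pd 1 (pd 2 x) p \<bullet> pd 1 nu p + pd 1 (pd 1 (pd 2 x)) p \<bullet> nu p)"
     "pd 2 L12 p = - (pd 1 (pd 2 x) p \<bullet> pd 2 nu p + pd 2 (pd 1 (pd 2 x)) p \<bullet> nu p)"
     "pd 2 L11 p = - (pd 1 (pd 1 x) p \<bullet> pd 2 nu p + pd 2 (pd 1 (pd 1 x)) p \<bullet> nu p)" if "p \<in> polar_dom" for p
    using pd_eqI[OF d(1)[OF that]] pd_eqI[OF d(2)[OF that]] pd_eqI[OF d(3)[OF that]] pd_eqI[OF d(4)[OF that]]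
    unfolding L11_def[abs_def] L12_def[abs_def] L22_def[abs_def] by simp_all
  have "vector [1, 0] \<in> polar_dom" using pi_gt3 by simp
  from order_trans[OF norm_ge_zero xb[OF this]] have B0: "0 \<le> B" .
  show ?thesis
  proof unfold_locales
    show "continuous_on polar_dom L11" "continuous_on polar_dom L12" "continuous_on polar_dom L22" by (fact cont_L)+
    show "continuous_on polar_dom (\<lambda>p. (x p - x0) \<bullet> pd 1 x p)" "continuous_on polar_dom (\<lambda>p. (x p - x0) \<bullet> pd 2 x p)"
      "continuous_on polar_dom (\<lambda>p. (x p - x0) \<bullet> nu p)"
      by (intro continuous_intros smooth_continuous_on[OF smooth_x] cpds cont_nu)+
    show "continuous_on polar_dom (pd 1 L22)" "continuous_on polar_dom (pd 1 L12)" "continuous_on polar_dom (pd 2 L12)"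
      "continuous_on polar_dom (pd 2 L11)"
      by (rule continuous_on_eq[OF _ dL(1)[symmetric]] continuous_on_eq[OF _ dL(2)[symmetric]]
          continuous_on_eq[OF _ dL(3)[symmetric]] continuous_on_eq[OF _ dL(4)[symmetric]],
          intro continuous_intros cpds cont_nu cont_pd_nu, assumption)+
    fix p :: "real^2" assume p: "p \<in> polar_dom"
    note ps = theta_pos[OF p] and n = nu_unit[OF p] and si = second_inner[OF p] and se = second_expansion[OF p]
    show "has_pd 1 L22 (pd 1 L22 p) p" "has_pd 1 L12 (pd 1 L12 p) p" "has_pd 2 L12 (pd 2 L12 p) p" "has_pd 2 L11 (pd 2 L11 p) p"
      unfolding dL[OF p] unfolding L11_def[abs_def] L12_def[abs_def] L22_def[abs_def] by (fact d[OF p])+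
    have "pd 2 L11 p - pd 1 L12 p = pd 1 (pd 2 x) p \<bullet> pd 1 nu p - pd 1 (pd 1 x) p \<bullet> pd 2 nu p"
      by (simp add: dL[OF p] commute3[OF p])
    also have "\<dots> = L12 p / (rho (p$1))\<^sup>2 * (rho (p$1) * (w (p$1) * k (p$1))) - L12 p / (w (p$1))\<^sup>2 * (w (p$1) * w1 (p$1))"
      by (simp add: pd_nu[OF p] inner_add_right si)
    also have "\<dots> = (w (p$1) * k (p$1) / rho (p$1) - w1 (p$1) / w (p$1)) * L12 p"
      using ps by (simp add: field_simps power2_eq_square)
    finally show "pd 2 L11 p - pd 1 L12 p = (w (p$1) * k (p$1) / rho (p$1) - w1 (p$1) / w (p$1)) * L12 p" .
    have "pd 2 L12 p - pd 1 L22 p = pd 2 (pd 2 x) p \<bullet> pd 1 nu p - pd 1 (pd 2 x) p \<bullet> pd 2 nu p"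
      by (simp add: dL[OF p] commute3[OF p])
    also have "\<dots> = - (L11 p / (w (p$1))\<^sup>2 * (rho (p$1) * (w (p$1) * k (p$1)))) - L22 p / (rho (p$1))\<^sup>2 * (rho (p$1) * (w (p$1) * k (p$1)))"
      by (simp add: pd_nu[OF p] inner_add_right si)
    also have "\<dots> = - (w (p$1) * k (p$1) / rho (p$1)) * L22 p - rho (p$1) * k (p$1) / w (p$1) * L11 p"
      using ps by (simp add: field_simps power2_eq_square)
    finally show "pd 2 L12 p - pd 1 L22 p = - (w (p$1) * k (p$1) / rho (p$1)) * L22 p - rho (p$1) * k (p$1) / w (p$1) * L11 p" .
    have dP: "has_pd i (\<lambda>p. (x p - x0) \<bullet> pd j x p) ((x p - x0) \<bullet> pd i (pd j x) p + pd i x p \<bullet> pd j x p) p" for i j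
      using has_pd_inner[OF has_pd_diff[OF pds(1)[OF p] has_pd_const] pds(2)[OF p]] by simp
    show "has_pd 1 (\<lambda>p. (x p - x0) \<bullet> pd 1 x p) ((w (p$1))\<^sup>2 + w1 (p$1) / w (p$1) * ((x p - x0) \<bullet> pd 1 x p) - L11 p * ((x p - x0) \<bullet> nu p)) p"
      by (rule has_pd_eq_rhs[OF dP]) (simp add: se(1) inner_diff_right first_form[OF p])
    show "has_pd 2 (\<lambda>p. (x p - x0) \<bullet> pd 1 x p) (w (p$1) * k (p$1) / rho (p$1) * ((x p - x0) \<bullet> pd 2 x p) - L12 p * ((x p - x0) \<bullet> nu p)) p"
      by (rule has_pd_eq_rhs[OF dP]) (simp add: commute2[OF p, of 2 1] se(2) inner_diff_right first_form[OF p] inner_commute[of "pd 2 x p" "pd 1 x p"])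
    show "has_pd 1 (\<lambda>p. (x p - x0) \<bullet> pd 2 x p) (w (p$1) * k (p$1) / rho (p$1) * ((x p - x0) \<bullet> pd 2 x p) - L12 p * ((x p - x0) \<bullet> nu p)) p"
      by (rule has_pd_eq_rhs[OF dP]) (simp add: se(2) inner_diff_right first_form[OF p])
    show "has_pd 2 (\<lambda>p. (x p - x0) \<bullet> pd 2 x p) ((rho (p$1))\<^sup>2 - rho (p$1) * k (p$1) / w (p$1) * ((x p - x0) \<bullet> pd 1 x p) - L22 p * ((x p - x0) \<bullet> nu p)) p"
      by (rule has_pd_eq_rhs[OF dP]) (simp add: se(3) inner_diff_right first_form[OF p])
    show "L11 p * L22 p - (L12 p)\<^sup>2 = - k1 (p$1) * w (p$1) * rho (p$1)" by (rule gauss[OF p])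
    show "0 < L11 p" by (rule pos[OF p])
    have BC: "B \<le> B + B * C" "B * C \<le> B + B * C" using B0 C_pos by auto
    have "\<bar>L11 p\<bar> \<le> B" "\<bar>L12 p\<bar> \<le> B * sin (p$1)" "\<bar>L22 p\<bar> \<le> B * (sin (p$1))\<^sup>2" by (fact bd[OF p])+
    moreover have "B * sin (p$1) \<le> (B + B * C) * sin (p$1)" "B * (sin (p$1))\<^sup>2 \<le> (B + B * C) * (sin (p$1))\<^sup>2"
      using BC ps by (intro mult_right_mono; force)+
    ultimately show "\<bar>L11 p\<bar> \<le> B + B * C" "\<bar>L12 p\<bar> \<le> (B + B * C) * sin (p$1)" "\<bar>L22 p\<bar> \<le> (B + B * C) * (sin (p$1))\<^sup>2"
      using BC by linarith+
    have nx: "norm (pd 1 x p) = w (p$1)" "norm (pd 2 x p) = rho (p$1)" "norm (nu p) = 1"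
      using first_form[OF p] ps n by (simp_all add: norm_eq_sqrt_inner)
    have "\<bar>(x p - x0) \<bullet> pd 1 x p\<bar> \<le> B * C"
      using mult_mono[OF xb[OF p] w_bounds(2)[OF ps(1,2)]] B0 ps Cauchy_Schwarz_ineq2[of "x p - x0" "pd 1 x p"] unfolding nx by linarith
    then show "\<bar>(x p - x0) \<bullet> pd 1 x p\<bar> \<le> B + B * C" using BC by linarith
    have "\<bar>(x p - x0) \<bullet> pd 2 x p\<bar> \<le> B * (C * sin (p$1))"
      using mult_mono[OF xb[OF p] rho_bounds(2)[OF ps(1,2)]] B0 ps Cauchy_Schwarz_ineq2[of "x p - x0" "pd 2 x p"] unfolding nx by linarith
    also have "\<dots> \<le> (B + B * C) * sin (p$1)" using B0 ps by (simp add: algebra_simps)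
    finally show "\<bar>(x p - x0) \<bullet> pd 2 x p\<bar> \<le> (B + B * C) * sin (p$1)" .
    show "\<bar>(x p - x0) \<bullet> nu p\<bar> \<le> B + B * C"
      using xb[OF p] Cauchy_Schwarz_ineq2[of "x p - x0" "nu p"] BC unfolding nx by linarith
  qed (simp_all add: periodic L11_def L12_def)
qed

end

subsection \<open>Convexity of positively curved surfaces\<close>

text \<open>Passing from \<open>N\<close> to the cone over it turns areas on the sphere into volumes
  in space, to which the change of variables for Lebesgue measure applies.\<close>

lemma cone_derivative:
  fixes N :: "real^2 \<Rightarrow> real^3"
  assumes "(N has_derivative D) (at (vector [z$2, z$3]))"
  shows "((\<lambda>z::real^3. z$1 *\<^sub>R N (vector [z$2, z$3])) has_derivative
      (\<lambda>v. z$1 *\<^sub>R D (vector [v$2, v$3]) + v$1 *\<^sub>R N (vector [z$2, z$3]))) (at z)"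
    "det (matrix (\<lambda>v::real^3. z$1 *\<^sub>R D (vector [v$2, v$3]) + v$1 *\<^sub>R N (vector [z$2, z$3]))) =
      (z$1)\<^sup>2 * (N (vector [z$2, z$3]) \<bullet> cross3 (D (axis 1 1)) (D (axis 2 1)))"
proof -
  have "linear (\<lambda>z::real^3. vector [z$2, z$3] :: real^2)"
    by (intro linearI) (auto simp: vec2_eq_iff vector_2)
  then have "((\<lambda>z::real^3. vector [z$2, z$3] :: real^2) has_derivative (\<lambda>v. vector [v$2, v$3])) (at z)"
    using bounded_linear.has_derivative[OF _ has_derivative_ident] linear_conv_bounded_linear by blast
  from has_derivative_compose[OF this assms]
  have 1: "((\<lambda>z::real^3. N (vector [z$2, z$3])) has_derivative (\<lambda>v. D (vector [v$2, v$3]))) (at z)" .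
  have 2: "((\<lambda>z::real^3. z$1) has_derivative (\<lambda>v. v$1)) (at z)"
    by (rule bounded_linear.has_derivative[OF bounded_linear_vec_nth has_derivative_ident])
  show "((\<lambda>z::real^3. z$1 *\<^sub>R N (vector [z$2, z$3])) has_derivative
      (\<lambda>v. z$1 *\<^sub>R D (vector [v$2, v$3]) + v$1 *\<^sub>R N (vector [z$2, z$3]))) (at z)"
    using bounded_bilinear.FDERIV[OF bounded_bilinear_scaleR 2 1] .
  have D0: "D 0 = 0" using has_derivative_linear[OF assms] by (rule linear_0)
  have det: "det (matrix F) = F (axis 1 1) \<bullet> cross3 (F (axis 2 1)) (F (axis 3 1))" for F :: "real^3 \<Rightarrow> real^3"
    by (simp add: det_3 matrix_def inner_vec_def sum_3 cross_components) (simp add: algebra_simps)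
  have ax: "(vector [axis 1 1 $ (2::3), axis 1 1 $ (3::3)] :: real^2) = 0" "(vector [axis 2 1 $ (2::3), axis 2 1 $ (3::3)] :: real^2) = axis 1 1"
    "(vector [axis 3 1 $ (2::3), axis 3 1 $ (3::3)] :: real^2) = axis 2 1" "axis 1 1 $ (1::3) = (1::real)"
    "axis 2 1 $ (1::3) = (0::real)" "axis 3 1 $ (1::3) = (0::real)"
    by (simp_all add: vec2_eq_iff vector_2 axis_def)
  show "det (matrix (\<lambda>v::real^3. z$1 *\<^sub>R D (vector [v$2, v$3]) + v$1 *\<^sub>R N (vector [z$2, z$3]))) =
      (z$1)\<^sup>2 * (N (vector [z$2, z$3]) \<bullet> cross3 (D (axis 1 1)) (D (axis 2 1)))"
    unfolding det ax by (simp add: D0 cross_mult_left cross_mult_right power2_eq_square)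
qed

text \<open>Half-open in the angle, so that polar coordinates reach each direction off the axis
  exactly once.\<close>

definition cone_dom :: "(real^3) set" where
  "cone_dom = {z. 0 < z$1 \<and> z$1 < 1 \<and> 0 < z$2 \<and> z$2 < pi \<and> 0 \<le> z$3 \<and> z$3 < 2 * pi}"

lemma cone_dom_measurable: "cone_dom \<in> sets lebesgue"
proof -
  have "convex cone_dom"
  proof -
    have eq: "cone_dom = (\<lambda>z. z$1) -` {0<..<1} \<inter> (\<lambda>z. z$2) -` {0<..<pi} \<inter> (\<lambda>z. z$3) -` {0..<2 * pi}"
      by (auto simp: cone_dom_def)
    show ?thesis unfolding eq
      by (intro convex_Int convex_linear_vimage bounded_linear.linear bounded_linear_vec_nth) (auto simp: convex_real_interval)
  qed
  moreover have "bounded cone_dom"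
  proof (rule bounded_subset[OF bounded_cbox])
    show "cone_dom \<subseteq> cbox (vector [0, 0, 0]) (vector [1, pi, 2 * pi])"
      by (auto simp: cone_dom_def mem_box_cart forall_3 vector_3)
  qed
  ultimately show ?thesis using measurable_convex fmeasurableD by blast
qed

lemma cos_sin_inj:
  assumes "cos a = cos b" "sin a = sin b" "0 \<le> a" "a < 2 * pi" "0 \<le> b" "b < 2 * pi"
  shows "a = b"
proof -
  obtain n :: int where n: "a = b + 2 * of_int n * pi"
    using assms(1,2) sin_cos_eq_iff[of a b] by (auto simp: mult.assoc)
  have "of_int n * (2 * pi) = a - b" using n by simp
  then have "\<bar>of_int n\<bar> * (2 * pi) = \<bar>a - b\<bar>" using pi_gt_zero by (metis abs_mult abs_of_pos mult_pos_pos zero_less_numeral)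
  also have "\<dots> < 1 * (2 * pi)" using assms(3-6) by simp
  finally have "\<bar>of_int n :: real\<bar> < 1" using pi_gt_zero by (simp only: mult_less_cancel_right_pos)
  then have "n = 0" by linarith
  with n show ?thesis by simp
qed

context revolution
begin

text \<open>The Jacobian, up to sign, of the cone over the Gauss map. As curvature times area
  element it depends on the metric alone, so a bound found on the surface of revolution holds for
  every surface with this metric.\<close>

definition cone_density :: "real^3 \<Rightarrow> real" where
  "cone_density z = (z$1)\<^sup>2 * (- k1 (z$2))"

lemma cone_density_pos: "z \<in> cone_dom \<Longrightarrow> 0 < cone_density z"
  unfolding cone_density_def cone_dom_def using k1_neg by (intro mult_pos_pos) auto

text \<open>The Gauss map of the surface of revolution is injective, so the integral of its Jacobian is the
  volume of a subset of the ball.\<close>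

lemma cone_density_integral:
  "cone_density integrable_on cone_dom" "integral cone_dom cone_density \<le> measure lebesgue (ball (0::real^3) 1)"
proof -
  define N where "N p = (vector [sig (p$1) * cos (p$2), sig (p$1) * sin (p$2), k (p$1)] :: real^3)" for p :: "real^2" 
  define N' where "N' p v = (vector [sig (p$1) * (- (sin (p$2) * v$2)) + (- (k (p$1) * k1 (p$1) / sig (p$1))) * v$1 * cos (p$2),
      sig (p$1) * (cos (p$2) * v$2) + (- (k (p$1) * k1 (p$1) / sig (p$1))) * v$1 * sin (p$2), k1 (p$1) * v$1] :: real^3)" for p v :: "real^2"
  have dN: "(N has_derivative N' p) (at p)" if p: "0 < p$1" "p$1 < pi" for p
  proof -
    have "((\<lambda>p. N p $ i) has_derivative (\<lambda>v. N' p v $ i)) (at p)" for i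
    proof -
      have c: "((\<lambda>p. N p $ 1) has_derivative (\<lambda>v. N' p v $ 1)) (at p)" "((\<lambda>p. N p $ 2) has_derivative (\<lambda>v. N' p v $ 2)) (at p)"
        "((\<lambda>p. N p $ 3) has_derivative (\<lambda>v. N' p v $ 3)) (at p)"
        unfolding N_def N'_def vector_3
        by (intro has_derivative_mult has_derivative_fun_coord[OF sig_deriv[OF p]] has_derivative_fun_coord[OF k_deriv[OF p]]
          has_derivative_fun_coord[OF DERIV_cos, simplified] has_derivative_fun_coord[OF DERIV_sin])+
      show ?thesis using c exhaust_3[of i] by auto
    qed
    then show ?thesis using has_derivative_componentwise_within[of N "N' p" p UNIV]
      by (auto simp: Basis_vec_def inner_axis)
  qed
  define f where "f z = z$1 *\<^sub>R N (vector [z$2, z$3])" for z :: "real^3"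
  define f' where "f' z = (\<lambda>v::real^3. z$1 *\<^sub>R N' (vector [z$2, z$3]) (vector [v$2, v$3]) + v$1 *\<^sub>R N (vector [z$2, z$3]))" for z :: "real^3"
  have d: "(f has_derivative f' z) (at z within cone_dom)" and J: "\<bar>det (matrix (f' z))\<bar> = cone_density z" if z: "z \<in> cone_dom" for z
  proof -
    have z2: "0 < z$2" "z$2 < pi" using z by (auto simp: cone_dom_def)
    have dd: "(N has_derivative N' (vector [z$2, z$3])) (at (vector [z$2, z$3]))"
      using dN[of "vector [z$2, z$3]"] z2 by (simp add: vector_2)
    show "(f has_derivative f' z) (at z within cone_dom)"
      unfolding f_def[abs_def] f'_def by (rule has_derivative_at_withinI[OF cone_derivative(1)[OF dd]])
    have s: "sig (z$2) > 0" "sig (z$2) * sig (z$2) = 1 - k (z$2) * k (z$2)"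
      using sig_bounds[OF z2] by (auto simp: power2_eq_square)
    have sc: "sin (z$3) * sin (z$3) = 1 - cos (z$3) * cos (z$3)" using sin_squared_eq[of "z$3"] by (simp add: power2_eq_square)
    have "N (vector [z$2, z$3]) \<bullet> cross3 (N' (vector [z$2, z$3]) (axis 1 1)) (N' (vector [z$2, z$3]) (axis 2 1)) =
       - (k1 (z$2) * (sig (z$2) * sig (z$2) + k (z$2) * k (z$2)))"
    proof -
      have g: "K * (K * K1) + K1 * (G * G) = A * (A * (K * (K * K1))) + (S * (S * (K * (K * K1))) + (A * (A * (K1 * (G * G))) + S * (S * (K1 * (G * G)))))"
        if "S * S = 1 - A * A" for A S K K1 G :: real
        using that by algebra
      show ?thesis
        using s(1) unfolding N_def N'_def
        by (simp add: inner_vec_def sum_3 cross_components vector_2 vector_3 axis_def) (simp add: field_simps, rule g[OF sc])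
    qed
    also have "\<dots> = - k1 (z$2)" by (simp add: s(2))
    finally have "det (matrix (f' z)) = (z$1)\<^sup>2 * (- k1 (z$2))"
      unfolding f'_def cone_derivative(2)[OF dd] by simp
    then show "\<bar>det (matrix (f' z))\<bar> = cone_density z"
      using cone_density_pos[OF z] by (simp add: cone_density_def)
  qed
  have nN: "norm (N p) = 1" if "0 < p$1" "p$1 < pi" for p
  proof -
    have "N p \<bullet> N p = (sig (p$1) * cos (p$2))\<^sup>2 + (sig (p$1) * sin (p$2))\<^sup>2 + (k (p$1))\<^sup>2"
      by (simp add: N_def inner_vec_def sum_3 vector_3 power2_eq_square)
    also have "\<dots> = (sig (p$1))\<^sup>2 * ((cos (p$2))\<^sup>2 + (sin (p$2))\<^sup>2) + (k (p$1))\<^sup>2"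
      by (simp only: power_mult_distrib distrib_left)
    finally show ?thesis using sig_bounds(4)[OF that] by (simp add: norm_eq_sqrt_inner)
  qed
  have "inj_on f cone_dom"
  proof (rule inj_onI)
    fix z z' assume z: "z \<in> cone_dom" "z' \<in> cone_dom" and eq: "f z = f z'"
    have b: "0 < z$1" "0 < z$2" "z$2 < pi" "0 < z'$1" "0 < z'$2" "z'$2 < pi" using z by (auto simp: cone_dom_def)
    have "norm (f z) = z$1" "norm (f z') = z'$1" using b nN by (simp_all add: f_def vector_2)
    then have 1: "z$1 = z'$1" using eq by simp
    then have N: "N (vector [z$2, z$3]) = N (vector [z'$2, z'$3])" using eq b by (simp add: f_def)
    then have "k (z$2) = k (z'$2)" unfolding N_def by (metis vector_2(1) vector_3(3))
    then have 2: "z$2 = z'$2" using k_decreasing[of "z$2" "z'$2"] k_decreasing[of "z'$2" "z$2"] b by (cases "z$2" "z'$2" rule: linorder_cases) auto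
    have "sig (z$2) * cos (z$3) = sig (z$2) * cos (z'$3)" "sig (z$2) * sin (z$3) = sig (z$2) * sin (z'$3)"
      using N unfolding N_def 2 by (metis vector_2 vector_3(1), metis vector_2 vector_3(2))
    then have "cos (z$3) = cos (z'$3)" "sin (z$3) = sin (z'$3)" using sig_bounds(2)[OF b(2,3)] by simp_all
    then have "z$3 = z'$3" by (rule cos_sin_inj) (use z in \<open>auto simp: cone_dom_def\<close>)
    with 1 2 show "z = z'" by (simp add: vec_eq_iff forall_3)
  qed
  note m = has_measure_differentiable_image[OF cone_dom_measurable d this]
  have sub: "f ` cone_dom \<subseteq> ball 0 1"
    using nN by (auto simp: f_def cone_dom_def vector_2)
  have "f differentiable_on cone_dom" using d unfolding differentiable_on_def differentiable_def by blast
  then have "f ` cone_dom \<in> sets lebesgue"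
    by (intro differentiable_image_in_sets_lebesgue cone_dom_measurable) auto
  then have lm: "f ` cone_dom \<in> lmeasurable"
    using sub bounded_set_imp_lmeasurable bounded_subset[OF bounded_ball sub] by blast
  then have "((\<lambda>z. \<bar>det (matrix (f' z))\<bar>) has_integral measure lebesgue (f ` cone_dom)) cone_dom"
    using m by blast
  then have h: "(cone_density has_integral measure lebesgue (f ` cone_dom)) cone_dom"
    by (rule has_integral_eq[OF J, rotated])
  then show "cone_density integrable_on cone_dom" by blast
  show "integral cone_dom cone_density \<le> measure lebesgue (ball (0::real^3) 1)"
    unfolding integral_unique[OF h] using sub lm by (intro measure_mono_fmeasurable) auto
qed

end

lemma sph_nth: "sph p $ 1 = sin (p$1) * cos (p$2)" "sph p $ 2 = sin (p$1) * sin (p$2)" "sph p $ 3 = cos (p$1)"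
  by (simp_all add: sph_def vector_3)

lemma norm_sph: "norm (sph p) = 1"
proof -
  have "sph p \<bullet> sph p = (sin (p$1) * cos (p$2))\<^sup>2 + (sin (p$1) * sin (p$2))\<^sup>2 + (cos (p$1))\<^sup>2"
    by (simp add: inner_vec_def sum_3 sph_nth power2_eq_square)
  also have "\<dots> = (sin (p$1))\<^sup>2 * ((cos (p$2))\<^sup>2 + (sin (p$2))\<^sup>2) + (cos (p$1))\<^sup>2"
    by (simp only: power_mult_distrib distrib_left)
  finally show ?thesis by (simp add: norm_eq_sqrt_inner)
qed

lemma sph_in_sphere [simp]: "sph p \<in> sphere 0 1"
  by (simp add: norm_sph)

lemma sph_surj:
  assumes "q \<in> sphere 0 1" "q \<noteq> axis 3 1" "q \<noteq> - axis 3 1"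
  obtains p where "p \<in> polar_dom" "0 \<le> p$2" "p$2 < 2 * pi" "q = sph p"
proof -
  have q: "(q$1)\<^sup>2 + (q$2)\<^sup>2 + (q$3)\<^sup>2 = 1"
    using assms(1) by (simp add: norm_eq_sqrt_inner inner_vec_def sum_3 power2_eq_square)
  have "\<bar>q$3\<bar> < 1"
  proof (rule ccontr)
    assume "\<not> \<bar>q$3\<bar> < 1"
    then have "(q$3)\<^sup>2 \<ge> 1" using abs_square_less_1[of "q$3"] by simp
    moreover have "0 \<le> (q$1)\<^sup>2" "0 \<le> (q$2)\<^sup>2" by simp_all
    ultimately have "(q$1)\<^sup>2 = 0" "(q$2)\<^sup>2 = 0" "(q$3)\<^sup>2 = 1" using q by linarith+
    then have "q$1 = 0" "q$2 = 0" "q$3 = 1 \<or> q$3 = -1" by (auto simp: power2_eq_1_iff)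
    then have "q = axis 3 1 \<or> q = - axis 3 1" by (auto simp: vec_eq_iff forall_3 axis_def)
    with assms show False by blast
  qed
  then have c: "-1 < q$3" "q$3 < 1" by auto
  define \<theta> where "\<theta> = arccos (q$3)"
  have \<theta>: "0 < \<theta>" "\<theta> < pi" "cos \<theta> = q$3" unfolding \<theta>_def using c arccos_lt_bounded[of "q$3"] by auto
  have s: "0 < sin \<theta>" using \<theta> sin_gt_zero by simp
  have "(q$1 / sin \<theta>)\<^sup>2 + (q$2 / sin \<theta>)\<^sup>2 = 1"
  proof -
    have "(q$1)\<^sup>2 + (q$2)\<^sup>2 = (sin \<theta>)\<^sup>2" using q sin_squared_eq[of \<theta>] \<theta>(3) by simp
    then show ?thesis using s by (simp add: power_divide flip: add_divide_distrib)
  qed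
  then obtain \<phi> where \<phi>: "0 \<le> \<phi>" "\<phi> < 2 * pi" "q$1 / sin \<theta> = cos \<phi>" "q$2 / sin \<theta> = sin \<phi>"
    by (rule sincos_total_2pi)
  show thesis
    by (rule that[of "vector [\<theta>, \<phi>]"])
      (use \<theta> \<phi> s in \<open>auto simp: vector_2 vec_eq_iff forall_3 sph_nth field_simps\<close>)
qed

lemma local_max_second_derivative:
  fixes g :: "real \<Rightarrow> real"
  assumes d: "\<And>s. \<bar>s\<bar> < \<delta> \<Longrightarrow> (g has_real_derivative g' s) (at s)" and "0 < \<delta>"
    and d2: "(g' has_real_derivative g2) (at 0)" and max: "\<And>s. g s \<le> g 0"
  shows "g' 0 = 0" "g2 \<le> 0"
proof -
  show g0: "g' 0 = 0"
    by (rule DERIV_local_max[OF d, of 0 1]) (use max \<open>0 < \<delta>\<close> in auto)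
  show "g2 \<le> 0"
  proof (rule ccontr)
    assume "\<not> g2 \<le> 0"
    then obtain \<epsilon> where \<epsilon>: "\<epsilon> > 0" "\<And>h. 0 < h \<Longrightarrow> h < \<epsilon> \<Longrightarrow> g' 0 < g' (0 + h)"
      using DERIV_pos_inc_right[OF d2] by auto
    define t where "t = min \<epsilon> \<delta> / 2"
    have t: "0 < t" "t < \<epsilon>" "t < \<delta>" using \<epsilon> \<open>0 < \<delta>\<close> by (auto simp: t_def min_def)
    obtain z where z: "0 < z" "z < t" "g t - g 0 = (t - 0) * g' z"
      using MVT2[of 0 t g g'] d t by auto
    have "0 < g' z" using \<epsilon>(2)[of z] z t g0 by simp
    then have "0 < t * g' z" using t by simp
    then have "g 0 < g t" using z by simp
    with max[of t] show False by simp
  qed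
qed

lemma periodic_int:
  fixes v :: "'a::real_vector"
  assumes "\<And>q. f (q + v) = f q" shows "f (q + of_int m *\<^sub>R v) = f q"
proof (induction m rule: int_induct[where k = 0])
  case (step1 i)
  then show ?case using assms[of "q + of_int i *\<^sub>R v"] by (simp add: algebra_simps)
next
  case (step2 i)
  then show ?case using assms[of "q + of_int (i - 1) *\<^sub>R v"] by (simp add: algebra_simps)
qed simp

text \<open>The chart misses the poles, so \<open>nu\<close> gives no information there.
  \<open>pole_tangent\<close> confines the directions supported at a pole to a plane, which is a
  null set.\<close>

locale convex_surface = surface +
  fixes Y :: "real^3 \<Rightarrow> real^3"
  assumes Y_cont: "continuous_on (sphere 0 1) Y" and x_eq: "x p = Y (sph p)"
    and L11_pos: "p \<in> polar_dom \<Longrightarrow> 0 < L11 p"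
    and pole_tangent: "q = axis 3 1 \<or> q = - axis 3 1 \<Longrightarrow>
      \<exists>v. v \<noteq> 0 \<and> (\<forall>n. (\<forall>q'\<in>sphere 0 1. n \<bullet> Y q' \<le> n \<bullet> Y q) \<longrightarrow> v \<bullet> n = 0)"
begin

text \<open>The first-order condition makes \<open>n\<close> a multiple of \<open>nu p\<close>; the
  second-order condition along the meridian, with \<open>L11\<close> positive, makes the factor
  nonnegative.\<close>

lemma maximum_normal:
  assumes p: "p \<in> polar_dom" and max: "\<And>q. q \<in> sphere 0 1 \<Longrightarrow> n \<bullet> Y q \<le> n \<bullet> x p"
  shows "n = norm n *\<^sub>R nu p"
proof -
  obtain \<delta> where \<delta>: "\<delta> > 0" "\<And>s i. \<bar>s\<bar> < \<delta> \<Longrightarrow> p + s *\<^sub>R axis i 1 \<in> polar_dom"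
  proof -
    obtain d where "d > 0" "ball p d \<subseteq> polar_dom" using open_polar_dom p openE by blast
    then show thesis by (intro that[of d]) (auto simp: subset_iff dist_norm norm_axis_1)
  qed
  have shift: "((\<lambda>s. n \<bullet> f (p + s *\<^sub>R axis i 1)) has_real_derivative n \<bullet> pd i f (p + s *\<^sub>R axis i 1)) (at s)"
    if "smooth f polar_dom" "\<bar>s\<bar> < \<delta>" for f :: "real^2 \<Rightarrow> real^3" and i s
  proof -
    let ?q = "p + s *\<^sub>R axis i 1"
    have e: "?q + t *\<^sub>R axis i 1 = p + (t + s) *\<^sub>R axis i 1" for t by (simp add: scaleR_add_left)
    have "has_pd i (\<lambda>q. n \<bullet> f q) (n \<bullet> pd i f ?q) ?q"
      using has_pd_linear[OF bounded_linear_inner_right smooth_has_pd'[OF that(1) \<delta>(2)[OF that(2)]]] .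
    then have "((\<lambda>t. n \<bullet> f (p + (t + s) *\<^sub>R axis i 1)) has_real_derivative n \<bullet> pd i f ?q) (at 0)"
      unfolding has_pd_def e has_real_derivative_iff_has_vector_derivative[symmetric] .
    then show ?thesis using DERIV_shift[of "\<lambda>t. n \<bullet> f (p + t *\<^sub>R axis i 1)" "n \<bullet> pd i f ?q" 0 s] by simp
  qed
  have mx: "n \<bullet> x (p + s *\<^sub>R axis i 1) \<le> n \<bullet> x (p + 0 *\<^sub>R axis i 1)" for s i
    using max[of "sph (p + s *\<^sub>R axis i 1)"] by (simp add: x_eq norm_sph)
  have "n \<bullet> pd i x p = 0" "n \<bullet> pd i (pd i x) p \<le> 0" for i
    using local_max_second_derivative[OF shift[OF smooth_x] \<delta>(1) shift[OF smooth_pds(1), of 0] mx, of i] \<delta>(1) by simp_all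
  then have n: "n = (n \<bullet> nu p) *\<^sub>R nu p" and "n \<bullet> pd 1 (pd 1 x) p \<le> 0"
    using expansion[OF p, of n] by simp_all
  then have "(n \<bullet> nu p) * (nu p \<bullet> pd 1 (pd 1 x) p) \<le> 0" by (metis inner_scaleR_left)
  then have "(n \<bullet> nu p) * (- L11 p) \<le> 0" by (simp add: L11_def inner_commute)
  then have "0 \<le> n \<bullet> nu p" using L11_pos[OF p] by (simp add: zero_le_mult_iff)
  moreover have "norm n = \<bar>n \<bullet> nu p\<bar>" using arg_cong[OF n, of norm] nu_unit(1)[OF p] by (simp add: norm_eq_sqrt_inner[of "nu p"])
  ultimately show ?thesis using n by simp
qed

text \<open>The Weingarten formulas produce the determinant of the second form, and the Gauss
  equation makes it a function of the metric, up to the orientation sign.\<close>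

lemma nu_cross: assumes p: "p \<in> polar_dom"
  shows "nu p \<bullet> cross3 (pd 1 nu p) (pd 2 nu p) = - e * k1 (p$1)"
proof -
  note ps = theta_pos[OF p]
  have "cross3 (pd 1 nu p) (pd 2 nu p) = ((L11 p * L22 p - (L12 p)\<^sup>2) / ((w (p$1))\<^sup>2 * (rho (p$1))\<^sup>2)) *\<^sub>R cross3 (pd 1 x p) (pd 2 x p)"
    using ps unfolding pd_nu[OF p]
    by (simp add: cross_add_left cross_add_right cross_mult_left cross_mult_right cross_skew[of "pd 2 x p" "pd 1 x p"]
        divide_simps power2_eq_square flip: scaleR_diff_left)
  also have "\<dots> = (- k1 (p$1)) *\<^sub>R (1 / (w (p$1) * rho (p$1))) *\<^sub>R cross3 (pd 1 x p) (pd 2 x p)"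
    unfolding gauss[OF p] using ps by (simp add: power2_eq_square)
  also have "(1 / (w (p$1) * rho (p$1))) *\<^sub>R cross3 (pd 1 x p) (pd 2 x p) = e *\<^sub>R nu p"
    using e_sign by (auto simp: nu_def)
  finally show ?thesis using nu_unit(1)[OF p] by simp
qed

text \<open>If a point lay beyond the tangent plane at \<open>p0\<close>, it would lie beyond those
  at all nearby parameters, and a box of these could be deleted from the domain. The points of
  support are all kept, so the cone map still covers the ball up to a null set; but the integral of
  its Jacobian is now smaller than the volume of the ball.\<close>

lemma support_inequality: assumes p0: "p0 \<in> polar_dom" and q0: "q0 \<in> sphere 0 1"
  shows "nu p0 \<bullet> (Y q0 - x p0) \<le> 0"
proof (rule ccontr)
  assume neg: "\<not> nu p0 \<bullet> (Y q0 - x p0) \<le> 0"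
  define f where "f z = z$1 *\<^sub>R nu (vector [z$2, z$3])" for z :: "real^3"
  define D where "D p = (SOME D. (nu has_derivative D) (at p))" for p
  define f' where "f' z = (\<lambda>v::real^3. z$1 *\<^sub>R D (vector [z$2, z$3]) (vector [v$2, v$3]) + v$1 *\<^sub>R nu (vector [z$2, z$3]))" for z :: "real^3"
  have D: "(nu has_derivative D p) (at p)" if "p \<in> polar_dom" for p
    unfolding D_def using someI_ex[OF nu_has_derivative[OF that]] .
  have d: "(f has_derivative f' z) (at z)" and J: "\<bar>det (matrix (f' z))\<bar> = cone_density z" if z: "z \<in> cone_dom" for z
  proof -
    have pp: "vector [z$2, z$3] \<in> polar_dom" using z by (auto simp: cone_dom_def)
    show "(f has_derivative f' z) (at z)"
      unfolding f_def[abs_def] f'_def by (rule cone_derivative(1)[OF D[OF pp]])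
    have "D (vector [z$2, z$3]) (axis i 1) = pd i nu (vector [z$2, z$3])" for i
      using pd_eqI[OF has_derivative_imp_has_pd[OF D[OF pp]]] by simp
    then have "det (matrix (f' z)) = (z$1)\<^sup>2 * (- e * k1 (z$2))"
      unfolding f'_def cone_derivative(2)[OF D[OF pp]] by (simp add: nu_cross[OF pp] vector_2)
    then show "\<bar>det (matrix (f' z))\<bar> = cone_density z"
      using cone_density_pos[OF z] e_sign by (auto simp: cone_density_def abs_if)
  qed
  \<comment> \<open>not being a point of support is an open condition, so it holds on a small box inside the chart\<close>
  let ?g = "\<lambda>p. nu p \<bullet> (Y q0 - x p)"
  let ?v = "(2 * pi) *\<^sub>R axis 2 1 :: real^2"
  have "nu (q + ?v) = nu q" for q
    unfolding nu_def pd_translate[of x ?v, OF x_periodic] by (simp add: axis_def)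
  then have per: "?g (q + ?v) = ?g q" for q by (simp add: x_periodic)
  \<comment> \<open>Whole turns are subtracted to bring the angle of \<open>p0\<close> into the
    half-open period.\<close>
  define m where "m = \<lfloor>p0$2 / (2 * pi)\<rfloor>"
  define \<phi>0 where "\<phi>0 = p0$2 - 2 * pi * of_int m"
  have "of_int m \<le> p0$2 / (2 * pi)" "p0$2 / (2 * pi) < of_int m + 1" unfolding m_def by linarith+
  then have \<phi>0: "0 \<le> \<phi>0" "\<phi>0 < 2 * pi" using pi_gt_zero by (simp_all add: \<phi>0_def field_simps)
  have "vector [p0$1, \<phi>0] = p0 + of_int (- m) *\<^sub>R ?v" by (simp add: vec2_eq_iff vector_2 axis_def \<phi>0_def)
  then have g0: "0 < ?g (vector [p0$1, \<phi>0])" using periodic_int[of ?g ?v p0 "- m", OF per] neg by simp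
  define U where "U = {z::real^3. 0 < z$1 \<and> z$1 < 1 \<and> 0 < z$2 \<and> z$2 < pi}"
  have "U = (\<lambda>z. z$1) -` {0<..<1} \<inter> (\<lambda>z. z$2) -` {0<..<pi}" by (auto simp: U_def)
  moreover have "open \<dots>" by (intro open_Int open_vimage continuous_intros)
  ultimately have oU: "open U" by simp
  have cg: "continuous_on U (\<lambda>z. ?g (vector [z$2, z$3]))"
  proof -
    have "continuous_on polar_dom ?g" by (intro continuous_intros cont_nu smooth_continuous_on[OF smooth_x])
    then show ?thesis by (rule continuous_on_compose2) (auto simp: U_def intro!: continuous_intros)
  qed
  define V where "V = {z \<in> U. 0 < ?g (vector [z$2, z$3])}"
  have "V = U \<inter> (\<lambda>z. ?g (vector [z$2, z$3])) -` {0<..}" by (auto simp: V_def)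
  then have oV: "open V" using continuous_open_preimage[OF cg oU open_greaterThan] by simp
  have "vector [1/2, p0$1, \<phi>0] \<in> V" using g0 p0 by (simp add: V_def U_def vector_3 mem_polar_dom)
  then obtain r where r: "r > 0" "ball (vector [1/2, p0$1, \<phi>0]) r \<subseteq> V" using oV openE by blast
  \<comment> \<open>The reduced angle may be 0, on the edge of the domain; a small increase leads to
    an interior point at which the strict inequality persists.\<close>
  define t where "t = min (r / 2) ((2 * pi - \<phi>0) / 2)"
  have t: "0 < t" "t < r" "\<phi>0 + t < 2 * pi" using r \<phi>0 by (auto simp: t_def min_def field_simps)
  have "vector [1/2, p0$1, \<phi>0] + t *\<^sub>R axis 3 1 \<in> ball (vector [1/2, p0$1, \<phi>0] :: real^3) r"
    using t by (simp add: dist_norm norm_axis_1)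
  then have "vector [1/2, p0$1, \<phi>0] + t *\<^sub>R axis 3 1 \<in> V \<inter> (\<lambda>z. z$3) -` {0<..<2*pi}"
    using r t \<phi>0 by (auto simp: axis_def vector_3)
  moreover have "open (V \<inter> (\<lambda>z. z$3) -` {0<..<2*pi})"
    by (intro open_Int oV open_vimage continuous_intros)
  ultimately obtain a b where ab': "cbox a b \<subseteq> V \<inter> (\<lambda>z. z$3) -` {0<..<2*pi}" "vector [1/2, p0$1, \<phi>0] + t *\<^sub>R axis 3 1 \<in> box a b"
    using open_contains_cbox by metis
  then have ab: "box a b \<noteq> {}" "cbox a b \<subseteq> cone_dom" "\<And>z. z \<in> cbox a b \<Longrightarrow> 0 < ?g (vector [z$2, z$3])"
    by (force simp: V_def U_def cone_dom_def)+
  let ?S = "cone_dom - cbox a b"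
  note ci = cone_density_integral
  have "continuous_on (cbox a b) (\<lambda>z. k1 (z$2))"
    by (rule continuous_on_compose2[OF cont_k1]) (use ab(2) in \<open>auto simp: cone_dom_def intro!: continuous_intros\<close>)
  then have cc: "continuous_on (cbox a b) cone_density" unfolding cone_density_def[abs_def] by (intro continuous_intros)
  then have cb1: "cone_density integrable_on cbox a b" by (rule integrable_continuous)
  have pos: "0 < cone_density z" if "z \<in> cbox a b" for z using cone_density_pos ab(2) that by blast
  have "integral (cbox a b) cone_density \<noteq> 0"
  proof
    assume "integral (cbox a b) cone_density = 0"
    then have "(cone_density has_integral 0) (cbox a b)" using integrable_integral[OF cb1] by simp
    then have "cone_density z = 0" if "z \<in> cbox a b" for z
      using has_integral_0_cbox_imp_0[OF cc] pos ab(1) that box_subset_cbox by (meson less_imp_le subsetD)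
    then show False using pos ab(1) box_subset_cbox by (metis all_not_in_conv less_irrefl subsetD)
  qed
  moreover have "0 \<le> integral (cbox a b) cone_density" by (rule integral_nonneg[OF cb1]) (use pos in force)
  ultimately have cb: "cone_density integrable_on cbox a b" "0 < integral (cbox a b) cone_density" using cb1 by auto
  have S: "(cone_density has_integral (integral cone_dom cone_density - integral (cbox a b) cone_density)) ?S"
    by (rule has_integral_setdiff[OF integrable_integral[OF ci(1)] integrable_integral[OF cb(1)]])
      (use ab(2) in \<open>auto simp: Diff_eq_empty_iff[THEN iffD2]\<close>)
  have Sm: "?S \<in> sets lebesgue" using cone_dom_measurable by auto
  have dS: "(f has_derivative f' z) (at z within ?S)" if "z \<in> ?S" for z
    using d that by (auto intro: has_derivative_at_withinI)
  have S': "((\<lambda>z. \<bar>det (matrix (f' z))\<bar>) has_integral (integral cone_dom cone_density - integral (cbox a b) cone_density)) ?S"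
    by (rule has_integral_eq[OF _ S]) (use J in auto)
  have im: "f ` ?S \<in> lmeasurable" "measure lebesgue (f ` ?S) \<le> integral cone_dom cone_density - integral (cbox a b) cone_density"
    using measurable_differentiable_image[OF Sm dS has_integral_integrable[OF S']]
      measure_differentiable_image[OF Sm dS has_integral_integrable[OF S']] integral_unique[OF S'] by auto
  obtain v1 v2 where v: "v1 \<noteq> 0" "v2 \<noteq> 0" "\<And>n. (\<forall>q'\<in>sphere 0 1. n \<bullet> Y q' \<le> n \<bullet> Y (axis 3 1)) \<Longrightarrow> v1 \<bullet> n = 0"
    "\<And>n. (\<forall>q'\<in>sphere 0 1. n \<bullet> Y q' \<le> n \<bullet> Y (- axis 3 1)) \<Longrightarrow> v2 \<bullet> n = 0"
    using pole_tangent by metis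
  let ?N = "{n. v1 \<bullet> n = 0} \<union> {n. v2 \<bullet> n = 0}"
  have N: "negligible ?N" using v by (intro negligible_Un negligible_hyperplane) auto
  have cover: "ball 0 1 \<subseteq> f ` ?S \<union> ?N"
  proof
    fix n :: "real^3" assume n: "n \<in> ball 0 1"
    have "continuous_on (sphere 0 1) (\<lambda>q. n \<bullet> Y q)" by (intro continuous_intros Y_cont)
    \<comment> \<open>A maximiser of \<open>n \<bullet> Y\<close> is a point of support. Off the
      poles it gives \<open>n = norm n *\<^sub>R nu p\<close>, and \<open>p\<close> is not a deleted
      parameter because \<open>Y q0\<close> does not lie beyond the tangent plane there.\<close>
    then obtain q where q: "q \<in> sphere 0 1" "\<And>q'. q' \<in> sphere 0 1 \<Longrightarrow> n \<bullet> Y q' \<le> n \<bullet> Y q"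
      using continuous_attains_sup[of "sphere (0::real^3) 1" "\<lambda>q. n \<bullet> Y q"] q0 by auto
    show "n \<in> f ` ?S \<union> ?N"
    proof (cases "q = axis 3 1 \<or> q = - axis 3 1 \<or> n = 0")
      case True then show ?thesis using v q by auto
    next
      case False
      then obtain p where p: "p \<in> polar_dom" "0 \<le> p$2" "p$2 < 2 * pi" "q = sph p" using sph_surj q(1) by metis
      have xp: "x p = Y q" by (simp add: x_eq p(4))
      have nn: "n = norm n *\<^sub>R nu p" by (rule maximum_normal[OF p(1)]) (use q(2) xp in auto)
      have n0: "0 < norm n" "norm n < 1" using False n by auto
      define z :: "real^3" where "z = vector [norm n, p$1, p$2]"
      have zz: "vector [z$2, z$3] = p" by (simp add: z_def vector_3)
      have "z \<in> cone_dom" using p n0 by (auto simp: cone_dom_def z_def vector_3 mem_polar_dom)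
      moreover have "norm n * (nu p \<bullet> (Y q0 - x p)) \<le> 0"
        using q(2)[OF q0] xp nn by (metis diff_le_0_iff_le inner_diff_right inner_scaleR_left)
      then have "nu p \<bullet> (Y q0 - x p) \<le> 0" using n0 by (simp add: mult_le_0_iff)
      then have "z \<notin> cbox a b" using ab(3)[of z] zz by fastforce
      moreover have "n = f z" unfolding f_def zz using nn by (simp add: z_def vector_3)
      ultimately show ?thesis by blast
    qed
  qed
  have "measure lebesgue (ball (0::real^3) 1) \<le> measure lebesgue (f ` ?S \<union> ?N)"
    by (rule measure_mono_fmeasurable[OF cover]) (use im(1) N in \<open>auto intro: fmeasurable.Un negligible_imp_measurable\<close>)
  also have "\<dots> \<le> measure lebesgue (f ` ?S) + measure lebesgue ?N"
    using im(1) N by (intro measure_Un_le) (auto dest: fmeasurableD negligible_imp_sets)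
  also have "\<dots> = measure lebesgue (f ` ?S)" using negligible_imp_measure0[OF N] by simp
  finally show False using im(2) ci(2) cb(2) by linarith
qed

section \<open>The convex hull of the surface and the outward direction\<close>

definition K where "K = convex hull (Y ` sphere 0 1)"

lemma compact_image: "compact (Y ` sphere 0 1)"
  by (intro compact_continuous_image Y_cont) simp

lemma hull_half: assumes "p \<in> polar_dom" "y \<in> K" shows "nu p \<bullet> y \<le> nu p \<bullet> x p"
proof -
  have "Y ` sphere 0 1 \<subseteq> {y. nu p \<bullet> y \<le> nu p \<bullet> x p}"
    using support_inequality[OF assms(1)] by (auto simp: inner_diff_right)
  then have "K \<subseteq> {y. nu p \<bullet> y \<le> nu p \<bullet> x p}" unfolding K_def by (intro hull_minimal convex_halfspace_le)
  then show ?thesis using assms(2) by blast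
qed

lemma image_subset_hull: "Y ` sphere 0 1 \<subseteq> K"
  by (simp add: K_def hull_subset)

text \<open>\<open>nu q \<bullet> (z - x q)\<close> is nonpositive in \<open>q\<close> and vanishes
  at \<open>p\<close>, so its derivatives vanish there. As the second form is nondegenerate, this
  kills the tangential part of \<open>z - x p\<close>.\<close>

lemma strict_support:
  assumes p: "p \<in> polar_dom" and z: "z \<in> K" "nu p \<bullet> z = nu p \<bullet> x p"
  shows "z = x p"
proof -
  define u where "u = z - x p"
  have "pd i nu p \<bullet> u = 0" for i
  proof -
    have d: "has_pd i (\<lambda>q. nu q \<bullet> (z - x q)) (nu p \<bullet> (0 - pd i x p) + pd i nu p \<bullet> (z - x p)) p"
      by (intro has_pd_inner nu_has_pd[OF p] has_pd_diff has_pd_const pds(1)[OF p])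
    have "open ((\<lambda>s. p + s *\<^sub>R axis i 1) -` polar_dom)"
      by (intro open_vimage open_polar_dom continuous_intros)
    then obtain \<delta> where \<delta>: "0 < \<delta>" "\<And>s. \<bar>s\<bar> < \<delta> \<Longrightarrow> p + s *\<^sub>R axis i 1 \<in> polar_dom"
      using p openE[of "(\<lambda>s. p + s *\<^sub>R axis i 1) -` polar_dom" 0] by (auto simp: subset_iff dist_real_def)
    have "nu p \<bullet> (0 - pd i x p) + pd i nu p \<bullet> (z - x p) = 0"
    proof (rule DERIV_local_max[OF _ \<delta>(1)])
      show "((\<lambda>s. nu (p + s *\<^sub>R axis i 1) \<bullet> (z - x (p + s *\<^sub>R axis i 1))) has_real_derivative
          nu p \<bullet> (0 - pd i x p) + pd i nu p \<bullet> (z - x p)) (at 0)"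
        using d unfolding has_pd_def has_real_derivative_iff_has_vector_derivative .
      show "\<forall>s. \<bar>0 - s\<bar> < \<delta> \<longrightarrow> nu (p + s *\<^sub>R axis i 1) \<bullet> (z - x (p + s *\<^sub>R axis i 1)) \<le> nu (p + 0 *\<^sub>R axis i 1) \<bullet> (z - x (p + 0 *\<^sub>R axis i 1))"
        using hull_half[OF \<delta>(2) z(1)] z(2) by (simp add: inner_diff_right)
    qed
    then show ?thesis using nu_unit(3)[OF p, of i] by (simp add: u_def inner_diff_right)
  qed
  note z' = this[of 1] this[of 2]
  define \<alpha> \<beta> where "\<alpha> = u \<bullet> pd 1 x p / (w (p$1))\<^sup>2" and "\<beta> = u \<bullet> pd 2 x p / (rho (p$1))\<^sup>2"
  have "L11 p * \<alpha> + L12 p * \<beta> = 0" "L12 p * \<alpha> + L22 p * \<beta> = 0"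
    using z' unfolding pd_nu[OF p] \<alpha>_def \<beta>_def by (simp_all add: inner_add_left inner_add_right inner_commute[of u])
  then have "(L11 p * L22 p - (L12 p)\<^sup>2) * \<alpha> = 0" "(L11 p * L22 p - (L12 p)\<^sup>2) * \<beta> = 0" by algebra+
  moreover have "L11 p * L22 p - (L12 p)\<^sup>2 \<noteq> 0"
    unfolding gauss[OF p] using k1_neg theta_pos[OF p] by (simp add: less_imp_neq)
  ultimately have "\<alpha> = 0" "\<beta> = 0" by auto
  moreover have "u \<bullet> nu p = 0" using z(2) by (simp add: u_def inner_diff_left inner_commute)
  ultimately have "u = 0" using expansion[OF p, of u] unfolding \<alpha>_def[symmetric] \<beta>_def[symmetric] by simp
  then show ?thesis by (simp add: u_def)
qed

text \<open>Otherwise both \<open>b\<close> and \<open>- b\<close> would attain their maximum at the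
  same chart point and be nonnegative multiples of the same unit normal, of equal length.\<close>

lemma not_planar:
  assumes "b \<noteq> 0" shows "\<exists>z\<in>K. b \<bullet> z \<noteq> d"
proof (rule ccontr)
  assume "\<not> ?thesis"
  then have eq: "b \<bullet> Y q = d" if "q \<in> sphere 0 1" for q using that image_subset_hull by blast
  have p: "vector [pi / 2, 0] \<in> polar_dom" by simp
  have "b = norm b *\<^sub>R nu (vector [pi / 2, 0])" "- b = norm (- b) *\<^sub>R nu (vector [pi / 2, 0])"
    by (rule maximum_normal[OF p]; simp add: x_eq eq norm_sph)+
  then have "b = - b" by simp
  then have "b = 0" using real_vector.scale_eq_0_iff[of 2 b] by (simp add: vec_eq_iff)
  then show False using assms by simp
qed

lemma frontier_hull_normal:
  assumes "y \<in> frontier K"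
  obtains n where "n \<noteq> 0" "\<And>z. z \<in> K \<Longrightarrow> n \<bullet> z \<le> n \<bullet> y"
proof -
  have cK: "convex K" "compact K" unfolding K_def by (simp_all add: compact_convex_hull compact_image)
  have "interior K \<noteq> {}"
  proof
    assume "interior K = {}"
    then obtain a b where ab: "a \<noteq> 0" "K \<subseteq> {x. a \<bullet> x = b}" by (rule empty_interior_subset_hyperplane[OF cK(1)])
    show False using not_planar[OF ab(1), of b] ab(2) by auto
  qed
  then have "rel_interior K = interior K" by (rule rel_interior_nonempty_interior)
  then have y: "y \<in> closure K" "y \<notin> rel_interior K" using assms by (auto simp: frontier_def)
  obtain a where a: "a \<noteq> 0" "\<And>z. z \<in> closure K \<Longrightarrow> a \<bullet> y \<le> a \<bullet> z"
    by (rule supporting_hyperplane_relative_frontier[OF cK(1) y]) blast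
  show thesis by (rule that[of "- a"]) (use a closure_subset in auto)
qed

text \<open>A supporting plane at a frontier point \<open>y\<close> meets the hull in a face spanned
  by surface points. If one of them lies off the images of the poles, \<open>strict_support\<close>
  identifies it with \<open>y\<close>; otherwise \<open>y\<close> is on the segment joining these
  images. If \<open>y\<close> is not on the surface, the frontier near it then lies in a line, and a
  line cannot separate the hull from its complement.\<close>

lemma frontier_hull: "frontier K \<subseteq> Y ` sphere 0 1"
proof -
  let ?S = "Y ` sphere 0 1" and ?N = "Y (axis 3 1)" and ?Z = "Y (- axis 3 1)"
  have cK: "convex K" "compact K" unfolding K_def by (simp_all add: compact_convex_hull compact_image)
  have clK: "closed K" using cK compact_imp_closed by blast
  have seg: "y \<in> ?S \<union> closed_segment ?N ?Z" if y: "y \<in> frontier K" for y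
  proof (rule ccontr)
    assume ny: "\<not> ?thesis"
    obtain n where n: "n \<noteq> 0" "\<And>z. z \<in> K \<Longrightarrow> n \<bullet> z \<le> n \<bullet> y" by (rule frontier_hull_normal[OF y]) blast
    have yK: "y \<in> K" using y clK by (auto simp: frontier_def)
    have "(K \<inter> {z. n \<bullet> z = n \<bullet> y}) face_of K" by (rule face_of_Int_supporting_hyperplane_le[OF cK(1) n(2)])
    then obtain s' where s': "s' \<subseteq> ?S" "K \<inter> {z. n \<bullet> z = n \<bullet> y} = convex hull s'"
      unfolding K_def by (rule face_of_convex_hull_subset[OF compact_image])
    have "s' \<subseteq> {?N, ?Z}"
    proof
      fix z assume z: "z \<in> s'"
      then obtain q where q: "q \<in> sphere 0 1" "z = Y q" using s'(1) by blast
      have nz: "n \<bullet> z = n \<bullet> y" using z s'(2) hull_subset[of s' convex] by blast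
      show "z \<in> {?N, ?Z}"
      proof (rule ccontr)
        assume "z \<notin> {?N, ?Z}"
        then obtain p where p: "p \<in> polar_dom" "q = sph p" using sph_surj[OF q(1)] q(2) by blast
        have "n = norm n *\<^sub>R nu p"
        proof (rule maximum_normal[OF p(1)])
          fix q' :: "real^3" assume "q' \<in> sphere 0 1"
          then have "Y q' \<in> K" using image_subset_hull by blast
          from n(2)[OF this] show "n \<bullet> Y q' \<le> n \<bullet> x p" using nz q p by (simp add: x_eq)
        qed
        then have "norm n * (nu p \<bullet> z) = norm n * (nu p \<bullet> y)" using nz by (metis inner_scaleR_left)
        then have "nu p \<bullet> y = nu p \<bullet> x p" using n(1) q p by (simp add: x_eq)
        then have "y = x p" by (rule strict_support[OF p(1) yK])
        then show False using ny by (simp add: x_eq norm_sph)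
      qed
    qed
    then have "convex hull s' \<subseteq> closed_segment ?N ?Z" unfolding segment_convex_hull by (rule hull_mono)
    then show False using s'(2) yK ny by blast
  qed
  show ?thesis
  proof (rule ccontr)
    assume "\<not> ?thesis"
    then obtain y where y: "y \<in> frontier K" "y \<notin> ?S" by blast
    have yK: "y \<in> K" using y clK by (auto simp: frontier_def)
    obtain \<epsilon> where \<epsilon>: "0 < \<epsilon>" "ball y \<epsilon> \<inter> ?S = {}"
      using y(2) compact_imp_closed[OF compact_image] by (metis open_contains_ball open_Compl ComplI disjoint_eq_subset_Compl)
    obtain n where n: "n \<noteq> 0" "\<And>z. z \<in> K \<Longrightarrow> n \<bullet> z \<le> n \<bullet> y" by (rule frontier_hull_normal[OF y(1)]) blast
    \<comment> \<open>\<open>b\<close> is normal to a plane containing the segment and the direction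
      \<open>n\<close>. A hull point \<open>i\<close> off this plane and a point \<open>w'\<close>
      of the plane outside the hull are joined within the ball; the frontier point between them lies
      in the plane, which forces it to be \<open>w'\<close>.\<close>
    have "dim {n, ?Z - ?N} < DIM(real^3)"
      using dim_le_card'[of "{n, ?Z - ?N}"] card_insert_le_m1[of 2 "{?Z - ?N}" n] by simp
    then obtain b where b: "b \<noteq> 0" "b \<bullet> n = 0" "b \<bullet> (?Z - ?N) = 0"
      by (rule orthogonal_to_subspace_exists) (metis insertI1 insertI2 orthogonal_def span_base)
    have on_line: "b \<bullet> c = b \<bullet> ?N" if c: "c \<in> closed_segment ?N ?Z" for c
    proof -
      obtain v where "c = (1 - v) *\<^sub>R ?N + v *\<^sub>R ?Z" using c unfolding closed_segment_def by blast
      then have "c = ?N + v *\<^sub>R (?Z - ?N)" by (simp add: algebra_simps)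
      then show ?thesis using b(3) by (simp add: inner_add_right)
    qed
    have by': "b \<bullet> y = b \<bullet> ?N" using seg[OF y(1)] y(2) on_line by blast
    obtain z where z: "z \<in> K" "b \<bullet> z \<noteq> b \<bullet> y" using not_planar[OF b(1)] by blast
    define v where "v = \<epsilon> / (norm (z - y) + \<epsilon>) / 2"
    have ne: "0 < norm (z - y) + \<epsilon>" using \<epsilon>(1) by (simp add: add_nonneg_pos)
    have v: "0 < v" "v \<le> 1" "v * norm (z - y) < \<epsilon>"
    proof -
      show "0 < v" "v \<le> 1" using \<epsilon>(1) ne by (simp_all add: v_def divide_simps)
      have "norm (z - y) / (norm (z - y) + \<epsilon>) / 2 < 1" using ne \<epsilon>(1) by (simp add: divide_simps add_nonneg_pos)
      then have "\<epsilon> * (norm (z - y) / (norm (z - y) + \<epsilon>) / 2) < \<epsilon> * 1" using \<epsilon>(1) by (intro mult_strict_left_mono)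
      then show "v * norm (z - y) < \<epsilon>" by (simp add: v_def)
    qed
    define i where "i = y + v *\<^sub>R (z - y)"
    have i: "i \<in> K" "i \<in> ball y \<epsilon>" "b \<bullet> i \<noteq> b \<bullet> y"
    proof -
      have "(1 - v) *\<^sub>R y + v *\<^sub>R z \<in> K" using v by (intro convexD[OF cK(1) yK z(1)]) auto
      then show "i \<in> K" by (simp add: i_def algebra_simps)
      show "i \<in> ball y \<epsilon>" using v by (simp add: i_def dist_norm)
      show "b \<bullet> i \<noteq> b \<bullet> y" using z(2) v(1) by (simp add: i_def inner_add_right inner_diff_right)
    qed
    define w' where "w' = y + (\<epsilon> / (2 * norm n)) *\<^sub>R n"
    have w': "w' \<notin> K" "w' \<in> ball y \<epsilon>" "b \<bullet> w' = b \<bullet> y"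
    proof -
      have "0 < (\<epsilon> / (2 * norm n)) * (n \<bullet> n)" using \<epsilon>(1) n(1) by simp
      then show "w' \<notin> K" using n(2)[of w'] by (auto simp: w'_def inner_add_right)
      show "w' \<in> ball y \<epsilon>" using \<epsilon>(1) n(1) by (simp add: w'_def dist_norm)
      show "b \<bullet> w' = b \<bullet> y" using b(2) by (simp add: w'_def inner_add_right)
    qed
    have "closed_segment i w' \<inter> frontier K \<noteq> {}"
      by (rule connected_Int_frontier) (use i w' in auto)
    then obtain c where c: "c \<in> closed_segment i w'" "c \<in> frontier K" by blast
    have "c \<in> ball y \<epsilon>" using c(1) i(2) w'(2) convex_contains_segment[of "ball y \<epsilon>"] by blast
    then have "c \<in> closed_segment ?N ?Z" using seg[OF c(2)] \<epsilon>(2) by blast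
    then have bc: "b \<bullet> c = b \<bullet> y" unfolding by' by (rule on_line)
    obtain u where u: "c = (1 - u) *\<^sub>R i + u *\<^sub>R w'" using c(1) by (auto simp: closed_segment_def)
    have "(1 - u) * (b \<bullet> i - b \<bullet> y) = 0" using bc unfolding u by (simp add: inner_add_right w'(3) algebra_simps)
    then have "u = 1" using i(3) by simp
    then have "c = w'" using u by simp
    moreover have "c \<in> K" using c(2) clK by (auto simp: frontier_def)
    ultimately show False using w'(1) by blast
  qed
qed

text \<open>The outside is connected and unbounded, so if it met the hull it would cross the
  frontier of the hull, which consists of surface points.\<close>

lemma hull_Int_outside: "K \<inter> outside (Y ` sphere 0 1) = {}"
proof (rule ccontr)
  let ?S = "Y ` sphere 0 1"
  assume "K \<inter> outside ?S \<noteq> {}"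
  then have 1: "outside ?S \<inter> K \<noteq> {}" by blast
  have bS: "bounded ?S" using compact_image compact_imp_bounded by blast
  have "\<not> bounded (outside ?S)" by (rule unbounded_outside[OF bS])
  moreover have "bounded K" unfolding K_def by (rule bounded_convex_hull[OF bS])
  ultimately have 2: "outside ?S - K \<noteq> {}" using bounded_subset by blast
  have "connected (outside ?S)" by (rule connected_outside[OF bS]) simp
  from connected_Int_frontier[OF this 1 2] show False
    using frontier_hull outside_no_overlap[of ?S] by blast
qed

text \<open>A hyperplane separating the hull from the open ray along \<open>- nu p\<close> would
  support the hull at \<open>x p\<close>; hence its normal is a positive multiple of
  \<open>nu p\<close>, and the ray lies on the wrong side.\<close>

lemma inner_point_in_hull:
  assumes p: "p \<in> polar_dom" shows "\<exists>t>0. x p - t *\<^sub>R nu p \<in> K"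
proof (rule ccontr)
  assume none: "\<not> ?thesis"
  define T where "T = (\<lambda>t. x p - t *\<^sub>R nu p) ` {0<..}"
  have xK: "x p \<in> K" using image_subset_hull by (auto simp: x_eq norm_sph)
  have eq: "T = (+) (x p) ` ((\<lambda>t. t *\<^sub>R (- nu p)) ` {0<..})" by (auto simp: T_def image_image)
  have "convex T" unfolding eq
    by (intro convex_translation convex_linear_image convex_real_interval linear_scaleR_left)
  moreover have "convex K" by (simp add: K_def)
  moreover have "T \<noteq> {}" "K \<noteq> {}" "K \<inter> T = {}" using none xK by (auto simp: T_def)
  ultimately obtain n b where n: "n \<noteq> 0" "\<forall>z\<in>K. n \<bullet> z \<le> b" "\<forall>z\<in>T. b \<le> n \<bullet> z"
    using separating_hyperplane_sets[of K T] by blast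
  have Tb: "b \<le> n \<bullet> x p - t * (n \<bullet> nu p)" if "0 < t" for t
    using n(3) that by (auto simp: T_def inner_diff_right)
  have lim: "((\<lambda>t. n \<bullet> x p - t * (n \<bullet> nu p)) \<longlongrightarrow> n \<bullet> x p - 0 * (n \<bullet> nu p)) (at_right 0)"
    by (intro tendsto_intros)
  have "\<forall>\<^sub>F t in at_right 0. b \<le> n \<bullet> x p - t * (n \<bullet> nu p)"
    unfolding eventually_at_right_field by (rule exI[of _ 1]) (use Tb in auto)
  then have "b \<le> n \<bullet> x p" using tendsto_lowerbound[OF lim] by simp
  then have "n \<bullet> Y q \<le> n \<bullet> x p" if "q \<in> sphere 0 1" for q using n(2) image_subset_hull that by force
  then have "n = norm n *\<^sub>R nu p" by (rule maximum_normal[OF p])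
  then have "n \<bullet> nu p = norm n" using nu_unit(1)[OF p] by (metis inner_scaleR_left mult.right_neutral)
  then have "n \<bullet> x p - 1 * (n \<bullet> nu p) < n \<bullet> x p" using n(1) by simp
  moreover have "n \<bullet> x p \<le> b" using n(2) xK by blast
  ultimately show False using Tb[of 1] by linarith
qed

lemma inner_normal:
  assumes p: "p \<in> polar_dom" and "0 < \<epsilon>"
  shows "\<exists>t\<in>{0<..<\<epsilon>}. x p - t *\<^sub>R nu p \<notin> outside (Y ` sphere 0 1)"
proof -
  obtain t0 where t0: "0 < t0" "x p - t0 *\<^sub>R nu p \<in> K" using inner_point_in_hull[OF p] by blast
  define t where "t = min t0 (\<epsilon> / 2)"
  have t: "0 < t" "t < \<epsilon>" "t \<le> t0" using t0 \<open>0 < \<epsilon>\<close> by (auto simp: t_def)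
  have "x p \<in> K" using image_subset_hull by (auto simp: x_eq norm_sph)
  moreover have "convex K" by (simp add: K_def)
  ultimately have "(1 - t / t0) *\<^sub>R x p + (t / t0) *\<^sub>R (x p - t0 *\<^sub>R nu p) \<in> K"
    using t t0 by (intro convexD) auto
  moreover have "(1 - t / t0) *\<^sub>R x p + (t / t0) *\<^sub>R (x p - t0 *\<^sub>R nu p) = x p - t *\<^sub>R nu p"
    using t0 by (simp add: algebra_simps)
  ultimately show ?thesis using t hull_Int_outside by auto
qed

end

subsection \<open>Total mean curvature\<close>

lemma connected_polar_dom: "connected polar_dom"
proof -
  have "polar_dom = (\<lambda>p. p$1) -` {0<..<pi}" by (auto simp: polar_dom_def)
  moreover have "convex \<dots>"
    by (intro convex_linear_vimage bounded_linear.linear bounded_linear_vec_nth) (auto simp: convex_real_interval)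
  ultimately show ?thesis by (simp add: convex_connected)
qed

lemma (in surface) L11_nonzero: assumes p: "p \<in> polar_dom" shows "L11 p \<noteq> 0"
proof
  assume "L11 p = 0"
  then have "- k1 (p$1) * w (p$1) * rho (p$1) \<le> 0" using gauss[OF p] zero_le_power2[of "L12 p"] by simp
  moreover have "0 < - k1 (p$1) * w (p$1) * rho (p$1)" using k1_neg theta_pos[OF p] by (intro mult_pos_pos) auto
  ultimately show False by simp
qed

text \<open>\<open>L11\<close> has no zero because the determinant of the second form is positive,
  and the chart is connected; replacing \<open>e\<close> by \<open>- e\<close> flips its
  sign.\<close>

lemma (in surface) orientation:
  "\<exists>e'. surface w rho k w1 k1 c C x e' \<and> (\<forall>p\<in>polar_dom. 0 < surface.L11 w rho x e' p)"
proof -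
  interpret m: surface w rho k w1 k1 c C x "- e"
    using surface_axioms e_sign unfolding surface_def surface_axioms_def by auto
  have m: "m.L11 p = - L11 p" for p by (simp add: m.L11_def L11_def m.nu_def nu_def)
  have "(\<forall>p\<in>polar_dom. 0 < L11 p) \<or> (\<forall>p\<in>polar_dom. L11 p < 0)"
  proof (rule ccontr)
    assume "\<not> ?thesis"
    then obtain p q where pq: "p \<in> polar_dom" "q \<in> polar_dom" "L11 p \<le> 0" "0 \<le> L11 q" by (meson not_less)
    have "connected (L11 ` polar_dom)" by (intro connected_continuous_image cont_L connected_polar_dom)
    then have "0 \<in> L11 ` polar_dom" using pq by (meson connected_contains_Icc[THEN subsetD] atLeastAtMost_iff imageI)
    then show False using L11_nonzero by force
  qed
  then show ?thesis using m surface_axioms m.surface_axioms by (metis neg_0_less_iff_less)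
qed

context convex_surface
begin

lemma Y_bounded: "\<exists>B. \<forall>p. norm (x p) \<le> B"
proof -
  have "bounded (Y ` sphere 0 1)" by (intro compact_imp_bounded compact_continuous_image Y_cont) simp
  then obtain B where "\<forall>q\<in>sphere 0 1. norm (Y q) \<le> B" unfolding bounded_iff by auto
  then show ?thesis using sph_in_sphere unfolding x_eq by blast
qed

lemma total_mean_curvature:
  assumes bd: "\<And>p. p \<in> polar_dom \<Longrightarrow> \<bar>L11 p\<bar> \<le> B" "\<And>p. p \<in> polar_dom \<Longrightarrow> \<bar>L12 p\<bar> \<le> B * sin (p$1)"
      "\<And>p. p \<in> polar_dom \<Longrightarrow> \<bar>L22 p\<bar> \<le> B * (sin (p$1))\<^sup>2"
  shows "integral polar_box (\<lambda>p. w (p$1) * L22 p / rho (p$1) + rho (p$1) * L11 p / w (p$1)) =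
    2 * pi * integral {0..pi} mean_density"
proof -
  obtain B0 where B0: "\<And>p. norm (x p) \<le> B0" using Y_bounded by blast
  \<comment> \<open>With a point of the surface as origin, \<open>support_inequality\<close> says
    exactly that the support function is nonnegative.\<close>
  define x0 where "x0 = Y (axis 3 1)"
  define B' where "B' = max B (B0 + norm x0)"
  have xb: "norm (x p - x0) \<le> B'" for p
    using norm_triangle_ineq4[of "x p" x0] B0[of p] by (simp add: B'_def)
  have bd': "\<bar>L11 p\<bar> \<le> B'" "\<bar>L12 p\<bar> \<le> B' * sin (p$1)" "\<bar>L22 p\<bar> \<le> B' * (sin (p$1))\<^sup>2" if "p \<in> polar_dom" for p
  proof -
    have "B * sin (p$1) \<le> B' * sin (p$1)" "B * (sin (p$1))\<^sup>2 \<le> B' * (sin (p$1))\<^sup>2" "B \<le> B'"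
      using theta_pos[OF that] by (intro mult_right_mono; force simp: B'_def)+ (simp add: B'_def)
    then show "\<bar>L11 p\<bar> \<le> B'" "\<bar>L12 p\<bar> \<le> B' * sin (p$1)" "\<bar>L22 p\<bar> \<le> B' * (sin (p$1))\<^sup>2"
      using bd[OF that] by linarith+
  qed
  note sf = second_form_of_surface[OF L11_pos bd' xb]
  obtain P h Bs where rs: "second_form w rho k w1 k1 c C (\<lambda>p. - w (p$1) * k1 (p$1) / sig (p$1)) (\<lambda>p. 0)
     (\<lambda>p. rho (p$1) * sig (p$1)) P (\<lambda>p. 0) h Bs" and h: "\<forall>p\<in>polar_dom. 0 \<le> h p"
    using second_form_of_revolution by blast
  interpret X: second_form w rho k w1 k1 c C L11 L12 L22 "\<lambda>p. (x p - x0) \<bullet> pd 1 x p" "\<lambda>p. (x p - x0) \<bullet> pd 2 x p"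
     "\<lambda>p. (x p - x0) \<bullet> nu p" "B' + B' * C" by (rule sf)
  interpret R: second_form w rho k w1 k1 c C "\<lambda>p. - w (p$1) * k1 (p$1) / sig (p$1)" "\<lambda>p. 0"
     "\<lambda>p. rho (p$1) * sig (p$1)" P "\<lambda>p. 0" h Bs by (rule rs)
  interpret XR: second_form_pair w rho k w1 k1 c C L11 L12 L22 "\<lambda>p. (x p - x0) \<bullet> pd 1 x p" "\<lambda>p. (x p - x0) \<bullet> pd 2 x p"
     "\<lambda>p. (x p - x0) \<bullet> nu p" "B' + B' * C" "\<lambda>p. - w (p$1) * k1 (p$1) / sig (p$1)" "\<lambda>p. 0"
     "\<lambda>p. rho (p$1) * sig (p$1)" P "\<lambda>p. 0" h Bs by unfold_locales
  interpret RX: second_form_pair w rho k w1 k1 c C "\<lambda>p. - w (p$1) * k1 (p$1) / sig (p$1)" "\<lambda>p. 0"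
     "\<lambda>p. rho (p$1) * sig (p$1)" P "\<lambda>p. 0" h Bs L11 L12 L22 "\<lambda>p. (x p - x0) \<bullet> pd 1 x p" "\<lambda>p. (x p - x0) \<bullet> pd 2 x p"
     "\<lambda>p. (x p - x0) \<bullet> nu p" "B' + B' * C" by unfold_locales
  have "0 \<le> (x p - x0) \<bullet> nu p" if "p \<in> polar_dom" for p
    using support_inequality[OF that, of "axis 3 1"] by (simp add: x0_def inner_commute inner_diff_right norm_axis_1)
  then have "integral polar_box X.mean_integrand = integral polar_box R.mean_integrand"
    using XR.total_mean_le RX.total_mean_le h by (intro antisym) auto
  also have "R.mean_integrand p = mean_density (p$1)" if "p \<in> polar_box" for p
    unfolding R.mean_integrand_def mean_density_def using w_pos[of "p$1"] rho_pos[of "p$1"] that by (simp add: mem_polar_box)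
  then have "integral polar_box R.mean_integrand = integral polar_box (\<lambda>p. mean_density (p$1))"
    by (intro integral_cong) auto
  also have "\<dots> = 2 * pi * integral {0..pi} mean_density"
    by (rule integral_unique, rule polar_box_integral_theta[OF cont_mean_density mean_density_bound]) auto
  finally show ?thesis unfolding X.mean_integrand_def[abs_def] .
qed

text \<open>The orthogonality conditions leave \<open>nu p\<close> and \<open>- nu p\<close>; along
  the latter there are points arbitrarily close to the surface that are not outside.\<close>

lemma outward_normal:
  assumes p: "p \<in> polar_dom"
    and e1: "e1 \<bullet> e1 = 1" "e1 \<bullet> pd 1 x p = 0" "e1 \<bullet> pd 2 x p = 0"
    and out: "0 < \<epsilon>" "\<And>s. s \<in> {0<..<\<epsilon>} \<Longrightarrow> x p + s *\<^sub>R e1 \<in> outside (Y ` sphere 0 1)"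
  shows "e1 = nu p"
proof -
  have e: "e1 = (e1 \<bullet> nu p) *\<^sub>R nu p" using expansion[OF p, of e1] e1 by simp
  then have "e1 \<bullet> e1 = (e1 \<bullet> nu p) * (e1 \<bullet> nu p)" by (metis inner_scaleR_right)
  then have "(e1 \<bullet> nu p)\<^sup>2 = 1" using e1(1) by (simp add: power2_eq_square)
  then consider "e1 \<bullet> nu p = 1" | "e1 \<bullet> nu p = -1" by (auto simp: power2_eq_1_iff)
  then show ?thesis
  proof cases
    case 1 then show ?thesis using e by simp
  next
    case 2
    then have "e1 = - nu p" using e by simp
    then show ?thesis using inner_normal[OF p out(1)] out(2) by auto
  qed
qed

end

subsection \<open>The curvature of the Kerr surfaces\<close>

text \<open>With \<open>R = r\<^sup>2\<close>, \<open>A = a\<^sup>2\<close>, \<open>M = 2 m r\<close>, \<open>c = cos\<^sup>2 \<theta>\<close> and \<open>s = sin\<^sup>2 \<theta>\<close> this is the inequality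
  \<open>|H|\<^sup>2 \<le> 4 K\<close>. After the substitution \<open>R = 3 A + X\<close> the polynomial, made homogeneous in \<open>c\<close> and \<open>s\<close>,
  has only one negative term, which \<open>M \<ge> 3 A\<close> absorbs.\<close>

lemma kerr_polynomial:
  fixes A X M c s R q P B D W T N :: real
  assumes nonneg: "0 \<le> A" "0 \<le> X" "0 \<le> c" "0 \<le> s" and M: "3 * A \<le> M" and cs: "s = 1 - c"
    and R: "R = 3 * A + X" and q: "q = R + A" and D: "D = q - M" and P: "P = R + A * c" and B: "B = q\<^sup>2 - D * A * s"
    and W: "W = B * P - D * A * s * P + A * s * B" and T: "T = (W + 4 * D * A * c * P) * B * P - c * W * (D * A * P + 4 * A * B)"
    and N: "N = 4 * R * q - 2 * R * A * s + M * A * s"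
  shows "N\<^sup>2 * D * P\<^sup>2 \<le> 16 * T * R"
proof -
  define f1 where "f1 = 36864 * A^6 * c^3 * s + 104256 * A^6 * c^2 * s^2 + 97056 * A^6 * c * s^3 + 29700 * A^6 * s^4 + 12288 * A^5 * c^4 * X + 96768 * A^5 * c^3 * s * X + 208928 * A^5 * c^2 * s^2 * X + 176136 * A^5 * c * s^3 * X + 51696 * A^5 * s^4 * X + 16384 * A^4 * c^4 * X^2 + 89984 * A^4 * c^3 * s * X^2 + 504476/3 * A^4 * c^2 * s^2 * X^2 + 131824 * A^4 * c * s^3 * X^2 + 37260 * A^4 * s^4 * X^2 + 8704 * A^3 * c^4 * X^3 + 41056 * A^3 * c^3 * s * X^3 + 70216 * A^3 * c^2 * s^2 * X^3 + 156280/3 * A^3 * c * s^3 * X^3 + 14228 * A^3 * s^4 * X^3 + 2304 * A^2 * c^4 * X^4 + 10008 * A^2 * c^3 * s * X^4 + 16136 * A^2 * c^2 * s^2 * X^4 + 34400/3 * A^2 * c * s^3 * X^4 + 9104/3 * A^2 * s^4 * X^4 + 304 * A * c^4 * X^5 + 1256 * A * c^3 * s * X^5 + 5828/3 * A * c^2 * s^2 * X^5 + 4000/3 * A * c * s^3 * X^5 + 1028/3 * A * s^4 * X^5 + 16 * c^4 * X^6 + 64 * c^3 * s * X^6 + 96 * c^2 * s^2 * X^6 + 64 * c * s^3 * X^6 + 16 * s^4 * X^6"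
  define f2 where "f2 = 1472 * A^5 * c^2 * s^2 + 3216 * A^5 * c * s^3 + 1728 * A^5 * s^4 + 384 * A^4 * c^3 * s * X + 2528 * A^4 * c^2 * s^2 * X + 4048 * A^4 * c * s^3 * X + 1899 * A^4 * s^4 * X + 320 * A^3 * c^3 * s * X^2 + 1384 * A^3 * c^2 * s^2 * X^2 + 1826 * A^3 * c * s^3 * X^2 + 762 * A^3 * s^4 * X^2 + 88 * A^2 * c^3 * s * X^3 + 307 * A^2 * c^2 * s^2 * X^3 + 350 * A^2 * c * s^3 * X^3 + 131 * A^2 * s^4 * X^3 + 8 * A * c^3 * s * X^4 + 24 * A * c^2 * s^2 * X^4 + 24 * A * c * s^3 * X^4 + 8 * A * s^4 * X^4"
  \<comment> \<open>An expansion in powers of \<open>M\<close>. Its value at \<open>M = 0\<close> is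
    the negative term \<open>- 4 * A\<^sup>2 * R\<^sup>2 * q * P\<^sup>2 * s\<^sup>2\<close>; the
    factor 4/3 combines it with a part of the linear term into a multiple of
    \<open>M - 3 * A\<close>, which explains the thirds in \<open>f1\<close>.\<close>
  have eq: "16 * T * R - N\<^sup>2 * D * P\<^sup>2 = M * f1 + M\<^sup>2 * f2 + M^3 * (A\<^sup>2 * s\<^sup>2 * P\<^sup>2) + (M - 3 * A) * (4/3 * A * R\<^sup>2 * q * P\<^sup>2 * s\<^sup>2)"
    unfolding f1_def f2_def T N W B D P q R cs by algebra
  have "0 \<le> R" "0 \<le> q" "0 \<le> P" using nonneg by (simp_all add: R q P)
  moreover have "0 \<le> f1" "0 \<le> f2" unfolding f1_def f2_def using nonneg by (intro add_nonneg_nonneg mult_nonneg_nonneg zero_le_power; simp)+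
  ultimately have "0 \<le> 16 * T * R - N\<^sup>2 * D * P\<^sup>2"
    unfolding eq using nonneg M by (intro add_nonneg_nonneg mult_nonneg_nonneg zero_le_power) auto
  then show ?thesis by simp
qed

lemma pos_bounds:
  fixes f :: "real \<Rightarrow> real"
  assumes "continuous_on {0..pi} f" "\<And>\<theta>. \<theta> \<in> {0..pi} \<Longrightarrow> 0 < f \<theta>"
  obtains c C where "0 < c" "\<And>\<theta>. \<theta> \<in> {0..pi} \<Longrightarrow> c \<le> f \<theta>" "\<And>\<theta>. \<theta> \<in> {0..pi} \<Longrightarrow> f \<theta> \<le> C"
proof -
  obtain x where x: "x \<in> {0..pi}" "\<forall>y\<in>{0..pi}. f x \<le> f y"
    using continuous_attains_inf[of "{0..pi}" f] assms(1) by auto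
  obtain z where z: "z \<in> {0..pi}" "\<forall>y\<in>{0..pi}. f y \<le> f z"
    using continuous_attains_sup[of "{0..pi}" f] assms(1) by auto
  show thesis by (rule that[of "f x" "f z"]) (use x z assms(2) in auto)
qed

locale kerr =
  fixes m a r :: real
  assumes m_pos: "0 < m" and a_nonneg: "0 \<le> a" and a_le_m: "a \<le> m" and r_gt: "kerr_rh m a < r"
begin

text \<open>The value \<open>3 * m / 2\<close>, common to the horizon radius and
  \<open>sqrt 3 * a\<close> at the junction of the two branches, separates these two radii on either
  side of it.\<close>

lemma r_facts: "sqrt 3 * a \<le> r" "m < r" "m\<^sup>2 - a\<^sup>2 < (r - m)\<^sup>2"
proof -
  have m2: "0 \<le> m\<^sup>2 - a\<^sup>2" using a_nonneg a_le_m by (simp add: power_mono)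
  have s33: "sqrt 3 * (sqrt 3 * m / 2) = 3 * m / 2" by (simp flip: mult.assoc)
  have "sqrt 3 * a \<le> r \<and> m < r \<and> m\<^sup>2 - a\<^sup>2 < (r - m)\<^sup>2"
  proof (cases "a \<le> sqrt 3 * m / 2")
    case True
    then have r: "m + sqrt (m\<^sup>2 - a\<^sup>2) < r" using r_gt by (simp add: kerr_rh_def)
    have "a\<^sup>2 \<le> (sqrt 3 * m / 2)\<^sup>2" using True a_nonneg by (rule power_mono)
    then have "(m / 2)\<^sup>2 \<le> m\<^sup>2 - a\<^sup>2" by (simp add: power_divide power_mult_distrib)
    then have "m / 2 \<le> sqrt (m\<^sup>2 - a\<^sup>2)" by (rule real_le_rsqrt)
    moreover have "sqrt 3 * a \<le> sqrt 3 * (sqrt 3 * m / 2)" using True by (intro mult_left_mono) auto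
    then have "sqrt 3 * a \<le> 3 * m / 2" unfolding s33 .
    moreover have "(sqrt (m\<^sup>2 - a\<^sup>2))\<^sup>2 < (r - m)\<^sup>2" using r m2 by (intro power_strict_mono) auto
    ultimately show ?thesis using r m_pos m2 by auto
  next
    case False
    then have r: "sqrt 3 * a < r" using r_gt by (simp add: kerr_rh_def)
    have "sqrt 3 * (sqrt 3 * m / 2) < sqrt 3 * a" using False by (intro mult_strict_left_mono) auto
    then have r2: "3 * m / 2 < r" using r unfolding s33 by linarith
    have "(sqrt 3 * m / 2)\<^sup>2 < a\<^sup>2" using False m_pos by (intro power_strict_mono) auto
    then have "m\<^sup>2 - a\<^sup>2 < (m / 2)\<^sup>2" by (simp add: power_divide power_mult_distrib)
    also have "\<dots> < (r - m)\<^sup>2" using r2 m_pos by (intro power_strict_mono) auto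
    finally show ?thesis using r r2 m_pos by auto
  qed
  then show "sqrt 3 * a \<le> r" "m < r" "m\<^sup>2 - a\<^sup>2 < (r - m)\<^sup>2" by auto
qed

definition D :: real where "D = kerr_Delta m a r"

lemma D_eq: "D = r\<^sup>2 + a\<^sup>2 - 2 * m * r"
  by (simp add: D_def kerr_Delta_def)

lemma D_pos: "0 < D" and r_pos: "0 < r" and r_sq: "3 * a\<^sup>2 \<le> r\<^sup>2" and mr_ge: "3 * a\<^sup>2 \<le> 2 * m * r"
proof -
  show "0 < r" using r_facts(2) m_pos by simp
  show "0 < D" using r_facts(3) by (simp add: D_eq power2_eq_square algebra_simps)
  have "(sqrt 3 * a)\<^sup>2 \<le> r\<^sup>2" using r_facts(1) a_nonneg by (intro power_mono) auto
  then show "3 * a\<^sup>2 \<le> r\<^sup>2" by (simp add: power_mult_distrib)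
  have "3 / 2 \<le> sqrt (3::real)" by (rule real_le_rsqrt) (simp add: power2_eq_square)
  then have "3 / 2 * a \<le> sqrt 3 * a" using a_nonneg by (rule mult_right_mono)
  then have "3 / 2 * a \<le> r" using r_facts(1) by simp
  then have "a * (3 / 2 * a) \<le> m * r" using a_le_m a_nonneg m_pos by (intro mult_mono) auto
  then show "3 * a\<^sup>2 \<le> 2 * m * r" by (simp add: power2_eq_square)
qed

text \<open>\<open>P\<close> is \<open>Sigma\<^sup>2\<close> and \<open>B\<close> is
  \<open>H * Sigma\<^sup>2 / sin\<^sup>2\<close>, with \<open>Br\<close> its derivative in
  \<open>r\<close>; \<open>W\<close> and \<open>T\<close> are, up to the factors \<open>cos\<close>
  and \<open>- sin\<close>, the polynomial numerators of \<open>k0\<close> and of its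
  derivative.\<close>

definition P :: "real \<Rightarrow> real" where "P \<theta> = r\<^sup>2 + a\<^sup>2 * (cos \<theta>)\<^sup>2"
definition B :: "real \<Rightarrow> real" where "B \<theta> = (r\<^sup>2 + a\<^sup>2)\<^sup>2 - D * a\<^sup>2 * (sin \<theta>)\<^sup>2"
definition b :: "real \<Rightarrow> real" where "b \<theta> = sqrt (B \<theta>)"
definition s :: "real \<Rightarrow> real" where "s \<theta> = sqrt (P \<theta>)"
definition rho :: "real \<Rightarrow> real" where "rho \<theta> = sin \<theta> * b \<theta> / s \<theta>"
definition W :: "real \<Rightarrow> real" where "W \<theta> = B \<theta> * P \<theta> - D * a\<^sup>2 * (sin \<theta>)\<^sup>2 * P \<theta> + a\<^sup>2 * (sin \<theta>)\<^sup>2 * B \<theta>"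
definition T :: "real \<Rightarrow> real" where
  "T \<theta> = (W \<theta> + 4 * D * a\<^sup>2 * (cos \<theta>)\<^sup>2 * P \<theta>) * B \<theta> * P \<theta> - (cos \<theta>)\<^sup>2 * W \<theta> * (D * a\<^sup>2 * P \<theta> + 4 * a\<^sup>2 * B \<theta>)"
definition k0 :: "real \<Rightarrow> real" where "k0 \<theta> = cos \<theta> * W \<theta> / (b \<theta> * (P \<theta>)\<^sup>2)"
definition k01 :: "real \<Rightarrow> real" where "k01 \<theta> = - (sin \<theta> * (T \<theta> / ((b \<theta>)^3 * (P \<theta>)^3)))"
definition s1 :: "real \<Rightarrow> real" where "s1 \<theta> = - (a\<^sup>2 * sin \<theta> * cos \<theta>) / s \<theta>"
definition s2 :: "real \<Rightarrow> real" where
  "s2 \<theta> = ((a\<^sup>2 * (sin \<theta>)\<^sup>2 - a\<^sup>2 * (cos \<theta>)\<^sup>2) * s \<theta> + a\<^sup>2 * sin \<theta> * cos \<theta> * s1 \<theta>) / (s \<theta>)\<^sup>2"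
definition Br :: "real \<Rightarrow> real" where "Br \<theta> = 4 * r * (r\<^sup>2 + a\<^sup>2) - 2 * (r - m) * a\<^sup>2 * (sin \<theta>)\<^sup>2"
definition h :: "real \<Rightarrow> real" where "h \<theta> = Br \<theta> * sqrt D / (2 * B \<theta> * s \<theta>)"
definition h1 :: "real \<Rightarrow> real" where
  "h1 \<theta> = ((- 4 * (r - m) * a\<^sup>2 * sin \<theta> * cos \<theta>) * sqrt D * (2 * B \<theta> * s \<theta>) -
     Br \<theta> * sqrt D * (2 * (- 2 * D * a\<^sup>2 * sin \<theta> * cos \<theta>) * s \<theta> + 2 * B \<theta> * s1 \<theta>)) / (2 * B \<theta> * s \<theta>)\<^sup>2"

lemma P_pos: "0 < P \<theta>"
  using r_pos by (simp add: P_def add_pos_nonneg)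

lemma B_pos: "0 < B \<theta>"
proof -
  have q: "0 < r\<^sup>2 + a\<^sup>2" using r_pos by (simp add: add_pos_nonneg)
  have sq: "a\<^sup>2 * (sin \<theta>)\<^sup>2 \<le> a\<^sup>2 * 1" by (intro mult_left_mono) (auto simp: abs_square_le_1)
  have "D * (a\<^sup>2 * (sin \<theta>)\<^sup>2) \<le> D * a\<^sup>2" using sq D_pos by (intro mult_left_mono) auto
  also have "\<dots> \<le> (r\<^sup>2 + a\<^sup>2) * a\<^sup>2" using m_pos r_pos by (intro mult_right_mono) (auto simp: D_eq)
  also have "\<dots> < (r\<^sup>2 + a\<^sup>2) * (r\<^sup>2 + a\<^sup>2)" using q r_pos by (intro mult_strict_left_mono) auto
  finally show ?thesis by (simp add: B_def power2_eq_square mult.assoc)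
qed

lemma b_pos: "0 < b \<theta>" and s_pos: "0 < s \<theta>" and b_sq: "b \<theta> * b \<theta> = B \<theta>" and s_sq: "s \<theta> * s \<theta> = P \<theta>"
  using B_pos[of \<theta>] P_pos[of \<theta>] by (simp_all add: b_def s_def)

lemma Br_pos: "0 < Br \<theta>"
proof -
  have "(r - m) * (a\<^sup>2 * (sin \<theta>)\<^sup>2) \<le> r * (a\<^sup>2 * 1)"
    using m_pos r_facts(2) r_pos by (intro mult_mono mult_left_mono) (auto simp: abs_square_le_1)
  moreover have "0 < r * r\<^sup>2" "0 \<le> r * a\<^sup>2" using r_pos by auto
  ultimately show ?thesis by (simp add: Br_def algebra_simps)
qed

lemma h_pos: "0 < h \<theta>"
  using Br_pos D_pos B_pos s_pos by (simp add: h_def)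

lemma P_deriv: "(P has_real_derivative - (2 * a\<^sup>2 * sin \<theta> * cos \<theta>)) (at \<theta>)"
  unfolding P_def[abs_def] by (auto intro!: derivative_eq_intros)

lemma B_deriv: "(B has_real_derivative - (2 * D * a\<^sup>2 * sin \<theta> * cos \<theta>)) (at \<theta>)"
  unfolding B_def[abs_def] by (auto intro!: derivative_eq_intros)

lemma s_deriv: "(s has_real_derivative s1 \<theta>) (at \<theta>)"
  unfolding s_def[abs_def] s1_def using P_pos[of \<theta>]
  by (auto intro!: derivative_eq_intros P_deriv simp: divide_simps)

lemma b_deriv: "(b has_real_derivative - (D * a\<^sup>2 * sin \<theta> * cos \<theta> / b \<theta>)) (at \<theta>)"
  unfolding b_def[abs_def] using B_pos[of \<theta>]
  by (auto intro!: derivative_eq_intros B_deriv simp: divide_simps)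

lemma s1_deriv: "(s1 has_real_derivative s2 \<theta>) (at \<theta>)"
proof -
  have "((\<lambda>\<theta>. - (a\<^sup>2 * sin \<theta> * cos \<theta>)) has_real_derivative a\<^sup>2 * (sin \<theta>)\<^sup>2 - a\<^sup>2 * (cos \<theta>)\<^sup>2) (at \<theta>)"
    by (auto intro!: derivative_eq_intros simp: power2_eq_square algebra_simps)
  from DERIV_divide[OF this s_deriv] show ?thesis
    using s_pos[of \<theta>] unfolding s1_def[abs_def] s2_def by (simp add: power2_eq_square)
qed

lemma rho_deriv: "(rho has_real_derivative s \<theta> * k0 \<theta>) (at \<theta>)"
proof -
  have "(rho has_real_derivative ((cos \<theta> * b \<theta> + - (D * a\<^sup>2 * sin \<theta> * cos \<theta> / b \<theta>) * sin \<theta>) * s \<theta> - sin \<theta> * b \<theta> * s1 \<theta>) / (s \<theta> * s \<theta>)) (at \<theta>)"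
    unfolding rho_def[abs_def] using s_pos[of \<theta>] by (intro DERIV_divide DERIV_mult DERIV_sin b_deriv s_deriv) simp
  moreover have "((cos \<theta> * b \<theta> + - (D * a\<^sup>2 * sin \<theta> * cos \<theta> / b \<theta>) * sin \<theta>) * s \<theta> - sin \<theta> * b \<theta> * s1 \<theta>) / (s \<theta> * s \<theta>) = s \<theta> * k0 \<theta>"
    using s_pos[of \<theta>] b_pos[of \<theta>] P_pos[of \<theta>] unfolding k0_def W_def s1_def b_sq[symmetric] s_sq[symmetric]
    by (simp add: divide_simps power2_eq_square) (simp add: algebra_simps)
  ultimately show ?thesis by simp
qed

lemma W_deriv: "(W has_real_derivative - (4 * D * a\<^sup>2 * sin \<theta> * cos \<theta> * P \<theta>)) (at \<theta>)"
  unfolding W_def[abs_def] by (auto intro!: derivative_eq_intros B_deriv P_deriv simp: power2_eq_square algebra_simps)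

lemma k0_deriv: "(k0 has_real_derivative k01 \<theta>) (at \<theta>)"
proof -
  have "(k0 has_real_derivative ((- sin \<theta> * W \<theta> + - (4 * D * a\<^sup>2 * sin \<theta> * cos \<theta> * P \<theta>) * cos \<theta>) * (b \<theta> * (P \<theta>)\<^sup>2) -
     cos \<theta> * W \<theta> * (- (D * a\<^sup>2 * sin \<theta> * cos \<theta> / b \<theta>) * (P \<theta>)\<^sup>2 + (2 * P \<theta> * - (2 * a\<^sup>2 * sin \<theta> * cos \<theta>)) * b \<theta>)) /
     ((b \<theta> * (P \<theta>)\<^sup>2) * (b \<theta> * (P \<theta>)\<^sup>2))) (at \<theta>)"
    unfolding k0_def[abs_def] using b_pos[of \<theta>] P_pos[of \<theta>]
    by (intro DERIV_divide DERIV_mult DERIV_cos b_deriv W_deriv) (auto intro!: derivative_eq_intros P_deriv)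
  moreover have "((- sin \<theta> * W \<theta> + - (4 * D * a\<^sup>2 * sin \<theta> * cos \<theta> * P \<theta>) * cos \<theta>) * (b \<theta> * (P \<theta>)\<^sup>2) -
     cos \<theta> * W \<theta> * (- (D * a\<^sup>2 * sin \<theta> * cos \<theta> / b \<theta>) * (P \<theta>)\<^sup>2 + (2 * P \<theta> * - (2 * a\<^sup>2 * sin \<theta> * cos \<theta>)) * b \<theta>)) /
     ((b \<theta> * (P \<theta>)\<^sup>2) * (b \<theta> * (P \<theta>)\<^sup>2)) = k01 \<theta>"
    using b_pos[of \<theta>] P_pos[of \<theta>] unfolding k01_def T_def b_sq[symmetric]
    by (simp add: divide_simps power2_eq_square power3_eq_cube) (simp add: algebra_simps)
  ultimately show ?thesis by simp
qed

lemma h_deriv: "(h has_real_derivative h1 \<theta>) (at \<theta>)"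
  unfolding h_def[abs_def] h1_def Br_def[abs_def] using s_pos[of \<theta>] B_pos[of \<theta>]
  by (auto intro!: derivative_eq_intros B_deriv s_deriv simp: power2_eq_square) (simp add: algebra_simps)

lemma continuous_basic:
  "continuous_on S P" "continuous_on S B" "continuous_on S b" "continuous_on S s" "continuous_on S rho" "continuous_on S W"
  "continuous_on S k0" "continuous_on S s1" "continuous_on S h"
  by (rule DERIV_continuous_on[OF has_field_derivative_at_within[OF P_deriv]] DERIV_continuous_on[OF has_field_derivative_at_within[OF B_deriv]]
    DERIV_continuous_on[OF has_field_derivative_at_within[OF b_deriv]] DERIV_continuous_on[OF has_field_derivative_at_within[OF s_deriv]]
    DERIV_continuous_on[OF has_field_derivative_at_within[OF rho_deriv]] DERIV_continuous_on[OF has_field_derivative_at_within[OF W_deriv]]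
    DERIV_continuous_on[OF has_field_derivative_at_within[OF k0_deriv]] DERIV_continuous_on[OF has_field_derivative_at_within[OF s1_deriv]]
    DERIV_continuous_on[OF has_field_derivative_at_within[OF h_deriv]])+

lemma continuous_derivs: "continuous_on S T" "continuous_on S k01" "continuous_on S s2" "continuous_on S h1"
proof -
  show T: "continuous_on S T" unfolding T_def[abs_def] by (intro continuous_intros continuous_basic)
  have n: "\<forall>\<theta>\<in>S. (b \<theta>)^3 * (P \<theta>)^3 \<noteq> 0" "\<forall>\<theta>\<in>S. (s \<theta>)\<^sup>2 \<noteq> 0" "\<forall>\<theta>\<in>S. (2 * B \<theta> * s \<theta>)\<^sup>2 \<noteq> 0"
    using b_pos P_pos s_pos B_pos by (auto simp: less_imp_neq[symmetric])
  show "continuous_on S k01" "continuous_on S s2" "continuous_on S h1"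
    unfolding k01_def[abs_def] s2_def[abs_def] h1_def[abs_def] Br_def[abs_def]
    by (intro continuous_intros T continuous_basic n)+
qed

text \<open>Multiplying by \<open>r\<^sup>2\<close> makes both sides polynomials in
  \<open>r\<^sup>2\<close>, \<open>2 * m * r\<close>, \<open>a\<^sup>2\<close> and the squared
  cosine, with \<open>r * Br\<close> in the role of \<open>N\<close>.\<close>

lemma curvature_bound: "(Br \<theta>)\<^sup>2 * D * (P \<theta>)\<^sup>2 \<le> 16 * T \<theta>"
proof -
  have "(r * Br \<theta>)\<^sup>2 * D * (P \<theta>)\<^sup>2 \<le> 16 * T \<theta> * r\<^sup>2"
    by (rule kerr_polynomial[where A = "a\<^sup>2" and X = "r\<^sup>2 - 3 * a\<^sup>2" and M = "2 * m * r" and c = "(cos \<theta>)\<^sup>2" and s = "(sin \<theta>)\<^sup>2"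
          and q = "r\<^sup>2 + a\<^sup>2" and B = "B \<theta>" and W = "W \<theta>"])
      (rule zero_le_power2 sin_squared_eq refl P_def B_def W_def T_def | use r_sq mr_ge in simp | simp add: D_eq
        | simp add: Br_def power2_eq_square algebra_simps)+
  then have "r\<^sup>2 * ((Br \<theta>)\<^sup>2 * D * (P \<theta>)\<^sup>2) \<le> r\<^sup>2 * (16 * T \<theta>)" by (simp add: power_mult_distrib mult_ac)
  then show ?thesis using r_pos by simp
qed

text \<open>Positive curvature of the Kerr surface itself, obtained from the same bound.\<close>

lemma T_pos: "0 < T \<theta>"
proof -
  have "0 < (Br \<theta>)\<^sup>2 * D * (P \<theta>)\<^sup>2" using Br_pos[of \<theta>] D_pos P_pos[of \<theta>] by simp
  then show ?thesis using curvature_bound[of \<theta>] by linarith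
qed

lemma k0_ends: "k0 0 = 1" "k0 pi = -1"
proof -
  have q: "0 < r\<^sup>2 + a\<^sup>2" using r_pos by (simp add: add_pos_nonneg)
  then have "b 0 = r\<^sup>2 + a\<^sup>2" "b pi = r\<^sup>2 + a\<^sup>2" by (simp_all add: b_def B_def)
  then show "k0 0 = 1" "k0 pi = -1" using q r_pos by (simp_all add: k0_def W_def B_def P_def power2_eq_square)
qed

lemma base_revolution: "\<exists>c C. revolution s rho k0 s1 k01 c C"
proof -
  obtain c1 C1 where 1: "0 < c1" "\<And>\<theta>. \<theta> \<in> {0..pi} \<Longrightarrow> c1 \<le> s \<theta>" "\<And>\<theta>. \<theta> \<in> {0..pi} \<Longrightarrow> s \<theta> \<le> C1"
    by (rule pos_bounds[OF continuous_basic(4) s_pos]) blast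
  have n: "\<forall>\<theta>\<in>{0..pi}. s \<theta> \<noteq> 0" "\<forall>\<theta>\<in>{0..pi}. (b \<theta>)^3 * (P \<theta>)^3 \<noteq> 0" using s_pos b_pos P_pos by (auto simp: less_imp_neq[symmetric])
  have co: "continuous_on {0..pi} (\<lambda>\<theta>. b \<theta> / s \<theta>)" "continuous_on {0..pi} (\<lambda>\<theta>. T \<theta> / ((b \<theta>)^3 * (P \<theta>)^3))"
    by (intro continuous_intros continuous_basic continuous_derivs n)+
  have po: "0 < b \<theta> / s \<theta>" "0 < T \<theta> / ((b \<theta>)^3 * (P \<theta>)^3)" for \<theta> using b_pos s_pos T_pos P_pos by simp_all
  obtain c2 C2 where 2: "0 < c2" "\<And>\<theta>. \<theta> \<in> {0..pi} \<Longrightarrow> c2 \<le> b \<theta> / s \<theta>" "\<And>\<theta>. \<theta> \<in> {0..pi} \<Longrightarrow> b \<theta> / s \<theta> \<le> C2"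
    by (rule pos_bounds[OF co(1) po(1)]) blast
  obtain c3 C3 where 3: "0 < c3" "\<And>\<theta>. \<theta> \<in> {0..pi} \<Longrightarrow> c3 \<le> T \<theta> / ((b \<theta>)^3 * (P \<theta>)^3)" "\<And>\<theta>. \<theta> \<in> {0..pi} \<Longrightarrow> T \<theta> / ((b \<theta>)^3 * (P \<theta>)^3) \<le> C3"
    by (rule pos_bounds[OF co(2) po(2)]) blast
  define c where "c = min c1 (min c2 c3)"
  define C where "C = max C1 (max C2 C3)"
  have "revolution s rho k0 s1 k01 c C"
  proof
    show "0 < c" using 1 2 3 by (simp add: c_def)
    fix \<theta> :: real assume \<theta>: "0 < \<theta>" "\<theta> < pi"
    then have i: "\<theta> \<in> {0..pi}" and sn: "0 \<le> sin \<theta>" using sin_gt_zero[OF \<theta>] by auto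
    show "c \<le> s \<theta>" "s \<theta> \<le> C" using 1(2,3)[OF i] by (auto simp: c_def C_def)
    have "c * sin \<theta> \<le> b \<theta> / s \<theta> * sin \<theta>" "b \<theta> / s \<theta> * sin \<theta> \<le> C * sin \<theta>"
      using 2(2,3)[OF i] sn by (intro mult_right_mono; auto simp: c_def C_def)+
    then show "c * sin \<theta> \<le> rho \<theta>" "rho \<theta> \<le> C * sin \<theta>" by (simp_all add: rho_def mult.commute)
    have "c * sin \<theta> \<le> T \<theta> / ((b \<theta>)^3 * (P \<theta>)^3) * sin \<theta>" "T \<theta> / ((b \<theta>)^3 * (P \<theta>)^3) * sin \<theta> \<le> C * sin \<theta>"
      using 3(2,3)[OF i] sn by (intro mult_right_mono; auto simp: c_def C_def)+
    then show "c * sin \<theta> \<le> - k01 \<theta>" "- k01 \<theta> \<le> C * sin \<theta>" by (simp_all add: k01_def mult.commute)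
  qed (use s_deriv rho_deriv k0_deriv continuous_basic continuous_derivs k0_ends in auto)
  then show ?thesis by blast
qed

text \<open>For \<open>g = sig\<close> the two summands are the principal curvatures of the surface
  of revolution times the area element. Their product is independent of \<open>g\<close>, and by
  \<open>curvature_bound\<close> four times it is at least \<open>(rho * s * h)\<^sup>2\<close>; the
  arithmetic-geometric mean finishes.\<close>

lemma mean_curvature_le:
  assumes "0 < \<theta>" "\<theta> < pi" and g: "0 < g"
  shows "rho \<theta> * s \<theta> * h \<theta> \<le> s \<theta> * g - rho \<theta> * k01 \<theta> / g"
proof -
  have sn: "0 < sin \<theta>" using sin_gt_zero assms by simp
  have rp: "0 < rho \<theta>" using sn b_pos s_pos by (simp add: rho_def)
  have kp: "0 < - k01 \<theta>" using sn T_pos[of \<theta>] b_pos[of \<theta>] P_pos[of \<theta>] by (simp add: k01_def)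
  have rs: "rho \<theta> * s \<theta> = sin \<theta> * b \<theta>" using s_pos[of \<theta>] by (simp add: rho_def)
  have hh: "(h \<theta>)\<^sup>2 * (rho \<theta> * s \<theta>) \<le> - 4 * k01 \<theta>"
  proof -
    have "(h \<theta>)\<^sup>2 = (Br \<theta>)\<^sup>2 * D / (4 * (b \<theta> * b \<theta>)\<^sup>2 * P \<theta>)"
      using D_pos unfolding h_def b_sq power_divide power_mult_distrib by (simp add: power2_eq_square[of "s \<theta>"] s_sq)
    then have "(h \<theta>)\<^sup>2 * (rho \<theta> * s \<theta>) = sin \<theta> / (4 * (b \<theta>)^3 * (P \<theta>)^3) * ((Br \<theta>)\<^sup>2 * D * (P \<theta>)\<^sup>2)"
      unfolding rs using b_pos[of \<theta>] P_pos[of \<theta>] by (simp add: divide_simps power2_eq_square power3_eq_cube)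
    also have "\<dots> \<le> sin \<theta> / (4 * (b \<theta>)^3 * (P \<theta>)^3) * (16 * T \<theta>)"
      using sn b_pos[of \<theta>] P_pos[of \<theta>] by (intro mult_left_mono curvature_bound) simp
    also have "\<dots> = - 4 * k01 \<theta>" by (simp add: k01_def)
    finally show ?thesis .
  qed
  define x where "x = s \<theta> * g"
  define y where "y = rho \<theta> * (- k01 \<theta>) / g"
  have xy: "0 < x" "0 < y" unfolding x_def y_def by (rule mult_pos_pos[OF s_pos g], rule divide_pos_pos[OF mult_pos_pos[OF rp kp] g])
  have "x * y = (rho \<theta> * s \<theta>) * (- k01 \<theta>)" using g by (simp add: x_def y_def)
  note xy = xy this
  have "(rho \<theta> * s \<theta> * h \<theta>)\<^sup>2 = (rho \<theta> * s \<theta>) * ((h \<theta>)\<^sup>2 * (rho \<theta> * s \<theta>))" by (simp add: power2_eq_square)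
  also have "\<dots> \<le> (rho \<theta> * s \<theta>) * (- 4 * k01 \<theta>)" using hh rp s_pos[of \<theta>] by (intro mult_left_mono) auto
  also have "\<dots> = 4 * (x * y)" using xy(3) by simp
  also have "\<dots> \<le> (x + y)\<^sup>2" using zero_le_power2[of "x - y"] by (simp add: power2_eq_square algebra_simps)
  finally have "rho \<theta> * s \<theta> * h \<theta> \<le> x + y" by (rule power2_le_imp_le) (use xy in simp)
  then show ?thesis by (simp add: x_def y_def)
qed

end

subsection \<open>Diagonal metrics in the polar chart\<close>

lemma matrix_inv_unique_left:
  fixes A :: "real^'n::finite^'n" assumes "B ** A = mat 1" shows "matrix_inv A = B"
proof -
  have "A ** B = mat 1" using assms matrix_left_right_inverse by blast
  with assms have "\<exists>A'. A ** A' = mat 1 \<and> A' ** A = mat 1" by blast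
  from someI_ex[OF this] have inv: "A ** matrix_inv A = mat 1" unfolding matrix_inv_def by blast
  have "matrix_inv A = (B ** A) ** matrix_inv A" by (simp only: assms matrix_mul_lid)
  also have "\<dots> = B ** (A ** matrix_inv A)" by (simp only: matrix_mul_assoc)
  also have "\<dots> = B" by (simp only: inv matrix_mul_rid)
  finally show ?thesis .
qed

lemma matrix_inv_diag2:
  fixes g :: "real^2^2"
  assumes "g = vector [vector [E, 0], vector [0, G]]" "E \<noteq> 0" "G \<noteq> 0"
  shows "matrix_inv g = vector [vector [1 / E, 0], vector [0, 1 / G]]"
  by (rule matrix_inv_unique_left)
    (use assms in \<open>auto simp: matrix_matrix_mult_def mat_def vec_eq_iff forall_2 sum_2 vector_2\<close>)

text \<open>The diagonal form is asked for on the chart only, since an embedding is known to be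
  isometric only there.\<close>

locale polar_metric =
  fixes g :: "real^2 \<Rightarrow> real^2^2" and E G E1 G1 :: "real \<Rightarrow> real"
  assumes g_eq: "p \<in> polar_dom \<Longrightarrow> g p = vector [vector [E (p$1), 0], vector [0, G (p$1)]]"
    and pos: "0 < \<theta> \<Longrightarrow> \<theta> < pi \<Longrightarrow> 0 < E \<theta>" "0 < \<theta> \<Longrightarrow> \<theta> < pi \<Longrightarrow> 0 < G \<theta>"
    and deriv: "0 < \<theta> \<Longrightarrow> \<theta> < pi \<Longrightarrow> (E has_real_derivative E1 \<theta>) (at \<theta>)"
      "0 < \<theta> \<Longrightarrow> \<theta> < pi \<Longrightarrow> (G has_real_derivative G1 \<theta>) (at \<theta>)"
begin

lemma posp: "p \<in> polar_dom \<Longrightarrow> 0 < E (p$1)" "p \<in> polar_dom \<Longrightarrow> 0 < G (p$1)"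
  using pos by (auto simp: mem_polar_dom)

lemma inv: assumes "p \<in> polar_dom"
  shows "matrix_inv (g p) = vector [vector [1 / E (p$1), 0], vector [0, 1 / G (p$1)]]"
  by (rule matrix_inv_diag2[OF g_eq]) (use assms posp[OF assms] in auto)

lemma pd_theta:
  assumes p: "p \<in> polar_dom" and f: "\<And>q. q \<in> polar_dom \<Longrightarrow> f q = F (q$1)" and F: "(F has_real_derivative d) (at (p$1))"
  shows "pd 1 f p = d" "pd 2 f p = 0"
  using pd_cong[OF open_polar_dom p f, where i = 1] pd_cong[OF open_polar_dom p f, where i = 2]
    pd_eqI[OF has_pd_fun_coord(1)[OF F]] pd_eqI[OF has_pd_other_coord[of 2 1 F p]] by simp_all

lemma pd_g: assumes p: "p \<in> polar_dom"
  shows "pd 1 (\<lambda>z. g z $ 1 $ 1) p = E1 (p$1)" "pd 1 (\<lambda>z. g z $ 2 $ 2) p = G1 (p$1)" "pd 1 (\<lambda>z. g z $ 1 $ 2) p = 0"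
    "pd 1 (\<lambda>z. g z $ 2 $ 1) p = 0" "pd 2 (\<lambda>z. g z $ i $ j) p = 0"
proof -
  have d: "0 < p$1" "p$1 < pi" using p by (auto simp: mem_polar_dom)
  show "pd 1 (\<lambda>z. g z $ 1 $ 1) p = E1 (p$1)" by (rule pd_theta(1)[OF p _ deriv(1)[OF d]]) (simp add: g_eq vector_2)
  show "pd 1 (\<lambda>z. g z $ 2 $ 2) p = G1 (p$1)" by (rule pd_theta(1)[OF p _ deriv(2)[OF d]]) (simp add: g_eq vector_2)
  have z: "((\<lambda>\<theta>. 0) has_real_derivative 0) (at (p$1))" by simp
  show "pd 1 (\<lambda>z. g z $ 1 $ 2) p = 0" "pd 1 (\<lambda>z. g z $ 2 $ 1) p = 0" by (rule pd_theta(1)[OF p _ z]; simp add: g_eq vector_2)+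
  have "pd 2 (\<lambda>z. g z $ 1 $ 1) p = 0" by (rule pd_theta(2)[OF p _ deriv(1)[OF d]]) (simp add: g_eq vector_2)
  moreover have "pd 2 (\<lambda>z. g z $ 2 $ 2) p = 0" by (rule pd_theta(2)[OF p _ deriv(2)[OF d]]) (simp add: g_eq vector_2)
  moreover have "pd 2 (\<lambda>z. g z $ 1 $ 2) p = 0" "pd 2 (\<lambda>z. g z $ 2 $ 1) p = 0" by (rule pd_theta(2)[OF p _ z]; simp add: g_eq vector_2)+
  ultimately show "pd 2 (\<lambda>z. g z $ i $ j) p = 0" using exhaust_2[of i] exhaust_2[of j] by auto
qed

lemma christoffel_eq: assumes p: "p \<in> polar_dom"
  shows "christoffel g p 1 1 1 = E1 (p$1) / (2 * E (p$1))" "christoffel g p 1 1 2 = 0" "christoffel g p 1 2 1 = 0"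
    "christoffel g p 1 2 2 = - G1 (p$1) / (2 * E (p$1))" "christoffel g p 2 1 1 = 0"
    "christoffel g p 2 1 2 = G1 (p$1) / (2 * G (p$1))" "christoffel g p 2 2 1 = G1 (p$1) / (2 * G (p$1))" "christoffel g p 2 2 2 = 0"
  unfolding christoffel_def inv[OF p] sum_2 by (simp_all add: vector_2 pd_g[OF p])

lemma gauss_curvature_eq:
  assumes p: "p \<in> polar_dom" and d: "((\<lambda>\<theta>. - G1 \<theta> / (2 * E \<theta>)) has_real_derivative d) (at (p$1))"
  shows "gauss_curvature g p = (d - E1 (p$1) * G1 (p$1) / (4 * (E (p$1))\<^sup>2) + (G1 (p$1))\<^sup>2 / (4 * E (p$1) * G (p$1))) / G (p$1)"
proof -
  have 1: "pd 1 (\<lambda>z. christoffel g z 1 2 2) p = d"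
    by (rule pd_theta(1)[OF p _ d]) (simp add: christoffel_eq)
  have 2: "pd 2 (\<lambda>z. christoffel g z 1 1 2) p = 0"
    by (rule pd_theta(2)[OF p, where F = "\<lambda>_. 0" and d = 0]) (simp_all add: christoffel_eq)
  show ?thesis
    using posp[OF p] unfolding gauss_curvature_def riemann_def sum_2 det_2
    by (simp add: g_eq[OF p] vector_2 1 2 christoffel_eq[OF p] power2_eq_square)
qed

lemma gradient_eq: assumes p: "p \<in> polar_dom" and "pd 1 f p = f1" "pd 2 f p = 0"
  shows "gradient g f p = vector [f1 / E (p$1), 0]"
  using assms by (simp add: gradient_def inv[OF p] sum_2 vec2_eq_iff vector_2)

lemma gradient_norm: assumes p: "p \<in> polar_dom" and "pd 1 f p = f1" "pd 2 f p = 0"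
  shows "metric_inner (g p) (gradient g f p) (gradient g f p) = f1\<^sup>2 / E (p$1)"
  using posp[OF p] by (simp add: metric_inner_def gradient_eq[OF assms] sum_2 g_eq[OF p] vector_2 power2_eq_square)

lemma laplacian_eq: assumes p: "p \<in> polar_dom" and "pd 1 f p = f1" "pd 2 f p = 0" "pd 1 (pd 1 f) p = f2" "pd 2 (pd 2 f) p = 0"
  shows "laplacian g f p = f2 / E (p$1) - E1 (p$1) * f1 / (2 * (E (p$1))\<^sup>2) + G1 (p$1) * f1 / (2 * E (p$1) * G (p$1))"
  using assms posp[OF p] by (simp add: laplacian_def inv[OF p] sum_2 vector_2 christoffel_eq[OF p] field_simps power2_eq_square)

end

subsection \<open>Admissible time functions on the Kerr surfaces\<close>

lemma extend_continuous:
  fixes f :: "real \<Rightarrow> real"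
  assumes "continuous_on {0<..<pi} f" "(f \<longlongrightarrow> l0) (at_right 0)" "(f \<longlongrightarrow> l1) (at_left pi)"
  obtains F where "continuous_on {0..pi} F" "\<And>\<theta>. 0 < \<theta> \<Longrightarrow> \<theta> < pi \<Longrightarrow> F \<theta> = f \<theta>" "F 0 = l0" "F pi = l1"
proof -
  define F where "F \<theta> = (if \<theta> = 0 then l0 else if \<theta> = pi then l1 else f \<theta>)" for \<theta>
  have F0: "F 0 = l0" "F pi = l1" by (simp_all add: F_def)
  have "continuous_on {0..pi} F"
  proof (rule continuous_on_IccI)
    have "\<forall>\<^sub>F x in at_right 0. f x = F x"
      unfolding eventually_at_right_field by (rule exI[of _ pi]) (auto simp: F_def)
    with assms(2) have "(F \<longlongrightarrow> l0) (at_right 0)" by (rule Lim_transform_eventually)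
    then show "(F \<longlongrightarrow> F 0) (at_right 0)" unfolding F0 .
    have "\<forall>\<^sub>F x in at_left pi. f x = F x"
      unfolding eventually_at_left_field by (rule exI[of _ 0]) (auto simp: F_def)
    with assms(3) have "(F \<longlongrightarrow> l1) (at_left pi)" by (rule Lim_transform_eventually)
    then show "(F \<longlongrightarrow> F pi) (at_left pi)" unfolding F0 .
    fix x :: real assume x: "0 < x" "x < pi"
    have "isCont f x" using assms(1) x by (simp add: continuous_on_eq_continuous_at)
    then have "(f \<longlongrightarrow> f x) (at x)" by (simp add: isCont_def)
    moreover have "\<forall>\<^sub>F u in at x. f u = F u"
      using eventually_at_in_open[of "{0<..<pi}" x] x by (auto elim!: eventually_mono simp: F_def)
    ultimately have "F \<midarrow>x\<rightarrow> f x" by (rule Lim_transform_eventually)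
    then show "F \<midarrow>x\<rightarrow> F x" using x by (simp add: F_def[of x])
  qed simp
  then show thesis by (rule that) (auto simp: F_def)
qed

text \<open>At each end \<open>y / sin\<close> is a quotient of difference quotients, so it tends to
  \<open>y1 z / cos z\<close> there and is bounded.\<close>

lemma le_sin_of_vanishing:
  fixes y y1 :: "real \<Rightarrow> real"
  assumes y: "\<And>\<theta>. (y has_real_derivative y1 \<theta>) (at \<theta>)" and "y 0 = 0" "y pi = 0"
  obtains N where "\<And>\<theta>. 0 < \<theta> \<Longrightarrow> \<theta> < pi \<Longrightarrow> \<bar>y \<theta>\<bar> \<le> N * sin \<theta>"
proof -
  have lim: "((\<lambda>\<theta>. (y \<theta> / (\<theta> - z)) / (sin \<theta> / (\<theta> - z))) \<longlongrightarrow> y1 z / cos z) (at z)"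
    if "y z = 0" "sin z = 0" "cos z \<noteq> 0" for z
    using y[of z] DERIV_sin[of z] that unfolding has_field_derivative_iff by (intro tendsto_divide) auto
  have eq: "(y \<theta> / (\<theta> - z)) / (sin \<theta> / (\<theta> - z)) = y \<theta> / sin \<theta>" if "\<theta> \<noteq> z" for \<theta> z
    using that by simp
  have lim': "((\<lambda>\<theta>. y \<theta> / sin \<theta>) \<longlongrightarrow> y1 z / cos z) (at z)" if "y z = 0" "sin z = 0" "cos z \<noteq> 0" for z
    using lim[OF that] by (rule Lim_transform_eventually) (auto simp: eventually_at_filter eq)
  have "continuous_on {0<..<pi} (\<lambda>\<theta>. y \<theta> / sin \<theta>)"
    using sin_gt_zero by (intro continuous_intros DERIV_continuous_on[OF has_field_derivative_at_within[OF y]]) force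
  moreover have "((\<lambda>\<theta>. y \<theta> / sin \<theta>) \<longlongrightarrow> y1 0 / cos 0) (at_right 0)" "((\<lambda>\<theta>. y \<theta> / sin \<theta>) \<longlongrightarrow> y1 pi / cos pi) (at_left pi)"
    using lim'[of 0] lim'[of pi] assms by (auto intro: filterlim_at_within_not_equal tendsto_mono[OF at_le])
  ultimately obtain F where F: "continuous_on {0..pi} F" "\<And>\<theta>. 0 < \<theta> \<Longrightarrow> \<theta> < pi \<Longrightarrow> F \<theta> = y \<theta> / sin \<theta>"
    by (rule extend_continuous) blast
  have "bounded (F ` {0..pi})" by (intro compact_imp_bounded compact_continuous_image F(1)) simp
  then obtain N where N: "\<forall>\<theta>\<in>{0..pi}. \<bar>F \<theta>\<bar> \<le> N" unfolding bounded_iff by auto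
  show thesis
  proof (rule that)
    fix \<theta> :: real assume \<theta>: "0 < \<theta>" "\<theta> < pi"
    note s = sin_gt_zero[OF \<theta>]
    have "\<bar>F \<theta>\<bar> \<le> N" using N \<theta> by auto
    then have "\<bar>y \<theta> / sin \<theta>\<bar> \<le> N" unfolding F(2)[OF \<theta>] .
    then show "\<bar>y \<theta>\<bar> \<le> N * sin \<theta>" using s by (simp add: abs_divide pos_divide_le_eq)
  qed
qed

lemma bdd_of_continuous: "continuous_on {0..pi} f \<Longrightarrow> bdd f" for f :: "real \<Rightarrow> real"
proof -
  assume "continuous_on {0..pi} f"
  then have "bounded (f ` {0..pi})" by (intro compact_imp_bounded compact_continuous_image) auto
  then obtain N where "\<forall>\<theta>\<in>{0..pi}. \<bar>f \<theta>\<bar> \<le> N" unfolding bounded_iff by auto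
  then show ?thesis by (intro bddI[of _ N]) auto
qed

text \<open>\<open>y\<close> lives on the whole line because a meridian continues through the poles;
  it vanishes at them because the time function depends on the polar angle alone.\<close>

locale kerr_fun = kerr +
  fixes y y1 y2 :: "real \<Rightarrow> real"
  assumes y_deriv: "(y has_real_derivative y1 \<theta>) (at \<theta>)" and y1_deriv: "(y1 has_real_derivative y2 \<theta>) (at \<theta>)"
    and y2_cont: "continuous_on UNIV y2" and y_ends: "y 0 = 0" "y pi = 0"
begin

definition w where "w \<theta> = sqrt (P \<theta> + (y \<theta>)\<^sup>2)"
definition w1 where "w1 \<theta> = (s \<theta> * s1 \<theta> + y \<theta> * y1 \<theta>) / w \<theta>"
definition k where "k \<theta> = s \<theta> * k0 \<theta> / w \<theta>"
definition k1 where "k1 \<theta> = ((s1 \<theta> * k0 \<theta> + s \<theta> * k01 \<theta>) * w \<theta> - s \<theta> * k0 \<theta> * w1 \<theta>) / (w \<theta>)\<^sup>2"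

lemma w_pos: "0 < w \<theta>" and w_sq: "(w \<theta>)\<^sup>2 = P \<theta> + (y \<theta>)\<^sup>2"
  using P_pos[of \<theta>] by (auto simp: w_def add_pos_nonneg add_nonneg_nonneg less_imp_le)

lemma w_deriv: "(w has_real_derivative w1 \<theta>) (at \<theta>)"
proof -
  have "0 < P \<theta> + (y \<theta>)\<^sup>2" using P_pos[of \<theta>] by (simp add: add_pos_nonneg)
  have e: "- (2 * a\<^sup>2 * sin \<theta> * cos \<theta>) = 2 * (s \<theta> * s1 \<theta>)" using s_pos[of \<theta>] by (simp add: s1_def)
  have "((\<lambda>\<theta>. (y \<theta>)\<^sup>2) has_real_derivative 2 * (y \<theta> * y1 \<theta>)) (at \<theta>)"
    by (auto intro!: derivative_eq_intros y_deriv)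
  from DERIV_add[OF P_deriv this]
  have "((\<lambda>\<theta>. P \<theta> + (y \<theta>)\<^sup>2) has_real_derivative 2 * (s \<theta> * s1 \<theta> + y \<theta> * y1 \<theta>)) (at \<theta>)" unfolding e by simp
  note d = this
  have q: "(sqrt has_real_derivative inverse (w \<theta>) / 2) (at (P \<theta> + (y \<theta>)\<^sup>2))"
    unfolding w_def by (rule DERIV_real_sqrt[OF \<open>0 < P \<theta> + (y \<theta>)\<^sup>2\<close>])
  have "((\<lambda>\<theta>. sqrt (P \<theta> + (y \<theta>)\<^sup>2)) has_real_derivative w1 \<theta>) (at \<theta>)"
    by (rule DERIV_cong[OF DERIV_chain2[OF q d]]) (use w_pos[of \<theta>] in \<open>simp add: w1_def field_simps\<close>)
  then show ?thesis unfolding w_def[abs_def] .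
qed

lemma k_deriv: "(k has_real_derivative k1 \<theta>) (at \<theta>)"
  unfolding k_def[abs_def] k1_def using w_pos[of \<theta>]
  by (auto intro!: derivative_eq_intros s_deriv k0_deriv w_deriv simp: power2_eq_square algebra_simps)

lemma continuous_time: "continuous_on S y" "continuous_on S y1" "continuous_on S y2" "continuous_on S w" "continuous_on S k"
  "continuous_on S w1" "continuous_on S k1"
proof -
  show *: "continuous_on S y" "continuous_on S y1" "continuous_on S w" "continuous_on S k"
    by (rule DERIV_continuous_on[OF has_field_derivative_at_within[OF y_deriv]]
      DERIV_continuous_on[OF has_field_derivative_at_within[OF y1_deriv]]
      DERIV_continuous_on[OF has_field_derivative_at_within[OF w_deriv]]
      DERIV_continuous_on[OF has_field_derivative_at_within[OF k_deriv]])+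
  have n: "\<forall>\<theta>\<in>S. w \<theta> \<noteq> 0" "\<forall>\<theta>\<in>S. (w \<theta>)\<^sup>2 \<noteq> 0" using w_pos by (auto simp: less_imp_neq[symmetric])
  show w1: "continuous_on S w1" unfolding w1_def[abs_def] by (intro continuous_intros * continuous_basic n)
  show "continuous_on S k1" unfolding k1_def[abs_def] by (intro continuous_intros * w1 continuous_basic continuous_derivs n)
  show "continuous_on S y2" using y2_cont continuous_on_subset by blast
qed

lemma H_eq: "kerr_H m a r \<theta> = (rho \<theta>)\<^sup>2"
  using B_pos[of \<theta>] P_pos[of \<theta>]
  by (simp add: kerr_H_def rho_def b_def s_def kerr_Sigma_def P_def[symmetric] power_mult_distrib power_divide B_def D_def)

lemma Sigma_eq: "kerr_Sigma a r = s"
  by (rule ext) (simp add: kerr_Sigma_def s_def P_def)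

sublocale aug: polar_metric "augmented_metric m a r y" "\<lambda>\<theta>. (w \<theta>)\<^sup>2" "\<lambda>\<theta>. (rho \<theta>)\<^sup>2"
  "\<lambda>\<theta>. 2 * w \<theta> * w1 \<theta>" "\<lambda>\<theta>. 2 * rho \<theta> * (w \<theta> * k \<theta>)"
proof
  fix \<theta> :: real assume \<theta>: "0 < \<theta>" "\<theta> < pi"
  show "0 < (w \<theta>)\<^sup>2" using w_pos[of \<theta>] by simp
  show "0 < (rho \<theta>)\<^sup>2" using sin_gt_zero[OF \<theta>] b_pos[of \<theta>] s_pos[of \<theta>] by (simp add: rho_def)
  have "w \<theta> * k \<theta> = s \<theta> * k0 \<theta>" using w_pos[of \<theta>] by (simp add: k_def)
  then show "((\<lambda>\<theta>. (rho \<theta>)\<^sup>2) has_real_derivative 2 * rho \<theta> * (w \<theta> * k \<theta>)) (at \<theta>)"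
    by (auto intro!: derivative_eq_intros rho_deriv)
  show "((\<lambda>\<theta>. (w \<theta>)\<^sup>2) has_real_derivative 2 * w \<theta> * w1 \<theta>) (at \<theta>)"
    by (auto intro!: derivative_eq_intros w_deriv)
qed (simp add: augmented_metric_def H_eq Sigma_eq w_sq s_sq power2_eq_square[of "s _"])

lemma rho_pos: "0 < \<theta> \<Longrightarrow> \<theta> < pi \<Longrightarrow> 0 < rho \<theta>"
  using sin_gt_zero[of \<theta>] b_pos[of \<theta>] s_pos[of \<theta>] by (simp add: rho_def)

lemma gauss_curvature_aug: assumes p: "p \<in> polar_dom"
  shows "gauss_curvature (augmented_metric m a r y) p = - k1 (p$1) / (w (p$1) * rho (p$1))"
proof -
  let ?t = "p$1"
  have pos: "0 < w ?t" "0 < rho ?t" using p w_pos rho_pos by (auto simp: mem_polar_dom)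
  have "(rho has_real_derivative w ?t * k ?t) (at ?t)" using rho_deriv[of ?t] w_pos[of ?t] by (simp add: k_def)
  then have "((\<lambda>\<theta>. - (rho \<theta> * k \<theta> / w \<theta>)) has_real_derivative
      - (((w ?t * k ?t * k ?t + k1 ?t * rho ?t) * w ?t - rho ?t * k ?t * w1 ?t) / (w ?t * w ?t))) (at ?t)"
    using pos by (intro DERIV_minus DERIV_divide DERIV_mult k_deriv w_deriv) auto
  moreover have "(\<lambda>\<theta>. - (2 * rho \<theta> * (w \<theta> * k \<theta>)) / (2 * (w \<theta>)\<^sup>2)) = (\<lambda>\<theta>. - (rho \<theta> * k \<theta> / w \<theta>))"
    using w_pos by (auto simp: power2_eq_square less_imp_neq[symmetric])
  ultimately have "((\<lambda>\<theta>. - (2 * rho \<theta> * (w \<theta> * k \<theta>)) / (2 * (w \<theta>)\<^sup>2)) has_real_derivative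
      - (((w ?t * k ?t * k ?t + k1 ?t * rho ?t) * w ?t - rho ?t * k ?t * w1 ?t) / (w ?t * w ?t))) (at ?t)" by simp
  from aug.gauss_curvature_eq[OF p this] show ?thesis
    using pos by (simp add: divide_simps power2_eq_square)
qed

end

locale kerr_time = kerr_fun +
  assumes curv: "positive_gauss_curvature (augmented_metric m a r y)"
begin

lemma aug_revolution: "\<exists>c C. revolution w rho k w1 k1 c C"
proof -
  let ?\<sigma> = "augmented_metric m a r y"
  \<comment> \<open>On the chart \<open>f\<close> is the curvature times
    \<open>v = w * rho / sin\<close>, and \<open>v\<close> is positive and continuous up to the
    poles. The assumed positive limits of the curvature therefore keep \<open>- k1 / sin\<close>
    between positive constants.\<close>
  define f where "f \<theta> = - k1 \<theta> / sin \<theta>" for \<theta>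
  define v where "v \<theta> = w \<theta> * (b \<theta> / s \<theta>)" for \<theta>
  have vc: "continuous_on S v" for S
    unfolding v_def[abs_def] using s_pos by (intro continuous_intros continuous_time continuous_basic) (auto simp: less_imp_neq[symmetric])
  have vp: "0 < v \<theta>" for \<theta> using w_pos b_pos s_pos by (simp add: v_def)
  have f: "f \<theta> = gauss_curvature ?\<sigma> (vector [\<theta>, 0]) * v \<theta>" if "0 < \<theta>" "\<theta> < pi" for \<theta>
    using gauss_curvature_aug[of "vector [\<theta>, 0]"] that w_pos[of \<theta>] rho_pos[of \<theta>] sin_gt_zero[of \<theta>] b_pos[of \<theta>] s_pos[of \<theta>]
    by (simp add: vector_2 f_def v_def rho_def)
  obtain K0 K1 where K: "0 < K0" "((\<lambda>\<theta>. gauss_curvature ?\<sigma> (vector [\<theta>, 0])) \<longlongrightarrow> K0) (at_right 0)"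
    "0 < K1" "((\<lambda>\<theta>. gauss_curvature ?\<sigma> (vector [\<theta>, 0])) \<longlongrightarrow> K1) (at_left pi)"
    and Kp: "\<And>p. p \<in> polar_dom \<Longrightarrow> 0 < gauss_curvature ?\<sigma> p"
    using curv unfolding positive_gauss_curvature_def by blast
  have vt: "(v \<longlongrightarrow> v z) (at z within S)" for z S
    using vc[of UNIV] by (auto simp: continuous_on_def intro: tendsto_mono[OF at_le])
  have ev: "\<forall>\<^sub>F \<theta> in at_right 0. gauss_curvature ?\<sigma> (vector [\<theta>, 0]) * v \<theta> = f \<theta>"
    "\<forall>\<^sub>F \<theta> in at_left pi. gauss_curvature ?\<sigma> (vector [\<theta>, 0]) * v \<theta> = f \<theta>"
    unfolding eventually_at_right_field eventually_at_left_field
    by (rule exI[of _ pi], simp add: f) (rule exI[of _ 0], simp add: f)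
  have lims: "(f \<longlongrightarrow> K0 * v 0) (at_right 0)" "(f \<longlongrightarrow> K1 * v pi) (at_left pi)"
    by (rule Lim_transform_eventually[OF tendsto_mult[OF K(2) vt] ev(1)] Lim_transform_eventually[OF tendsto_mult[OF K(4) vt] ev(2)])+
  have "continuous_on {0<..<pi} f"
    unfolding f_def[abs_def] using sin_gt_zero by (intro continuous_intros continuous_time) force
  from extend_continuous[OF this lims] obtain F where F: "continuous_on {0..pi} F"
    "\<And>\<theta>. 0 < \<theta> \<Longrightarrow> \<theta> < pi \<Longrightarrow> F \<theta> = f \<theta>" "F 0 = K0 * v 0" "F pi = K1 * v pi" by blast
  have Fp: "0 < F \<theta>" if "\<theta> \<in> {0..pi}" for \<theta>
  proof (cases "\<theta> = 0 \<or> \<theta> = pi")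
    case True then show ?thesis using F K vp by auto
  next
    case False then show ?thesis using F(2)[of \<theta>] f[of \<theta>] Kp[of "vector [\<theta>, 0]"] vp that by auto
  qed
  obtain c1 C1 where 1: "0 < c1" "\<And>\<theta>. \<theta> \<in> {0..pi} \<Longrightarrow> c1 \<le> F \<theta>" "\<And>\<theta>. \<theta> \<in> {0..pi} \<Longrightarrow> F \<theta> \<le> C1"
    by (rule pos_bounds[OF F(1) Fp]) blast+
  obtain c2 C2 where 2: "0 < c2" "\<And>\<theta>. \<theta> \<in> {0..pi} \<Longrightarrow> c2 \<le> w \<theta>" "\<And>\<theta>. \<theta> \<in> {0..pi} \<Longrightarrow> w \<theta> \<le> C2"
    by (rule pos_bounds[OF continuous_time(4) w_pos]) blast
  obtain c3 C3 where 3: "revolution s rho k0 s1 k01 c3 C3" using base_revolution by blast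
  define c where "c = min c1 (min c2 c3)"
  define C where "C = max C1 (max C2 C3)"
  interpret b: revolution s rho k0 s1 k01 c3 C3 by (rule 3)
  have "w 0 = s 0" "w pi = s pi" using s_pos by (simp_all add: w_def s_def y_ends)
  then have kk: "k 0 = 1" "k pi = -1" using s_pos[of 0] s_pos[of pi] k0_ends by (simp_all add: k_def)
  have "revolution w rho k w1 k1 c C"
  proof
    show "0 < c" using 1 2 b.c_pos by (simp add: c_def)
    fix \<theta> :: real assume \<theta>: "0 < \<theta>" "\<theta> < pi"
    then have i: "\<theta> \<in> {0..pi}" and sn: "0 < sin \<theta>" using sin_gt_zero[OF \<theta>] by auto
    show "c \<le> w \<theta>" "w \<theta> \<le> C" using 2(2,3)[OF i] by (auto simp: c_def C_def)
    have "c * sin \<theta> \<le> c3 * sin \<theta>" "C3 * sin \<theta> \<le> C * sin \<theta>" using sn by (intro mult_right_mono; simp add: c_def C_def)+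
    then show "c * sin \<theta> \<le> rho \<theta>" "rho \<theta> \<le> C * sin \<theta>" using b.rho_bounds[OF \<theta>] by linarith+
    have "c * sin \<theta> \<le> f \<theta> * sin \<theta>" "f \<theta> * sin \<theta> \<le> C * sin \<theta>"
      using 1(2,3)[OF i] F(2)[OF \<theta>] sn by (intro mult_right_mono; auto simp: c_def C_def)+
    then show "c * sin \<theta> \<le> - k1 \<theta>" "- k1 \<theta> \<le> C * sin \<theta>" using sn by (simp_all add: f_def)
    show "(rho has_real_derivative w \<theta> * k \<theta>) (at \<theta>)" using rho_deriv[of \<theta>] w_pos[of \<theta>] by (simp add: k_def)
  qed (use w_deriv k_deriv continuous_time kk in auto)
  then show ?thesis by blast
qed

lemma energy_locale: "\<exists>c C c' C' N d. energy s rho k0 s1 k01 c C w k w1 k1 c' C' y y1 y2 s2 h h1 N d"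
proof -
  obtain c C where 1: "revolution s rho k0 s1 k01 c C" using base_revolution by blast
  obtain c' C' where 2: "revolution w rho k w1 k1 c' C'" using aug_revolution by blast
  obtain N where N: "\<And>\<theta>. 0 < \<theta> \<Longrightarrow> \<theta> < pi \<Longrightarrow> \<bar>y \<theta>\<bar> \<le> N * sin \<theta>"
    by (rule le_sin_of_vanishing[OF y_deriv y_ends]) blast
  obtain d C2 where d: "0 < d" "\<And>\<theta>. \<theta> \<in> {0..pi} \<Longrightarrow> d \<le> h \<theta>" "\<And>\<theta>. \<theta> \<in> {0..pi} \<Longrightarrow> h \<theta> \<le> C2"
    by (rule pos_bounds[OF continuous_basic(9) h_pos]) blast
  interpret b: revolution s rho k0 s1 k01 c C by (rule 1)
  interpret g: revolution w rho k w1 k1 c' C' by (rule 2)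
  have "energy s rho k0 s1 k01 c C w k w1 k1 c' C' y y1 y2 s2 h h1 N d"
  proof
    fix \<theta> :: real assume \<theta>: "0 < \<theta>" "\<theta> < pi"
    show "(w \<theta>)\<^sup>2 = (s \<theta>)\<^sup>2 + (y \<theta>)\<^sup>2" by (simp add: w_sq s_sq power2_eq_square[of "s \<theta>"])
    show "rho \<theta> * s \<theta> * h \<theta> \<le> b.mean_density \<theta>"
      using mean_curvature_le[OF \<theta> b.sig_bounds(2)[OF \<theta>]] by (simp add: b.mean_density_def)
  qed (use N d y_deriv y1_deriv s1_deriv h_deriv continuous_time continuous_derivs continuous_basic in \<open>auto intro: bdd_of_continuous\<close>)
  then show ?thesis by blast
qed

end

subsection \<open>The Chen--Nester--Tung energy\<close>

text \<open>With \<open>x\<close> solved for, \<open>al\<close> is proportional to \<open>ch\<close>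
  and the density splits: the first term is the physical mean curvature term, the terms free of
  \<open>X\<close> give the reference density, and those with \<open>X\<close> or its derivative
  collapse to the derivative of the boost.\<close>

lemma cnt_algebra:
  fixes rho y y1 s s1 w w1 k k1 g h ch sh dsh d :: real
  assumes pos: "0 < rho" "0 < s" "0 < w" "0 < g" "0 < ch" "0 < d"
    and w1: "w * w1 = s * s1 + y * y1" and w2: "w\<^sup>2 = s\<^sup>2 + y\<^sup>2" and g: "g\<^sup>2 = 1 - k\<^sup>2"
    and l: "l = w\<^sup>2" and al: "al = s * w / d * ch" and be: "be = 2 * rho * w * g" and HSr: "HSr = 2 * rho\<^sup>2 * s^3 * h / d"
    and R: "R = s / d" and Rt: "Rt = s1 / d" and Ht: "Ht = 2 * rho * (w * k)" and Htt: "Htt = 2 * ((w * k)\<^sup>2 + rho * (w1 * k + w * k1))"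
    and X: "X = - (sh * w) / d" and xt: "xt = - (dsh * w + sh * w1) / d"
  shows "- (al * HSr) / (2 * rho * R\<^sup>2 * s\<^sup>2)
        - rho * ((Htt - 2 * l) / be + Rt * X * y / (R * al) - (X * y^3 * be + Ht * al * s\<^sup>2) / (l * al * be * s) * s1)
        + rho * y * xt / al + rho * y * (Ht * al - X * y * be) / (l * al * be) * y1
     = w * g - rho * k1 / g - (rho * w * h * ch + rho * y / s * (dsh / ch))"
proof -
  have p: "0 < l" "0 < al" "0 < be" "0 < R" using pos by (simp_all add: l al be R)
  have T1: "- (al * HSr) / (2 * rho * R\<^sup>2 * s\<^sup>2) = - (rho * w * h * ch)"
    using pos unfolding al HSr R by (simp add: divide_simps power2_eq_square power3_eq_cube)
  have T2: "(X * y^3 * be + Ht * al * s\<^sup>2) / (l * al * be * s) * s1 = X * y^3 * s1 / (l * al * s) + Ht * s * s1 / (l * be)"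
    using pos p by (simp add: divide_simps power2_eq_square) (simp add: algebra_simps)
  have T4: "rho * y * (Ht * al - X * y * be) / (l * al * be) * y1 = rho * Ht * (y * y1) / (l * be) - rho * y * X * (y * y1) / (l * al)"
    using pos p by (simp add: divide_simps) (simp add: algebra_simps)
  have Rtt: "Rt * X * y / (R * al) = X * y * s1 / (s * al)" using pos unfolding Rt R by simp
  have A: "- (rho * ((Htt - 2 * l) / be)) + rho * (Ht * s * s1 / (l * be)) + rho * Ht * (y * y1) / (l * be) = w * g - rho * k1 / g"
  proof -
    have "rho * (Ht * s * s1 / (l * be)) + rho * Ht * (y * y1) / (l * be) = rho * Ht * (w * w1) / (l * be)"
      unfolding w1 by (simp add: add_divide_distrib distrib_left mult.assoc)
    also have "\<dots> = rho * k * w1 / (w * g)" using pos unfolding Ht l be by (simp add: divide_simps power2_eq_square)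
    finally have 1: "rho * (Ht * s * s1 / (l * be)) + rho * Ht * (y * y1) / (l * be) = rho * k * w1 / (w * g)" .
    have "rho * ((Htt - 2 * l) / be) = ((w * k)\<^sup>2 + rho * (w1 * k + w * k1) - w\<^sup>2) / (w * g)"
      using pos unfolding Htt l be by (simp add: divide_simps)
    also have "\<dots> = (rho * k * w1 + w * rho * k1 - w\<^sup>2 * g\<^sup>2) / (w * g)" unfolding g by (simp add: algebra_simps)
    also have "\<dots> = rho * k * w1 / (w * g) + rho * k1 / g - w * g"
      using pos by (simp add: divide_simps power2_eq_square)
    finally show ?thesis using 1 by linarith
  qed
  have C: "- (rho * (X * y * s1 / (s * al))) + rho * (X * y^3 * s1 / (l * al * s)) + rho * y * xt / al - rho * y * X * (y * y1) / (l * al)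
    = - (rho * y / s * (dsh / ch))"
  proof -
    have "- (rho * (X * y * s1 / (s * al))) + rho * (X * y^3 * s1 / (l * al * s)) + rho * y * xt / al - rho * y * X * (y * y1) / (l * al)
      = rho * y / al * (xt - X * (s1 * (l - y\<^sup>2) + s * y * y1) / (s * l))"
      using pos p by (simp add: divide_simps power2_eq_square power3_eq_cube) (simp add: algebra_simps)
    also have "s1 * (l - y\<^sup>2) + s * y * y1 = s * (w * w1)" unfolding l w2 w1 by (simp add: power2_eq_square algebra_simps)
    also have "X * (s * (w * w1)) / (s * l) = - (sh * w1) / d" using pos unfolding X l by (simp add: divide_simps power2_eq_square)
    also have "xt - - (sh * w1) / d = - (dsh * w) / d" unfolding xt using pos by (simp add: divide_simps)
    also have "rho * y / al * (- (dsh * w) / d) = - (rho * y / s * (dsh / ch))" using pos unfolding al by (simp add: divide_simps)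
    finally show ?thesis .
  qed
  have dist: "rho * (u1 + u2 - (u3 + u4)) = rho * u1 + rho * u2 - (rho * u3 + rho * u4)" for u1 u2 u3 u4
    by (simp only: distrib_left right_diff_distrib)
  show ?thesis unfolding T1 T2 T4 Rtt dist using A C by linarith
qed

context kerr
begin

lemma HS_r: "deriv (\<lambda>u. kerr_H m a u \<theta> * (kerr_Sigma a u \<theta>)\<^sup>2) r = (sin \<theta>)\<^sup>2 * Br \<theta>"
proof -
  have "((\<lambda>u. (sin \<theta>)\<^sup>2 * ((u\<^sup>2 + a\<^sup>2)\<^sup>2 - kerr_Delta m a u * a\<^sup>2 * (sin \<theta>)\<^sup>2)) has_real_derivative (sin \<theta>)\<^sup>2 * Br \<theta>) (at r)"
    unfolding kerr_Delta_def Br_def by (auto intro!: derivative_eq_intros simp: power2_eq_square algebra_simps)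
  then have "((\<lambda>u. kerr_H m a u \<theta> * (kerr_Sigma a u \<theta>)\<^sup>2) has_real_derivative (sin \<theta>)\<^sup>2 * Br \<theta>) (at r)"
  proof (rule has_field_derivative_transform_within_open[of _ _ _ "{0<..}"])
    fix u :: real assume "u \<in> {0<..}"
    then have "(kerr_Sigma a u \<theta>)\<^sup>2 \<noteq> 0" by (simp add: kerr_Sigma_def add_pos_nonneg less_imp_neq[symmetric])
    then show "(sin \<theta>)\<^sup>2 * ((u\<^sup>2 + a\<^sup>2)\<^sup>2 - kerr_Delta m a u * a\<^sup>2 * (sin \<theta>)\<^sup>2) = kerr_H m a u \<theta> * (kerr_Sigma a u \<theta>)\<^sup>2"
      by (simp add: kerr_H_def)
  qed (use r_pos in auto)
  then show ?thesis by (rule DERIV_imp_deriv)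
qed

lemma HS_r_eq: "(sin \<theta>)\<^sup>2 * Br \<theta> = 2 * (rho \<theta>)\<^sup>2 * (s \<theta>)^3 * h \<theta> / sqrt D"
proof -
  have "sqrt D > 0" using D_pos by simp
  then show ?thesis
    using s_pos[of \<theta>] b_pos[of \<theta>] unfolding rho_def h_def b_sq[symmetric]
    by (simp add: divide_simps power2_eq_square power3_eq_cube)
qed

lemma kerr_R_eq: "kerr_R m a r = (\<lambda>\<theta>. s \<theta> / sqrt D)"
proof
  fix \<theta>
  have "kerr_Sigma a r \<theta> = s \<theta>" by (simp add: kerr_Sigma_def s_def P_def)
  then show "kerr_R m a r \<theta> = s \<theta> / sqrt D"
    using s_pos[of \<theta>] by (simp add: kerr_R_def D_def real_sqrt_divide)
qed

end

context kerr_time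
begin

text \<open>The relation determining \<open>x\<close> is the frame condition of the Wang-Yau energy
  in other variables; its solution is \<open>- (sh * w) / sqrt D\<close>. The function
  \<open>y'\<close> is tied to \<open>y\<close> on the open interval only.\<close>

lemma cnt_energy_eq:
  assumes e: "energy s rho k0 s1 k01 c C w k w1 k1 c' C' y y1 y2 s2 h h1 N d"
    and y': "\<And>\<theta>. 0 < \<theta> \<Longrightarrow> \<theta> < pi \<Longrightarrow> y' \<theta> = y \<theta>"
  shows "cnt_energy m a r y' = 1/4 * integral {0..pi} (\<lambda>\<theta>. revolution.mean_density w rho k k1 \<theta> - energy.phys s rho k0 s1 k01 w w1 y y1 y2 s2 h h1 \<theta>)"
proof -
  interpret e: energy s rho k0 s1 k01 c C w k w1 k1 c' C' y y1 y2 s2 h h1 N d by (rule e)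
  have sD: "0 < sqrt D" using D_pos by simp
  have dy: "deriv y' \<theta> = y1 \<theta>" if "0 < \<theta>" "\<theta> < pi" for \<theta>
    by (rule DERIV_imp_deriv, rule has_field_derivative_transform_within_open[OF y_deriv, of "{0<..<pi}"])
      (use that y' in auto)
  have dH: "(kerr_H m a r has_real_derivative 2 * rho \<theta> * (s \<theta> * k0 \<theta>)) (at \<theta>)" for \<theta>
    unfolding H_eq[abs_def] by (auto intro!: derivative_eq_intros rho_deriv)
  have dH': "deriv (kerr_H m a r) = (\<lambda>\<theta>. 2 * rho \<theta> * (s \<theta> * k0 \<theta>))"
    using DERIV_imp_deriv[OF dH] by auto
  have ddH: "deriv (\<lambda>\<theta>. 2 * rho \<theta> * (s \<theta> * k0 \<theta>)) \<theta> = 2 * ((s \<theta> * k0 \<theta>)\<^sup>2 + rho \<theta> * (s1 \<theta> * k0 \<theta> + s \<theta> * k01 \<theta>))" for \<theta>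
    by (rule DERIV_imp_deriv) (auto intro!: derivative_eq_intros rho_deriv s_deriv k0_deriv simp: power2_eq_square algebra_simps)
  have dR: "deriv (\<lambda>\<theta>. s \<theta> / sqrt D) \<theta> = s1 \<theta> / sqrt D" for \<theta>
    by (rule DERIV_imp_deriv[OF DERIV_cdivide[OF s_deriv]])
  have ds: "deriv s \<theta> = s1 \<theta>" for \<theta> by (rule DERIV_imp_deriv[OF s_deriv])
  have HS': "deriv (\<lambda>u. (kerr_Sigma a u \<theta>)\<^sup>2 * kerr_H m a u \<theta>) r = 2 * (rho \<theta>)\<^sup>2 * (s \<theta>)^3 * h \<theta> / sqrt D" for \<theta>
    using HS_r[of \<theta>] unfolding HS_r_eq by (simp add: mult.commute)
  have x: "cnt_x m a r y' \<theta> = - (e.sh \<theta> * w \<theta>) / sqrt D" if \<theta>: "0 < \<theta>" "\<theta> < pi" for \<theta>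
  proof -
    note p = e.pos[OF \<theta>]
    define A where "A = - (2 * (rho \<theta>)\<^sup>2 * (s \<theta>)^3 * h \<theta> / sqrt D) / (2 * (rho \<theta>)\<^sup>2 * (s \<theta> / sqrt D)\<^sup>2)"
    have A: "A = - (s \<theta> * h \<theta> * sqrt D)" using p sD by (simp add: A_def divide_simps power2_eq_square power3_eq_cube)
    have A0: "A \<noteq> 0" using p sD by (simp add: A)
    have "(s \<theta> * (2 * rho \<theta> * (s \<theta> * k0 \<theta>)) - 2 * (rho \<theta>)\<^sup>2 * s1 \<theta>) / (2 * (rho \<theta>)\<^sup>2 * s \<theta>) * y \<theta> =
        s \<theta> * k0 \<theta> * (y \<theta> / rho \<theta>) - y \<theta> * s1 \<theta> / s \<theta>"
      using p by (simp add: divide_simps power2_eq_square) (simp add: algebra_simps)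
    moreover have "A * (- (e.sh \<theta> * w \<theta>) / sqrt D) = s \<theta> * e.Dv \<theta>"
      using p sD by (simp add: A e.sh_def)
    moreover have "s \<theta> * e.Dv \<theta> = s \<theta> * k0 \<theta> * (y \<theta> / rho \<theta>) + y1 \<theta> - y \<theta> * s1 \<theta> / s \<theta>"
      using p by (simp add: e.Dv_def power2_eq_square distrib_left right_diff_distrib)
    ultimately have sol: "y1 \<theta> = A * (- (e.sh \<theta> * w \<theta>) / sqrt D) -
        (s \<theta> * (2 * rho \<theta> * (s \<theta> * k0 \<theta>)) - 2 * (rho \<theta>)\<^sup>2 * s1 \<theta>) / (2 * (rho \<theta>)\<^sup>2 * s \<theta>) * y \<theta>" by linarith
    show ?thesis
      unfolding cnt_x_def Let_def HS' H_eq Sigma_eq dH' kerr_R_eq ds y'[OF \<theta>] dy[OF \<theta>] A_def[symmetric]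
    proof (rule the_equality)
      show "y1 \<theta> = A * (- (e.sh \<theta> * w \<theta>) / sqrt D) -
        (s \<theta> * (2 * rho \<theta> * (s \<theta> * k0 \<theta>)) - 2 * (rho \<theta>)\<^sup>2 * s1 \<theta>) / (2 * (rho \<theta>)\<^sup>2 * s \<theta>) * y \<theta>" by (rule sol)
    next
      fix x assume "y1 \<theta> = A * x - (s \<theta> * (2 * rho \<theta> * (s \<theta> * k0 \<theta>)) - 2 * (rho \<theta>)\<^sup>2 * s1 \<theta>) / (2 * (rho \<theta>)\<^sup>2 * s \<theta>) * y \<theta>"
      then have "A * x = A * (- (e.sh \<theta> * w \<theta>) / sqrt D)" using sol by linarith
      then show "x = - (e.sh \<theta> * w \<theta>) / sqrt D" unfolding mult_cancel_left using A0 by blast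
    qed
  qed
  have dx: "deriv (cnt_x m a r y') \<theta> = - (e.dsh \<theta> * w \<theta> + e.sh \<theta> * w1 \<theta>) / sqrt D" if \<theta>: "0 < \<theta>" "\<theta> < pi" for \<theta>
  proof (rule DERIV_imp_deriv, rule has_field_derivative_transform_within_open[of _ _ _ "{0<..<pi}"])
    show "((\<lambda>\<theta>. - (e.sh \<theta> * w \<theta>) / sqrt D) has_real_derivative - (e.dsh \<theta> * w \<theta> + e.sh \<theta> * w1 \<theta>) / sqrt D) (at \<theta>)"
      by (rule DERIV_cong[OF DERIV_cdivide[OF DERIV_minus[OF DERIV_mult[OF e.sh_deriv[OF \<theta>] w_deriv]]]]) (simp add: mult.commute)
  qed (use \<theta> x in auto)
  have density: "cnt_density m a r (cnt_x m a r y') y' \<theta> = e.aug.mean_density \<theta> - e.phys \<theta>" if \<theta>: "0 < \<theta>" "\<theta> < pi" for \<theta>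
  proof -
    note p = e.pos[OF \<theta>]
    have ch: "e.sh \<theta> * e.sh \<theta> + 1 = (cosh (e.chi \<theta>))\<^sup>2" "0 < cosh (e.chi \<theta>)"
      by (simp_all add: e.chi_def cosh_arsinh_real power2_eq_square add_nonneg_pos)
    have kw: "s \<theta> * k0 \<theta> = w \<theta> * k \<theta>" using e.k_rel[OF \<theta>] by simp
    have wk1: "s1 \<theta> * k0 \<theta> + s \<theta> * k01 \<theta> = w1 \<theta> * k \<theta> + w \<theta> * k1 \<theta>" using e.k1_rel[OF \<theta>] by simp
    have l: "(y \<theta>)\<^sup>2 + (s \<theta>)\<^sup>2 = (w \<theta>)\<^sup>2" using e.w_sq[OF \<theta>] by simp
    have "(- (e.sh \<theta> * w \<theta>) / sqrt D)\<^sup>2 * (s \<theta>)\<^sup>2 + (s \<theta> / sqrt D)\<^sup>2 * (w \<theta>)\<^sup>2 = (s \<theta> * w \<theta> / sqrt D)\<^sup>2 * (e.sh \<theta> * e.sh \<theta> + 1)"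
      by (simp add: power2_eq_square algebra_simps)
    also have "\<dots> = (s \<theta> * w \<theta> / sqrt D * cosh (e.chi \<theta>))\<^sup>2" unfolding ch by (simp only: power_mult_distrib)
    finally have al: "sqrt ((- (e.sh \<theta> * w \<theta>) / sqrt D)\<^sup>2 * (s \<theta>)\<^sup>2 + (s \<theta> / sqrt D)\<^sup>2 * (w \<theta>)\<^sup>2) = s \<theta> * w \<theta> / sqrt D * cosh (e.chi \<theta>)"
      using p sD ch(2) by simp
    have "- (2 * rho \<theta> * (w \<theta> * k \<theta>))\<^sup>2 + 4 * (rho \<theta>)\<^sup>2 * (w \<theta>)\<^sup>2 = (2 * rho \<theta> * w \<theta> * e.aug.sig \<theta>)\<^sup>2"
      unfolding power_mult_distrib e.aug.sig_bounds(4)[OF \<theta>] by (simp add: algebra_simps)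
    then have be: "sqrt (- (2 * rho \<theta> * (w \<theta> * k \<theta>))\<^sup>2 + 4 * (rho \<theta>)\<^sup>2 * (w \<theta>)\<^sup>2) = 2 * rho \<theta> * w \<theta> * e.aug.sig \<theta>"
      using p by simp
    have rr: "sqrt ((rho \<theta>)\<^sup>2) = rho \<theta>" using p by simp
    show ?thesis
      unfolding cnt_density_def Let_def HS_r HS_r_eq ddH dH' dR Sigma_eq ds H_eq y'[OF \<theta>] dy[OF \<theta>] x[OF \<theta>] dx[OF \<theta>] kerr_R_eq
        kw wk1 l al be rr e.aug.mean_density_def e.phys_def e.dchi_def e.Y_def
      by (rule cnt_algebra[OF _ _ _ _ _ _ e.w1_rel[OF \<theta>] e.w_sq[OF \<theta>] e.aug.sig_bounds(4)[OF \<theta>]])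
        (use p sD ch in auto)
  qed
  \<comment> \<open>The computation of the density is confined to the open interval; the two poles
    are a null set.\<close>
  have "integral {0..pi} (cnt_density m a r (cnt_x m a r y') y') = integral {0..pi} (\<lambda>\<theta>. e.aug.mean_density \<theta> - e.phys \<theta>)"
    by (rule integral_spike[of "{0, pi}"]) (use density in auto)
  then show ?thesis by (simp add: cnt_energy_def cnt_energy_xy_def)
qed

end

subsection \<open>The case of vanishing time function\<close>

context kerr
begin

interpretation zero: kerr_fun m a r "\<lambda>_. 0" "\<lambda>_. 0" "\<lambda>_. 0"
  by unfold_locales auto

lemma zero_simps: "zero.w = s" "zero.w1 = s1" "zero.k = k0" "zero.k1 = k01"
proof -
  show w: "zero.w = s" by (rule ext) (simp add: zero.w_def s_def)
  show w1: "zero.w1 = s1" using s_pos by (auto simp: zero.w1_def w less_imp_neq[symmetric])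
  show "zero.k = k0" using s_pos by (auto simp: zero.k_def w less_imp_neq[symmetric])
  show "zero.k1 = k01" using s_pos by (auto simp: zero.k1_def w w1 less_imp_neq[symmetric] power2_eq_square algebra_simps)
qed

text \<open>The curvature is \<open>T / (b^4 * P^3)\<close> on the chart: positive by
  \<open>T_pos\<close>, and continuous past the poles, which supplies the limits.\<close>

lemma kerr_time_zero: "kerr_time m a r (\<lambda>_. 0) (\<lambda>_. 0) (\<lambda>_. 0)"
proof
  let ?\<sigma> = "augmented_metric m a r (\<lambda>_. 0)" and ?K = "\<lambda>\<theta>. T \<theta> / ((b \<theta>)^4 * (P \<theta>)^3)"
  have K: "gauss_curvature ?\<sigma> p = ?K (p$1)" if p: "p \<in> polar_dom" for p
    using zero.gauss_curvature_aug[OF p] sin_gt_zero[of "p$1"] p s_pos[of "p$1"] b_pos[of "p$1"] P_pos[of "p$1"]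
    unfolding zero_simps rho_def k01_def by (simp add: mem_polar_dom divide_simps power4_eq_xxxx power3_eq_cube mult_ac)
  have Kp: "0 < ?K \<theta>" for \<theta> using T_pos[of \<theta>] b_pos[of \<theta>] P_pos[of \<theta>] by simp
  have "continuous_on UNIV ?K"
    using b_pos P_pos by (intro continuous_intros continuous_derivs continuous_basic) (auto simp: less_imp_neq[symmetric])
  then have lim: "(?K \<longlongrightarrow> ?K z) (at z within S)" for z S
    by (auto simp: continuous_on_def intro: tendsto_mono[OF at_le])
  have "((\<lambda>\<theta>. gauss_curvature ?\<sigma> (vector [\<theta>, \<phi>])) \<longlongrightarrow> ?K 0) (at_right 0)" for \<phi>
  proof (rule Lim_transform_eventually[OF lim])
    show "\<forall>\<^sub>F \<theta> in at_right 0. ?K \<theta> = gauss_curvature ?\<sigma> (vector [\<theta>, \<phi>])"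
      unfolding eventually_at_right_field by (rule exI[of _ pi]) (simp add: K vector_2)
  qed
  moreover have "((\<lambda>\<theta>. gauss_curvature ?\<sigma> (vector [\<theta>, \<phi>])) \<longlongrightarrow> ?K pi) (at_left pi)" for \<phi>
  proof (rule Lim_transform_eventually[OF lim])
    show "\<forall>\<^sub>F \<theta> in at_left pi. ?K \<theta> = gauss_curvature ?\<sigma> (vector [\<theta>, \<phi>])"
      unfolding eventually_at_left_field by (rule exI[of _ 0]) (simp add: K vector_2)
  qed
  ultimately show "positive_gauss_curvature ?\<sigma>"
    unfolding positive_gauss_curvature_def using K Kp by metis
qed

lemma cnt_energy_zero:
  assumes "revolution s rho k0 s1 k01 c C"
  shows "cnt_energy m a r (\<lambda>_. 0) = 1/4 * integral {0..pi} (\<lambda>\<theta>. revolution.mean_density s rho k0 k01 \<theta> - rho \<theta> * s \<theta> * h \<theta>)"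
proof -
  interpret z: kerr_time m a r "\<lambda>_. 0" "\<lambda>_. 0" "\<lambda>_. 0" by (rule kerr_time_zero)
  obtain c C c' C' N d where "energy s rho k0 s1 k01 c C s k0 s1 k01 c' C' (\<lambda>_. 0) (\<lambda>_. 0) (\<lambda>_. 0) s2 h h1 N d"
    using z.energy_locale unfolding zero_simps by blast
  then interpret e: energy s rho k0 s1 k01 c C s k0 s1 k01 c' C' "\<lambda>_. 0" "\<lambda>_. 0" "\<lambda>_. 0" s2 h h1 N d .
  have "e.phys \<theta> = rho \<theta> * s \<theta> * h \<theta>" for \<theta>
    by (simp add: e.phys_def e.chi_def e.sh_def e.Dv_def e.Y_def)
  then show ?thesis using z.cnt_energy_eq[of c C c' C' N d "\<lambda>_. 0"] e.energy_axioms unfolding zero_simps by simp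
qed

end

subsection \<open>The physical integral\<close>

text \<open>Christoffel symbols of the first kind. Products with covariant derivatives involve only
  these, so the inverse of the metric enters merely through its existence.\<close>

definition lowered :: "(real^'n \<Rightarrow> real^'n^'n::finite) \<Rightarrow> real^'n \<Rightarrow> 'n \<Rightarrow> 'n \<Rightarrow> 'n \<Rightarrow> real" where
  "lowered g x l i j = (pd i (\<lambda>z. g z $ j $ l) x + pd j (\<lambda>z. g z $ i $ l) x - pd l (\<lambda>z. g z $ i $ j) x) / 2"

lemma christoffel_lowered: "christoffel g x k i j = (\<Sum>l\<in>UNIV. matrix_inv (g x) $ k $ l * lowered g x l i j)"
  by (simp add: christoffel_def lowered_def sum_divide_distrib)

lemma sum_metric_christoffel:
  assumes inv: "g x ** matrix_inv (g x) = mat 1" and sym: "transpose (g x) = g x"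
  shows "(\<Sum>k\<in>UNIV. g x $ k $ n * christoffel g x k i j) = lowered g x n i j"
proof -
  have s: "g x $ k $ n = g x $ n $ k" for k using sym by (metis transpose_def vec_lambda_beta)
  have "(\<Sum>k\<in>UNIV. g x $ k $ n * christoffel g x k i j) = (\<Sum>k\<in>UNIV. \<Sum>l\<in>UNIV. g x $ n $ k * matrix_inv (g x) $ k $ l * lowered g x l i j)"
    unfolding christoffel_lowered by (simp add: s sum_distrib_left mult.assoc)
  also have "\<dots> = (\<Sum>l\<in>UNIV. (g x ** matrix_inv (g x)) $ n $ l * lowered g x l i j)"
    by (subst sum.swap) (simp add: matrix_matrix_mult_def sum_distrib_right)
  also have "\<dots> = lowered g x n i j" unfolding inv by (simp add: mat_def if_distrib[of "\<lambda>u. u * _"] cong: if_cong)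
  finally show ?thesis .
qed

lemma metric_inner_cov:
  assumes inv: "g (F p) ** matrix_inv (g (F p)) = mat 1" and sym: "transpose (g (F p)) = g (F p)"
  shows "metric_inner (g (F p)) (cov_along g F i V p) n = metric_inner (g (F p)) (pd i V p) n +
    (\<Sum>l\<in>UNIV. \<Sum>\<alpha>\<in>UNIV. \<Sum>\<beta>\<in>UNIV. lowered g (F p) l \<alpha> \<beta> * pd i F p $ \<alpha> * V p $ \<beta> * n $ l)"
proof -
  let ?G = "g (F p)" and ?c = "christoffel g (F p)"
  have "metric_inner ?G (cov_along g F i V p) n = metric_inner ?G (pd i V p) n +
     (\<Sum>k\<in>UNIV. \<Sum>l\<in>UNIV. ?G $ k $ l * (\<Sum>\<alpha>\<in>UNIV. \<Sum>\<beta>\<in>UNIV. ?c k \<alpha> \<beta> * pd i F p $ \<alpha> * V p $ \<beta>) * n $ l)"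
    by (simp add: metric_inner_def cov_along_def distrib_left distrib_right sum.distrib)
  also have "(\<Sum>k\<in>UNIV. \<Sum>l\<in>UNIV. ?G $ k $ l * (\<Sum>\<alpha>\<in>UNIV. \<Sum>\<beta>\<in>UNIV. ?c k \<alpha> \<beta> * pd i F p $ \<alpha> * V p $ \<beta>) * n $ l) =
     (\<Sum>l\<in>UNIV. \<Sum>\<alpha>\<in>UNIV. \<Sum>\<beta>\<in>UNIV. (\<Sum>k\<in>UNIV. ?G $ k $ l * ?c k \<alpha> \<beta>) * pd i F p $ \<alpha> * V p $ \<beta> * n $ l)"
  proof -
    have "(\<Sum>k\<in>UNIV. \<Sum>l\<in>UNIV. ?G $ k $ l * (\<Sum>\<alpha>\<in>UNIV. \<Sum>\<beta>\<in>UNIV. ?c k \<alpha> \<beta> * pd i F p $ \<alpha> * V p $ \<beta>) * n $ l) =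
      (\<Sum>l\<in>UNIV. \<Sum>k\<in>UNIV. \<Sum>\<alpha>\<in>UNIV. \<Sum>\<beta>\<in>UNIV. ?G $ k $ l * (?c k \<alpha> \<beta> * pd i F p $ \<alpha> * V p $ \<beta>) * n $ l)"
      unfolding sum_distrib_left sum_distrib_right by (rule sum.swap)
    also have "\<dots> = (\<Sum>l\<in>UNIV. \<Sum>\<alpha>\<in>UNIV. \<Sum>k\<in>UNIV. \<Sum>\<beta>\<in>UNIV. ?G $ k $ l * (?c k \<alpha> \<beta> * pd i F p $ \<alpha> * V p $ \<beta>) * n $ l)"
      by (rule sum.cong[OF refl]) (rule sum.swap)
    also have "\<dots> = (\<Sum>l\<in>UNIV. \<Sum>\<alpha>\<in>UNIV. \<Sum>\<beta>\<in>UNIV. \<Sum>k\<in>UNIV. ?G $ k $ l * (?c k \<alpha> \<beta> * pd i F p $ \<alpha> * V p $ \<beta>) * n $ l)"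
      by (rule sum.cong[OF refl], rule sum.cong[OF refl]) (rule sum.swap)
    finally show ?thesis unfolding sum_distrib_right by (simp only: mult.assoc)
  qed
  finally show ?thesis unfolding sum_metric_christoffel[of g "F p", OF inv sym] .
qed

lemma has_pd_vec:
  fixes f :: "real^'n::finite \<Rightarrow> real^'k::finite"
  assumes "\<And>j. has_pd i (\<lambda>p. f p $ j) (d $ j) p" shows "has_pd i f d p"
proof -
  have "((\<lambda>s. f (p + s *\<^sub>R axis i 1)) has_derivative (\<lambda>s. s *\<^sub>R d)) (at 0)"
  proof (rule iffD2[OF has_derivative_componentwise_within], rule ballI)
    fix e :: "real^'k" assume "e \<in> Basis"
    then obtain j where e: "e = axis j 1" by (auto simp: Basis_vec_def)
    show "((\<lambda>s. f (p + s *\<^sub>R axis i 1) \<bullet> e) has_derivative (\<lambda>s. s *\<^sub>R d \<bullet> e)) (at 0)"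
      using assms[of j] by (simp add: e inner_axis has_pd_def has_vector_derivative_def)
  qed
  then show ?thesis by (simp add: has_pd_def has_vector_derivative_def)
qed

lemma metric_inner_linear_left:
  "metric_inner A (u + v) n = metric_inner A u n + metric_inner A v n"
  "metric_inner A (u - v) n = metric_inner A u n - metric_inner A v n"
  "metric_inner A (c *\<^sub>R u) n = c * metric_inner A u n"
  "metric_inner A (sum f I) n = (\<Sum>i\<in>I. metric_inner A (f i) n)"
proof -
  show 1: "metric_inner A (u + v) n = metric_inner A u n + metric_inner A v n" for u v
    by (simp add: metric_inner_def distrib_left distrib_right sum.distrib)
  show "metric_inner A (u - v) n = metric_inner A u n - metric_inner A v n"
    by (simp add: metric_inner_def right_diff_distrib left_diff_distrib sum_subtractf)
  show "metric_inner A (c *\<^sub>R u) n = c * metric_inner A u n"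
    by (simp add: metric_inner_def sum_distrib_left mult_ac)
  have 0: "metric_inner A 0 n = 0" by (simp add: metric_inner_def)
  show "metric_inner A (sum f I) n = (\<Sum>i\<in>I. metric_inner A (f i) n)"
    by (induction I rule: infinite_finite_induct) (simp_all add: 0 1)
qed

lemma normal_part_inner:
  assumes "\<And>i. metric_inner (g (F p)) (pd i F p) n = 0"
  shows "metric_inner (g (F p)) (normal_part g F p v) n = metric_inner (g (F p)) v n"
  unfolding normal_part_def by (simp add: metric_inner_linear_left assms)

lemma mean_curvature_inner:
  fixes g :: "real^'n \<Rightarrow> real^'n^'n::finite" and F :: "real^2 \<Rightarrow> real^'n"
  assumes n: "\<And>i. metric_inner (g (F p)) (pd i F p) n = 0"
    and \<sigma>: "matrix_inv (induced_metric g F p) = vector [vector [A, 0], vector [0, B]]"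
  shows "metric_inner (g (F p)) (mean_curvature_vector g F p) n =
    A * metric_inner (g (F p)) (cov_along g F 1 (pd 1 F) p) n + B * metric_inner (g (F p)) (cov_along g F 2 (pd 2 F) p) n"
proof -
  have "mean_curvature_vector g F p = A *\<^sub>R normal_part g F p (cov_along g F 1 (pd 1 F) p) + B *\<^sub>R normal_part g F p (cov_along g F 2 (pd 2 F) p)"
    by (simp add: mean_curvature_vector_def \<sigma> sum_2 vector_2)
  then show ?thesis by (simp add: metric_inner_linear_left normal_part_inner[of g F p n, OF n])
qed

context kerr
begin

text \<open>Lapse and angular velocity of the zero angular momentum observers.\<close>

definition N where "N \<theta> = sqrt D * s \<theta> / b \<theta>"
definition Om where "Om \<theta> = 2 * m * a * r / B \<theta>"
definition Rr where "Rr \<theta> = s \<theta> / sqrt D"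

lemma N_pos: "0 < N \<theta>" and Rr_pos: "0 < Rr \<theta>"
  using D_pos s_pos[of \<theta>] b_pos[of \<theta>] by (simp_all add: N_def Rr_def)

lemma rho_sq: "(rho \<theta>)\<^sup>2 = (sin \<theta>)\<^sup>2 * B \<theta> / P \<theta>"
  by (simp add: rho_def power_mult_distrib power_divide power2_eq_square[of "b \<theta>"] power2_eq_square[of "s \<theta>"] b_sq s_sq)

text \<open>The lapse-shift form of the metric: \<open>- N\<^sup>2 dt\<^sup>2 + rho\<^sup>2 (d\<phi>
  - Om dt)\<^sup>2\<close> plus the radial and polar squares.\<close>

lemma coeff_eq: "kerr_H m a r \<theta> = (rho \<theta>)\<^sup>2" "kerr_Sigma a r \<theta> = s \<theta>" "kerr_R m a r \<theta> = Rr \<theta>"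
  "kerr_G m a r \<theta> = - Om \<theta> * (rho \<theta>)\<^sup>2" "kerr_F m a r \<theta> = (Om \<theta>)\<^sup>2 * (rho \<theta>)\<^sup>2 - (N \<theta>)\<^sup>2"
proof -
  show S: "kerr_Sigma a r \<theta> = s \<theta>" by (simp add: kerr_Sigma_def s_def P_def)
  have S2: "(s \<theta>)\<^sup>2 = P \<theta>" by (simp add: power2_eq_square s_sq)
  show "kerr_H m a r \<theta> = (rho \<theta>)\<^sup>2" by (simp add: kerr_H_def rho_sq S S2 B_def D_def)
  show "kerr_R m a r \<theta> = Rr \<theta>" by (simp add: kerr_R_eq Rr_def)
  show "kerr_G m a r \<theta> = - Om \<theta> * (rho \<theta>)\<^sup>2"
    using B_pos[of \<theta>] by (simp add: kerr_G_def rho_sq S S2 Om_def)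
  have N2: "(N \<theta>)\<^sup>2 = D * P \<theta> / B \<theta>"
    using D_pos by (simp add: N_def power_mult_distrib power_divide S2 power2_eq_square[of "b \<theta>"] b_sq)
  define S where "S = (sin \<theta>)\<^sup>2"
  have PS: "P \<theta> = r\<^sup>2 + a\<^sup>2 - a\<^sup>2 * S" by (simp add: P_def S_def cos_squared_eq right_diff_distrib)
  have BS: "B \<theta> = (r\<^sup>2 + a\<^sup>2)\<^sup>2 - D * a\<^sup>2 * S" by (simp add: B_def S_def)
  have key: "- (D - a\<^sup>2 * S) * B \<theta> = (2 * m * a * r)\<^sup>2 * S - D * (P \<theta>)\<^sup>2"
    unfolding PS BS D_eq by algebra
  have "(Om \<theta>)\<^sup>2 * (rho \<theta>)\<^sup>2 - (N \<theta>)\<^sup>2 = ((2 * m * a * r)\<^sup>2 * S - D * (P \<theta>)\<^sup>2) / (P \<theta> * B \<theta>)"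
    unfolding N2 rho_sq Om_def S_def[symmetric] using P_pos[of \<theta>] B_pos[of \<theta>] by (simp add: divide_simps power2_eq_square)
  also have "\<dots> = - (D - a\<^sup>2 * S) / P \<theta>" unfolding key[symmetric] using P_pos[of \<theta>] B_pos[of \<theta>] by simp
  also have "\<dots> = kerr_F m a r \<theta>" by (simp add: kerr_F_def S S2 S_def D_def)
  finally show "kerr_F m a r \<theta> = (Om \<theta>)\<^sup>2 * (rho \<theta>)\<^sup>2 - (N \<theta>)\<^sup>2" by simp
qed

end

lemma vector_4 [simp]:
  "(vector [w, x, y, z] :: 'a::zero^4) $ 1 = w" "(vector [w, x, y, z] :: 'a::zero^4) $ 2 = x"
  "(vector [w, x, y, z] :: 'a::zero^4) $ 3 = y" "(vector [w, x, y, z] :: 'a::zero^4) $ 4 = z"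
  unfolding vector_def by simp_all

lemma pd_zero: "pd i (\<lambda>z. 0) x = 0"
  by (rule pd_eqI) simp

lemma kerr_metric_nth:
  "kerr_metric m a z $ 1 $ 1 = kerr_F m a (z$2) (z$3)" "kerr_metric m a z $ 1 $ 4 = kerr_G m a (z$2) (z$3)"
  "kerr_metric m a z $ 4 $ 1 = kerr_G m a (z$2) (z$3)" "kerr_metric m a z $ 4 $ 4 = kerr_H m a (z$2) (z$3)"
  "kerr_metric m a z $ 2 $ 2 = (kerr_R m a (z$2) (z$3))\<^sup>2" "kerr_metric m a z $ 3 $ 3 = (kerr_Sigma a (z$2) (z$3))\<^sup>2"
  "kerr_metric m a z $ 1 $ 2 = 0" "kerr_metric m a z $ 1 $ 3 = 0" "kerr_metric m a z $ 2 $ 1 = 0" "kerr_metric m a z $ 2 $ 3 = 0"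
  "kerr_metric m a z $ 2 $ 4 = 0" "kerr_metric m a z $ 3 $ 1 = 0" "kerr_metric m a z $ 3 $ 2 = 0" "kerr_metric m a z $ 3 $ 4 = 0"
  "kerr_metric m a z $ 4 $ 2 = 0" "kerr_metric m a z $ 4 $ 3 = 0"
  by (simp_all add: kerr_metric_def Let_def)

lemma pd_r_theta:
  fixes f :: "real \<Rightarrow> real \<Rightarrow> real" and x :: "real^4"
  shows "pd 1 (\<lambda>z. f (z$2) (z$3)) x = 0" "pd 4 (\<lambda>z. f (z$2) (z$3)) x = 0"
    "((\<lambda>u. f u (x$3)) has_real_derivative d) (at (x$2)) \<Longrightarrow> pd 2 (\<lambda>z. f (z$2) (z$3)) x = d"
    "((\<lambda>u. f (x$2) u) has_real_derivative d) (at (x$3)) \<Longrightarrow> pd 3 (\<lambda>z. f (z$2) (z$3)) x = d"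
proof -
  show "pd 1 (\<lambda>z. f (z$2) (z$3)) x = 0" "pd 4 (\<lambda>z. f (z$2) (z$3)) x = 0"
    by (rule pd_eqI, simp add: has_pd_def axis_def)+
  assume "((\<lambda>u. f u (x$3)) has_real_derivative d) (at (x$2))"
  from has_pd_fun_coord(1)[where F = "\<lambda>u. f u (x$3)", OF this] show "pd 2 (\<lambda>z. f (z$2) (z$3)) x = d"
    by (intro pd_eqI) (simp add: has_pd_def axis_def)
next
  assume "((\<lambda>u. f (x$2) u) has_real_derivative d) (at (x$3))"
  from has_pd_fun_coord(1)[where F = "\<lambda>u. f (x$2) u", OF this] show "pd 3 (\<lambda>z. f (z$2) (z$3)) x = d"
    by (intro pd_eqI) (simp add: has_pd_def axis_def)
qed

lemma pd_kerr_surface: "pd 1 (kerr_surface t r) = (\<lambda>p. axis 3 1)" "pd 2 (kerr_surface t r) = (\<lambda>p. axis 4 1)"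
proof -
  have "has_pd 1 (kerr_surface t r) (axis 3 1) p" for p
  proof (rule has_pd_vec)
    fix j :: 4 show "has_pd 1 (\<lambda>p. kerr_surface t r p $ j) (axis 3 1 $ j) p"
      using exhaust_4[of j] has_pd_coord[of 1 1 p] has_pd_coord[of 1 2 p] by (auto simp: kerr_surface_def axis_def)
  qed
  then show "pd 1 (kerr_surface t r) = (\<lambda>p. axis 3 1)" using pd_eqI by blast
  have "has_pd 2 (kerr_surface t r) (axis 4 1) p" for p
  proof (rule has_pd_vec)
    fix j :: 4 show "has_pd 2 (\<lambda>p. kerr_surface t r p $ j) (axis 4 1 $ j) p"
      using exhaust_4[of j] has_pd_coord[of 2 1 p] has_pd_coord[of 2 2 p] by (auto simp: kerr_surface_def axis_def)
  qed
  then show "pd 2 (kerr_surface t r) = (\<lambda>p. axis 4 1)" using pd_eqI by blast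
qed

context kerr
begin

definition Om1 where "Om1 \<theta> = 2 * m * a * r * (2 * D * a\<^sup>2 * sin \<theta> * cos \<theta>) / (B \<theta>)\<^sup>2"
definition N1 where "N1 \<theta> = sqrt D * (s1 \<theta> * b \<theta> + s \<theta> * (D * a\<^sup>2 * sin \<theta> * cos \<theta> / b \<theta>)) / B \<theta>"
definition Rr1 where "Rr1 \<theta> = s1 \<theta> / sqrt D"

lemma Om_deriv: "(Om has_real_derivative Om1 \<theta>) (at \<theta>)"
  unfolding Om_def[abs_def] Om1_def using B_pos[of \<theta>]
  by (auto intro!: derivative_eq_intros B_deriv simp: power2_eq_square)

lemma N_deriv: "(N has_real_derivative N1 \<theta>) (at \<theta>)"
  unfolding N_def[abs_def] N1_def b_sq[symmetric] using b_pos[of \<theta>]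
  by (auto intro!: derivative_eq_intros s_deriv b_deriv simp: algebra_simps)

lemma Rr_deriv: "(Rr has_real_derivative Rr1 \<theta>) (at \<theta>)"
  unfolding Rr_def[abs_def] Rr1_def by (rule DERIV_cdivide[OF s_deriv])

abbreviation (input) g :: "real^4 \<Rightarrow> real^4^4" where "g \<equiv> kerr_metric m a"

lemma metric_inner_eq:
  assumes z: "z$2 = r" and "z$3 = \<theta>"
  shows "metric_inner (g z) u v = - (N \<theta>)\<^sup>2 * u$1 * v$1 + (rho \<theta>)\<^sup>2 * (u$4 - Om \<theta> * u$1) * (v$4 - Om \<theta> * v$1)
    + (Rr \<theta>)\<^sup>2 * u$2 * v$2 + (s \<theta>)\<^sup>2 * u$3 * v$3"
  by (simp add: metric_inner_def sum_4 kerr_metric_nth assms coeff_eq power2_eq_square algebra_simps)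

lemma kerr_metric_inverse:
  assumes z: "z$2 = r" and \<theta>: "0 < z$3" "z$3 < pi"
  shows "g z ** matrix_inv (g z) = mat 1" and "transpose (g z) = g z"
proof -
  let ?\<theta> = "z$3"
  have p: "0 < rho ?\<theta>" using sin_gt_zero[OF \<theta>] b_pos s_pos by (simp add: rho_def)
  note q = p N_pos[of ?\<theta>] Rr_pos[of ?\<theta>] s_pos[of ?\<theta>]
  define A :: "real^4^4" where "A = vector
     [vector [- 1 / (N ?\<theta>)\<^sup>2, 0, 0, - Om ?\<theta> / (N ?\<theta>)\<^sup>2],
      vector [0, 1 / (Rr ?\<theta>)\<^sup>2, 0, 0],
      vector [0, 0, 1 / (s ?\<theta>)\<^sup>2, 0],
      vector [- Om ?\<theta> / (N ?\<theta>)\<^sup>2, 0, 0, 1 / (rho ?\<theta>)\<^sup>2 - (Om ?\<theta>)\<^sup>2 / (N ?\<theta>)\<^sup>2]]"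
  have "A ** g z = mat 1"
    using q by (simp add: vec_eq_iff forall_4 matrix_matrix_mult_def sum_4 mat_def A_def kerr_metric_nth z coeff_eq field_simps power2_eq_square)
  moreover from this have "matrix_inv (g z) = A" by (rule matrix_inv_unique_left)
  ultimately show "g z ** matrix_inv (g z) = mat 1" using matrix_left_right_inverse by metis
  show "transpose (g z) = g z" by (simp add: vec_eq_iff forall_4 transpose_def kerr_metric_nth)
qed

text \<open>The sum in the second claim is twice the logarithmic \<open>r\<close>-derivative of the
  area element. By the first variation of area, \<open>h\<close> is therefore the size of the mean
  curvature in the unit radial direction.\<close>

lemma coeff_r_deriv:
  assumes "0 < \<theta>" "\<theta> < pi"
  shows "((\<lambda>u. (kerr_Sigma a u \<theta>)\<^sup>2) has_real_derivative 2 * r) (at r)"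
    and "\<exists>d. ((\<lambda>u. kerr_H m a u \<theta>) has_real_derivative d) (at r) \<and> d / (rho \<theta>)\<^sup>2 + 2 * r / (s \<theta>)\<^sup>2 = 2 * h \<theta> * Rr \<theta>"
proof -
  have S: "(\<lambda>u. (kerr_Sigma a u \<theta>)\<^sup>2) = (\<lambda>u. u\<^sup>2 + a\<^sup>2 * (cos \<theta>)\<^sup>2)" by (simp add: kerr_Sigma_def fun_eq_iff)
  show dS: "((\<lambda>u. (kerr_Sigma a u \<theta>)\<^sup>2) has_real_derivative 2 * r) (at r)"
    unfolding S by (auto intro!: derivative_eq_intros)
  let ?f = "\<lambda>u. (sin \<theta>)\<^sup>2 * ((u\<^sup>2 + a\<^sup>2)\<^sup>2 - kerr_Delta m a u * a\<^sup>2 * (sin \<theta>)\<^sup>2)"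
  have d: "(?f has_real_derivative (sin \<theta>)\<^sup>2 * Br \<theta>) (at r)"
    unfolding kerr_Delta_def Br_def by (auto intro!: derivative_eq_intros simp: power2_eq_square algebra_simps)
  have Sr: "(kerr_Sigma a r \<theta>)\<^sup>2 = (s \<theta>)\<^sup>2" by (simp add: coeff_eq)
  have fr: "?f r = (rho \<theta>)\<^sup>2 * (s \<theta>)\<^sup>2" using P_pos[of \<theta>] unfolding rho_sq by (simp add: B_def D_def power2_eq_square[of "s \<theta>"] s_sq)
  have "((\<lambda>u. ?f u / (kerr_Sigma a u \<theta>)\<^sup>2) has_real_derivative
      ((sin \<theta>)\<^sup>2 * Br \<theta> * (s \<theta>)\<^sup>2 - (rho \<theta>)\<^sup>2 * (s \<theta>)\<^sup>2 * (2 * r)) / ((s \<theta>)\<^sup>2 * (s \<theta>)\<^sup>2)) (at r)"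
    using DERIV_divide[OF d dS] s_pos[of \<theta>] unfolding Sr fr by simp
  moreover have "((sin \<theta>)\<^sup>2 * Br \<theta> * (s \<theta>)\<^sup>2 - (rho \<theta>)\<^sup>2 * (s \<theta>)\<^sup>2 * (2 * r)) / ((s \<theta>)\<^sup>2 * (s \<theta>)\<^sup>2) / (rho \<theta>)\<^sup>2 + 2 * r / (s \<theta>)\<^sup>2 = 2 * h \<theta> * Rr \<theta>"
    using s_pos[of \<theta>] b_pos[of \<theta>] sin_gt_zero[OF assms] D_pos unfolding HS_r_eq Rr_def rho_def
    by (simp add: divide_simps power2_eq_square power3_eq_cube) 
  ultimately show "\<exists>d. ((\<lambda>u. kerr_H m a u \<theta>) has_real_derivative d) (at r) \<and> d / (rho \<theta>)\<^sup>2 + 2 * r / (s \<theta>)\<^sup>2 = 2 * h \<theta> * Rr \<theta>"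
    unfolding kerr_H_def by blast
qed

lemma kerr_surface_nth [simp]: "kerr_surface t r p $ 1 = t" "kerr_surface t r p $ 2 = r" "kerr_surface t r p $ 3 = p$1" "kerr_surface t r p $ 4 = p$2"
  by (simp_all add: kerr_surface_def)

lemma pd_kerr_r_zero: "pd 1 (\<lambda>z. g z $ i $ j) x = 0" "pd 4 (\<lambda>z. g z $ i $ j) x = 0"
proof -
  have "\<exists>f. (\<lambda>z. g z $ i $ j) = (\<lambda>z. f (z$2) (z$3))"
    unfolding kerr_metric_def Let_def by (rule exI[of _ "\<lambda>r \<theta>. vector
     [vector [kerr_F m a r \<theta>, 0, 0, kerr_G m a r \<theta>],
      vector [0, (kerr_R m a r \<theta>)\<^sup>2, 0, 0],
      vector [0, 0, (kerr_Sigma a r \<theta>)\<^sup>2, 0],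
      vector [kerr_G m a r \<theta>, 0, 0, kerr_H m a r \<theta>]] $ i $ j"]) (rule refl)
  then obtain f where "(\<lambda>z. g z $ i $ j) = (\<lambda>z. f (z$2) (z$3))" ..
  then show "pd 1 (\<lambda>z. g z $ i $ j) x = 0" "pd 4 (\<lambda>z. g z $ i $ j) x = 0" by (simp_all add: pd_r_theta)
qed

lemma kerr_induced: "polar_metric (induced_metric g (kerr_surface t r)) (\<lambda>\<theta>. (s \<theta>)\<^sup>2) (\<lambda>\<theta>. (rho \<theta>)\<^sup>2) (\<lambda>\<theta>. 2 * s \<theta> * s1 \<theta>) (\<lambda>\<theta>. 2 * rho \<theta> * (s \<theta> * k0 \<theta>))"
proof
  fix p :: "real^2"
  show "induced_metric g (kerr_surface t r) p = vector [vector [(s (p$1))\<^sup>2, 0], vector [0, (rho (p$1))\<^sup>2]]"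
    by (simp add: vec_eq_iff forall_2 induced_metric_def pd_kerr_surface metric_inner_eq[of _ "p$1"] axis_def)
next
  fix \<theta> :: real assume \<theta>: "0 < \<theta>" "\<theta> < pi"
  show "0 < (s \<theta>)\<^sup>2" "0 < (rho \<theta>)\<^sup>2" using s_pos[of \<theta>] b_pos[of \<theta>] sin_gt_zero[OF \<theta>] by (simp_all add: rho_def)
  show "((\<lambda>\<theta>. (s \<theta>)\<^sup>2) has_real_derivative 2 * s \<theta> * s1 \<theta>) (at \<theta>)"
    "((\<lambda>\<theta>. (rho \<theta>)\<^sup>2) has_real_derivative 2 * rho \<theta> * (s \<theta> * k0 \<theta>)) (at \<theta>)"
    by (auto intro!: derivative_eq_intros s_deriv rho_deriv)
qed

context
  fixes t :: real and p :: "real^2"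
  assumes p: "p \<in> polar_dom"
begin

abbreviation (input) "F \<equiv> kerr_surface t r"

text \<open>The normal plane is spanned by the radial direction and the direction of the zero
  angular momentum observers.\<close>

lemma normal_iff: "normal_to g F p v \<longleftrightarrow> v$3 = 0 \<and> v$4 = Om (p$1) * v$1"
proof -
  have "0 < rho (p$1)" using p sin_gt_zero[of "p$1"] b_pos s_pos by (simp add: rho_def mem_polar_dom)
  then show ?thesis using s_pos[of "p$1"]
    by (auto simp: normal_to_def forall_2 pd_kerr_surface metric_inner_eq[of _ "p$1"] axis_def)
qed

lemma inner_normal:
  assumes "normal_to g F p u" "normal_to g F p v"
  shows "metric_inner (g (F p)) u v = - (N (p$1))\<^sup>2 * u$1 * v$1 + (Rr (p$1))\<^sup>2 * u$2 * v$2"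
  using assms by (simp add: normal_iff metric_inner_eq[of _ "p$1"])

text \<open>Against a normal vector, stationarity and axial symmetry leave only
  \<open>r\<close>-derivatives of the metric, so the mean curvature vector is purely radial, of
  length \<open>h\<close>.\<close>

lemma mean_curvature_normal:
  assumes n: "normal_to g F p n"
  shows "metric_inner (g (F p)) (mean_curvature_vector g F p) n = - (h (p$1) * Rr (p$1) * n$2)"
proof -
  let ?\<theta> = "p$1"
  interpret i: polar_metric "induced_metric g F" "\<lambda>\<theta>. (s \<theta>)\<^sup>2" "\<lambda>\<theta>. (rho \<theta>)\<^sup>2" "\<lambda>\<theta>. 2 * s \<theta> * s1 \<theta>" "\<lambda>\<theta>. 2 * rho \<theta> * (s \<theta> * k0 \<theta>)"
    by (rule kerr_induced)
  have \<theta>: "0 < ?\<theta>" "?\<theta> < pi" using p by (auto simp: mem_polar_dom)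
  have inv: "g (F p) ** matrix_inv (g (F p)) = mat 1" "transpose (g (F p)) = g (F p)"
    using kerr_metric_inverse[of "F p"] \<theta> by simp_all
  have ip0: "metric_inner (g (F p)) 0 n = 0" by (simp add: metric_inner_def)
  have n3: "n$3 = 0" using n by (simp add: normal_iff)
  have sym: "metric_inner (g (F p)) u n = metric_inner (g (F p)) n u" for u
    by (simp add: metric_inner_eq[of _ ?\<theta>] mult_ac)
  have n': "metric_inner (g (F p)) (pd i F p) n = 0" for i using n unfolding sym by (simp add: normal_to_def)
  obtain d where d: "((\<lambda>u. kerr_H m a u ?\<theta>) has_real_derivative d) (at r)" "d / (rho ?\<theta>)\<^sup>2 + 2 * r / (s ?\<theta>)\<^sup>2 = 2 * h ?\<theta> * Rr ?\<theta>"
    using coeff_r_deriv(2)[OF \<theta>] by blast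
  have 1: "pd 2 (\<lambda>z. g z $ 3 $ 3) (F p) = 2 * r"
    unfolding kerr_metric_nth by (rule pd_r_theta(3)) (use coeff_r_deriv(1)[OF \<theta>] in simp)
  have 2: "pd 2 (\<lambda>z. g z $ 4 $ 4) (F p) = d"
    unfolding kerr_metric_nth by (rule pd_r_theta(3)) (use d in simp)
  have "metric_inner (g (F p)) (cov_along g F 1 (pd 1 F) p) n = - r * n$2"
    unfolding metric_inner_cov[of g F p, OF inv] pd_kerr_surface pd_zero pd_eqI[OF has_pd_const] ip0 sum_4
    by (simp add: axis_def n3 lowered_def pd_kerr_r_zero 1) (simp add: kerr_metric_nth pd_zero)
  moreover have "metric_inner (g (F p)) (cov_along g F 2 (pd 2 F) p) n = - d / 2 * n$2"
    unfolding metric_inner_cov[of g F p, OF inv] pd_kerr_surface pd_zero pd_eqI[OF has_pd_const] ip0 sum_4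
    by (simp add: axis_def n3 lowered_def pd_kerr_r_zero 2)
  ultimately have "metric_inner (g (F p)) (mean_curvature_vector g F p) n = - ((d / (rho ?\<theta>)\<^sup>2 + 2 * r / (s ?\<theta>)\<^sup>2) / 2 * n$2)"
    unfolding mean_curvature_inner[of g F p, OF n' i.inv[OF p]]
    by (simp add: algebra_simps)
  then show ?thesis unfolding d(2) by simp
qed

text \<open>All terms with \<open>rho\<close> and with the derivative of \<open>Om\<close> cancel
  against a normal \<open>n\<close>: the result is as if the normal plane carried the diagonal
  metric with entries \<open>- N\<^sup>2\<close> and \<open>Rr\<^sup>2\<close>.\<close>

lemma connection_normal:
  assumes e1: "\<And>q. q \<in> polar_dom \<Longrightarrow> e1 q = vector [A (q$1), C (q$1), 0, Om (q$1) * A (q$1)]"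
    and A: "(A has_real_derivative A1) (at (p$1))" and C: "(C has_real_derivative C1) (at (p$1))"
    and n: "normal_to g F p n"
  shows "metric_inner (g (F p)) (cov_along g F 1 e1 p) n =
    - (N (p$1))\<^sup>2 * A1 * n$1 - N (p$1) * N1 (p$1) * A (p$1) * n$1 + (Rr (p$1))\<^sup>2 * C1 * n$2 + Rr (p$1) * Rr1 (p$1) * C (p$1) * n$2"
proof -
  let ?\<theta> = "p$1"
  have \<theta>: "0 < ?\<theta>" "?\<theta> < pi" using p by (auto simp: mem_polar_dom)
  have inv: "g (F p) ** matrix_inv (g (F p)) = mat 1" "transpose (g (F p)) = g (F p)"
    using kerr_metric_inverse[of "F p"] \<theta> by simp_all
  have n3: "n$3 = 0" "n$4 = Om ?\<theta> * n$1" using n by (simp_all add: normal_iff)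
  define V :: "real^4" where "V = vector [A1, C1, 0, Om ?\<theta> * A1 + Om1 ?\<theta> * A ?\<theta>]"
  have V: "pd 1 e1 p = V"
  proof (rule pd_eqI, rule has_pd_cong[OF open_polar_dom p e1[symmetric]], assumption, rule has_pd_vec)
    fix j :: 4
    have "((\<lambda>\<theta>. Om \<theta> * A \<theta>) has_real_derivative Om ?\<theta> * A1 + Om1 ?\<theta> * A ?\<theta>) (at ?\<theta>)"
      by (auto intro!: derivative_eq_intros Om_deriv A)
    from has_pd_fun_coord(1)[OF this] has_pd_fun_coord(1)[OF A] has_pd_fun_coord(1)[OF C]
    show "has_pd 1 (\<lambda>p. vector [A (p$1), C (p$1), 0, Om (p$1) * A (p$1)] $ j) (V $ j) p"
      using exhaust_4[of j] by (auto simp: V_def)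
  qed
  have dF: "pd 3 (\<lambda>z. g z $ 1 $ 1) (F p) = 2 * Om ?\<theta> * Om1 ?\<theta> * (rho ?\<theta>)\<^sup>2 + (Om ?\<theta>)\<^sup>2 * (2 * rho ?\<theta> * (s ?\<theta> * k0 ?\<theta>)) - 2 * N ?\<theta> * N1 ?\<theta>"
    unfolding kerr_metric_nth by (rule pd_r_theta(4))
      (auto simp: coeff_eq intro!: derivative_eq_intros Om_deriv N_deriv rho_deriv)
  have dG: "pd 3 (\<lambda>z. kerr_G m a (z$2) (z$3)) (F p) = - Om1 ?\<theta> * (rho ?\<theta>)\<^sup>2 - Om ?\<theta> * (2 * rho ?\<theta> * (s ?\<theta> * k0 ?\<theta>))"
    by (rule pd_r_theta(4)) (auto simp: coeff_eq intro!: derivative_eq_intros Om_deriv rho_deriv)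
  have dH: "pd 3 (\<lambda>z. g z $ 4 $ 4) (F p) = 2 * rho ?\<theta> * (s ?\<theta> * k0 ?\<theta>)"
    unfolding kerr_metric_nth by (rule pd_r_theta(4)) (auto simp: coeff_eq intro!: derivative_eq_intros rho_deriv)
  have dR: "pd 3 (\<lambda>z. g z $ 2 $ 2) (F p) = 2 * Rr ?\<theta> * Rr1 ?\<theta>"
    unfolding kerr_metric_nth by (rule pd_r_theta(4)) (auto simp: coeff_eq intro!: derivative_eq_intros Rr_deriv)
  have ev: "e1 p = vector [A ?\<theta>, C ?\<theta>, 0, Om ?\<theta> * A ?\<theta>]" by (rule e1[OF p])
  have L: "(\<Sum>l\<in>UNIV. \<Sum>\<alpha>\<in>UNIV. \<Sum>\<beta>\<in>UNIV. lowered g (F p) l \<alpha> \<beta> * axis 3 1 $ \<alpha> * e1 p $ \<beta> * n $ l) =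
    (pd 3 (\<lambda>z. g z $ 1 $ 1) (F p) * A ?\<theta> * n$1 + pd 3 (\<lambda>z. kerr_G m a (z$2) (z$3)) (F p) * (Om ?\<theta> * A ?\<theta> * n$1 + A ?\<theta> * (Om ?\<theta> * n$1))
      + pd 3 (\<lambda>z. g z $ 4 $ 4) (F p) * (Om ?\<theta> * A ?\<theta>) * (Om ?\<theta> * n$1) + pd 3 (\<lambda>z. g z $ 2 $ 2) (F p) * C ?\<theta> * n$2) / 2"
    unfolding sum_4 ev n3
    by (simp add: axis_def lowered_def pd_kerr_r_zero) (simp add: kerr_metric_nth pd_zero algebra_simps)
  show ?thesis
    unfolding metric_inner_cov[of g F p, OF inv] pd_kerr_surface V L dF dG dH dR
    by (simp add: metric_inner_eq[of _ ?\<theta>] V_def n3) (simp add: power2_eq_square algebra_simps)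
qed

end

end

context kerr_time
begin

text \<open>The frame conditions leave only the frame boosted by \<open>chi\<close>, so the
  abstractly given \<open>e0\<close> and \<open>e1\<close> become explicit and can be
  differentiated.\<close>

lemma kerr_integral:
  assumes e: "energy s rho k0 s1 k01 c C w k w1 k1 c' C' y y1 y2 s2 h h1 N' d"
    and frame: "is_kerr_frame m a t r \<tau> e0 e1"
    and \<tau>: "\<And>p. \<tau> (sph p) = tm (p$1)" "\<And>\<theta>. 0 < \<theta> \<Longrightarrow> \<theta> < pi \<Longrightarrow> (tm has_real_derivative y \<theta>) (at \<theta>)"
  shows "wang_yau_integral (kerr_metric m a) (kerr_surface t r) (\<lambda>p. \<tau> (sph p)) e0 e1 =
    2 * pi * integral {0..pi} (energy.phys s rho k0 s1 k01 w w1 y y1 y2 s2 h h1)"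
proof -
  interpret e: energy s rho k0 s1 k01 c C w k w1 k1 c' C' y y1 y2 s2 h h1 N' d by (rule e)
  let ?g = "kerr_metric m a" and ?F = "kerr_surface t r" and ?f = "\<lambda>p. \<tau> (sph p)"
  interpret i: polar_metric "induced_metric ?g ?F" "\<lambda>\<theta>. (s \<theta>)\<^sup>2" "\<lambda>\<theta>. (rho \<theta>)\<^sup>2" "\<lambda>\<theta>. 2 * s \<theta> * s1 \<theta>" "\<lambda>\<theta>. 2 * rho \<theta> * (s \<theta> * k0 \<theta>)"
    by (rule kerr_induced)
  have pdf: "pd 1 ?f p = y (p$1)" "pd 2 ?f p = 0" "pd 1 (pd 1 ?f) p = y1 (p$1)" "pd 2 (pd 2 ?f) p = 0" if p: "p \<in> polar_dom" for p
  proof -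
    have 1: "pd 1 ?f p = y (p$1)" if p: "p \<in> polar_dom" for p
      unfolding \<tau>(1) using p by (intro pd_eqI has_pd_fun_coord(1) \<tau>(2)) (auto simp: mem_polar_dom)
    show "pd 1 ?f p = y (p$1)" by (rule 1[OF p])
    have 2: "pd 2 ?f = (\<lambda>p. 0)" unfolding \<tau>(1) by (rule ext, intro pd_eqI has_pd_other_coord) simp
    show "pd 2 ?f p = 0" "pd 2 (pd 2 ?f) p = 0" by (simp_all add: 2 pd_zero)
    show "pd 1 (pd 1 ?f) p = y1 (p$1)" by (rule i.pd_theta(1)[OF p 1 y_deriv])
  qed
  have cs: "(cosh (e.chi \<theta>))\<^sup>2 = 1 + (e.sh \<theta>)\<^sup>2" "0 < cosh (e.chi \<theta>)" for \<theta>
    by (simp_all add: e.chi_def cosh_arsinh_real add_nonneg_pos)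
  have norm: "sqrt (1 + metric_inner (induced_metric ?g ?F p) (gradient (induced_metric ?g ?F) ?f p) (gradient (induced_metric ?g ?F) ?f p)) = w (p$1) / s (p$1)"
    if p: "p \<in> polar_dom" for p
  proof -
    have "1 + (y (p$1))\<^sup>2 / (s (p$1))\<^sup>2 = (w (p$1) / s (p$1))\<^sup>2"
      using s_pos[of "p$1"] P_pos[of "p$1"] by (simp add: w_sq power_divide divide_simps power2_eq_square[of "s _"] s_sq)
    then show ?thesis unfolding i.gradient_norm[OF p pdf(1,2)[OF p]] using s_pos[of "p$1"] w_pos[of "p$1"] by simp
  qed
  have lap: "laplacian (induced_metric ?g ?F) ?f p = e.Dv (p$1) / s (p$1)" if p: "p \<in> polar_dom" for p
    unfolding i.laplacian_eq[OF p pdf[OF p]] e.Dv_def using s_pos[of "p$1"] rho_pos[of "p$1"] p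
    by (simp add: mem_polar_dom field_simps power2_eq_square)
  have comp: "e0 p $ 1 = cosh (e.chi (p$1)) / N (p$1) \<and> e0 p $ 2 = e.sh (p$1) / Rr (p$1) \<and>
     e1 p = vector [e.sh (p$1) / N (p$1), cosh (e.chi (p$1)) / Rr (p$1), 0, Om (p$1) * (e.sh (p$1) / N (p$1))]
     \<and> normal_to ?g ?F p (e0 p) \<and> normal_to ?g ?F p (e1 p)" if p: "p \<in> polar_dom" for p
  proof -
    let ?\<theta> = "p$1"
    have \<theta>: "0 < ?\<theta>" "?\<theta> < pi" using p by (auto simp: mem_polar_dom)
    note pos = N_pos[of ?\<theta>] Rr_pos[of ?\<theta>] h_pos[of ?\<theta>] w_pos[of ?\<theta>] s_pos[of ?\<theta>] rho_pos[OF \<theta>]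
    have fr: "normal_to ?g ?F p (e0 p)" "metric_inner (?g (?F p)) (e0 p) (e0 p) = -1"
      "metric_inner (?g (?F p)) (e0 p) (kerr_future m a (?F p)) < 0"
      "metric_inner (?g (?F p)) (mean_curvature_vector ?g ?F p) (e0 p) = - (e.Dv ?\<theta> / s ?\<theta>) / (w ?\<theta> / s ?\<theta>)"
      "normal_to ?g ?F p (e1 p)" "metric_inner (?g (?F p)) (e1 p) (e1 p) = 1" "metric_inner (?g (?F p)) (e1 p) (e0 p) = 0" "0 < e1 p $ 2"
      using frame p unfolding is_kerr_frame_def Let_def by (auto simp: norm lap)
    \<comment> \<open>Components in the orthonormal frame of the zero angular momentum observers.
      Orthonormality gives the hyperbolic relations, and the two sign conditions select the
      branch.\<close>
    define x y' u v where "x = N ?\<theta> * e0 p $ 1" and "y' = Rr ?\<theta> * e0 p $ 2" and "u = N ?\<theta> * e1 p $ 1" and "v = Rr ?\<theta> * e1 p $ 2"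
    note d = x_def y'_def u_def v_def
    have "normal_to ?g ?F p (kerr_future m a (?F p))"
      using pos unfolding normal_iff[OF p] by (simp add: kerr_future_def coeff_eq)
    from fr(3)[unfolded inner_normal[OF p fr(1) this]] have "N ?\<theta> * x > 0" by (simp add: kerr_future_def x_def power2_eq_square)
    then have x0: "0 < x" using pos by (simp add: zero_less_mult_iff)
    have v0: "0 < v" using pos fr(8) by (simp add: v_def)
    have "h ?\<theta> * y' = e.Dv ?\<theta> / w ?\<theta>"
      using fr(4) pos unfolding mean_curvature_normal[OF p fr(1)] y'_def by (simp add: mult.assoc)
    then have y': "y' = e.sh ?\<theta>" using pos by (simp add: e.sh_def field_simps)
    have q: "x\<^sup>2 = 1 + y'\<^sup>2" "v\<^sup>2 = 1 + u\<^sup>2" "u * x = v * y'"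
      using fr(2,6,7) unfolding inner_normal[OF p fr(1) fr(1)] inner_normal[OF p fr(5) fr(5)] inner_normal[OF p fr(5) fr(1)] d
      by (simp_all add: power2_eq_square algebra_simps)
    have x: "x = cosh (e.chi ?\<theta>)" by (rule power2_eq_imp_eq) (use q(1) x0 cs[of ?\<theta>] in \<open>auto simp: y'\<close>)
    have "v\<^sup>2 * x\<^sup>2 = x\<^sup>2 + (u * x)\<^sup>2" unfolding q(2) by (simp add: algebra_simps power_mult_distrib)
    then have "v\<^sup>2 = x\<^sup>2" unfolding q(3) power_mult_distrib q(1) by (simp add: algebra_simps)
    then have vx: "v = x" using x0 v0 by (simp add: power2_eq_iff)
    then have uy: "u = y'" using q(3) x0 by simp
    have "e1 p $ 3 = 0" "e1 p $ 4 = Om ?\<theta> * e1 p $ 1" using fr(5) by (simp_all add: normal_iff[OF p])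
    moreover have "e0 p $ 1 = x / N ?\<theta>" "e0 p $ 2 = y' / Rr ?\<theta>" "e1 p $ 1 = u / N ?\<theta>" "e1 p $ 2 = v / Rr ?\<theta>"
      using pos by (simp_all add: d)
    ultimately show ?thesis
      using fr(1,5) unfolding vx uy unfolding x y' by (auto simp: vec_eq_iff forall_4)
  qed
  have density: "(- (w (p$1) / s (p$1)) * metric_inner (?g (?F p)) (mean_curvature_vector ?g ?F p) (e1 p)
      + metric_inner (?g (?F p)) (cov_along_dir ?g ?F (- gradient (induced_metric ?g ?F) ?f p) e1 p) (e0 p)) * sqrt (det (induced_metric ?g ?F p))
      = e.phys (p$1)" if p: "p \<in> polar_dom" for p
  proof -
    let ?\<theta> = "p$1"
    have \<theta>: "0 < ?\<theta>" "?\<theta> < pi" using p by (auto simp: mem_polar_dom)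
    note pos = N_pos[of ?\<theta>] Rr_pos[of ?\<theta>] h_pos[of ?\<theta>] w_pos[of ?\<theta>] s_pos[of ?\<theta>] rho_pos[OF \<theta>]
    note c = comp[OF p]
    define ch where "ch = cosh (e.chi ?\<theta>)"
    have chp: "0 < ch" "ch\<^sup>2 = 1 + (e.sh ?\<theta>)\<^sup>2" using cs by (simp_all add: ch_def)
    have det: "sqrt (det (induced_metric ?g ?F p)) = s ?\<theta> * rho ?\<theta>"
      using pos by (simp add: det_2 i.g_eq[OF p] real_sqrt_mult)
    have A: "((\<lambda>\<theta>. e.sh \<theta> / N \<theta>) has_real_derivative (e.dsh ?\<theta> * N ?\<theta> - e.sh ?\<theta> * N1 ?\<theta>) / (N ?\<theta> * N ?\<theta>)) (at ?\<theta>)"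
      by (rule DERIV_divide[OF e.sh_deriv[OF \<theta>] N_deriv]) (use pos in simp)
    have "((\<lambda>\<theta>. cosh (e.chi \<theta>)) has_real_derivative sinh (e.chi ?\<theta>) * e.dchi ?\<theta>) (at ?\<theta>)"
      by (rule DERIV_chain2[OF _ e.chi_deriv[OF \<theta>]]) (auto intro!: derivative_eq_intros)
    then have Ch: "((\<lambda>\<theta>. cosh (e.chi \<theta>)) has_real_derivative e.sh ?\<theta> * e.dchi ?\<theta>) (at ?\<theta>)" by (simp add: e.chi_def)
    have C: "((\<lambda>\<theta>. cosh (e.chi \<theta>) / Rr \<theta>) has_real_derivative (e.sh ?\<theta> * e.dchi ?\<theta> * Rr ?\<theta> - ch * Rr1 ?\<theta>) / (Rr ?\<theta> * Rr ?\<theta>)) (at ?\<theta>)"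
      unfolding ch_def by (rule DERIV_divide[OF Ch Rr_deriv]) (use pos in simp)
    have "metric_inner (?g (?F p)) (cov_along ?g ?F 1 e1 p) (e0 p) = - (e.dsh ?\<theta> * ch) + e.sh ?\<theta> * (e.sh ?\<theta> * e.dchi ?\<theta>)"
    proof -
      have f: "e1 q = vector [e.sh (q$1) / N (q$1), cosh (e.chi (q$1)) / Rr (q$1), 0, Om (q$1) * (e.sh (q$1) / N (q$1))]"
        if "q \<in> polar_dom" for q using comp[OF that] by blast
      have e0n: "normal_to ?g ?F p (e0 p)" and e0: "e0 p $ 1 = ch / N ?\<theta>" "e0 p $ 2 = e.sh ?\<theta> / Rr ?\<theta>"
        using c by (simp_all add: ch_def)
      show ?thesis
        by (rule trans[OF connection_normal[where A = "\<lambda>\<theta>. e.sh \<theta> / N \<theta>" and C = "\<lambda>\<theta>. cosh (e.chi \<theta>) / Rr \<theta>", OF p f A C e0n]])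
          (use pos in \<open>simp_all add: e0 ch_def[symmetric] field_simps power2_eq_square\<close>)
    qed
    \<comment> \<open>Since \<open>dsh = ch * dchi\<close>, the identity for \<open>cosh\<close> and
      \<open>sinh\<close> leaves only the derivative of the boost.\<close>
    also have "\<dots> = - (ch\<^sup>2 - (e.sh ?\<theta>)\<^sup>2) * e.dchi ?\<theta>"
      using chp(1) by (simp add: e.dchi_def ch_def[symmetric] field_simps power2_eq_square)
    finally have conn: "metric_inner (?g (?F p)) (cov_along ?g ?F 1 e1 p) (e0 p) = - e.dchi ?\<theta>" unfolding chp by simp
    have dir: "cov_along_dir ?g ?F (- gradient (induced_metric ?g ?F) ?f p) e1 p = (- (y ?\<theta> / (s ?\<theta>)\<^sup>2)) *\<^sub>R cov_along ?g ?F 1 e1 p"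
      by (simp add: cov_along_dir_def sum_2 i.gradient_eq[OF p pdf(1,2)[OF p]])
    have e1n: "normal_to ?g ?F p (e1 p)" using c by blast
    have e12: "e1 p $ 2 = ch / Rr ?\<theta>" using c by (simp add: ch_def)
    show ?thesis
      unfolding dir metric_inner_linear_left conn det mean_curvature_normal[OF p e1n] e12 e.phys_def e.Y_def ch_def[symmetric]
      using pos by (simp add: field_simps power2_eq_square)
  qed
  have "wang_yau_integral ?g ?F ?f e0 e1 = integral polar_box (\<lambda>p. e.phys (p$1))"
    unfolding wang_yau_integral_def Let_def
  proof (rule integral_cong)
    fix p :: "real^2" assume "p \<in> polar_box"
    then have p: "p \<in> polar_dom" by (simp add: mem_polar_box mem_polar_dom)
    show "(- sqrt (1 + metric_inner (induced_metric ?g ?F p) (gradient (induced_metric ?g ?F) ?f p) (gradient (induced_metric ?g ?F) ?f p)) *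
        metric_inner (?g (?F p)) (mean_curvature_vector ?g ?F p) (e1 p) +
        metric_inner (?g (?F p)) (cov_along_dir ?g ?F (- gradient (induced_metric ?g ?F) ?f p) e1 p) (e0 p)) *
        sqrt (det (induced_metric ?g ?F p)) = e.phys (p$1)"
      unfolding norm[OF p] by (rule density[OF p])
  qed
  also have "\<dots> = 2 * pi * integral {0..pi} e.phys"
  proof -
    obtain K where K: "\<And>\<theta>. 0 < \<theta> \<Longrightarrow> \<theta> < pi \<Longrightarrow> \<bar>e.phys \<theta>\<bar> \<le> K" using e.bdd_phys unfolding bdd_def by blast
    show ?thesis by (rule integral_unique, rule polar_box_integral_theta[OF e.cont_phys K]) auto
  qed
  finally show ?thesis .
qed

end

subsection \<open>The reference integral\<close>

lemma cov_along_minkowski: "cov_along minkowski_metric F i V p = pd i V p"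
proof -
  have "pd i (\<lambda>z. minkowski_metric z $ j $ l) x = 0" for i j l :: 4 and x
    unfolding minkowski_metric_def by (rule pd_eqI) simp
  then show ?thesis by (simp add: cov_along_def christoffel_def vec_eq_iff)
qed

lemma metric_inner_minkowski: "metric_inner (minkowski_metric z) u v = - (u$1 * v$1) + spatial_part u \<bullet> spatial_part v"
  by (simp add: metric_inner_def minkowski_metric_def sum_4 spatial_part_def inner_vec_def sum_3)

lemma bounded_linear_spatial_part: "bounded_linear spatial_part"
  by (intro linear_conv_bounded_linear[THEN iffD1] linearI) (auto simp: spatial_part_def vec_eq_iff forall_3)

context kerr_time
begin

text \<open>\<open>e1\<close> is the unit normal of the projected surface, and the spatial part of
  \<open>e0\<close> is a multiple of \<open>pd 1 x\<close>. The connection term replaces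
  \<open>w\<^sup>2\<close> by \<open>w\<^sup>2 - y\<^sup>2 = s\<^sup>2\<close> in the coefficient of
  \<open>L11\<close>, which becomes \<open>rho / w\<close>, the weight belonging to the augmented
  metric.\<close>

lemma minkowski_integral:
  fixes X :: "real^3 \<Rightarrow> real^4"
  assumes S: "convex_surface w rho k w1 k1 c C (\<lambda>p. spatial_part (X (sph p))) \<epsilon> (\<lambda>q. spatial_part (X q))"
    and smooth_X: "smooth (\<lambda>p. X (sph p)) polar_dom"
    and metric: "\<And>p. p \<in> polar_dom \<Longrightarrow> induced_metric minkowski_metric (\<lambda>q. X (sph q)) p = induced_metric (kerr_metric m a) (kerr_surface t r) p"
    and \<tau>: "\<And>p. \<tau> (sph p) = tm (p$1)" "\<And>\<theta>. 0 < \<theta> \<Longrightarrow> \<theta> < pi \<Longrightarrow> (tm has_real_derivative y \<theta>) (at \<theta>)"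
    and time: "\<And>q. q \<in> sphere 0 1 \<Longrightarrow> X q $ 1 = \<tau> q"
    and frame: "is_minkowski_frame X e0 e1"
    and bd: "\<And>p. p \<in> polar_dom \<Longrightarrow> \<bar>surface.L11 w rho (\<lambda>p. spatial_part (X (sph p))) \<epsilon> p\<bar> \<le> Bd"
      "\<And>p. p \<in> polar_dom \<Longrightarrow> \<bar>surface.L12 w rho (\<lambda>p. spatial_part (X (sph p))) \<epsilon> p\<bar> \<le> Bd * sin (p$1)"
      "\<And>p. p \<in> polar_dom \<Longrightarrow> \<bar>surface.L22 w rho (\<lambda>p. spatial_part (X (sph p))) \<epsilon> p\<bar> \<le> Bd * (sin (p$1))\<^sup>2"
  shows "wang_yau_integral minkowski_metric (\<lambda>q. X (sph q)) (\<lambda>p. \<tau> (sph p)) e0 e1 =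
    2 * pi * integral {0..pi} (revolution.mean_density w rho k k1)"
proof -
  define x where "x p = spatial_part (X (sph p))" for p
  interpret S: convex_surface w rho k w1 k1 c C x \<epsilon> "\<lambda>q. spatial_part (X q)" using S unfolding x_def .
  let ?g = minkowski_metric and ?F = "\<lambda>q. X (sph q)" and ?f = "\<lambda>p. \<tau> (sph p)"
  interpret i: polar_metric "induced_metric ?g ?F" "\<lambda>\<theta>. (s \<theta>)\<^sup>2" "\<lambda>\<theta>. (rho \<theta>)\<^sup>2" "\<lambda>\<theta>. 2 * s \<theta> * s1 \<theta>" "\<lambda>\<theta>. 2 * rho \<theta> * (s \<theta> * k0 \<theta>)"
    using kerr_induced metric unfolding polar_metric_def by auto
  have F1: "X (sph p) $ 1 = tm (p$1)" for p using time[of "sph p"] \<tau>(1)[of p] by (simp add: norm_sph)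
  have pdf: "pd 1 ?f p = y (p$1)" "pd 2 ?f p = 0" if p: "p \<in> polar_dom" for p
  proof -
    show "pd 1 ?f p = y (p$1)" unfolding \<tau>(1) using p by (intro pd_eqI has_pd_fun_coord(1) \<tau>(2)) (auto simp: mem_polar_dom)
    show "pd 2 ?f p = 0" unfolding \<tau>(1) by (intro pd_eqI has_pd_other_coord) simp
  qed
  have pdF1: "pd 1 ?F p $ 1 = y (p$1)" "pd 2 ?F p $ 1 = 0" if p: "p \<in> polar_dom" for p
  proof -
    have "pd i (\<lambda>q. X (sph q) $ 1) p = pd i ?F p $ 1" for i
      by (rule pd_eqI[OF has_pd_linear[OF bounded_linear_vec_nth smooth_has_pd'[OF smooth_X p]]])
    then show "pd 1 ?F p $ 1 = y (p$1)" "pd 2 ?F p $ 1 = 0" using pdf[OF p] unfolding F1 \<tau>(1) by auto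
  qed
  have pdx: "spatial_part (pd i ?F p) = pd i x p" if p: "p \<in> polar_dom" for p i
    unfolding x_def[abs_def] by (rule pd_eqI[OF has_pd_linear[OF bounded_linear_spatial_part smooth_has_pd'[OF smooth_X p]], symmetric])
  have pdxx: "spatial_part (pd i (pd i ?F) p) = pd i (pd i x) p" if p: "p \<in> polar_dom" for p i
  proof -
    have "pd i (pd i x) p = pd i (\<lambda>p. spatial_part (pd i ?F p)) p"
      by (rule pd_cong[OF open_polar_dom p]) (simp add: pdx)
    also have "\<dots> = spatial_part (pd i (pd i ?F) p)"
      by (rule pd_eqI[OF has_pd_linear[OF bounded_linear_spatial_part smooth_has_pd'[OF smooth_pd[OF smooth_X open_polar_dom] p]]])
    finally show ?thesis ..
  qed
  have norm: "sqrt (1 + metric_inner (induced_metric ?g ?F p) (gradient (induced_metric ?g ?F) ?f p) (gradient (induced_metric ?g ?F) ?f p)) = w (p$1) / s (p$1)"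
    if p: "p \<in> polar_dom" for p
  proof -
    have "1 + (y (p$1))\<^sup>2 / (s (p$1))\<^sup>2 = (w (p$1) / s (p$1))\<^sup>2"
      using s_pos[of "p$1"] P_pos[of "p$1"] by (simp add: w_sq power_divide divide_simps power2_eq_square[of "s _"] s_sq)
    then show ?thesis unfolding i.gradient_norm[OF p pdf(1,2)[OF p]] using s_pos[of "p$1"] w_pos[of "p$1"] by simp
  qed
  have fr: "normal_to ?g ?F p (e1 p)" "metric_inner (?g (?F p)) (e1 p) (e1 p) = 1" "metric_inner (?g (?F p)) (e1 p) (axis 1 1) = 0"
    "\<exists>\<delta>>0. \<forall>s\<in>{0<..<\<delta>}. spatial_part (X (sph p) + s *\<^sub>R e1 p) \<in> outside ((\<lambda>q. spatial_part (X q)) ` sphere 0 1)"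
    "normal_to ?g ?F p (e0 p)" "metric_inner (?g (?F p)) (e0 p) (e0 p) = -1" "metric_inner (?g (?F p)) (e0 p) (e1 p) = 0"
    "metric_inner (?g (?F p)) (e0 p) (axis 1 1) < 0" if "p \<in> polar_dom" for p
    using frame that unfolding is_minkowski_frame_def Let_def image_image by auto
  have dT: "metric_inner (?g z) u (axis 1 1) = - u$1" for z u
    by (simp add: metric_inner_minkowski spatial_part_def axis_def inner_vec_def sum_3)
  have e1_time: "e1 p $ 1 = 0" if "p \<in> polar_dom" for p using fr(3)[OF that] unfolding dT by simp
  have e1: "spatial_part (e1 p) = S.nu p" if p: "p \<in> polar_dom" for p
  proof -
    have n: "spatial_part (e1 p) \<bullet> pd i x p = 0" for i
      using fr(1)[OF p] e1_time[OF p] by (simp add: normal_to_def metric_inner_minkowski pdx[OF p])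
    have u: "spatial_part (e1 p) \<bullet> spatial_part (e1 p) = 1"
      using fr(2)[OF p] e1_time[OF p] by (simp add: metric_inner_minkowski)
    obtain \<delta> where "0 < \<delta>" "\<And>s. s \<in> {0<..<\<delta>} \<Longrightarrow> spatial_part (X (sph p) + s *\<^sub>R e1 p) \<in> outside ((\<lambda>q. spatial_part (X q)) ` sphere 0 1)"
      using fr(4)[OF p] by blast
    then show ?thesis
      by (intro S.outward_normal[OF p u n n])
        (auto simp: x_def linear_add[OF bounded_linear.linear[OF bounded_linear_spatial_part]]
          linear_cmul[OF bounded_linear.linear[OF bounded_linear_spatial_part]])
  qed
  have e0: "spatial_part (e0 p) = (y (p$1) / (s (p$1) * w (p$1))) *\<^sub>R pd 1 x p" if p: "p \<in> polar_dom" for p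
  proof -
    let ?v = "spatial_part (e0 p)" and ?\<alpha> = "e0 p $ 1" and ?y = "y (p$1)" and ?w = "w (p$1)" and ?s = "s (p$1)"
    note pos = w_pos[of "p$1"] s_pos[of "p$1"]
    have n: "?v \<bullet> pd 1 x p = ?\<alpha> * ?y" "?v \<bullet> pd 2 x p = 0" "?v \<bullet> S.nu p = 0"
      using fr(5,7)[OF p] e1_time[OF p] by (simp_all add: normal_to_def forall_2 metric_inner_minkowski pdx[OF p] pdF1[OF p] e1[OF p])
    have v: "?v = (?\<alpha> * ?y / ?w\<^sup>2) *\<^sub>R pd 1 x p" using S.expansion[OF p, of ?v] unfolding n by simp
    have "?v \<bullet> ?v = (?\<alpha> * ?y / ?w\<^sup>2) * (?v \<bullet> pd 1 x p)" by (subst (2) v) simp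
    then have "?v \<bullet> ?v = ?\<alpha>\<^sup>2 * ?y\<^sup>2 / ?w\<^sup>2" unfolding n by (simp add: power2_eq_square)
    moreover have "?v \<bullet> ?v = ?\<alpha>\<^sup>2 - 1" using fr(6)[OF p] by (simp add: metric_inner_minkowski power2_eq_square)
    ultimately have "?\<alpha>\<^sup>2 * ?w\<^sup>2 - ?w\<^sup>2 = ?\<alpha>\<^sup>2 * ?y\<^sup>2" using pos by (simp add: field_simps)
    moreover have "?w\<^sup>2 - ?y\<^sup>2 = ?s\<^sup>2" by (simp add: w_sq power2_eq_square[of ?s] s_sq)
    then have "?\<alpha>\<^sup>2 * ?w\<^sup>2 - ?\<alpha>\<^sup>2 * ?y\<^sup>2 = ?\<alpha>\<^sup>2 * ?s\<^sup>2" by (metis right_diff_distrib)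
    ultimately have "(?\<alpha> * ?s)\<^sup>2 = ?w\<^sup>2" by (simp add: power_mult_distrib)
    moreover have "0 < ?\<alpha> * ?s" using fr(8)[OF p] pos unfolding dT by simp
    ultimately have "?\<alpha> * ?s = ?w" using pos by (intro power2_eq_imp_eq[of "?\<alpha> * ?s" ?w]) simp_all
    then have "?\<alpha> = ?w / ?s" using pos by (simp add: field_simps)
    then show ?thesis using v pos by (simp add: power2_eq_square)
  qed
  \<comment> \<open>\<open>e1\<close> is only known as a function satisfying the frame conditions;
    on the open chart it equals \<open>emb (nu p)\<close>, which can be differentiated.\<close>
  define emb where "emb v = (vector [0, v$1, v$2, v$3] :: real^4)" for v :: "real^3"
  have emb: "bounded_linear emb"
    by (intro linear_conv_bounded_linear[THEN iffD1] linearI) (auto simp: emb_def vec_eq_iff forall_4)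
  have emb_spatial: "spatial_part (emb v) = v" "emb v $ 1 = 0" for v by (simp_all add: spatial_part_def emb_def vec_eq_iff forall_3)
  have e1_emb: "e1 p = emb (S.nu p)" if p: "p \<in> polar_dom" for p
    using e1[OF p] e1_time[OF p] by (auto simp: emb_def spatial_part_def vec_eq_iff forall_4 forall_3)
  have pd_e1: "pd 1 e1 p = emb (pd 1 S.nu p)" if p: "p \<in> polar_dom" for p
    using pd_cong[OF open_polar_dom p e1_emb, where i = 1] pd_eqI[OF has_pd_linear[OF emb S.nu_has_pd[OF p]]] by simp
  have density: "(- (w (p$1) / s (p$1)) * metric_inner (?g (?F p)) (mean_curvature_vector ?g ?F p) (e1 p)
      + metric_inner (?g (?F p)) (cov_along_dir ?g ?F (- gradient (induced_metric ?g ?F) ?f p) e1 p) (e0 p)) * sqrt (det (induced_metric ?g ?F p))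
      = w (p$1) * S.L22 p / rho (p$1) + rho (p$1) * S.L11 p / w (p$1)" if p: "p \<in> polar_dom" for p
  proof -
    let ?\<theta> = "p$1"
    have \<theta>: "0 < ?\<theta>" "?\<theta> < pi" using p by (auto simp: mem_polar_dom)
    note pos = w_pos[of ?\<theta>] s_pos[of ?\<theta>] rho_pos[OF \<theta>]
    have det: "sqrt (det (induced_metric ?g ?F p)) = s ?\<theta> * rho ?\<theta>"
      using pos by (simp add: det_2 i.g_eq[OF p] real_sqrt_mult)
    have n: "metric_inner (?g (?F p)) (pd i ?F p) (e1 p) = 0" for i
      using fr(1)[OF p] by (simp add: normal_to_def metric_inner_minkowski inner_commute mult.commute)
    have "metric_inner (?g (?F p)) (pd i (pd i ?F) p) (e1 p) = pd i (pd i x) p \<bullet> S.nu p" for i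
      by (simp add: metric_inner_minkowski e1_time[OF p] e1[OF p] pdxx[OF p])
    then have H: "metric_inner (?g (?F p)) (mean_curvature_vector ?g ?F p) (e1 p) = - S.L11 p / (s ?\<theta>)\<^sup>2 - S.L22 p / (rho ?\<theta>)\<^sup>2"
      unfolding mean_curvature_inner[of ?g ?F p, OF n i.inv[OF p]] cov_along_minkowski S.L11_def S.L22_def by simp
    have dir: "cov_along_dir ?g ?F (- gradient (induced_metric ?g ?F) ?f p) e1 p = (- (y ?\<theta> / (s ?\<theta>)\<^sup>2)) *\<^sub>R emb (pd 1 S.nu p)"
      by (simp add: cov_along_dir_def sum_2 i.gradient_eq[OF p pdf(1,2)[OF p]] cov_along_minkowski pd_e1[OF p])
    have "pd 1 S.nu p \<bullet> pd 1 x p = S.L11 p"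
      using pos S.first_form[OF p] by (simp add: S.pd_nu[OF p] inner_add_left inner_commute[of "pd 2 x p" "pd 1 x p"])
    then have C: "metric_inner (?g (?F p)) (emb (pd 1 S.nu p)) (e0 p) = y ?\<theta> / (s ?\<theta> * w ?\<theta>) * S.L11 p"
      by (simp add: metric_inner_minkowski emb_spatial e0[OF p])
    have "(w ?\<theta>)\<^sup>2 - (y ?\<theta>)\<^sup>2 = (s ?\<theta>)\<^sup>2" by (simp add: w_sq power2_eq_square[of "s ?\<theta>"] s_sq)
    then have y2: "y ?\<theta> * y ?\<theta> = w ?\<theta> * w ?\<theta> - s ?\<theta> * s ?\<theta>" by (simp add: power2_eq_square)
    have "(- (w ?\<theta> / s ?\<theta>) * (- S.L11 p / (s ?\<theta>)\<^sup>2 - S.L22 p / (rho ?\<theta>)\<^sup>2) + - (y ?\<theta> / (s ?\<theta>)\<^sup>2) * (y ?\<theta> / (s ?\<theta> * w ?\<theta>) * S.L11 p)) * (s ?\<theta> * rho ?\<theta>)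
      = w ?\<theta> * S.L22 p / rho ?\<theta> + rho ?\<theta> * S.L11 p * (w ?\<theta> * w ?\<theta> - y ?\<theta> * y ?\<theta>) / ((s ?\<theta>)\<^sup>2 * w ?\<theta>)"
      using pos by (simp add: divide_simps power2_eq_square) (simp add: algebra_simps)
    also have "\<dots> = w ?\<theta> * S.L22 p / rho ?\<theta> + rho ?\<theta> * S.L11 p / w ?\<theta>"
      unfolding y2 using pos by (simp add: power2_eq_square)
    finally show ?thesis unfolding H det dir metric_inner_linear_left C .
  qed
  have "wang_yau_integral ?g ?F ?f e0 e1 = integral polar_box (\<lambda>p. w (p$1) * S.L22 p / rho (p$1) + rho (p$1) * S.L11 p / w (p$1))"
    unfolding wang_yau_integral_def Let_def
  proof (rule integral_cong)
    fix p :: "real^2" assume "p \<in> polar_box"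
    then have p: "p \<in> polar_dom" by (simp add: mem_polar_box mem_polar_dom)
    show "(- sqrt (1 + metric_inner (induced_metric ?g ?F p) (gradient (induced_metric ?g ?F) ?f p) (gradient (induced_metric ?g ?F) ?f p)) *
        metric_inner (?g (?F p)) (mean_curvature_vector ?g ?F p) (e1 p) +
        metric_inner (?g (?F p)) (cov_along_dir ?g ?F (- gradient (induced_metric ?g ?F) ?f p) e1 p) (e0 p)) *
        sqrt (det (induced_metric ?g ?F p)) = w (p$1) * S.L22 p / rho (p$1) + rho (p$1) * S.L11 p / w (p$1)"
      unfolding norm[OF p] by (rule density[OF p])
  qed
  also have "\<dots> = 2 * pi * integral {0..pi} S.mean_density"
    by (rule S.total_mean_curvature[OF bd[unfolded x_def[symmetric]]])
  finally show ?thesis .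
qed

end

subsection \<open>Smooth maps of the sphere in polar coordinates\<close>

lemma smooth_sin_cos: "smooth (sin :: real \<Rightarrow> real) UNIV" "smooth (cos :: real \<Rightarrow> real) UNIV"
proof -
  have "Ck_on k (sin :: real \<Rightarrow> real) UNIV \<and> Ck_on k (cos :: real \<Rightarrow> real) UNIV" for k
  proof (induction k)
    case 0
    then show ?case by (simp add: continuous_intros)
  next
    case (Suc k)
    have "Ck_on (Suc k) (sin :: real \<Rightarrow> real) UNIV"
    proof (rule Ck_on_SucI[where D = "\<lambda>x v. cos x * v"])
      show "(sin has_derivative (\<lambda>v. cos x * v)) (at x)" for x :: real
        using DERIV_sin[of x] by (simp add: has_field_derivative_def)
      show "Ck_on k (\<lambda>x. cos x * v) UNIV" for v :: real
        using Suc by (intro Ck_on_linear[OF bounded_linear_mult_left]) auto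
    qed simp
    moreover have "Ck_on (Suc k) (cos :: real \<Rightarrow> real) UNIV"
    proof (rule Ck_on_SucI[where D = "\<lambda>x v. sin x * (- v)"])
      show "(cos has_derivative (\<lambda>v. sin x * (- v))) (at x)" for x :: real
        using DERIV_cos[of x] unfolding has_field_derivative_def by (rule has_derivative_eq_rhs) auto
      show "Ck_on k (\<lambda>x. sin x * (- v)) UNIV" for v :: real
        using Suc by (intro Ck_on_linear[OF bounded_linear_mult_left]) auto
    qed simp
    ultimately show ?case ..
  qed
  then show "smooth (sin :: real \<Rightarrow> real) UNIV" "smooth (cos :: real \<Rightarrow> real) UNIV" by (simp_all add: smooth_def)
qed

lemma smooth_add: "open U \<Longrightarrow> smooth f U \<Longrightarrow> smooth g U \<Longrightarrow> smooth (\<lambda>x. f x + g x) U"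
  unfolding smooth_def using Ck_on_add by blast

lemma smooth_id: "open U \<Longrightarrow> smooth (\<lambda>x. x) U"
proof -
  assume U: "open U"
  have "Ck_on k (\<lambda>x. x) U" for k
  proof (cases k)
    case 0 then show ?thesis by (simp add: continuous_intros)
  next
    case (Suc l)
    then show ?thesis by (auto intro!: Ck_on_SucI[where D = "\<lambda>x v. v"] U Ck_on_const has_derivative_ident simp del: Ck_on.simps)
  qed
  then show ?thesis by (simp add: smooth_def)
qed

lemma smooth_sph: "smooth sph UNIV"
proof -
  have c: "smooth (\<lambda>p::real^2. f (p$i)) UNIV" if "smooth f UNIV" for f :: "real \<Rightarrow> real" and i
    by (rule smooth_compose[OF that smooth_linear[OF bounded_linear_vec_nth open_UNIV smooth_id]]) auto
  note sc = smooth_sin_cos[THEN c]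
  have v: "smooth (\<lambda>p. f p *\<^sub>R (v :: real^3)) UNIV" if "smooth f UNIV" for f :: "real^2 \<Rightarrow> real" and v
    by (rule smooth_linear[OF bounded_linear_scaleR_left open_UNIV that])
  have e: "sph = (\<lambda>p. (sin (p$1) * cos (p$2)) *\<^sub>R axis 1 1 + (sin (p$1) * sin (p$2)) *\<^sub>R axis 2 1 + cos (p$1) *\<^sub>R axis 3 1)"
    by (auto simp: vec_eq_iff forall_3 sph_nth axis_def)
  show ?thesis
    unfolding e by (intro smooth_add open_UNIV v sc smooth_bilinear[OF bounded_bilinear_mult open_UNIV])
qed

section \<open>The unit tangent frame of the sphere and derivatives along it\<close>

definition sph_theta :: "real^2 \<Rightarrow> real^3" where
  "sph_theta p = vector [cos (p$1) * cos (p$2), cos (p$1) * sin (p$2), - sin (p$1)]"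

definition sph_phi :: "real^2 \<Rightarrow> real^3" where
  "sph_phi p = vector [- sin (p$2), cos (p$2), 0]"

lemma has_pd_sph: "has_pd 1 sph (sph_theta p) p" "has_pd 2 sph (sin (p$1) *\<^sub>R sph_phi p) p"
  "has_pd 1 sph_theta (- sph p) p" "has_pd 1 sph_phi 0 p"
  "has_pd 2 sph_phi (- (sin (p$1) *\<^sub>R sph p + cos (p$1) *\<^sub>R sph_theta p)) p"
proof -
  note sc = DERIV_sin[THEN has_pd_fun_coord(1)] DERIV_cos[THEN has_pd_fun_coord(1)] has_pd_other_coord[where F = sin] has_pd_other_coord[where F = cos]
  note m = has_pd_mult has_pd_minus sc has_pd_const
  have 3: "(\<forall>j. P j) \<longleftrightarrow> P 1 \<and> P 2 \<and> P 3" for P :: "3 \<Rightarrow> bool" by (rule forall_3)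
  have sq: "sin (p$1) * (sin (p$1) * u) = u - cos (p$1) * (cos (p$1) * u)" for u
    using sin_cos_squared_add[of "p$1"] by (simp add: power2_eq_square left_diff_distrib flip: mult.assoc eq_diff_eq)
  show "has_pd 1 sph (sph_theta p) p"
    by (rule has_pd_vec, unfold sph_def sph_theta_def, rule spec, unfold 3 vector_3, intro conjI; rule has_pd_eq_rhs, (rule m | simp)+)
  show "has_pd 2 sph (sin (p$1) *\<^sub>R sph_phi p) p"
    by (rule has_pd_vec, unfold sph_def sph_phi_def vector_scaleR_component, rule spec, unfold 3 vector_3, intro conjI; rule has_pd_eq_rhs, (rule m | simp)+)
  show "has_pd 1 sph_theta (- sph p) p"
    by (rule has_pd_vec, unfold sph_def sph_theta_def vector_uminus_component, rule spec, unfold 3 vector_3, intro conjI; rule has_pd_eq_rhs, (rule m | simp)+)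
  show "has_pd 1 sph_phi 0 p"
    by (rule has_pd_vec, unfold sph_phi_def zero_index, rule spec, unfold 3 vector_3, intro conjI; rule has_pd_eq_rhs, (rule m | simp)+)
  show "has_pd 2 sph_phi (- (sin (p$1) *\<^sub>R sph p + cos (p$1) *\<^sub>R sph_theta p)) p"
    by (rule has_pd_vec, unfold sph_def sph_theta_def sph_phi_def vector_uminus_component vector_add_component vector_scaleR_component, rule spec, unfold 3 vector_3,
        intro conjI; rule has_pd_eq_rhs, (rule m | simp add: sq)+)
qed

lemma norm_sph_frame: "norm (sph_theta p) = 1" "norm (sph_phi p) = 1"
proof -
  have sq: "sin u * (sin u * z) = z - cos u * (cos u * z)" for u z :: real
    using sin_cos_squared_add[of u] by (simp add: power2_eq_square left_diff_distrib flip: mult.assoc eq_diff_eq)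
  have sq1: "sin u * sin u = 1 - cos u * cos u" for u :: real using sq[of u 1] by simp
  show "norm (sph_theta p) = 1" "norm (sph_phi p) = 1"
    by (simp_all add: sph_theta_def sph_phi_def norm_eq_sqrt_inner inner_vec_def sum_3 sq sq1 algebra_simps)
qed

lemma has_pd_compose:
  assumes "(f has_derivative D) (at (g p))" "has_pd i g d p" shows "has_pd i (\<lambda>p. f (g p)) (D d) p"
proof -
  have g: "((\<lambda>s. g (p + s *\<^sub>R axis i 1)) has_derivative (\<lambda>s. s *\<^sub>R d)) (at 0)"
    using assms(2) by (simp add: has_pd_def has_vector_derivative_def)
  have "((\<lambda>s. f (g (p + s *\<^sub>R axis i 1))) has_derivative (\<lambda>s. D (s *\<^sub>R d))) (at 0)"
    by (rule has_derivative_compose[OF g]) (use assms(1) in simp)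
  then show ?thesis
    using linear_cmul[OF has_derivative_linear[OF assms(1)]] by (simp add: has_pd_def has_vector_derivative_def)
qed

lemma sum_axis: "(\<Sum>j\<in>UNIV. v $ j *\<^sub>R axis j 1) = (v :: real^'n::finite)"
  by (simp add: vec_eq_iff axis_def if_distrib[of "\<lambda>x. _ * x"] cong: if_cong)

locale sphere_map =
  fixes U :: "(real^3) set" and H :: "real^3 \<Rightarrow> real^3"
  assumes open_U: "open U" and sphere_U: "sphere 0 1 \<subseteq> U" and smooth_H: "smooth H U"
begin

definition A where "A v q = frechet_derivative H (at q) v"
definition A2 where "A2 v d q = (\<Sum>j\<in>UNIV. v $ j *\<^sub>R frechet_derivative (A (axis j 1)) (at q) d)"
definition x where "x p = H (sph p)"

lemma sph_U: "sph p \<in> U"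
  using sphere_U sph_in_sphere by blast

lemma smooth_A: "smooth (A v) U"
  unfolding A_def[abs_def] by (rule smooth_frechet[OF smooth_H])

lemma linear_A: "q \<in> U \<Longrightarrow> linear (\<lambda>v. A v q)"
  unfolding A_def by (rule has_derivative_linear[OF smooth_has_derivative[OF smooth_H]])

lemma A_expansion: "q \<in> U \<Longrightarrow> A v q = (\<Sum>j\<in>UNIV. v $ j *\<^sub>R A (axis j 1) q)"
  using linear_sum[OF linear_A, of q "\<lambda>j. v $ j *\<^sub>R axis j 1" UNIV] by (simp add: sum_axis linear_cmul[OF linear_A])

text \<open>The direction varies with the point. Expanding it in the standard basis separates its
  own derivative from the second derivative \<open>A2\<close> of \<open>H\<close>.\<close>

lemma has_pd_A:
  assumes V: "has_pd i V V' p" and d: "has_pd i sph d p"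
  shows "has_pd i (\<lambda>p. A (V p) (sph p)) (A V' (sph p) + A2 (V p) d (sph p)) p"
proof -
  have "has_pd i (\<lambda>p. V p $ j *\<^sub>R A (axis j 1) (sph p))
      (V p $ j *\<^sub>R frechet_derivative (A (axis j 1)) (at (sph p)) d + V' $ j *\<^sub>R A (axis j 1) (sph p)) p" for j
    by (rule has_pd_scaleR[OF has_pd_linear[OF bounded_linear_vec_nth V] has_pd_compose[OF smooth_has_derivative[OF smooth_A sph_U] d]])
  then have "has_pd i (\<lambda>p. \<Sum>j\<in>UNIV. V p $ j *\<^sub>R A (axis j 1) (sph p))
      (\<Sum>j\<in>UNIV. V p $ j *\<^sub>R frechet_derivative (A (axis j 1)) (at (sph p)) d + V' $ j *\<^sub>R A (axis j 1) (sph p)) p"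
    by (rule has_pd_sum)
  then show ?thesis
    unfolding A_expansion[OF sph_U, symmetric] by (simp add: A2_def sum.distrib A_expansion[OF sph_U, of V'] add.commute)
qed

lemma pd_x: "pd 1 x p = A (sph_theta p) (sph p)" "pd 2 x p = sin (p$1) *\<^sub>R A (sph_phi p) (sph p)"
  "pd 1 (pd 1 x) p = A (- sph p) (sph p) + A2 (sph_theta p) (sph_theta p) (sph p)"
  "pd 1 (pd 2 x) p = cos (p$1) *\<^sub>R A (sph_phi p) (sph p) + sin (p$1) *\<^sub>R A2 (sph_phi p) (sph_theta p) (sph p)"
  "pd 2 (pd 2 x) p = sin (p$1) *\<^sub>R (A (- (sin (p$1) *\<^sub>R sph p + cos (p$1) *\<^sub>R sph_theta p)) (sph p) + A2 (sph_phi p) (sin (p$1) *\<^sub>R sph_phi p) (sph p))"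
proof -
  have A0: "A 0 (sph p) = 0" for p by (rule linear_0[OF linear_A[OF sph_U]])
  have c: "has_pd i x (A d (sph p)) p" if "has_pd i sph d p" for i d p
    unfolding x_def[abs_def] A_def by (rule has_pd_compose[OF smooth_has_derivative[OF smooth_H sph_U] that])
  have 1: "pd 1 x = (\<lambda>p. A (sph_theta p) (sph p))"
    by (rule ext) (rule pd_eqI[OF c[OF has_pd_sph(1)]])
  have 2: "pd 2 x = (\<lambda>p. sin (p$1) *\<^sub>R A (sph_phi p) (sph p))"
    by (rule ext) (simp add: pd_eqI[OF c[OF has_pd_sph(2)]] linear_cmul[OF linear_A[OF sph_U]])
  show "pd 1 x p = A (sph_theta p) (sph p)" "pd 2 x p = sin (p$1) *\<^sub>R A (sph_phi p) (sph p)" by (simp_all add: 1 2)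
  show "pd 1 (pd 1 x) p = A (- sph p) (sph p) + A2 (sph_theta p) (sph_theta p) (sph p)"
    unfolding 1 by (rule pd_eqI[OF has_pd_A[OF has_pd_sph(3,1)]])
  have s: "has_pd 1 (\<lambda>p. sin (p$1)) (cos (p$1)) p" "has_pd 2 (\<lambda>p. sin (p$1)) 0 p"
    by (rule has_pd_fun_coord(1)[OF DERIV_sin], rule has_pd_other_coord) simp
  show "pd 1 (pd 2 x) p = cos (p$1) *\<^sub>R A (sph_phi p) (sph p) + sin (p$1) *\<^sub>R A2 (sph_phi p) (sph_theta p) (sph p)"
    unfolding 2 using pd_eqI[OF has_pd_scaleR[OF s(1) has_pd_A[OF has_pd_sph(4,1)]]] by (simp add: A0)
  show "pd 2 (pd 2 x) p = sin (p$1) *\<^sub>R (A (- (sin (p$1) *\<^sub>R sph p + cos (p$1) *\<^sub>R sph_theta p)) (sph p) + A2 (sph_phi p) (sin (p$1) *\<^sub>R sph_phi p) (sph p))"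
    unfolding 2 using pd_eqI[OF has_pd_scaleR[OF s(2) has_pd_A[OF has_pd_sph(5,2)]]] by simp
qed

lemma smooth_x: "smooth x polar_dom"
  unfolding x_def[abs_def]
  by (rule smooth_compose[OF smooth_H smooth_subset[OF smooth_sph] open_polar_dom]) (use sph_U in auto)

text \<open>\<open>H\<close> is smooth near the whole sphere, so compactness gives bounds that hold
  up to the poles.\<close>

lemma derivative_bounds:
  obtains M where "0 \<le> M" "\<And>v q. q \<in> sphere 0 1 \<Longrightarrow> norm (A v q) \<le> M * norm v"
    "\<And>v d q. q \<in> sphere 0 1 \<Longrightarrow> norm (A2 v d q) \<le> M * norm v * norm d"
proof -
  define N1 N2 where "N1 q = (\<Sum>j\<in>UNIV. norm (A (axis j 1) q))" and
    "N2 q = (\<Sum>j\<in>UNIV. \<Sum>i\<in>UNIV. norm (frechet_derivative (A (axis j 1)) (at q) (axis i 1)))" for q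
  have c: "continuous_on (sphere 0 1) N1" "continuous_on (sphere 0 1) N2"
    unfolding N1_def[abs_def] N2_def[abs_def]
    by (intro continuous_on_sum continuous_on_norm continuous_on_subset[OF smooth_continuous_on sphere_U] smooth_A smooth_frechet)+
  have "\<exists>M. \<forall>q\<in>sphere 0 1. \<bar>f q\<bar> \<le> M" if "continuous_on (sphere 0 1) f" for f :: "real^3 \<Rightarrow> real"
    using compact_imp_bounded[OF compact_continuous_image[OF that]] unfolding bounded_iff by auto
  from this[OF c(1)] this[OF c(2)] obtain M1 M2 where M: "\<forall>q\<in>sphere 0 1. \<bar>N1 q\<bar> \<le> M1" "\<forall>q\<in>sphere 0 1. \<bar>N2 q\<bar> \<le> M2" by blast
  have b: "norm (\<Sum>j\<in>UNIV. v $ j *\<^sub>R f j) \<le> (\<Sum>j\<in>UNIV. norm (f j)) * norm v" for v :: "real^3" and f :: "3 \<Rightarrow> real^3"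
  proof -
    have "norm (\<Sum>j\<in>UNIV. v $ j *\<^sub>R f j) \<le> (\<Sum>j\<in>UNIV. norm (v $ j *\<^sub>R f j))" by (rule norm_sum)
    also have "\<dots> \<le> (\<Sum>j\<in>UNIV. norm (f j) * norm v)"
    proof (rule sum_mono)
      fix j show "norm (v $ j *\<^sub>R f j) \<le> norm (f j) * norm v"
        using mult_right_mono[OF component_le_norm_cart[of v j] norm_ge_zero[of "f j"]] by (simp add: mult.commute)
    qed
    finally show ?thesis by (simp add: sum_distrib_right)
  qed
  show thesis
  proof (rule that[of "max 0 (max M1 M2)"])
    fix q :: "real^3" assume q: "q \<in> sphere 0 1"
    then have qU: "q \<in> U" using sphere_U by blast
    have m: "N1 q \<le> max 0 (max M1 M2)" "N2 q \<le> max 0 (max M1 M2)" using M q by fastforce+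
    show "norm (A v q) \<le> max 0 (max M1 M2) * norm v" for v
      using b[of v "\<lambda>j. A (axis j 1) q"] mult_right_mono[OF m(1) norm_ge_zero[of v]]
      unfolding A_expansion[OF qU, symmetric] N1_def by linarith
    fix v d :: "real^3"
    have "frechet_derivative (A (axis j 1)) (at q) d = (\<Sum>i\<in>UNIV. d $ i *\<^sub>R frechet_derivative (A (axis j 1)) (at q) (axis i 1))" for j
    proof -
      have l: "linear (frechet_derivative (A (axis j 1)) (at q))" by (rule has_derivative_linear[OF smooth_has_derivative[OF smooth_A qU]])
      show ?thesis using linear_sum[OF l, of "\<lambda>i. d $ i *\<^sub>R axis i 1" UNIV] by (simp add: sum_axis linear_cmul[OF l])
    qed
    then have "norm (frechet_derivative (A (axis j 1)) (at q) d) \<le> (\<Sum>i\<in>UNIV. norm (frechet_derivative (A (axis j 1)) (at q) (axis i 1))) * norm d" for j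
      using b[of d "\<lambda>i. frechet_derivative (A (axis j 1)) (at q) (axis i 1)"] by simp
    then have "(\<Sum>j\<in>UNIV. norm (frechet_derivative (A (axis j 1)) (at q) d)) \<le> N2 q * norm d"
      unfolding N2_def sum_distrib_right[of _ _ "norm d"] by (intro sum_mono) (simp add: sum_distrib_right)
    also have "\<dots> \<le> max 0 (max M1 M2) * norm d" using m(2) by (intro mult_right_mono) auto
    finally have "(\<Sum>j\<in>UNIV. norm (frechet_derivative (A (axis j 1)) (at q) d)) * norm v \<le> max 0 (max M1 M2) * norm d * norm v"
      by (intro mult_right_mono) auto
    then show "norm (A2 v d q) \<le> max 0 (max M1 M2) * norm v * norm d"
      using b[of v "\<lambda>j. frechet_derivative (A (axis j 1)) (at q) d"] unfolding A2_def by (simp add: mult_ac)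
  qed simp
qed

end

text \<open>Each derivative in \<open>\<phi>\<close> brings a factor \<open>sin \<theta>\<close>,
  and the terms of \<open>pd_x\<close> that lack one are tangential and drop out against
  \<open>nu\<close>; hence the powers of \<open>sin \<theta>\<close> in the bounds.\<close>

lemma convex_surface_of_sphere_map:
  assumes rev: "revolution w rho k w1 k1 c C" and map: "sphere_map U H"
    and first_form: "\<And>p. p \<in> polar_dom \<Longrightarrow> pd 1 (\<lambda>p. H (sph p)) p \<bullet> pd 1 (\<lambda>p. H (sph p)) p = (w (p$1))\<^sup>2"
      "\<And>p. p \<in> polar_dom \<Longrightarrow> pd 1 (\<lambda>p. H (sph p)) p \<bullet> pd 2 (\<lambda>p. H (sph p)) p = 0"
      "\<And>p. p \<in> polar_dom \<Longrightarrow> pd 2 (\<lambda>p. H (sph p)) p \<bullet> pd 2 (\<lambda>p. H (sph p)) p = (rho (p$1))\<^sup>2"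
  obtains e M where "convex_surface w rho k w1 k1 c C (\<lambda>p. H (sph p)) e H"
    "\<And>p. p \<in> polar_dom \<Longrightarrow> \<bar>surface.L11 w rho (\<lambda>p. H (sph p)) e p\<bar> \<le> M"
    "\<And>p. p \<in> polar_dom \<Longrightarrow> \<bar>surface.L12 w rho (\<lambda>p. H (sph p)) e p\<bar> \<le> M * sin (p$1)"
    "\<And>p. p \<in> polar_dom \<Longrightarrow> \<bar>surface.L22 w rho (\<lambda>p. H (sph p)) e p\<bar> \<le> M * (sin (p$1))\<^sup>2"
proof -
  interpret sphere_map U H by (rule map)
  interpret r: revolution w rho k w1 k1 c C by (rule rev)
  have s0: "surface w rho k w1 k1 c C x 1"
  proof
    fix p show "x (p + (2 * pi) *\<^sub>R axis 2 1) = x p"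
      by (simp add: x_def sph_def axis_def)
  qed (use first_form smooth_x in \<open>simp_all add: x_def[abs_def]\<close>)
  obtain e where e: "surface w rho k w1 k1 c C x e" "\<And>p. p \<in> polar_dom \<Longrightarrow> 0 < surface.L11 w rho x e p"
    using surface.orientation[OF s0] by blast
  interpret S: surface w rho k w1 k1 c C x e by (rule e(1))
  have pole: "\<exists>v. v \<noteq> 0 \<and> (\<forall>n. (\<forall>q'\<in>sphere 0 1. n \<bullet> H q' \<le> n \<bullet> H q) \<longrightarrow> v \<bullet> n = 0)"
    if q: "q = axis 3 1 \<or> q = - axis 3 1" for q
  proof -
    obtain z where z: "q = sph (vector [z, 0])" "sin z = 0" "cos z \<noteq> 0" "z = 0 \<or> z = pi"
      using q by (elim disjE; intro that[of 0] that[of pi]) (auto simp: vec_eq_iff forall_3 sph_nth axis_def)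
    have qs: "q \<in> sphere 0 1" unfolding z by (rule sph_in_sphere)
    then have qU: "q \<in> U" using sphere_U by blast
    \<comment> \<open>The meridian at angle \<open>pi / 2\<close> passes the pole with image
      velocity \<open>v\<close> up to sign, so \<open>v\<close> is orthogonal to every direction
      supported there. Along the meridian at angle 0, the norm of \<open>v\<close> is the limit of
      \<open>rho / sin\<close>, hence at least \<open>c\<close>.\<close>
    define v where "v = A (axis 2 1) q"
    have "c \<le> norm v"
    proof -
      have ge: "c \<le> norm (A (axis 2 1) (sph (vector [\<theta>, 0])))" if \<theta>: "0 < \<theta>" "\<theta> < pi" for \<theta>
      proof -
        let ?p = "vector [\<theta>, 0] :: real^2"
        have p: "?p \<in> polar_dom" using \<theta> by simp
        have "sph_phi ?p = axis 2 1" by (simp add: sph_phi_def vec_eq_iff forall_3 axis_def)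
        then have "norm (pd 2 x ?p) = sin \<theta> * norm (A (axis 2 1) (sph ?p))" using sin_gt_zero[OF \<theta>] by (simp add: pd_x)
        moreover have "norm (pd 2 x ?p) = rho \<theta>" using S.first_form(3)[OF p] r.rho_pos[OF \<theta>] by (simp add: norm_eq_sqrt_inner)
        ultimately have "c * sin \<theta> \<le> norm (A (axis 2 1) (sph ?p)) * sin \<theta>" using r.rho_bounds(1)[OF \<theta>] by (simp add: mult.commute)
        then show ?thesis using sin_gt_zero[OF \<theta>] by simp
      qed
      have "continuous_on UNIV (\<lambda>\<theta>. norm (A (axis 2 1) (sph (vector [\<theta>, 0]))))"
        by (intro continuous_on_norm continuous_on_compose2[OF smooth_continuous_on[OF smooth_A]]
            continuous_on_compose2[OF smooth_continuous_on[OF smooth_sph]] continuous_intros) (use sph_U in auto)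
      then have "isCont (\<lambda>\<theta>. norm (A (axis 2 1) (sph (vector [\<theta>, 0])))) z" by (simp add: continuous_on_eq_continuous_at)
      then have l: "((\<lambda>\<theta>. norm (A (axis 2 1) (sph (vector [\<theta>, 0])))) \<longlongrightarrow> norm v) (at z)" by (simp add: isCont_def v_def z(1))
      from z(4) show ?thesis
      proof
        assume z0: "z = 0"
        have l': "((\<lambda>\<theta>. norm (A (axis 2 1) (sph (vector [\<theta>, 0])))) \<longlongrightarrow> norm v) (at_right 0)"
          using l unfolding z0 by (rule tendsto_mono[OF at_le, rotated]) simp
        have "\<forall>\<^sub>F \<theta> in at_right 0. c \<le> norm (A (axis 2 1) (sph (vector [\<theta>, 0])))"
          unfolding eventually_at_right_field by (rule exI[of _ pi]) (use ge in auto)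
        then show ?thesis using tendsto_lowerbound[OF l'] by simp
      next
        assume z0: "z = pi"
        have l': "((\<lambda>\<theta>. norm (A (axis 2 1) (sph (vector [\<theta>, 0])))) \<longlongrightarrow> norm v) (at_left pi)"
          using l unfolding z0 by (rule tendsto_mono[OF at_le, rotated]) simp
        have "\<forall>\<^sub>F \<theta> in at_left pi. c \<le> norm (A (axis 2 1) (sph (vector [\<theta>, 0])))"
          unfolding eventually_at_left_field by (rule exI[of _ 0]) (use ge in auto)
        then show ?thesis using tendsto_lowerbound[OF l'] by simp
      qed
    qed
    then have "v \<noteq> 0" using r.c_pos by auto
    moreover have "v \<bullet> n = 0" if max: "\<forall>q'\<in>sphere 0 1. n \<bullet> H q' \<le> n \<bullet> H q" for n
    proof -
      let ?p = "vector [z, pi / 2] :: real^2"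
      have qp: "sph ?p = q" unfolding z(1) by (simp add: vec_eq_iff forall_3 sph_nth z(2))
      have "has_pd 1 (\<lambda>p. n \<bullet> H (sph p)) (n \<bullet> A (sph_theta ?p) (sph ?p)) ?p"
        unfolding A_def by (rule has_pd_linear[OF bounded_linear_inner_right has_pd_compose[OF smooth_has_derivative[OF smooth_H sph_U] has_pd_sph(1)]])
      then have "((\<lambda>s. n \<bullet> H (sph (?p + s *\<^sub>R axis 1 1))) has_real_derivative n \<bullet> A (sph_theta ?p) q) (at 0)"
        unfolding qp has_pd_def has_real_derivative_iff_has_vector_derivative .
      then have "n \<bullet> A (sph_theta ?p) q = 0"
        by (rule DERIV_local_max[of _ _ _ 1]) (use max sph_in_sphere in \<open>auto simp: qp simp del: mem_sphere_0\<close>)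
      moreover have "sph_theta ?p = cos z *\<^sub>R axis 2 1"
        by (simp add: sph_theta_def vec_eq_iff forall_3 axis_def z(2))
      ultimately show ?thesis
        using z(3) linear_cmul[OF linear_A[OF qU]] by (simp add: v_def inner_commute)
    qed
    ultimately show ?thesis by blast
  qed
  have cs: "convex_surface w rho k w1 k1 c C x e H"
  proof
    show "continuous_on (sphere 0 1) H" by (rule continuous_on_subset[OF smooth_continuous_on[OF smooth_H] sphere_U])
  qed (use e(2) pole in \<open>simp_all add: x_def\<close>)
  obtain M where M: "0 \<le> M" "\<And>v q. q \<in> sphere 0 1 \<Longrightarrow> norm (A v q) \<le> M * norm v"
    "\<And>v d q. q \<in> sphere 0 1 \<Longrightarrow> norm (A2 v d q) \<le> M * norm v * norm d" by (rule derivative_bounds) blast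
  have n: "\<bar>u \<bullet> S.nu p\<bar> \<le> norm u" if "p \<in> polar_dom" for u p
    using Cauchy_Schwarz_ineq2[of u "S.nu p"] S.nu_unit(1)[OF that] by (simp add: norm_eq_sqrt_inner[of "S.nu p"])
  have bounds: "\<bar>S.L11 p\<bar> \<le> 2 * M \<and> \<bar>S.L12 p\<bar> \<le> 2 * M * sin (p$1) \<and> \<bar>S.L22 p\<bar> \<le> 2 * M * (sin (p$1))\<^sup>2" if p: "p \<in> polar_dom" for p
  proof -
    let ?s = "sin (p$1)"
    have s: "0 < ?s" by (rule S.theta_pos(5)[OF p])
    have t: "A (sph_theta p) (sph p) \<bullet> S.nu p = 0" "A (sph_phi p) (sph p) \<bullet> S.nu p = 0"
      using S.nu_unit(2)[OF p, of 1] S.nu_unit(2)[OF p, of 2] s by (simp_all add: pd_x)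
    have a: "norm (A (sph p) (sph p)) \<le> M" using M(2)[OF sph_in_sphere, of "sph p"] by (simp add: norm_sph)
    have a2: "norm (A2 (sph_theta p) (sph_theta p) (sph p)) \<le> M" "norm (A2 (sph_phi p) (sph_theta p) (sph p)) \<le> M" "norm (A2 (sph_phi p) (sph_phi p) (sph p)) \<le> M"
      using M(3)[OF sph_in_sphere, of "sph_theta p" "sph_theta p" p] M(3)[OF sph_in_sphere, of "sph_phi p" "sph_theta p" p]
        M(3)[OF sph_in_sphere, of "sph_phi p" "sph_phi p" p] by (simp_all add: norm_sph_frame)
    note lin = linear_add[OF linear_A[OF sph_U]] linear_cmul[OF linear_A[OF sph_U]] linear_neg[OF linear_A[OF sph_U]] linear_diff[OF linear_A[OF sph_U]]
    have A2lin: "A2 v (t *\<^sub>R d) (sph p) = t *\<^sub>R A2 v d (sph p)" for v t d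
      using linear_cmul[OF has_derivative_linear[OF smooth_has_derivative[OF smooth_A sph_U]]]
      by (simp add: A2_def scaleR_sum_right mult.commute)
    have "S.L11 p = (A (sph p) (sph p) - A2 (sph_theta p) (sph_theta p) (sph p)) \<bullet> S.nu p"
      by (simp add: S.L11_def pd_x lin inner_add_left inner_diff_left)
    then have 1: "\<bar>S.L11 p\<bar> \<le> 2 * M"
      using n[OF p, of "A (sph p) (sph p) - A2 (sph_theta p) (sph_theta p) (sph p)"] norm_triangle_ineq4[of "A (sph p) (sph p)" "A2 (sph_theta p) (sph_theta p) (sph p)"] a a2
      by linarith
    have "S.L12 p = ?s * - (A2 (sph_phi p) (sph_theta p) (sph p) \<bullet> S.nu p)"
      by (simp add: S.L12_def pd_x inner_add_left t)
    then have "\<bar>S.L12 p\<bar> = \<bar>A2 (sph_phi p) (sph_theta p) (sph p) \<bullet> S.nu p\<bar> * ?s" using s by (simp add: abs_mult mult.commute)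
    also have "\<dots> \<le> (2 * M) * ?s" using n[OF p, of "A2 (sph_phi p) (sph_theta p) (sph p)"] a2(2) M(1) s by (intro mult_right_mono) linarith+
    finally have 2: "\<bar>S.L12 p\<bar> \<le> 2 * M * ?s" .
    have "S.L22 p = ?s\<^sup>2 * ((A (sph p) (sph p) - A2 (sph_phi p) (sph_phi p) (sph p)) \<bullet> S.nu p)"
      by (simp add: S.L22_def pd_x lin A2lin inner_add_left inner_diff_left t power2_eq_square algebra_simps)
    then have "\<bar>S.L22 p\<bar> = \<bar>(A (sph p) (sph p) - A2 (sph_phi p) (sph_phi p) (sph p)) \<bullet> S.nu p\<bar> * ?s\<^sup>2" by (simp add: abs_mult mult.commute)
    also have "\<dots> \<le> (2 * M) * ?s\<^sup>2"
      using n[OF p, of "A (sph p) (sph p) - A2 (sph_phi p) (sph_phi p) (sph p)"] norm_triangle_ineq4[of "A (sph p) (sph p)" "A2 (sph_phi p) (sph_phi p) (sph p)"] a a2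
      by (intro mult_right_mono) auto
    finally show ?thesis using 1 2 by blast
  qed
  show thesis
    by (rule that[of e "2 * M"]) (use cs bounds in \<open>simp_all add: x_def[abs_def]\<close>)
qed

subsection \<open>Comparison of the energies\<close>

text \<open>A prescribed \<open>y\<close> is tied to the time function on the open interval only,
  and the curvature condition sees the metric on the open chart only.\<close>

lemma positive_gauss_curvature_cong:
  assumes eq: "\<And>p. p \<in> polar_dom \<Longrightarrow> \<sigma> p = \<sigma>' p" and pos: "positive_gauss_curvature \<sigma>"
  shows "positive_gauss_curvature \<sigma>'"
proof -
  have c: "christoffel \<sigma> p = christoffel \<sigma>' p" if p: "p \<in> polar_dom" for p
  proof -
    have "pd i (\<lambda>z. \<sigma> z $ j $ l) p = pd i (\<lambda>z. \<sigma>' z $ j $ l) p" for i j l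
      by (rule pd_cong[OF open_polar_dom p]) (simp add: eq)
    then show ?thesis by (simp add: christoffel_def eq[OF p] fun_eq_iff)
  qed
  have g: "gauss_curvature \<sigma> p = gauss_curvature \<sigma>' p" if p: "p \<in> polar_dom" for p
  proof -
    have "pd i (\<lambda>z. christoffel \<sigma> z l j k) p = pd i (\<lambda>z. christoffel \<sigma>' z l j k) p" for i j k l
      by (rule pd_cong[OF open_polar_dom p]) (simp add: c)
    then show ?thesis by (simp add: gauss_curvature_def riemann_def c[OF p] eq[OF p])
  qed
  have lim: "((\<lambda>\<theta>. gauss_curvature \<sigma>' (vector [\<theta>, \<phi>])) \<longlongrightarrow> K) (at_right 0)"
    if "((\<lambda>\<theta>. gauss_curvature \<sigma> (vector [\<theta>, \<phi>])) \<longlongrightarrow> K) (at_right 0)" for \<phi> K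
  proof (rule Lim_transform_eventually[OF that])
    show "\<forall>\<^sub>F \<theta> in at_right 0. gauss_curvature \<sigma> (vector [\<theta>, \<phi>]) = gauss_curvature \<sigma>' (vector [\<theta>, \<phi>])"
      unfolding eventually_at_right_field by (rule exI[of _ pi]) (auto intro!: g)
  qed
  have lim': "((\<lambda>\<theta>. gauss_curvature \<sigma>' (vector [\<theta>, \<phi>])) \<longlongrightarrow> K) (at_left pi)"
    if "((\<lambda>\<theta>. gauss_curvature \<sigma> (vector [\<theta>, \<phi>])) \<longlongrightarrow> K) (at_left pi)" for \<phi> K
  proof (rule Lim_transform_eventually[OF that])
    show "\<forall>\<^sub>F \<theta> in at_left pi. gauss_curvature \<sigma> (vector [\<theta>, \<phi>]) = gauss_curvature \<sigma>' (vector [\<theta>, \<phi>])"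
      unfolding eventually_at_left_field by (rule exI[of _ 0]) (auto intro!: g)
  qed
  show ?thesis
    using pos lim lim' g unfolding positive_gauss_curvature_def by metis
qed

lemma meridian:
  assumes "smooth_on_sphere \<tau>" and dep: "depends_only_on_theta \<tau>"
  defines "T \<equiv> \<lambda>\<theta>. \<tau> (sph (vector [\<theta>, 0]))"
  obtains y1 y2 where "\<And>\<theta>. (T has_real_derivative theta_deriv \<tau> \<theta>) (at \<theta>)"
    "\<And>\<theta>. (theta_deriv \<tau> has_real_derivative y1 \<theta>) (at \<theta>)" "\<And>\<theta>. (y1 has_real_derivative y2 \<theta>) (at \<theta>)"
    "continuous_on UNIV y2" "theta_deriv \<tau> 0 = 0" "theta_deriv \<tau> pi = 0" "\<And>p. \<tau> (sph p) = T (p$1)"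
proof -
  have T: "\<tau> (sph p) = T (p$1)" for p
    using dep[unfolded depends_only_on_theta_def, rule_format, of "p$1" "p$2" 0] by (simp add: T_def)
  obtain U h where h: "open U" "sphere 0 1 \<subseteq> U" "smooth h U" "\<And>q. q \<in> sphere 0 1 \<Longrightarrow> h q = \<tau> q"
    using assms(1) unfolding smooth_on_sphere_def smooth_def by blast
  have Th: "T = (\<lambda>\<theta>. h (sph (\<theta> *\<^sub>R axis 1 1)))"
  proof
    fix \<theta>
    have "vector [\<theta>, 0] = (\<theta> *\<^sub>R axis 1 1 :: real^2)" by (simp add: vec2_eq_iff axis_def)
    then show "T \<theta> = h (sph (\<theta> *\<^sub>R axis 1 1))" using h(4)[OF sph_in_sphere] by (simp add: T_def)
  qed
  have "smooth (\<lambda>\<theta>::real. sph (\<theta> *\<^sub>R axis 1 1)) UNIV"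
    by (rule smooth_compose[OF smooth_sph smooth_linear[OF bounded_linear_scaleR_left open_UNIV smooth_id]]) auto
  then have sT: "smooth T UNIV"
    unfolding Th by (rule smooth_compose[OF h(3) _ open_UNIV]) (use h(2) sph_in_sphere in blast)
  have d: "(f has_real_derivative frechet_derivative f (at \<theta>) 1) (at \<theta>)" if "smooth f UNIV" for f \<theta>
  proof -
    have f: "(f has_derivative frechet_derivative f (at \<theta>)) (at \<theta>)" by (rule smooth_has_derivative[OF that]) simp
    have "frechet_derivative f (at \<theta>) v = frechet_derivative f (at \<theta>) 1 * v" for v
      using linear_cmul[OF has_derivative_linear[OF f], of v 1] by (simp add: mult.commute)
    then have "frechet_derivative f (at \<theta>) = (*) (frechet_derivative f (at \<theta>) 1)" by (rule ext)
    with f show ?thesis unfolding has_field_derivative_def by (simp only:)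
  qed
  have y: "theta_deriv \<tau> = (\<lambda>\<theta>. frechet_derivative T (at \<theta>) 1)"
    unfolding theta_deriv_def T_def[symmetric] using DERIV_imp_deriv[OF d[OF sT]] by blast
  define y1 where "y1 \<theta> = frechet_derivative (theta_deriv \<tau>) (at \<theta>) 1" for \<theta>
  define y2 where "y2 \<theta> = frechet_derivative y1 (at \<theta>) 1" for \<theta>
  have sm: "smooth (theta_deriv \<tau>) UNIV" unfolding y by (rule smooth_frechet[OF sT])
  have sm1: "smooth y1 UNIV" unfolding y1_def by (rule smooth_frechet[OF sm])
  have ends: "theta_deriv \<tau> z = 0" if z: "sin z = 0" for z
  proof -
    have cz: "cos z \<noteq> 0" using z sin_cos_squared_add[of z] by auto
    \<comment> \<open>Reflected through a pole, the meridian continues at angle \<open>pi\<close>,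
      where the time function has the same values; its derivative at the pole must vanish.\<close>
    have even: "T (2 * z - \<theta>) = T \<theta>" for \<theta>
    proof -
      have "sph (vector [2 * z - \<theta>, 0]) = sph (vector [\<theta>, pi])"
        using z by (simp add: vec_eq_iff forall_3 sph_nth sin_diff cos_diff sin_double cos_double cos_squared_eq)
      then show ?thesis using T[of "vector [\<theta>, pi]"] T[of "vector [2 * z - \<theta>, 0]"] by simp
    qed
    have "((\<lambda>\<theta>. T (2 * z - \<theta>)) has_real_derivative theta_deriv \<tau> z * - 1) (at z)"
      by (rule DERIV_chain2[of T]) (use d[OF sT, of z] in \<open>auto simp: y intro!: derivative_eq_intros\<close>)
    then have "(T has_real_derivative - theta_deriv \<tau> z) (at z)" by (simp add: even)
    moreover have "(T has_real_derivative theta_deriv \<tau> z) (at z)" using d[OF sT, of z] by (simp add: y)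
    ultimately have "- theta_deriv \<tau> z = theta_deriv \<tau> z" by (rule DERIV_unique)
    then show ?thesis by simp
  qed
  show thesis
  proof (rule that[of y1 y2])
    show "(T has_real_derivative theta_deriv \<tau> \<theta>) (at \<theta>)" for \<theta> using d[OF sT] by (simp add: y)
    show "(theta_deriv \<tau> has_real_derivative y1 \<theta>) (at \<theta>)" for \<theta> using d[OF sm] by (simp add: y1_def)
    show "(y1 has_real_derivative y2 \<theta>) (at \<theta>)" for \<theta> using d[OF sm1] by (simp add: y2_def)
    show "continuous_on UNIV y2" unfolding y2_def by (rule smooth_continuous_on[OF smooth_frechet[OF sm1]])
  qed (use ends T in auto)
qed

context kerr_time
begin

text \<open>The right side does not mention the embedding, so the energy relation has at most one
  value, and both parts of the theorem reduce to one inequality.\<close>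

lemma wang_yau_energy_eq:
  assumes E: "is_wang_yau_energy m a t r \<tau> E"
    and \<tau>: "\<And>p. \<tau> (sph p) = tm (p$1)" "\<And>\<theta>. (tm has_real_derivative y \<theta>) (at \<theta>)"
  shows "E = cnt_energy m a r y"
proof -
  obtain c C c' C' N d where e: "energy s rho k0 s1 k01 c C w k w1 k1 c' C' y y1 y2 s2 h h1 N d" using energy_locale by blast
  interpret e: energy s rho k0 s1 k01 c C w k w1 k1 c' C' y y1 y2 s2 h h1 N d by (rule e)
  obtain X e0 e1 e0' e1' where X: "is_isometric_embedding (induced_metric (kerr_metric m a) (kerr_surface t r)) \<tau> X"
    and fr: "is_minkowski_frame X e0' e1'" "is_kerr_frame m a t r \<tau> e0 e1"
    and E: "E = 1 / (8 * pi) * wang_yau_integral minkowski_metric (\<lambda>q. X (sph q)) (\<lambda>p. \<tau> (sph p)) e0' e1'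
          - 1 / (8 * pi) * wang_yau_integral (kerr_metric m a) (kerr_surface t r) (\<lambda>p. \<tau> (sph p)) e0 e1"
    using E unfolding is_wang_yau_energy_def by blast
  have X': "smooth_on_sphere X" "\<And>q. q \<in> sphere 0 1 \<Longrightarrow> X q $ 1 = \<tau> q"
    "\<And>p. p \<in> polar_dom \<Longrightarrow> induced_metric minkowski_metric (\<lambda>q. X (sph q)) p = induced_metric (kerr_metric m a) (kerr_surface t r) p"
    using X unfolding is_isometric_embedding_def by blast+
  obtain U h' where h: "open U" "sphere 0 1 \<subseteq> U" "smooth h' U" "\<And>q. q \<in> sphere 0 1 \<Longrightarrow> h' q = X q"
    using X'(1) unfolding smooth_on_sphere_def smooth_def by blast
  define H where "H q = spatial_part (h' q)" for q
  have map: "sphere_map U H"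
    unfolding H_def[abs_def] by unfold_locales (use h smooth_linear[OF bounded_linear_spatial_part h(1,3)] in auto)
  have hX: "(\<lambda>p. h' (sph p)) = (\<lambda>p. X (sph p))" and HX: "(\<lambda>p. H (sph p)) = (\<lambda>p. spatial_part (X (sph p)))"
    using h(4)[OF sph_in_sphere] by (simp_all add: H_def)
  have smooth_X: "smooth (\<lambda>p. X (sph p)) polar_dom"
    unfolding hX[symmetric]
    by (rule smooth_compose[OF h(3) smooth_subset[OF smooth_sph] open_polar_dom]) (use h(2) sph_in_sphere in blast)+
  have pdx: "pd i (\<lambda>p. H (sph p)) p = spatial_part (pd i (\<lambda>p. X (sph p)) p)" if p: "p \<in> polar_dom" for p i
    unfolding HX by (rule pd_eqI[OF has_pd_linear[OF bounded_linear_spatial_part smooth_has_pd'[OF smooth_X p]]])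
  have F1: "X (sph p) $ 1 = tm (p$1)" for p using X'(2)[OF sph_in_sphere] \<tau>(1) by simp
  have pdF1: "pd 1 (\<lambda>q. X (sph q)) p $ 1 = y (p$1)" "pd 2 (\<lambda>q. X (sph q)) p $ 1 = 0" if p: "p \<in> polar_dom" for p
  proof -
    have e: "pd i (\<lambda>q. X (sph q)) p $ 1 = pd i (\<lambda>q. X (sph q) $ 1) p" for i
      by (rule pd_eqI[OF has_pd_linear[OF bounded_linear_vec_nth smooth_has_pd'[OF smooth_X p]], symmetric])
    show "pd 1 (\<lambda>q. X (sph q)) p $ 1 = y (p$1)" unfolding e F1 by (intro pd_eqI has_pd_fun_coord(1) \<tau>(2))
    show "pd 2 (\<lambda>q. X (sph q)) p $ 1 = 0" unfolding e F1 by (intro pd_eqI has_pd_other_coord) simp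
  qed
  interpret i: polar_metric "induced_metric (kerr_metric m a) (kerr_surface t r)" "\<lambda>\<theta>. (s \<theta>)\<^sup>2" "\<lambda>\<theta>. (rho \<theta>)\<^sup>2" "\<lambda>\<theta>. 2 * s \<theta> * s1 \<theta>" "\<lambda>\<theta>. 2 * rho \<theta> * (s \<theta> * k0 \<theta>)"
    by (rule kerr_induced)
  \<comment> \<open>Dropping the time component adds back the square of the differential of the time
    function: the projected surface carries the augmented metric.\<close>
  have ff: "pd i (\<lambda>p. H (sph p)) p \<bullet> pd j (\<lambda>p. H (sph p)) p =
      induced_metric (kerr_metric m a) (kerr_surface t r) p $ i $ j + pd i (\<lambda>q. X (sph q)) p $ 1 * pd j (\<lambda>q. X (sph q)) p $ 1"
    if p: "p \<in> polar_dom" for i j p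
    unfolding X'(3)[OF p, symmetric] by (simp add: induced_metric_def metric_inner_minkowski pdx[OF p])
  have sy: "(s \<theta>)\<^sup>2 + y \<theta> * y \<theta> = (w \<theta>)\<^sup>2" for \<theta> using w_sq[of \<theta>] s_sq[of \<theta>] by (simp add: power2_eq_square)
  obtain \<epsilon> M where cs: "convex_surface w rho k w1 k1 c' C' (\<lambda>p. H (sph p)) \<epsilon> H"
    and M: "\<And>p. p \<in> polar_dom \<Longrightarrow> \<bar>surface.L11 w rho (\<lambda>p. H (sph p)) \<epsilon> p\<bar> \<le> M"
    "\<And>p. p \<in> polar_dom \<Longrightarrow> \<bar>surface.L12 w rho (\<lambda>p. H (sph p)) \<epsilon> p\<bar> \<le> M * sin (p$1)"
    "\<And>p. p \<in> polar_dom \<Longrightarrow> \<bar>surface.L22 w rho (\<lambda>p. H (sph p)) \<epsilon> p\<bar> \<le> M * (sin (p$1))\<^sup>2"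
  proof (rule convex_surface_of_sphere_map[OF e.aug.revolution_axioms map])
    fix p :: "real^2" assume p: "p \<in> polar_dom"
    show "pd 1 (\<lambda>p. H (sph p)) p \<bullet> pd 1 (\<lambda>p. H (sph p)) p = (w (p$1))\<^sup>2"
      "pd 1 (\<lambda>p. H (sph p)) p \<bullet> pd 2 (\<lambda>p. H (sph p)) p = 0"
      "pd 2 (\<lambda>p. H (sph p)) p \<bullet> pd 2 (\<lambda>p. H (sph p)) p = (rho (p$1))\<^sup>2"
      unfolding ff[OF p] pdF1[OF p] i.g_eq[OF p] by (simp_all add: sy)
  qed blast
  interpret cs: convex_surface w rho k w1 k1 c' C' "\<lambda>p. H (sph p)" \<epsilon> H by (rule cs)
  have cs': "convex_surface w rho k w1 k1 c' C' (\<lambda>p. spatial_part (X (sph p))) \<epsilon> (\<lambda>q. spatial_part (X q))"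
  proof -
    have s: "surface w rho k w1 k1 c' C' (\<lambda>p. spatial_part (X (sph p))) \<epsilon>" using cs.surface_axioms unfolding HX .
    have Hq: "H q = spatial_part (X q)" if "q \<in> sphere 0 1" for q using h(4)[OF that] by (simp add: H_def)
    have ax: "axis 3 1 \<in> sphere (0::real^3) 1" "- axis 3 1 \<in> sphere (0::real^3) 1" by simp_all
    show ?thesis
    proof (rule convex_surface.intro[OF s], unfold_locales)
      show "continuous_on (sphere 0 1) (\<lambda>q. spatial_part (X q))"
        by (rule continuous_on_eq[OF cs.Y_cont Hq])
      show "0 < surface.L11 w rho (\<lambda>p. spatial_part (X (sph p))) \<epsilon> p" if "p \<in> polar_dom" for p
        using cs.L11_pos[OF that] unfolding HX .
      show "\<exists>v. v \<noteq> 0 \<and> (\<forall>n. (\<forall>q'\<in>sphere 0 1. n \<bullet> spatial_part (X q') \<le> n \<bullet> spatial_part (X q)) \<longrightarrow> v \<bullet> n = 0)"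
        if q: "q = axis 3 1 \<or> q = - axis 3 1" for q
      proof -
        have qs: "q \<in> sphere 0 1" using q ax by blast
        have "(\<forall>q'\<in>sphere 0 1. n \<bullet> H q' \<le> n \<bullet> H q) \<longleftrightarrow> (\<forall>q'\<in>sphere 0 1. n \<bullet> spatial_part (X q') \<le> n \<bullet> spatial_part (X q))" for n
          by (rule ball_cong[OF refl]) (simp only: Hq Hq[OF qs])
        then show ?thesis using cs.pole_tangent[OF q] by simp
      qed
    qed simp
  qed
  have \<tau>2: "\<And>\<theta>. 0 < \<theta> \<Longrightarrow> \<theta> < pi \<Longrightarrow> (tm has_real_derivative y \<theta>) (at \<theta>)" by (rule \<tau>(2))
  have 1: "wang_yau_integral minkowski_metric (\<lambda>q. X (sph q)) (\<lambda>p. \<tau> (sph p)) e0' e1' = 2 * pi * integral {0..pi} e.aug.mean_density"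
    by (rule minkowski_integral[OF cs' smooth_X X'(3) \<tau>(1) \<tau>2 X'(2) fr(1) M[unfolded HX]])
  have 2: "wang_yau_integral (kerr_metric m a) (kerr_surface t r) (\<lambda>p. \<tau> (sph p)) e0 e1 = 2 * pi * integral {0..pi} e.phys"
    by (rule kerr_integral[OF e fr(2) \<tau>(1) \<tau>2])
  have i: "e.aug.mean_density integrable_on {0..pi}" "e.phys integrable_on {0..pi}"
    by (rule integrable_bdd[OF bddI[OF e.aug.mean_density_bound] e.aug.cont_mean_density]; assumption)
      (rule integrable_bdd[OF e.bdd_phys e.cont_phys])
  have "E = 1/4 * (integral {0..pi} e.aug.mean_density - integral {0..pi} e.phys)"
    unfolding E 1 2 by (simp add: algebra_simps)
  also have "\<dots> = cnt_energy m a r y"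
    by (simp add: cnt_energy_eq[OF e] integral_diff[OF i])
  finally show ?thesis .
qed

lemma cnt_energy_ge:
  assumes y': "\<And>\<theta>. 0 < \<theta> \<Longrightarrow> \<theta> < pi \<Longrightarrow> y' \<theta> = y \<theta>"
  shows "cnt_energy m a r (\<lambda>_. 0) \<le> cnt_energy m a r y'"
proof -
  obtain c C c' C' N d where e: "energy s rho k0 s1 k01 c C w k w1 k1 c' C' y y1 y2 s2 h h1 N d" using energy_locale by blast
  interpret e: energy s rho k0 s1 k01 c C w k w1 k1 c' C' y y1 y2 s2 h h1 N d by (rule e)
  have "cnt_energy m a r y' = 1/4 * integral {0..pi} (\<lambda>\<theta>. e.aug.mean_density \<theta> - e.phys \<theta>)"
    by (rule cnt_energy_eq[OF e]) (rule y')
  then show ?thesis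
    unfolding cnt_energy_zero[OF e.base.revolution_axioms] using e.energy_le by simp
qed

end

lemma kerr_time_meridian:
  assumes "kerr m a r" and \<tau>: "smooth_on_sphere \<tau>" "depends_only_on_theta \<tau>"
    and curv: "positive_gauss_curvature (augmented_metric m a r (theta_deriv \<tau>))"
  obtains tm y1 y2 where "kerr_time m a r (theta_deriv \<tau>) y1 y2" "\<And>p. \<tau> (sph p) = tm (p$1)"
    "\<And>\<theta>. (tm has_real_derivative theta_deriv \<tau> \<theta>) (at \<theta>)"
proof -
  interpret kerr m a r by (rule assms(1))
  obtain y1 y2 where *: "\<And>\<theta>. ((\<lambda>\<theta>. \<tau> (sph (vector [\<theta>, 0]))) has_real_derivative theta_deriv \<tau> \<theta>) (at \<theta>)"
    "\<And>\<theta>. (theta_deriv \<tau> has_real_derivative y1 \<theta>) (at \<theta>)" "\<And>\<theta>. (y1 has_real_derivative y2 \<theta>) (at \<theta>)"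
    "continuous_on UNIV y2" "theta_deriv \<tau> 0 = 0" "theta_deriv \<tau> pi = 0" "\<And>p. \<tau> (sph p) = \<tau> (sph (vector [p$1, 0]))"
    by (rule meridian[OF \<tau>]) blast
  have "kerr_time m a r (theta_deriv \<tau>) y1 y2"
    by unfold_locales (use *(1-6) curv in auto)
  then show thesis by (rule that[where tm = "\<lambda>\<theta>. \<tau> (sph (vector [\<theta>, 0]))"]) (rule *(7), rule *(1))
qed

theorem corollary5p1:
  fixes m a r t :: real
  assumes "0 < m" and "0 \<le> a" and "a \<le> m" and "kerr_rh m a < r"
  shows "(\<forall>\<tau> E E0. smooth_on_sphere \<tau> \<and> depends_only_on_theta \<tau> \<and>
           positive_gauss_curvature (augmented_metric m a r (theta_deriv \<tau>)) \<and>
           is_wang_yau_energy m a t r \<tau> E \<and> is_wang_yau_energy m a t r (\<lambda>_. 0) E0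
           \<longrightarrow> E \<ge> E0) \<and>
         (\<forall>y \<tau>. smooth_on_sphere \<tau> \<and> depends_only_on_theta \<tau> \<and>
           (\<forall>\<theta>\<in>{0<..<pi}. y \<theta> = theta_deriv \<tau> \<theta>) \<and>
           positive_gauss_curvature (augmented_metric m a r y)
           \<longrightarrow> cnt_energy m a r y \<ge> cnt_energy m a r (\<lambda>_. 0))"
proof (intro conjI allI impI; elim conjE)
  have kerr: "kerr m a r" using assms by unfold_locales
  fix \<tau> E E0
  assume \<tau>: "smooth_on_sphere \<tau>" "depends_only_on_theta \<tau>" "positive_gauss_curvature (augmented_metric m a r (theta_deriv \<tau>))"
    and E: "is_wang_yau_energy m a t r \<tau> E" "is_wang_yau_energy m a t r (\<lambda>_. 0) E0"
  obtain tm y1 y2 where T: "kerr_time m a r (theta_deriv \<tau>) y1 y2" "\<And>p. \<tau> (sph p) = tm (p$1)"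
    "\<And>\<theta>. (tm has_real_derivative theta_deriv \<tau> \<theta>) (at \<theta>)"
    by (rule kerr_time_meridian[OF kerr \<tau>]) blast
  have "E = cnt_energy m a r (theta_deriv \<tau>)" by (rule kerr_time.wang_yau_energy_eq[OF T(1) E(1) T(2,3)])
  moreover have "E0 = cnt_energy m a r (\<lambda>_. 0)"
    by (rule kerr_time.wang_yau_energy_eq[OF kerr.kerr_time_zero[OF kerr] E(2), where tm = "\<lambda>_. 0"]) simp_all
  ultimately show "E0 \<le> E" using kerr_time.cnt_energy_ge[OF T(1)] by simp
next
  have kerr: "kerr m a r" using assms by unfold_locales
  fix y \<tau>
  assume \<tau>: "smooth_on_sphere \<tau>" "depends_only_on_theta \<tau>" "\<forall>\<theta>\<in>{0<..<pi}. y \<theta> = theta_deriv \<tau> \<theta>"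
    and curv: "positive_gauss_curvature (augmented_metric m a r y)"
  have "positive_gauss_curvature (augmented_metric m a r (theta_deriv \<tau>))"
    by (rule positive_gauss_curvature_cong[OF _ curv]) (use \<tau>(3) in \<open>auto simp: augmented_metric_def mem_polar_dom\<close>)
  then obtain tm y1 y2 where "kerr_time m a r (theta_deriv \<tau>) y1 y2"
    by (rule kerr_time_meridian[OF kerr \<tau>(1,2)]) blast
  then show "cnt_energy m a r (\<lambda>_. 0) \<le> cnt_energy m a r y"
    by (rule kerr_time.cnt_energy_ge) (use \<tau>(3) in auto)
qed

end
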